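(* Let $\mathsf E\to M$ be an $\Omega$ vector bundle equipped with a module connection $\triangle$ with curvature $\mathsf R$ and a Higgs field $\phi$. Then the string form of $(\triangle,\phi)$ is $$s(\triangle,\phi)=\sum_{j=1}^\infty\frac{1}{(j-1)!}\Big(\frac{1}{2\pi i}\Big)^j\int_{S^1}\mathrm{tr}\big(\triangle\phi\wedge\underbrace{\mathsf R\wedge\dots\wedge\mathsf R}_{j-1}\big)\,d\theta .$$
   Context: $M$ is a compact smooth manifold, possibly with corners; $S^1=\mathbb R/2\pi\mathbb Z$ with basepoint $0$; $M_0=M\times\{0\}$; integration over the fibre of $M\times S^1\to M$ uses the canonical orientation, with $\int_{S^1}(f\,\mathrm{pr}^*\beta)\wedge d\theta=\beta\int_{S^1}f\,d\theta$. $L\mathbb C=C^\infty(S^1,\mathbb C)$. For a free $L\mathbb C$-module $N$ of rank $n$, $I_\theta N$ is the submodule of elements vanishing at $\theta$ (under any $N\cong L\mathbb C^n$). An $\Omega$-module of rank $n$ is such an $N$ with a chosen isomorphism $N/I_0N\cong\mathbb C^n$ (a framing at $0$); isomorphisms are $L\mathbb C$-linear and preserve framings. An $\Omega$ vector bundle of rank $n$ is a smooth Fréchet bundle $\mathsf E\to M$ with $\Omega$-module fibres, locally isomorphic to $U\times L\mathbb C^n$ by fibrewise $\Omega$-module isomorphisms. Its caloron transform is the complex vector bundle $E\to M\times S^1$ with fibres $E_{(m,\theta)}=\mathsf E_m/I_\theta\mathsf E_m$ (smooth structure induced by local trivialisations of $\mathsf E$), framed over $M_0$ by the framings at $0$.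 Evaluation $\check s\mapsto s$, $s(m,\theta)=[\check s(m)]\in\mathsf E_m/I_\theta\mathsf E_m$, identifies $\Gamma(M,\mathsf E)$ with $\Gamma(M\times S^1,E)$ as $C^\infty(M\times S^1,\mathbb C)$-modules. A Higgs field $\phi$ on $\mathsf E$ is a smooth family of $\mathbb C$-linear maps $\phi\colon\mathsf E_m\to\mathsf E_m$ with $\phi(fv)=(\partial_\theta f)v+f\phi(v)$ for $f\in L\mathbb C$. A module connection $\triangle$ is a connection on $\mathsf E$ with $\triangle(fv)=(d_Mf)v+f\triangle v$ for $f\in C^\infty(M\times S^1,\mathbb C)$ ($d_M$ the differential in the $M$ directions) which induces the trivial connection on $\bigcup_m\mathsf E_m/I_0\mathsf E_m\cong M\times\mathbb C^n$. The pair $(\triangle,\phi)$ determines a framed connection $\nabla$ (one restricting to the trivial connection on $E_{|M_0}$) on $E$ by $\nabla_Xs=\triangle_X\check s$ for $X$ tangent to $M$ and $\nabla_{\partial_\theta}s=\phi(\check s)$, under the identification of sections. For a connection $\nabla$ with curvature $R$, $Ch(\nabla)=\sum_{j\ge0}\frac1{j!}\big(\frac1{2\pi i}\big)^j\mathrm{tr}(R^{\wedge j})$. The string form is $s(\triangle,\phi):=\int_{S^1}Ch(\nabla)$, an odd complex-valued form on $M$. The Higgs field covariant derivative is the $\mathrm{End}_{L\mathbb C}(\mathsf E)$-valued 1-form $\triangle\phi(X)\check s=\triangle_X(\phi(\check s))-\phi(\triangle_X\check s)$, and $\mathrm{tr}$ is the $L\mathbb C$-valued trace of $L\mathbb C$-module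 endomorphisms. *)

theory Defs
  imports
    "HOL-Analysis.Analysis"
    "HOL-Algebra.Module"
    "HOL-Algebra.AbelCoset"
    "HOL-Combinatorics.Permutations"
begin

section \<open>Manifolds with corners\<close>

text \<open>The space \<open>\<real>^d\<close> is the set of \<open>x :: nat \<Rightarrow> real\<close> with \<open>x i = 0\<close> for \<open>i \<ge> d\<close>; the product
  topology of the function type induces the Euclidean topology on it. For a set \<open>C\<close> of coordinates
  below \<open>d\<close> the set \<open>corner_model d C\<close> is isomorphic to \<open>[0,\<infinity>)^c \<times> \<real>^(d-c)\<close> with \<open>c = card C\<close>.\<close>

definition corner_model :: "nat \<Rightarrow> nat set \<Rightarrow> (nat \<Rightarrow> real) set" where
  "corner_model d C = {x. (\<forall>i\<ge>d. x i = 0) \<and> (\<forall>i\<in>C. 0 \<le> x i)}"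

text \<open>\<open>C^k\<close> functions on a relatively open subset of a corner model: all iterated partial derivatives
  up to order \<open>k\<close> exist (one-sided ones on the faces) and are continuous.\<close>

primrec Ck_on :: "nat \<Rightarrow> nat \<Rightarrow> (nat \<Rightarrow> real) set \<Rightarrow> ((nat \<Rightarrow> real) \<Rightarrow> 'b::real_normed_vector) \<Rightarrow> bool" where
  "Ck_on 0 d S f \<longleftrightarrow> continuous_on S f"
| "Ck_on (Suc k) d S f \<longleftrightarrow> continuous_on S f \<and>
     (\<forall>i<d. \<exists>g. (\<forall>x\<in>S. ((\<lambda>t. f (x(i := t))) has_vector_derivative g x)
                        (at (x i) within {t. x(i := t) \<in> S})) \<and> Ck_on k d S g)"

definition Cinf_on :: "nat \<Rightarrow> (nat \<Rightarrow> real) set \<Rightarrow> ((nat \<Rightarrow> real) \<Rightarrow> 'b::real_normed_vector) \<Rightarrow> bool" where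
  "Cinf_on d S f \<longleftrightarrow> (\<forall>k. Ck_on k d S f)"

text \<open>A chart \<open>(U, x)\<close> has as its domain the set \<open>U\<close>; the values of \<open>x\<close> outside \<open>U\<close> are irrelevant.\<close>

record 'm manifold =
  mdim :: nat
  charts :: "('m set \<times> ('m \<Rightarrow> nat \<Rightarrow> real)) set"

definition manifold_with_corners :: "'m::t2_space manifold \<Rightarrow> bool" where
  "manifold_with_corners M \<longleftrightarrow>
     (\<forall>(U, x)\<in>charts M. open U \<and> homeomorphism U (x ` U) x (inv_into U x) \<and>
        (\<exists>C\<subseteq>{..<mdim M}. openin (top_of_set (corner_model (mdim M) C)) (x ` U))) \<and>
     (\<Union>(U, x)\<in>charts M. U) = UNIV \<and>
     (\<forall>(U, x)\<in>charts M. \<forall>(V, y)\<in>charts M. \<forall>i<mdim M.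
        Cinf_on (mdim M) (x ` (U \<inter> V)) (\<lambda>a. y (inv_into U x a) i))"

text \<open>Second countability follows from compactness.\<close>

definition compact_manifold_with_corners :: "'m::t2_space manifold \<Rightarrow> bool" where
  "compact_manifold_with_corners M \<longleftrightarrow> manifold_with_corners M \<and> compact (UNIV :: 'm set)"

definition smooth_fun_on :: "'m manifold \<Rightarrow> 'm set \<Rightarrow> ('m \<Rightarrow> 'b::real_normed_vector) \<Rightarrow> bool" where
  "smooth_fun_on M W f \<longleftrightarrow> (\<forall>(U, x)\<in>charts M. Cinf_on (mdim M) (x ` (U \<inter> W)) (f \<circ> inv_into U x))"

abbreviation smooth_fun :: "'m manifold \<Rightarrow> ('m \<Rightarrow> 'b::real_normed_vector) \<Rightarrow> bool" where
  "smooth_fun M \<equiv> smooth_fun_on M UNIV"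

text \<open>Tangent vectors are derivations of the algebra of smooth real functions at a point; they are
  normalised to be \<open>0\<close> on functions that are not smooth, so that a derivation is one HOL function.\<close>

type_synonym 'm tvector = "('m \<Rightarrow> real) \<Rightarrow> real"
type_synonym 'm vfield = "'m \<Rightarrow> 'm tvector"

definition tangent_space :: "'m manifold \<Rightarrow> 'm \<Rightarrow> 'm tvector set" where
  "tangent_space M p = {X.
     (\<forall>f. \<not> smooth_fun M f \<longrightarrow> X f = 0) \<and>
     (\<forall>f g. smooth_fun M f \<longrightarrow> smooth_fun M g \<longrightarrow> X (\<lambda>q. f q + g q) = X f + X g) \<and>
     (\<forall>c f. smooth_fun M f \<longrightarrow> X (\<lambda>q. c * f q) = c * X f) \<and>
     (\<forall>f g. smooth_fun M f \<longrightarrow> smooth_fun M g \<longrightarrow> X (\<lambda>q. f q * g q) = f p * X g + g p * X f)}"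

definition vector_fields :: "'m manifold \<Rightarrow> 'm vfield set" where
  "vector_fields M = {X. (\<forall>p. X p \<in> tangent_space M p) \<and>
     (\<forall>f. smooth_fun M f \<longrightarrow> smooth_fun M (\<lambda>p. X p f))}"

definition lie_bracket :: "'m manifold \<Rightarrow> 'm vfield \<Rightarrow> 'm vfield \<Rightarrow> 'm vfield" where
  "lie_bracket M X Y p f =
     (if smooth_fun M f then X p (\<lambda>q. Y q f) - Y p (\<lambda>q. X q f) else 0)"

definition cderiv :: "'m tvector \<Rightarrow> ('m \<Rightarrow> complex) \<Rightarrow> complex" where
  "cderiv X f = Complex (X (\<lambda>q. Re (f q))) (X (\<lambda>q. Im (f q)))"


section \<open>The circle and products with it\<close>

quotient_type circle = real / "\<lambda>x y. \<exists>k::int. y = x + 2 * pi * of_int k"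
  morphisms rep_circle circ
proof (rule equivpI)
  show "reflp (\<lambda>x y. \<exists>k::int. y = x + 2 * pi * of_int k)"
    by (rule reflpI, rule exI[of _ 0]) simp
  show "symp (\<lambda>x y. \<exists>k::int. y = x + 2 * pi * of_int k)"
  proof (rule sympI)
    fix x y :: real
    assume "\<exists>k::int. y = x + 2 * pi * of_int k"
    then obtain k :: int where "y = x + 2 * pi * of_int k" by blast
    then have "x = y + 2 * pi * of_int (- k)" by simp
    then show "\<exists>k::int. x = y + 2 * pi * of_int k" by blast
  qed
  show "transp (\<lambda>x y. \<exists>k::int. y = x + 2 * pi * of_int k)"
  proof (rule transpI)
    fix x y z :: real
    assume "\<exists>k::int. y = x + 2 * pi * of_int k" "\<exists>k::int. z = y + 2 * pi * of_int k"
    then obtain k l :: int where "y = x + 2 * pi * of_int k" "z = y + 2 * pi * of_int l" by blast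
    then have "z = x + 2 * pi * of_int (k + l)" by (simp add: algebra_simps)
    then show "\<exists>k::int. z = x + 2 * pi * of_int k" by blast
  qed
qed

instantiation circle :: topological_space
begin

definition open_circle :: "circle set \<Rightarrow> bool" where
  "open_circle U \<longleftrightarrow> open (circ -` U)"

instance
proof
  show "open (UNIV :: circle set)" by (simp add: open_circle_def)
next
  fix S T :: "circle set"
  assume "open S" "open T"
  then show "open (S \<inter> T)" by (simp add: open_circle_def vimage_Int open_Int)
next
  fix K :: "circle set set"
  assume "\<forall>S\<in>K. open S"
  then show "open (\<Union> K)" by (auto simp: open_circle_def vimage_Union intro!: open_UN)
qed

end

definition times_circle :: "'m manifold \<Rightarrow> ('m \<times> circle) manifold" where
  "times_circle M = \<lparr> mdim = Suc (mdim M),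
     charts = {(U \<times> circ ` {a<..<a + 2 * pi},
                \<lambda>(m, z). (x m)(mdim M := the_inv_into {a<..<a + 2 * pi} circ z)) | U x a.
               (U, x) \<in> charts M} \<rparr>"

text \<open>A vector field (or tangent vector) on \<open>M\<close> regarded on \<open>M \<times> S\<^sup>1\<close>, and the vector field
  \<open>\<partial>\<^sub>\<theta>\<close>.\<close>

definition lift_vfield :: "'m manifold \<Rightarrow> 'm vfield \<Rightarrow> ('m \<times> circle) vfield" where
  "lift_vfield M X = (\<lambda>(m, z) f.
     if smooth_fun (times_circle M) f then X m (\<lambda>m'. f (m', z)) else 0)"

definition theta_vfield :: "'m manifold \<Rightarrow> ('m \<times> circle) vfield" where
  "theta_vfield M = (\<lambda>(m, z) f.
     if smooth_fun (times_circle M) f then deriv (\<lambda>t. f (m, circ t)) (rep_circle z) else 0)"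

text \<open>The components of a tangent vector \<open>Y\<close> at \<open>(m, z)\<close> under
  \<open>T(M \<times> S\<^sup>1) = TM \<oplus> TS\<^sup>1\<close>: its push-forward to \<open>M\<close>, and the number \<open>d\<theta>(Y)\<close>. The latter is computed
  with the globally defined smooth function \<open>sin (\<theta> - \<theta>\<^sub>0)\<close>, where \<open>z = circ \<theta>\<^sub>0\<close>, whose differential
  at \<open>z\<close> is \<open>d\<theta>\<close>.\<close>

definition push_fst :: "'m manifold \<Rightarrow> ('m \<times> circle) tvector \<Rightarrow> 'm tvector" where
  "push_fst M Y f = (if smooth_fun M f then Y (\<lambda>(m, z). f m) else 0)"

definition dtheta :: "circle \<Rightarrow> ('m \<times> circle) tvector \<Rightarrow> real" where
  "dtheta z Y = Y (\<lambda>(m', z'). sin (rep_circle z' - rep_circle z))"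


section \<open>Modules\<close>

text \<open>A module record inherits from the ring record two multiplicative fields which the locale
  \<open>module\<close> does not use; they carry no meaning below.\<close>

definition CC :: "complex ring" where
  "CC = \<lparr> carrier = UNIV, monoid.mult = (*), one = 1, zero = 0, add = (+) \<rparr>"

definition free_module :: "'k ring \<Rightarrow> nat \<Rightarrow> ('k, nat \<Rightarrow> 'k) module" where
  "free_module R n = \<lparr>
     carrier = {v. (\<forall>i<n. v i \<in> carrier R) \<and> (\<forall>i\<ge>n. v i = \<zero>\<^bsub>R\<^esub>)},
     monoid.mult = (\<lambda>v w i. v i \<otimes>\<^bsub>R\<^esub> w i),
     one = (\<lambda>i. if i < n then \<one>\<^bsub>R\<^esub> else \<zero>\<^bsub>R\<^esub>),
     zero = (\<lambda>i. \<zero>\<^bsub>R\<^esub>),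
     add = (\<lambda>v w i. v i \<oplus>\<^bsub>R\<^esub> w i),
     smult = (\<lambda>a v i. a \<otimes>\<^bsub>R\<^esub> v i) \<rparr>"

definition unit_vector :: "'k ring \<Rightarrow> nat \<Rightarrow> nat \<Rightarrow> 'k" where
  "unit_vector R j = (\<lambda>i. if i = j then \<one>\<^bsub>R\<^esub> else \<zero>\<^bsub>R\<^esub>)"

definition module_iso :: "'k ring \<Rightarrow> ('k, 'v) module \<Rightarrow> ('k, 'w) module \<Rightarrow> ('v \<Rightarrow> 'w) \<Rightarrow> bool" where
  "module_iso R N P h \<longleftrightarrow> bij_betw h (carrier N) (carrier P) \<and>
     (\<forall>v\<in>carrier N. \<forall>w\<in>carrier N. h (v \<oplus>\<^bsub>N\<^esub> w) = h v \<oplus>\<^bsub>P\<^esub> h w) \<and>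
     (\<forall>a\<in>carrier R. \<forall>v\<in>carrier N. h (a \<odot>\<^bsub>N\<^esub> v) = a \<odot>\<^bsub>P\<^esub> h v)"

definition free_of_rank :: "'k ring \<Rightarrow> nat \<Rightarrow> ('k, 'v) module \<Rightarrow> bool" where
  "free_of_rank R n N \<longleftrightarrow> module R N \<and> (\<exists>h. module_iso R N (free_module R n) h)"

text \<open>The trace of an endomorphism of a free module of rank \<open>n\<close>; it does not depend on the
  chosen isomorphism with \<open>R^n\<close>.\<close>

definition module_trace :: "'k ring \<Rightarrow> nat \<Rightarrow> ('k, 'v) module \<Rightarrow> ('v \<Rightarrow> 'v) \<Rightarrow> 'k" where
  "module_trace R n N A =
     (let h = (SOME h. module_iso R N (free_module R n) h)
      in \<Oplus>\<^bsub>R\<^esub>i\<in>{..<n}. h (A (inv_into (carrier N) h (unit_vector R i))) i)"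

definition quotient_module :: "('k, 'v) module \<Rightarrow> 'v set \<Rightarrow> ('k, 'v set) module" where
  "quotient_module N I = \<lparr>
     carrier = a_rcosets\<^bsub>N\<^esub> I,
     monoid.mult = undefined,
     one = undefined,
     zero = I,
     add = set_add N,
     smult = (\<lambda>a K. \<Union>v\<in>K. I +>\<^bsub>N\<^esub> (a \<odot>\<^bsub>N\<^esub> v)) \<rparr>"


section \<open>The loop algebra and smooth maps into it\<close>

definition dcirc :: "(circle \<Rightarrow> complex) \<Rightarrow> circle \<Rightarrow> complex" where
  "dcirc f z = vector_derivative (f \<circ> circ) (at (rep_circle z))"

definition LC :: "(circle \<Rightarrow> complex) ring" where
  "LC = \<lparr>
     carrier = {f. \<forall>k t. ((dcirc ^^ k) f \<circ> circ) differentiable (at t)},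
     monoid.mult = (\<lambda>f g z. f z * g z),
     one = (\<lambda>z. 1),
     zero = (\<lambda>z. 0),
     add = (\<lambda>f g z. f z + g z) \<rparr>"

text \<open>Convergence in the Frechet topology of \<open>C\<^sup>\<infinity>(S\<^sup>1, \<complex>)\<close>: uniform convergence of all derivatives.\<close>

definition LC_tendsto :: "('a \<Rightarrow> circle \<Rightarrow> complex) \<Rightarrow> (circle \<Rightarrow> complex) \<Rightarrow> 'a filter \<Rightarrow> bool" where
  "LC_tendsto F f \<F> \<longleftrightarrow> (\<forall>k. uniform_limit UNIV (\<lambda>y. (dcirc ^^ k) (F y)) ((dcirc ^^ k) f) \<F>)"

primrec LC_Ck_on :: "nat \<Rightarrow> nat \<Rightarrow> (nat \<Rightarrow> real) set \<Rightarrow> ((nat \<Rightarrow> real) \<Rightarrow> circle \<Rightarrow> complex) \<Rightarrow> bool" where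
  "LC_Ck_on 0 d S f \<longleftrightarrow> (\<forall>x\<in>S. f x \<in> carrier LC \<and> LC_tendsto f (f x) (at x within S))"
| "LC_Ck_on (Suc k) d S f \<longleftrightarrow>
     (\<forall>x\<in>S. f x \<in> carrier LC \<and> LC_tendsto f (f x) (at x within S)) \<and>
     (\<forall>i<d. \<exists>g. (\<forall>x\<in>S. LC_tendsto (\<lambda>t z. (f (x(i := t)) z - f x z) / of_real (t - x i)) (g x)
                        (at (x i) within {t. x(i := t) \<in> S})) \<and> LC_Ck_on k d S g)"

definition LC_smooth_on :: "'m manifold \<Rightarrow> 'm set \<Rightarrow> ('m \<Rightarrow> circle \<Rightarrow> complex) \<Rightarrow> bool" where
  "LC_smooth_on M W f \<longleftrightarrow>
     (\<forall>(U, x)\<in>charts M. \<forall>k. LC_Ck_on k (mdim M) (x ` (U \<inter> W)) (f \<circ> inv_into U x))"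


section \<open>\<open>\<Omega>\<close> vector bundles\<close>

text \<open>The submodule \<open>I\<^sub>z N\<close> of elements vanishing at \<open>z\<close>.\<close>

definition vanishing_at :: "nat \<Rightarrow> (circle \<Rightarrow> complex, 'v) module \<Rightarrow> circle \<Rightarrow> 'v set" where
  "vanishing_at n N z = {v \<in> carrier N.
     \<forall>h. module_iso LC N (free_module LC n) h \<longrightarrow> (\<forall>i<n. h v i z = 0)}"

definition complex_scalars :: "(circle \<Rightarrow> complex, 'v) module \<Rightarrow> (complex, 'v) module" where
  "complex_scalars N = \<lparr>
     carrier = carrier N,
     monoid.mult = monoid.mult N,
     one = one N,
     zero = zero N,
     add = add N,
     smult = (\<lambda>c v. (\<lambda>z. c) \<odot>\<^bsub>N\<^esub> v) \<rparr>"

definition fibre_at :: "nat \<Rightarrow> (circle \<Rightarrow> complex, 'v) module \<Rightarrow> circle \<Rightarrow> (complex, 'v set) module" where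
  "fibre_at n N z = quotient_module (complex_scalars N) (vanishing_at n N z)"

definition omega_module ::
  "nat \<Rightarrow> (circle \<Rightarrow> complex, 'v) module \<Rightarrow> ('v set \<Rightarrow> nat \<Rightarrow> complex) \<Rightarrow> bool" where
  "omega_module n N fr \<longleftrightarrow> free_of_rank LC n N \<and>
     module_iso CC (fibre_at n N (circ 0)) (free_module CC n) fr"

text \<open>An isomorphism of \<open>\<Omega>\<close>-modules onto \<open>L\<complex>^n\<close>, which is framed by evaluation at \<open>0\<close>.\<close>

definition omega_iso_std ::
  "nat \<Rightarrow> (circle \<Rightarrow> complex, 'v) module \<Rightarrow> ('v set \<Rightarrow> nat \<Rightarrow> complex) \<Rightarrow>
   ('v \<Rightarrow> nat \<Rightarrow> circle \<Rightarrow> complex) \<Rightarrow> bool" where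
  "omega_iso_std n N fr h \<longleftrightarrow> module_iso LC N (free_module LC n) h \<and>
     (\<forall>v\<in>carrier N. \<forall>i<n. fr (vanishing_at n N (circ 0) +>\<^bsub>N\<^esub> v) i = h v i (circ 0))"

record ('m, 'v) omega_bundle =
  orank :: nat
  ofibre :: "'m \<Rightarrow> (circle \<Rightarrow> complex, 'v) module"
  oframing :: "'m \<Rightarrow> 'v set \<Rightarrow> nat \<Rightarrow> complex"
  otrivs :: "('m set \<times> ('m \<Rightarrow> 'v \<Rightarrow> nat \<Rightarrow> circle \<Rightarrow> complex)) set"

text \<open>The smooth structure of the total space is given by the local trivialisations. A
  transition function takes values in \<open>L\<complex>\<close>-linear automorphisms of \<open>L\<complex>^n\<close>, that is in matrices with
  entries in \<open>L\<complex>\<close>, and it is required to be smooth as a map into this Frechet space.\<close>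

definition omega_vector_bundle :: "'m::topological_space manifold \<Rightarrow> ('m, 'v) omega_bundle \<Rightarrow> bool" where
  "omega_vector_bundle M E \<longleftrightarrow>
     (\<forall>m. omega_module (orank E) (ofibre E m) (oframing E m)) \<and>
     (\<forall>(U, \<Psi>)\<in>otrivs E. open U \<and>
        (\<forall>m\<in>U. omega_iso_std (orank E) (ofibre E m) (oframing E m) (\<Psi> m))) \<and>
     (\<Union>(U, \<Psi>)\<in>otrivs E. U) = UNIV \<and>
     (\<forall>(U, \<Psi>)\<in>otrivs E. \<forall>(V, \<Phi>)\<in>otrivs E. \<forall>i<orank E. \<forall>j<orank E.
        LC_smooth_on M (U \<inter> V)
          (\<lambda>m. \<Phi> m (inv_into (carrier (ofibre E m)) (\<Psi> m) (unit_vector LC j)) i))"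

definition osections_on :: "'m manifold \<Rightarrow> ('m, 'v) omega_bundle \<Rightarrow> 'm set \<Rightarrow> ('m \<Rightarrow> 'v) set" where
  "osections_on M E W = {s. (\<forall>m\<in>W. s m \<in> carrier (ofibre E m)) \<and>
     (\<forall>(U, \<Psi>)\<in>otrivs E. \<forall>i<orank E. LC_smooth_on M (U \<inter> W) (\<lambda>m. \<Psi> m (s m) i))}"

abbreviation osections :: "'m manifold \<Rightarrow> ('m, 'v) omega_bundle \<Rightarrow> ('m \<Rightarrow> 'v) set" where
  "osections M E \<equiv> osections_on M E UNIV"

text \<open>Smoothness of the family \<open>\<phi>\<close>: as a map of total spaces it carries smooth local sections
  to smooth local sections. For fibrewise linear maps satisfying the Leibniz rule this is the same
  as smoothness of the local representatives, which have the form \<open>\<partial>\<^sub>\<theta> + A\<close> with a smooth matrix \<open>A\<close>.\<close>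

definition higgs_field :: "'m::topological_space manifold \<Rightarrow> ('m, 'v) omega_bundle \<Rightarrow> ('m \<Rightarrow> 'v \<Rightarrow> 'v) \<Rightarrow> bool" where
  "higgs_field M E \<phi> \<longleftrightarrow>
     (\<forall>m. \<forall>v\<in>carrier (ofibre E m). \<phi> m v \<in> carrier (ofibre E m)) \<and>
     (\<forall>m. \<forall>v\<in>carrier (ofibre E m). \<forall>w\<in>carrier (ofibre E m).
        \<phi> m (v \<oplus>\<^bsub>ofibre E m\<^esub> w) = \<phi> m v \<oplus>\<^bsub>ofibre E m\<^esub> \<phi> m w) \<and>
     (\<forall>m. \<forall>c. \<forall>v\<in>carrier (ofibre E m).
        \<phi> m ((\<lambda>z. c) \<odot>\<^bsub>ofibre E m\<^esub> v) = (\<lambda>z. c) \<odot>\<^bsub>ofibre E m\<^esub> \<phi> m v) \<and>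
     (\<forall>m. \<forall>f\<in>carrier LC. \<forall>v\<in>carrier (ofibre E m).
        \<phi> m (f \<odot>\<^bsub>ofibre E m\<^esub> v) =
          (dcirc f \<odot>\<^bsub>ofibre E m\<^esub> v) \<oplus>\<^bsub>ofibre E m\<^esub> (f \<odot>\<^bsub>ofibre E m\<^esub> \<phi> m v)) \<and>
     (\<forall>W. open W \<longrightarrow> (\<forall>s\<in>osections_on M E W. (\<lambda>m. \<phi> m (s m)) \<in> osections_on M E W))"

text \<open>A covariant derivative sends a point, a tangent vector there and a section to an element
  of the fibre.\<close>

type_synonym ('m, 'v) covariant_derivative = "'m \<Rightarrow> 'm tvector \<Rightarrow> ('m \<Rightarrow> 'v) \<Rightarrow> 'v"

definition module_connection ::
  "'m manifold \<Rightarrow> ('m, 'v) omega_bundle \<Rightarrow> ('m, 'v) covariant_derivative \<Rightarrow> bool" where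
  "module_connection M E D \<longleftrightarrow>
     (\<forall>m. \<forall>X\<in>tangent_space M m. \<forall>s\<in>osections M E. D m X s \<in> carrier (ofibre E m)) \<and>
     (\<forall>m. \<forall>X\<in>tangent_space M m. \<forall>Y\<in>tangent_space M m. \<forall>a b. \<forall>s\<in>osections M E.
        D m (\<lambda>f. a * X f + b * Y f) s =
          ((\<lambda>z. of_real a) \<odot>\<^bsub>ofibre E m\<^esub> D m X s) \<oplus>\<^bsub>ofibre E m\<^esub>
          ((\<lambda>z. of_real b) \<odot>\<^bsub>ofibre E m\<^esub> D m Y s)) \<and>
     (\<forall>m. \<forall>X\<in>tangent_space M m. \<forall>s\<in>osections M E. \<forall>s'\<in>osections M E.
        D m X (\<lambda>q. s q \<oplus>\<^bsub>ofibre E q\<^esub> s' q) = D m X s \<oplus>\<^bsub>ofibre E m\<^esub> D m X s') \<and>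
     (\<forall>m. \<forall>X\<in>tangent_space M m. \<forall>s\<in>osections M E. \<forall>f. smooth_fun (times_circle M) f \<longrightarrow>
        D m X (\<lambda>q. (\<lambda>z. f (q, z)) \<odot>\<^bsub>ofibre E q\<^esub> s q) =
          ((\<lambda>z. cderiv X (\<lambda>q. f (q, z))) \<odot>\<^bsub>ofibre E m\<^esub> s m) \<oplus>\<^bsub>ofibre E m\<^esub>
          ((\<lambda>z. f (m, z)) \<odot>\<^bsub>ofibre E m\<^esub> D m X s)) \<and>
     (\<forall>X\<in>vector_fields M. \<forall>s\<in>osections M E. (\<lambda>m. D m (X m) s) \<in> osections M E) \<and>
     (\<forall>m. \<forall>X\<in>tangent_space M m. \<forall>s\<in>osections M E. \<forall>i<orank E.
        oframing E m (vanishing_at (orank E) (ofibre E m) (circ 0) +>\<^bsub>ofibre E m\<^esub> D m X s) i =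
        cderiv X (\<lambda>q. oframing E q
          (vanishing_at (orank E) (ofibre E q) (circ 0) +>\<^bsub>ofibre E q\<^esub> s q) i))"


section \<open>The caloron transform\<close>

record ('p, 'v) complex_bundle =
  crank :: nat
  cfibre :: "'p \<Rightarrow> (complex, 'v) module"
  ctrivs :: "('p set \<times> ('p \<Rightarrow> 'v \<Rightarrow> nat \<Rightarrow> complex)) set"

definition csections :: "'p manifold \<Rightarrow> ('p, 'v) complex_bundle \<Rightarrow> ('p \<Rightarrow> 'v) set" where
  "csections N E = {s. (\<forall>p. s p \<in> carrier (cfibre E p)) \<and>
     (\<forall>(U, \<psi>)\<in>ctrivs E. \<forall>i<crank E. smooth_fun_on N U (\<lambda>p. \<psi> p (s p) i))}"

text \<open>A trivialisation \<open>\<Psi>\<close> over \<open>U\<close> induces the isomorphisms \<open>[v] \<mapsto> (\<Psi> v)(z)\<close> of the fibres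
  over \<open>U \<times> S\<^sup>1\<close> with \<open>\<complex>^n\<close>.\<close>

definition caloron :: "('m, 'v) omega_bundle \<Rightarrow> ('m \<times> circle, 'v set) complex_bundle" where
  "caloron E = \<lparr> crank = orank E,
     cfibre = (\<lambda>(m, z). fibre_at (orank E) (ofibre E m) z),
     ctrivs = {(U \<times> UNIV, \<lambda>(m, z) K i. \<Psi> m (SOME v. v \<in> K) i z) | U \<Psi>. (U, \<Psi>) \<in> otrivs E} \<rparr>"

definition evaluate :: "('m, 'v) omega_bundle \<Rightarrow> ('m \<Rightarrow> 'v) \<Rightarrow> 'm \<times> circle \<Rightarrow> 'v set" where
  "evaluate E s = (\<lambda>(m, z). vanishing_at (orank E) (ofibre E m) z +>\<^bsub>ofibre E m\<^esub> s m)"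

definition caloron_connection ::
  "'m manifold \<Rightarrow> ('m, 'v) omega_bundle \<Rightarrow> ('m, 'v) covariant_derivative \<Rightarrow> ('m \<Rightarrow> 'v \<Rightarrow> 'v) \<Rightarrow>
   ('m \<times> circle, 'v set) covariant_derivative" where
  "caloron_connection M E D \<phi> = (\<lambda>(m, z) Y s.
     let s' = inv_into (osections M E) (evaluate E) s;
         I = vanishing_at (orank E) (ofibre E m) z;
         V = fibre_at (orank E) (ofibre E m) z
     in (I +>\<^bsub>ofibre E m\<^esub> D m (push_fst M Y) s') \<oplus>\<^bsub>V\<^esub>
        (of_real (dtheta z Y) \<odot>\<^bsub>V\<^esub> (I +>\<^bsub>ofibre E m\<^esub> \<phi> m (s' m))))"


section \<open>Curvature, endomorphism-valued forms and the string form\<close>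

text \<open>A \<open>k\<close>-form is a function of \<open>k\<close> vector fields \<open>X 0, \<dots>, X (k - 1)\<close>; values \<open>X i\<close> with
  \<open>i \<ge> k\<close> are ignored. An endomorphism-valued form has as its values operators on sections. The degree
  of such a form is not recorded in it and is passed as an argument where it is needed.\<close>

type_synonym ('p, 'v) endo_form = "(nat \<Rightarrow> 'p vfield) \<Rightarrow> ('p \<Rightarrow> 'v) \<Rightarrow> 'p \<Rightarrow> 'v"

definition curvature ::
  "'p manifold \<Rightarrow> ('p \<Rightarrow> (complex, 'v) module) \<Rightarrow> ('p, 'v) covariant_derivative \<Rightarrow> ('p, 'v) endo_form" where
  "curvature N V D X s p =
     (D p (X 0 p) (\<lambda>q. D q (X 1 q) s) \<ominus>\<^bsub>V p\<^esub> D p (X 1 p) (\<lambda>q. D q (X 0 q) s))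
       \<ominus>\<^bsub>V p\<^esub> D p (lie_bracket N (X 0) (X 1) p) s"

definition higgs_derivative ::
  "('m, 'v) omega_bundle \<Rightarrow> ('m, 'v) covariant_derivative \<Rightarrow> ('m \<Rightarrow> 'v \<Rightarrow> 'v) \<Rightarrow> ('m, 'v) endo_form" where
  "higgs_derivative E D \<phi> X s m =
     D m (X 0 m) (\<lambda>q. \<phi> q (s q)) \<ominus>\<^bsub>ofibre E m\<^esub> \<phi> m (D m (X 0 m) s)"

text \<open>Wedge product of a \<open>k\<close>-form and an \<open>l\<close>-form, normalised by \<open>1 / (k! l!)\<close> so that
  \<open>(\<alpha> \<and> \<beta>)(X, Y) = \<alpha>(X) \<beta>(Y) - \<alpha>(Y) \<beta>(X)\<close> for one-forms; coefficients are composed.\<close>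

definition wedge ::
  "('p \<Rightarrow> (complex, 'v) module) \<Rightarrow> nat \<Rightarrow> nat \<Rightarrow> ('p, 'v) endo_form \<Rightarrow> ('p, 'v) endo_form \<Rightarrow> ('p, 'v) endo_form" where
  "wedge V k l \<alpha> \<beta> X s p =
     (\<Oplus>\<^bsub>V p\<^esub>\<sigma>\<in>{\<sigma>. \<sigma> permutes {..<k + l}}.
        (of_int (sign \<sigma>) / (fact k * fact l)) \<odot>\<^bsub>V p\<^esub>
          \<alpha> (\<lambda>i. X (\<sigma> i)) (\<beta> (\<lambda>i. X (\<sigma> (k + i))) s) p)"

text \<open>The \<open>j\<close>-fold wedge power of a two-form.\<close>

primrec wedge_power ::
  "('p \<Rightarrow> (complex, 'v) module) \<Rightarrow> ('p, 'v) endo_form \<Rightarrow> nat \<Rightarrow> ('p, 'v) endo_form" where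
  "wedge_power V \<alpha> 0 = (\<lambda>X s. s)"
| "wedge_power V \<alpha> (Suc j) = wedge V 2 (2 * j) \<alpha> (wedge_power V \<alpha> j)"

text \<open>The endomorphism of the fibre at \<open>p\<close> induced by an operator \<open>A\<close> on sections that is linear over
  smooth functions; \<open>(A s)(p)\<close> then depends only on \<open>s p\<close>.\<close>

definition endo_at :: "('p \<Rightarrow> 'v) set \<Rightarrow> (('p \<Rightarrow> 'v) \<Rightarrow> 'p \<Rightarrow> 'v) \<Rightarrow> 'p \<Rightarrow> 'v \<Rightarrow> 'v" where
  "endo_at \<Gamma> A p v = A (SOME s. s \<in> \<Gamma> \<and> s p = v) p"

text \<open>A scalar form of mixed degree is represented by its homogeneous components, with the degree
  as first argument. In each degree only finitely many terms of the following series are nonzero.\<close>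

type_synonym 'p mixed_form = "nat \<Rightarrow> (nat \<Rightarrow> 'p vfield) \<Rightarrow> 'p \<Rightarrow> complex"

definition chern_form ::
  "'p manifold \<Rightarrow> ('p, 'v) complex_bundle \<Rightarrow> ('p, 'v) covariant_derivative \<Rightarrow> 'p mixed_form" where
  "chern_form N E D k X p =
     (\<Sum>j. if k = 2 * j
           then 1 / fact j * (1 / (2 * of_real pi * \<i>)) ^ j *
                module_trace CC (crank E) (cfibre E p)
                  (endo_at (csections N E)
                    (wedge_power (cfibre E) (curvature N (cfibre E) D) j X) p)
           else 0)"

definition circle_integral :: "(circle \<Rightarrow> complex) \<Rightarrow> complex" where
  "circle_integral f = integral {0..2 * pi} (\<lambda>t. f (circ t))"

text \<open>\<open>\<partial>\<^sub>\<theta>\<close> enters in the last slot, in accordance with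
  \<open>\<integral> (f pr^*\<beta>) \<and> d\<theta> = \<beta> \<integral> f d\<theta>\<close>.\<close>

definition fibre_integral :: "'m manifold \<Rightarrow> ('m \<times> circle) mixed_form \<Rightarrow> 'm mixed_form" where
  "fibre_integral M \<omega> k X m =
     circle_integral (\<lambda>z. \<omega> (Suc k) (\<lambda>i. if i < k then lift_vfield M (X i) else theta_vfield M) (m, z))"

definition string_form ::
  "'m manifold \<Rightarrow> ('m, 'v) omega_bundle \<Rightarrow> ('m, 'v) covariant_derivative \<Rightarrow> ('m \<Rightarrow> 'v \<Rightarrow> 'v) \<Rightarrow>
   'm mixed_form" where
  "string_form M E D \<phi> =
     fibre_integral M (chern_form (times_circle M) (caloron E) (caloron_connection M E D \<phi>))"

definition complex_fibre :: "('m, 'v) omega_bundle \<Rightarrow> 'm \<Rightarrow> (complex, 'v) module" where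
  "complex_fibre E m = complex_scalars (ofibre E m)"

text \<open>The \<open>L\<complex>\<close>-valued trace of a form with values in endomorphisms of an \<open>\<Omega>\<close> vector bundle.\<close>

definition loop_trace ::
  "'m manifold \<Rightarrow> ('m, 'v) omega_bundle \<Rightarrow> ('m, 'v) endo_form \<Rightarrow> (nat \<Rightarrow> 'm vfield) \<Rightarrow> 'm \<Rightarrow> circle \<Rightarrow> complex" where
  "loop_trace M E \<alpha> X m =
     module_trace LC (orank E) (ofibre E m) (endo_at (osections M E) (\<alpha> X) m)"

end

theory Submission
  imports Defs
begin

text \<open>
  The caloron correspondence carries sections of \<open>E\<close> over \<open>M\<close> to sections of the caloron
  transform over \<open>M \<times> S\<^sup>1\<close>. Since \<open>\<nabla>\<close> is \<open>\<triangle>\<close> in the directions of \<open>M\<close> and \<open>\<phi>\<close> in the direction of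
  \<open>\<partial>\<^sub>\<theta>\<close>, and since the lift of a vector field on \<open>M\<close> commutes with \<open>\<partial>\<^sub>\<theta>\<close>, the curvature of \<open>\<nabla>\<close> on two
  lifts is the curvature of \<open>\<triangle>\<close>, and on a lift and \<open>\<partial>\<^sub>\<theta>\<close> it is \<open>\<triangle>\<phi>\<close>. All these operators are linear
  over smooth functions on \<open>M \<times> S\<^sup>1\<close>; as there are bump functions on a manifold with corners, they act
  on the fibre at \<open>(m, z)\<close> by matrices. The matrix \<open>W a b\<close> of the curvature on the fields with
  numbers \<open>a\<close> and \<open>b\<close> is antisymmetric in \<open>a\<close> and \<open>b\<close>. In the alternating sum for the trace of
  \<open>W \<and> \<dots> \<and> W\<close> (\<open>j + 1\<close> factors) the field \<open>\<partial>\<^sub>\<theta>\<close> fills one of \<open>2 j + 2\<close> slots. Cyclicity of the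
  trace and antisymmetry make the contributions of these slots equal, and each is half the trace of
  \<open>\<triangle>\<phi> \<and> R \<and> \<dots> \<and> R\<close>. The factor \<open>j + 1\<close> turns \<open>1 / (j + 1)!\<close> into \<open>1 / j!\<close>.
\<close>

section \<open>Smooth functions on corner models\<close>

text \<open>The obstacle is analytic. Smoothness means iterated one-sided partial derivatives, loops
  carry a Frechet topology, and tangent vectors are abstract derivations of global functions.
  Linearity of the curvature over functions \<open>f\<close> on the product with the circle needs
  \<open>X f\<close> to be jointly smooth in point and angle; linearity of \<triangle>\<phi> needs
  \<open>X\<close> to commute with the angular derivative. Two tools give both. Hadamard's lemma
  with smooth coefficients, valid at faces and corners, yields the chain rule and the coordinate
  form of a derivation. The exponential law turns a smooth map into \<open>LC\<close> into a smooth
  function on a cylinder over a chart, where the angle is one more coordinate and mixed partials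
  commute.

  A second obstacle is that both traces are defined through arbitrary choices: an isomorphism with a
  free module and a section through each vector. Everything is therefore read off from values of
  coordinates at one fixed pair \<open>(m, z)\<close> in one trivialisation. Evaluation of sections
  intertwines the two sides, so the same complex matrices compute the value at \<open>z\<close> of
  the \<open>LC\<close>-valued trace and the trace on the caloron fibre.\<close>

lemma has_vector_derivative_cong_on:
  assumes "(f has_vector_derivative D) (at t within A)" "\<And>s. s \<in> A \<Longrightarrow> f s = g s" "t \<in> A"
  shows "(g has_vector_derivative D) (at t within A)"
  by (rule has_vector_derivative_transform[OF assms(3) _ assms(1)]) (simp add: assms(2))

lemma Ck_on_imp_continuous_on: "Ck_on k d S f \<Longrightarrow> continuous_on S f"
  by (cases k) auto

lemma Ck_on_SucE:
  assumes "Ck_on (Suc k) d S f" "i < d"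
  obtains g where
    "\<And>x. x \<in> S \<Longrightarrow> ((\<lambda>t. f (x(i := t))) has_vector_derivative g x) (at (x i) within {t. x(i := t) \<in> S})"
    "Ck_on k d S g"
  using assms unfolding Ck_on.simps(2) by meson

lemma Ck_on_subset: "Ck_on k d S f \<Longrightarrow> S' \<subseteq> S \<Longrightarrow> Ck_on k d S' f"
proof (induction k arbitrary: f)
  case 0
  then show ?case by (simp add: continuous_on_subset)
next
  case (Suc k)
  have "\<exists>g. (\<forall>x\<in>S'. ((\<lambda>t. f (x(i := t))) has_vector_derivative g x)
      (at (x i) within {t. x(i := t) \<in> S'})) \<and> Ck_on k d S' g" if "i < d" for i
  proof -
    obtain g where g: "\<And>x. x \<in> S \<Longrightarrow> ((\<lambda>t. f (x(i := t))) has_vector_derivative g x)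
      (at (x i) within {t. x(i := t) \<in> S})" "Ck_on k d S g"
      using Ck_on_SucE[OF Suc.prems(1) \<open>i < d\<close>] by metis
    have "((\<lambda>t. f (x(i := t))) has_vector_derivative g x)
        (at (x i) within {t. x(i := t) \<in> S'})" if "x \<in> S'" for x
      using g(1) that Suc.prems(2)
      by (intro has_vector_derivative_within_subset[where S = "{t. x(i := t) \<in> S}" and T="{t. x(i := t) \<in> S'}"]) auto
    then show ?thesis using Suc.IH[OF g(2) Suc.prems(2)] by (intro exI[of _ g] conjI ballI)
  qed
  then show ?case
    using continuous_on_subset[OF Ck_on_imp_continuous_on[OF Suc.prems(1)] Suc.prems(2)] by simp
qed

lemma Ck_on_cong:
  assumes "Ck_on k d S f" "\<And>x. x \<in> S \<Longrightarrow> f x = g x"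
  shows "Ck_on k d S g"
proof (cases k)
  case 0
  then show ?thesis using assms by (simp cong: continuous_on_cong)
next
  case (Suc l)
  have "\<exists>h. (\<forall>x\<in>S. ((\<lambda>t. g (x(i := t))) has_vector_derivative h x)
      (at (x i) within {t. x(i := t) \<in> S})) \<and> Ck_on l d S h" if "i < d" for i
  proof -
    obtain h where h: "\<And>x. x \<in> S \<Longrightarrow> ((\<lambda>t. f (x(i := t))) has_vector_derivative h x)
      (at (x i) within {t. x(i := t) \<in> S})" "Ck_on l d S h"
      using Ck_on_SucE[OF assms(1)[unfolded Suc] \<open>i < d\<close>] by metis
    have "((\<lambda>t. g (x(i := t))) has_vector_derivative h x)
        (at (x i) within {t. x(i := t) \<in> S})" if "x \<in> S" for x
      by (rule has_vector_derivative_cong_on[OF h(1)[OF that]]) (simp_all add: assms(2) that)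
    then show ?thesis using h(2) by (intro exI[of _ h] conjI ballI)
  qed
  moreover have "continuous_on S g"
    using Ck_on_imp_continuous_on[OF assms(1)] assms(2) by (simp cong: continuous_on_cong)
  ultimately show ?thesis using Suc by simp
qed

lemma Ck_on_Suc_imp: "Ck_on (Suc k) d S f \<Longrightarrow> Ck_on k d S f"
proof (induction k arbitrary: f)
  case (Suc k)
  have "continuous_on S f" using Suc.prems by simp
  moreover have "\<exists>g. (\<forall>x\<in>S. ((\<lambda>t. f (x(i := t))) has_vector_derivative g x)
      (at (x i) within {t. x(i := t) \<in> S})) \<and> Ck_on k d S g" if i: "i < d" for i
  proof -
    have "\<exists>g. (\<forall>x\<in>S. ((\<lambda>t. f (x(i := t))) has_vector_derivative g x)
      (at (x i) within {t. x(i := t) \<in> S})) \<and> Ck_on (Suc k) d S g"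
      using Suc.prems i unfolding Ck_on.simps(2)[of "Suc k"] by blast
    with Suc.IH show ?thesis by blast
  qed
  ultimately show ?case by simp
qed simp

lemma Ck_on_const [simp]: "Ck_on k d S (\<lambda>x. c)"
  by (induction k arbitrary: c) (auto intro!: exI[of _ "\<lambda>x. 0"])

lemma Ck_on_coord: "Ck_on k d S (\<lambda>x. x j)"
proof (cases k)
  case 0
  then show ?thesis by (auto intro: continuous_on_subset[OF continuous_on_product_coordinates])
next
  case (Suc l)
  have "\<exists>g. (\<forall>x\<in>S. ((\<lambda>t. (x(i := t)) j) has_vector_derivative g x)
      (at (x i) within {t. x(i := t) \<in> S})) \<and> Ck_on l d S g" for i
    by (rule exI[of _ "\<lambda>x. if i = j then 1 else 0"]) auto
  then show ?thesis using Suc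
    by (auto intro: continuous_on_subset[OF continuous_on_product_coordinates])
qed

text \<open>The product rule turns a derivative of \<open>P (f x) (g x)\<close> into a sum, so the
  induction for products rests on closure under sums. Sums are settled first, for every order and
  every value space.\<close>

lemma Ck_on_bounded_bilinear:
  assumes P: "bounded_bilinear P"
  shows "Ck_on k d S f \<Longrightarrow> Ck_on k d S g \<Longrightarrow> Ck_on k d S (\<lambda>x. P (f x) (g x))"
    and "Ck_on k d S f' \<Longrightarrow> Ck_on k d S g' \<Longrightarrow> Ck_on k d S (\<lambda>x. f' x + (g' x :: 'c :: real_normed_vector))"
proof -
  show add: "Ck_on k d S f' \<Longrightarrow> Ck_on k d S g' \<Longrightarrow> Ck_on k d S (\<lambda>x. f' x + g' x)"
    for k and f' g' :: "_ \<Rightarrow> 'e::real_normed_vector"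
  proof (induction k arbitrary: f' g')
    case (Suc k)
    have "\<exists>h. (\<forall>x\<in>S. ((\<lambda>t. f' (x(i := t)) + g' (x(i := t))) has_vector_derivative h x)
      (at (x i) within {t. x(i := t) \<in> S})) \<and> Ck_on k d S h" if "i < d" for i
    proof -
      obtain a b where
        "\<And>x. x \<in> S \<Longrightarrow> ((\<lambda>t. f' (x(i := t))) has_vector_derivative a x) (at (x i) within {t. x(i := t) \<in> S})" "Ck_on k d S a"
        "\<And>x. x \<in> S \<Longrightarrow> ((\<lambda>t. g' (x(i := t))) has_vector_derivative b x) (at (x i) within {t. x(i := t) \<in> S})" "Ck_on k d S b"
        using Ck_on_SucE[OF Suc.prems(1) \<open>i < d\<close>] Ck_on_SucE[OF Suc.prems(2) \<open>i < d\<close>] by metis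
      then show ?thesis
        by (intro exI[of _ "\<lambda>x. a x + b x"]) (auto intro: has_vector_derivative_add Suc.IH)
    qed
    then show ?case using continuous_on_add[OF Suc.prems[THEN Ck_on_imp_continuous_on]] by simp
  qed (auto intro: continuous_on_add)
  show "Ck_on k d S f \<Longrightarrow> Ck_on k d S g \<Longrightarrow> Ck_on k d S (\<lambda>x. P (f x) (g x))"
  proof (induction k arbitrary: f g)
    case 0
    then show ?case by (auto intro: bounded_bilinear.continuous_on[OF P])
  next
    case (Suc k)
    have "\<exists>h. (\<forall>x\<in>S. ((\<lambda>t. P (f (x(i := t))) (g (x(i := t)))) has_vector_derivative h x)
      (at (x i) within {t. x(i := t) \<in> S})) \<and> Ck_on k d S h" if "i < d" for i
    proof -
      obtain a b where ab:
        "\<And>x. x \<in> S \<Longrightarrow> ((\<lambda>t. f (x(i := t))) has_vector_derivative a x) (at (x i) within {t. x(i := t) \<in> S})" "Ck_on k d S a"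
        "\<And>x. x \<in> S \<Longrightarrow> ((\<lambda>t. g (x(i := t))) has_vector_derivative b x) (at (x i) within {t. x(i := t) \<in> S})" "Ck_on k d S b"
        using Ck_on_SucE[OF Suc.prems(1) \<open>i < d\<close>] Ck_on_SucE[OF Suc.prems(2) \<open>i < d\<close>] by metis
      have "((\<lambda>t. P (f (x(i := t))) (g (x(i := t)))) has_vector_derivative P (f x) (b x) + P (a x) (g x))
         (at (x i) within {t. x(i := t) \<in> S})" if "x \<in> S" for x
        using bounded_bilinear.has_vector_derivative[OF P ab(1)[OF that] ab(3)[OF that]]
        by simp
      moreover have "Ck_on k d S (\<lambda>x. P (f x) (b x) + P (a x) (g x))"
        by (intro add Suc.IH ab Ck_on_Suc_imp[OF Suc.prems(1)] Ck_on_Suc_imp[OF Suc.prems(2)])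
      ultimately show ?thesis by (intro exI[of _ "\<lambda>x. P (f x) (b x) + P (a x) (g x)"] conjI ballI)
    qed
    then show ?case
      using bounded_bilinear.continuous_on[OF P Suc.prems[THEN Ck_on_imp_continuous_on]] by simp
  qed
qed

lemmas Ck_on_add = Ck_on_bounded_bilinear(2)[OF bounded_bilinear_scaleR]
lemmas Ck_on_scaleR = Ck_on_bounded_bilinear(1)[OF bounded_bilinear_scaleR]

lemma Ck_on_mult:
  fixes f g :: "(nat \<Rightarrow> real) \<Rightarrow> 'a::real_normed_algebra"
  shows "Ck_on k d S f \<Longrightarrow> Ck_on k d S g \<Longrightarrow> Ck_on k d S (\<lambda>x. f x * g x)"
  by (rule Ck_on_bounded_bilinear(1)[OF bounded_bilinear_mult])

lemma Ck_on_bounded_linear: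
  assumes L: "bounded_linear L"
  shows "Ck_on k d S f \<Longrightarrow> Ck_on k d S (\<lambda>x. L (f x))"
proof (induction k arbitrary: f)
  case 0
  then show ?case by (auto intro: bounded_linear.continuous_on[OF L])
next
  case (Suc k)
  have "\<exists>h. (\<forall>x\<in>S. ((\<lambda>t. L (f (x(i := t)))) has_vector_derivative h x)
      (at (x i) within {t. x(i := t) \<in> S})) \<and> Ck_on k d S h" if "i < d" for i
  proof -
    obtain a where a:
      "\<And>x. x \<in> S \<Longrightarrow> ((\<lambda>t. f (x(i := t))) has_vector_derivative a x) (at (x i) within {t. x(i := t) \<in> S})" "Ck_on k d S a"
      using Ck_on_SucE[OF Suc.prems(1) \<open>i < d\<close>] by metis
    then show ?thesis
      by (intro exI[of _ "\<lambda>x. L (a x)"]) (auto intro!: bounded_linear.has_vector_derivative[OF L] Suc.IH)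
  qed
  then show ?case
    using bounded_linear.continuous_on[OF L Suc.prems[THEN Ck_on_imp_continuous_on]] by simp
qed

lemma Ck_on_minus: "Ck_on k d S f \<Longrightarrow> Ck_on k d S (\<lambda>x. - f x)"
  using Ck_on_bounded_linear[OF bounded_linear_minus[OF bounded_linear_ident]] .

lemma Ck_on_diff: "Ck_on k d S f \<Longrightarrow> Ck_on k d S g \<Longrightarrow> Ck_on k d S (\<lambda>x. f x - g x)"
  using Ck_on_add[OF _ Ck_on_minus, of k d S f g] by simp

lemma Ck_on_sum: "(\<And>a. a \<in> A \<Longrightarrow> Ck_on k d S (f a)) \<Longrightarrow> Ck_on k d S (\<lambda>x. \<Sum>a\<in>A. f a x)"
  by (induction A rule: infinite_finite_induct) (auto intro: Ck_on_add)

lemma Ck_on_prod: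
  fixes f :: "'i \<Rightarrow> (nat \<Rightarrow> real) \<Rightarrow> 'a::real_normed_field"
  shows "(\<And>a. a \<in> A \<Longrightarrow> Ck_on k d S (f a)) \<Longrightarrow> Ck_on k d S (\<lambda>x. \<Prod>a\<in>A. f a x)"
  by (induction A rule: infinite_finite_induct) (auto intro: Ck_on_mult)

text \<open>The derivative of \<open>1 / f\<close> is a product of \<open>1 / f\<close>,
  \<open>1 / f\<close> and the derivative of \<open>f\<close>, so the order below supplies its
  regularity.\<close>

lemma Ck_on_inverse:
  fixes f :: "(nat \<Rightarrow> real) \<Rightarrow> real"
  assumes nz: "\<And>x. x \<in> S \<Longrightarrow> f x \<noteq> 0"
  shows "Ck_on k d S f \<Longrightarrow> Ck_on k d S (\<lambda>x. inverse (f x))"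
proof (induction k)
  case 0
  then show ?case using nz by (auto intro!: continuous_intros)
next
  case (Suc k)
  have inv: "Ck_on k d S (\<lambda>x. inverse (f x))" using Suc.IH[OF Ck_on_Suc_imp[OF Suc.prems]] .
  have "\<exists>h. (\<forall>x\<in>S. ((\<lambda>t. inverse (f (x(i := t)))) has_vector_derivative h x)
      (at (x i) within {t. x(i := t) \<in> S})) \<and> Ck_on k d S h" if "i < d" for i
  proof -
    obtain a where a:
      "\<And>x. x \<in> S \<Longrightarrow> ((\<lambda>t. f (x(i := t))) has_vector_derivative a x) (at (x i) within {t. x(i := t) \<in> S})" "Ck_on k d S a"
      using Ck_on_SucE[OF Suc.prems(1) \<open>i < d\<close>] by metis
    have "((\<lambda>t. inverse (f (x(i := t)))) has_vector_derivative - (inverse (f x) * a x * inverse (f x)))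
      (at (x i) within {t. x(i := t) \<in> S})" if "x \<in> S" for x
      using DERIV_inverse'[of "\<lambda>t. f (x(i := t))" "a x" "x i" "{t. x(i := t) \<in> S}"] a(1) nz that
      by (simp add: has_real_derivative_iff_has_vector_derivative)
    moreover have "Ck_on k d S (\<lambda>x. - (inverse (f x) * a x * inverse (f x)))"
      by (intro Ck_on_minus Ck_on_mult inv a(2))
    ultimately show ?thesis by (intro exI[of _ "\<lambda>x. - (inverse (f x) * a x * inverse (f x))"] conjI ballI)
  qed
  moreover have "continuous_on S (\<lambda>x. inverse (f x))"
    using Suc.prems[THEN Ck_on_imp_continuous_on] nz by (intro continuous_on_inverse) auto
  ultimately show ?case by simp
qed

text \<open>The class \<open>P\<close> of outer functions is closed under derivatives; this avoids iterated derivatives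
  of composites.\<close>

lemma Ck_on_compose:
  fixes P :: "(real \<Rightarrow> real) set"
  assumes P: "\<And>g. g \<in> P \<Longrightarrow> \<exists>g'\<in>P. \<forall>t. (g has_real_derivative g' t) (at t)"
  shows "g \<in> P \<Longrightarrow> Ck_on k d S u \<Longrightarrow> Ck_on k d S (\<lambda>x. g (u x))"
proof (induction k arbitrary: g)
  case 0
  then have "continuous_on UNIV g"
    using P by (meson DERIV_continuous continuous_at_imp_continuous_on)
  with 0 show ?case by (auto intro: continuous_on_compose2)
next
  case (Suc k)
  obtain g' where g': "g' \<in> P" "\<And>t. (g has_real_derivative g' t) (at t)"
    using P Suc.prems by blast
  have "continuous_on UNIV g"
    using g'(2) by (meson DERIV_continuous continuous_at_imp_continuous_on)
  then have "continuous_on S (\<lambda>x. g (u x))"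
    using Suc.prems by (auto intro: continuous_on_compose2)
  moreover have "\<exists>h. (\<forall>x\<in>S. ((\<lambda>t. g (u (x(i := t)))) has_vector_derivative h x)
      (at (x i) within {t. x(i := t) \<in> S})) \<and> Ck_on k d S h" if "i < d" for i
  proof -
    obtain a where a:
      "\<And>x. x \<in> S \<Longrightarrow> ((\<lambda>t. u (x(i := t))) has_vector_derivative a x) (at (x i) within {t. x(i := t) \<in> S})" "Ck_on k d S a"
      using Ck_on_SucE[OF Suc.prems(2) \<open>i < d\<close>] by metis
    have "((\<lambda>t. g (u (x(i := t)))) has_vector_derivative a x * g' (u x))
      (at (x i) within {t. x(i := t) \<in> S})" if "x \<in> S" for x
      using field_vector_diff_chain_within[of "\<lambda>t. u (x(i := t))" "a x" "x i" "{t. x(i := t) \<in> S}" g "g' (u x)"]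
        a(1) that has_field_derivative_at_within[OF g'(2)] by (simp add: o_def)
    moreover have "Ck_on k d S (\<lambda>x. a x * g' (u x))"
      by (rule Ck_on_mult[OF a(2) Suc.IH[OF g'(1) Ck_on_Suc_imp[OF Suc.prems(2)]]])
    ultimately show ?thesis by (intro exI[of _ "\<lambda>x. a x * g' (u x)"] conjI ballI)
  qed
  ultimately show ?case by simp
qed

lemma Cinf_onI: "(\<And>k. Ck_on k d S f) \<Longrightarrow> Cinf_on d S f"
  by (simp add: Cinf_on_def)

lemma Cinf_onD: "Cinf_on d S f \<Longrightarrow> Ck_on k d S f"
  by (simp add: Cinf_on_def)

lemma Cinf_on_subset: "Cinf_on d S f \<Longrightarrow> S' \<subseteq> S \<Longrightarrow> Cinf_on d S' f"
  unfolding Cinf_on_def using Ck_on_subset by blast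

lemma Cinf_on_cong: "Cinf_on d S f \<Longrightarrow> (\<And>x. x \<in> S \<Longrightarrow> f x = g x) \<Longrightarrow> Cinf_on d S g"
  unfolding Cinf_on_def using Ck_on_cong by blast

lemma Cinf_on_const [simp]: "Cinf_on d S (\<lambda>x. c)"
  by (simp add: Cinf_on_def)

lemma Cinf_on_coord: "Cinf_on d S (\<lambda>x. x j)"
  by (simp add: Cinf_on_def Ck_on_coord)

lemma Cinf_on_add: "Cinf_on d S f \<Longrightarrow> Cinf_on d S g \<Longrightarrow> Cinf_on d S (\<lambda>x. f x + g x)"
  by (simp add: Cinf_on_def Ck_on_add)

lemma Cinf_on_diff: "Cinf_on d S f \<Longrightarrow> Cinf_on d S g \<Longrightarrow> Cinf_on d S (\<lambda>x. f x - g x)"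
  by (simp add: Cinf_on_def Ck_on_diff)

lemma Cinf_on_mult:
  fixes f g :: "(nat \<Rightarrow> real) \<Rightarrow> 'a::real_normed_algebra"
  shows "Cinf_on d S f \<Longrightarrow> Cinf_on d S g \<Longrightarrow> Cinf_on d S (\<lambda>x. f x * g x)"
  by (simp add: Cinf_on_def Ck_on_mult)

lemma Cinf_on_sum: "(\<And>a. a \<in> A \<Longrightarrow> Cinf_on d S (f a)) \<Longrightarrow> Cinf_on d S (\<lambda>x. \<Sum>a\<in>A. f a x)"
  by (simp add: Cinf_on_def Ck_on_sum)

lemma Cinf_on_prod:
  fixes f :: "'i \<Rightarrow> (nat \<Rightarrow> real) \<Rightarrow> 'a::real_normed_field"
  shows "(\<And>a. a \<in> A \<Longrightarrow> Cinf_on d S (f a)) \<Longrightarrow> Cinf_on d S (\<lambda>x. \<Prod>a\<in>A. f a x)"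
  by (simp add: Cinf_on_def Ck_on_prod)

lemma Cinf_on_bounded_linear: "bounded_linear L \<Longrightarrow> Cinf_on d S f \<Longrightarrow> Cinf_on d S (\<lambda>x. L (f x))"
  by (simp add: Cinf_on_def Ck_on_bounded_linear)

lemma Cinf_on_inverse:
  fixes f :: "(nat \<Rightarrow> real) \<Rightarrow> real"
  shows "Cinf_on d S f \<Longrightarrow> (\<And>x. x \<in> S \<Longrightarrow> f x \<noteq> 0) \<Longrightarrow> Cinf_on d S (\<lambda>x. inverse (f x))"
  by (simp add: Cinf_on_def Ck_on_inverse)

lemma Cinf_on_imp_continuous_on: "Cinf_on d S f \<Longrightarrow> continuous_on S f"
  using Cinf_onD[of d S f 0] by simp

section \<open>Relatively open sets and one-sided partial derivatives\<close>

definition corner_open :: "nat \<Rightarrow> nat set \<Rightarrow> (nat \<Rightarrow> real) set \<Rightarrow> bool" where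
  "corner_open d C S \<longleftrightarrow> C \<subseteq> {..<d} \<and> openin (top_of_set (corner_model d C)) S"

definition slice :: "nat set \<Rightarrow> nat \<Rightarrow> real set" where
  "slice C i = (if i \<in> C then {0..} else UNIV)"

text \<open>\<open>Ck_on\<close> only asserts that some derivative exists, along whatever part of
  the coordinate line lies in the given set. On relatively open sets it is unique and may be taken
  along the full slice of the model, so one operator, independent of the set, serves everywhere and
  can be iterated.\<close>

definition pd :: "nat set \<Rightarrow> nat \<Rightarrow> ((nat \<Rightarrow> real) \<Rightarrow> 'b::real_normed_vector) \<Rightarrow> (nat \<Rightarrow> real) \<Rightarrow> 'b" where
  "pd C i f x = vector_derivative (\<lambda>t. f (x(i := t))) (at (x i) within slice C i)"

lemma fun_upd_mem_corner_model:
  "x \<in> corner_model d C \<Longrightarrow> i < d \<Longrightarrow> x(i := t) \<in> corner_model d C \<longleftrightarrow> t \<in> slice C i"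
  by (auto simp: corner_model_def slice_def)

lemma mem_corner_model_slice: "x \<in> corner_model d C \<Longrightarrow> x i \<in> slice C i"
  by (auto simp: corner_model_def slice_def)

lemma corner_open_subset: "corner_open d C S \<Longrightarrow> S \<subseteq> corner_model d C"
  unfolding corner_open_def using openin_imp_subset by blast

lemma corner_open_mem_slice: "corner_open d C S \<Longrightarrow> x \<in> S \<Longrightarrow> x i \<in> slice C i"
  using corner_open_subset mem_corner_model_slice by blast

lemma corner_open_obtain:
  assumes "corner_open d C S"
  obtains O' where "open O'" "S = corner_model d C \<inter> O'"
  using assms unfolding corner_open_def openin_open by auto

lemma continuous_on_fun_upd [continuous_intros]:
  assumes "continuous_on S f" "continuous_on S g"
  shows "continuous_on S (\<lambda>t. (f t)(i := g t))"
proof (rule continuous_on_coordinatewise_then_product)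
  fix j
  show "continuous_on S (\<lambda>t. ((f t)(i := g t)) j)"
    using assms(2) continuous_on_product_then_coordinatewise[OF assms(1), of j] by (cases "j = i") auto
qed

lemma corner_open_slice:
  assumes "corner_open d C S" "x \<in> S" "i < d"
  obtains e where "e > 0" "\<And>t. \<bar>t - x i\<bar> < e \<Longrightarrow> x(i := t) \<in> S \<longleftrightarrow> t \<in> slice C i"
proof -
  obtain V where V: "open V" "S = corner_model d C \<inter> V" using corner_open_obtain[OF assms(1)] .
  have "open ((\<lambda>t. x(i := t)) -` V)"
    by (rule open_vimage[OF V(1)]) (intro continuous_intros)
  moreover have "x i \<in> (\<lambda>t. x(i := t)) -` V" using assms V by simp
  ultimately obtain e where e: "e > 0" "ball (x i) e \<subseteq> (\<lambda>t. x(i := t)) -` V"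
    using openE by blast
  show ?thesis
  proof (rule that[OF e(1)])
    fix t assume "\<bar>t - x i\<bar> < e"
    then have "t \<in> ball (x i) e" by (simp add: dist_real_def abs_minus_commute)
    then have "x(i := t) \<in> V" using e(2) by blast
    then show "x(i := t) \<in> S \<longleftrightarrow> t \<in> slice C i"
      using assms V fun_upd_mem_corner_model[of x d C i t] by simp
  qed
qed

lemma at_within_corner_open_slice:
  assumes "corner_open d C S" "x \<in> S" "i < d"
  shows "at (x i) within {t. x(i := t) \<in> S} = at (x i) within slice C i"
proof -
  obtain e where e: "e > 0" "\<And>t. \<bar>t - x i\<bar> < e \<Longrightarrow> x(i := t) \<in> S \<longleftrightarrow> t \<in> slice C i"
    using corner_open_slice[OF assms] by blast
  show ?thesis
    by (rule at_within_nhd[of _ "ball (x i) e"]) (use e in \<open>auto simp: dist_real_def abs_minus_commute\<close>)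
qed

lemma at_within_corner_open:
  assumes "corner_open d C S" "x \<in> S"
  shows "at x within S = at x within corner_model d C"
proof -
  obtain V where V: "open V" "S = corner_model d C \<inter> V" using corner_open_obtain[OF assms(1)] .
  show ?thesis by (rule at_within_nhd[of _ V]) (use V assms in auto)
qed

lemma convex_slice: "convex (slice C i)"
  by (simp add: slice_def convex_real_interval)

text \<open>Nontriviality of this filter makes derivatives along a slice unique, also at a face,
  where the slice is a half-line.\<close>

lemma at_within_slice_ball_nontrivial:
  assumes "t \<in> slice C i" "e > 0"
  shows "at t within (slice C i \<inter> ball t e) \<noteq> bot"
proof -
  \<comment> \<open>A slice is closed under increasing the coordinate, so this second point exists
    even when \<open>t\<close> lies on a face.\<close>
  have "t + e / 2 \<in> slice C i \<inter> ball t e" using assms by (auto simp: slice_def dist_real_def split: if_splits)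
  moreover have "connected (slice C i \<inter> ball t e)"
    by (intro convex_connected convex_Int convex_slice convex_ball)
  moreover have "t \<in> slice C i \<inter> ball t e" using assms by simp
  moreover have "slice C i \<inter> ball t e \<noteq> {x}" for x
  proof
    assume "slice C i \<inter> ball t e = {x}"
    then have "t + e / 2 = x" "t = x" using calculation by blast+
    then show False using assms by simp
  qed
  ultimately have "t islimpt (slice C i \<inter> ball t e)"
    by (intro connected_imp_perfect)
  then show ?thesis by (simp add: trivial_limit_within)
qed

lemma at_within_slice_nontrivial: "t \<in> slice C i \<Longrightarrow> at t within slice C i \<noteq> bot"
  using at_within_slice_ball_nontrivial[of t C i 1]
  by (metis at_le bot.extremum_uniqueI inf_le1 zero_less_one)

lemma pd_eqI:
  assumes "((\<lambda>t. f (x(i := t))) has_vector_derivative D) (at (x i) within slice C i)" "x i \<in> slice C i"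
  shows "pd C i f x = D"
  unfolding pd_def using assms at_within_slice_nontrivial vector_derivative_within by blast

lemma pd_cong_slice:
  assumes "\<And>t. f (x(i := t)) = g (y(i := t))" "x i = y i"
  shows "pd C i f x = pd C i g y"
  using assms by (simp add: pd_def)

text \<open>Uniqueness of the derivative replaces the witness in \<open>Ck_on\<close> by
  \<open>pd\<close>. As \<open>pd\<close> does not refer to \<open>S\<close>, regularity on
  different relatively open sets can be compared.\<close>

lemma Ck_on_Suc_iff:
  assumes "corner_open d C S"
  shows "Ck_on (Suc k) d S f \<longleftrightarrow> continuous_on S f \<and>
    (\<forall>i<d. (\<forall>x\<in>S. ((\<lambda>t. f (x(i := t))) has_vector_derivative pd C i f x) (at (x i) within slice C i)) \<and>
       Ck_on k d S (pd C i f))" (is "?L \<longleftrightarrow> ?R")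
proof
  assume L: ?L
  show ?R
  proof (intro conjI allI impI)
    show "continuous_on S f" using L by simp
    fix i assume i: "i < d"
    obtain g where g:
      "\<And>x. x \<in> S \<Longrightarrow> ((\<lambda>t. f (x(i := t))) has_vector_derivative g x) (at (x i) within {t. x(i := t) \<in> S})"
      "Ck_on k d S g"
      using Ck_on_SucE[OF L i] by metis
    have g': "((\<lambda>t. f (x(i := t))) has_vector_derivative g x) (at (x i) within slice C i)" if "x \<in> S" for x
      using g(1)[OF that] at_within_corner_open_slice[OF assms that i] by simp
    have eq: "pd C i f x = g x" if "x \<in> S" for x
      by (rule pd_eqI[OF g'[OF that] corner_open_mem_slice[OF assms that]])
    show "\<forall>x\<in>S. ((\<lambda>t. f (x(i := t))) has_vector_derivative pd C i f x) (at (x i) within slice C i)"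
      using g' eq by simp
    show "Ck_on k d S (pd C i f)"
      by (rule Ck_on_cong[OF g(2)]) (simp add: eq)
  qed
next
  assume R: ?R
  have "\<exists>g. (\<forall>x\<in>S. ((\<lambda>t. f (x(i := t))) has_vector_derivative g x)
      (at (x i) within {t. x(i := t) \<in> S})) \<and> Ck_on k d S g" if i: "i < d" for i
  proof (intro exI[of _ "pd C i f"] conjI ballI)
    show "Ck_on k d S (pd C i f)" using R i by simp
    fix x assume x: "x \<in> S"
    show "((\<lambda>t. f (x(i := t))) has_vector_derivative pd C i f x) (at (x i) within {t. x(i := t) \<in> S})"
      using R i x at_within_corner_open_slice[OF assms x i] by simp
  qed
  then show ?L using R by simp
qed

lemma Cinf_on_pd: "corner_open d C S \<Longrightarrow> Cinf_on d S f \<Longrightarrow> i < d \<Longrightarrow> Cinf_on d S (pd C i f)"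
  using Ck_on_Suc_iff[of d C S _ f] unfolding Cinf_on_def by blast

lemma Cinf_on_has_pd:
  assumes "corner_open d C S" "Cinf_on d S f" "i < d" "x \<in> S"
  shows "((\<lambda>t. f (x(i := t))) has_vector_derivative pd C i f x) (at (x i) within slice C i)"
  using Ck_on_Suc_iff[of d C S 0 f] assms unfolding Cinf_on_def by blast

text \<open>The local hypotheses all speak about the same function \<open>pd C i f\<close>, so the
  induction passes to it without any gluing of derivatives.\<close>

lemma Ck_on_local:
  assumes "corner_open d C S"
    and "\<And>x. x \<in> S \<Longrightarrow> \<exists>S'. x \<in> S' \<and> corner_open d C S' \<and> Ck_on k d S' f"
  shows "Ck_on k d S f"
  using assms(2)
proof (induction k arbitrary: f)
  case 0
  have "continuous (at x within S) f" if x: "x \<in> S" for x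
  proof -
    obtain S' where S': "x \<in> S'" "corner_open d C S'" "continuous_on S' f" using "0" x by auto
    then have "continuous (at x within S') f" by (simp add: continuous_on_eq_continuous_within)
    then show ?thesis using at_within_corner_open[OF S'(2,1)] at_within_corner_open[OF assms(1) x] by simp
  qed
  then show ?case by (simp add: continuous_on_eq_continuous_within)
next
  case (Suc k)
  have "continuous (at x within S) f" if x: "x \<in> S" for x
  proof -
    obtain S' where S': "x \<in> S'" "corner_open d C S'" "continuous_on S' f"
      using Suc.prems[OF x] Ck_on_imp_continuous_on by blast
    then have "continuous (at x within S') f" by (simp add: continuous_on_eq_continuous_within)
    then show ?thesis using at_within_corner_open[OF S'(2,1)] at_within_corner_open[OF assms(1) x] by simp
  qed
  moreover have "((\<lambda>t. f (x(i := t))) has_vector_derivative pd C i f x) (at (x i) within slice C i)"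
    if "i < d" "x \<in> S" for i x
    using Suc.prems[OF that(2)] Ck_on_Suc_iff that(1) by blast
  moreover have "Ck_on k d S (pd C i f)" if "i < d" for i
  proof (rule Suc.IH)
    fix x assume "x \<in> S"
    from Suc.prems[OF this] show "\<exists>S'. x \<in> S' \<and> corner_open d C S' \<and> Ck_on k d S' (pd C i f)"
      using Ck_on_Suc_iff that by blast
  qed
  ultimately show ?case
    unfolding Ck_on_Suc_iff[OF assms(1)] by (simp add: continuous_on_eq_continuous_within)
qed

lemma Cinf_on_local:
  assumes "corner_open d C S"
    and "\<And>x. x \<in> S \<Longrightarrow> \<exists>S'. x \<in> S' \<and> corner_open d C S' \<and> Cinf_on d S' f"
  shows "Cinf_on d S f"
proof (rule Cinf_onI, rule Ck_on_local[OF assms(1)])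
  fix k x assume "x \<in> S"
  from assms(2)[OF this] show "\<exists>S'. x \<in> S' \<and> corner_open d C S' \<and> Ck_on k d S' f"
    using Cinf_onD by blast
qed

text \<open>Differentiation under the integral sign: \<open>g s t - g s (t0 - 1)\<close> is the
  integral of \<open>gt s\<close>, its derivative in \<open>s\<close> is the integral of
  \<open>gts\<close>, and the fundamental theorem then differentiates in \<open>t\<close>. This
  yields the existence of the derivative of \<open>gs\<close> in \<open>t\<close> together with its
  value, and \<open>s\<close> may range over a one-sided interval.\<close>

lemma mixed_derivatives_commute:
  fixes g :: "real \<Rightarrow> real \<Rightarrow> 'b::banach"
  assumes gs: "\<And>s t. s \<in> U \<Longrightarrow> ((\<lambda>s. g s t) has_vector_derivative gs s t) (at s within U)"
    and gt: "\<And>s t. s \<in> U \<Longrightarrow> ((\<lambda>t. g s t) has_vector_derivative gt s t) (at t)"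
    and gts: "\<And>s t. s \<in> U \<Longrightarrow> ((\<lambda>s. gt s t) has_vector_derivative gts s t) (at s within U)"
    and cont: "continuous_on (U \<times> UNIV) (\<lambda>(s, t). gts s t)"
    and U: "convex U" "s0 \<in> U" "at s0 within U \<noteq> bot"
  shows "((\<lambda>t. gs s0 t) has_vector_derivative gts s0 t0) (at t0)"
proof -
  \<comment> \<open>The interval is chosen with \<open>t0\<close> in its interior, so that the
    derivative found within it is two-sided.\<close>
  let ?a = "t0 - 1" let ?b = "t0 + 1"
  have int: "(gt s has_integral g s t - g s ?a) {?a..t}" if "s \<in> U" "?a \<le> t" for s t
    by (rule fundamental_theorem_of_calculus[OF that(2)])
      (rule has_vector_derivative_at_within[OF gt[OF that(1)]])
  have eq: "gs s0 t = gs s0 ?a + integral {?a..t} (gts s0)" if t: "t \<in> {?a..?b}" for t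
  proof -
    have "((\<lambda>s. integral (cbox ?a t) (gt s)) has_vector_derivative integral (cbox ?a t) (gts s0)) (at s0 within U)"
    proof (rule leibniz_rule_vector_derivative[OF _ _ _ U(2,1)])
      show "continuous_on (U \<times> cbox ?a t) (\<lambda>(s, t). gts s t)"
        by (rule continuous_on_subset[OF cont]) auto
      show "gt s integrable_on cbox ?a t" if "s \<in> U" for s
        using has_integral_integrable[OF int[OF that, of t]] t by simp
    qed (rule gts)
    moreover have "integral (cbox ?a t) (gt s) = g s t - g s ?a" if "s \<in> U" for s
      using int[OF that, of t] t by (simp add: integral_unique)
    ultimately have "((\<lambda>s. g s t - g s ?a) has_vector_derivative integral (cbox ?a t) (gts s0)) (at s0 within U)"
      using U(2) by (auto intro: has_vector_derivative_cong_on)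
    moreover have "((\<lambda>s. g s t - g s ?a) has_vector_derivative gs s0 t - gs s0 ?a) (at s0 within U)"
      by (intro has_vector_derivative_diff gs U(2))
    ultimately have "integral (cbox ?a t) (gts s0) = gs s0 t - gs s0 ?a"
      using vector_derivative_unique_within[OF U(3)] by blast
    then show ?thesis by (simp add: algebra_simps)
  qed
  have "continuous_on {?a..?b} (gts s0)"
    using U(2) by (intro continuous_on_compose2[OF cont, of _ "\<lambda>t. (s0, t)", simplified]) (auto intro!: continuous_intros)
  then have "((\<lambda>t. integral {?a..t} (gts s0)) has_vector_derivative gts s0 t0) (at t0 within {?a..?b})"
    by (rule integral_has_vector_derivative) auto
  then have "((\<lambda>t. gs s0 ?a + integral {?a..t} (gts s0)) has_vector_derivative 0 + gts s0 t0) (at t0 within {?a..?b})"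
    by (intro has_vector_derivative_add has_vector_derivative_const)
  then have "((\<lambda>t. gs s0 t) has_vector_derivative 0 + gts s0 t0) (at t0 within {?a..?b})"
    by (rule has_vector_derivative_cong_on[OF _ eq[symmetric]]) simp_all
  then show ?thesis using at_within_interior[of t0 "{?a..?b}"] by simp
qed

text \<open>Shaped for the angular coordinate: the direction \<open>j\<close> has no face and
  \<open>S\<close> contains whole lines in that direction, while \<open>i\<close> may be a direction
  with a face.\<close>

lemma pd_commute:
  fixes f :: "(nat \<Rightarrow> real) \<Rightarrow> 'b::banach"
  assumes S: "corner_open d C S" and f: "Cinf_on d S f"
    and ij: "i < d" "j < d" "i \<noteq> j" "j \<notin> C"
    and x: "x \<in> S" and full: "\<And>y t. y \<in> S \<Longrightarrow> y(j := t) \<in> S"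
  shows "((\<lambda>t. pd C i f (x(j := t))) has_vector_derivative pd C i (pd C j f) x) (at (x j))"
    and "pd C j (pd C i f) x = pd C i (pd C j f) x"
proof -
  obtain e where e: "e > 0" "\<And>t. \<bar>t - x i\<bar> < e \<Longrightarrow> x(i := t) \<in> S \<longleftrightarrow> t \<in> slice C i"
    using corner_open_slice[OF S x ij(1)] by blast
  define U where "U = slice C i \<inter> ball (x i) e"
  define pt where "pt s t = x(i := s, j := t)" for s t
  have pt: "pt s t \<in> S" if "s \<in> U" for s t
    unfolding pt_def using that e(2)[of s] by (intro full) (auto simp: U_def dist_real_def abs_minus_commute)
  have sj: "slice C j = UNIV" using ij by (simp add: slice_def)
  have Ds: "((\<lambda>s. h (pt s t)) has_vector_derivative pd C i h (pt s t)) (at s within U)"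
    if "Cinf_on d S h" "s \<in> U" for h :: "(nat \<Rightarrow> real) \<Rightarrow> 'b" and s t
  proof -
    have "((\<lambda>r. h ((pt s t)(i := r))) has_vector_derivative pd C i h (pt s t)) (at ((pt s t) i) within slice C i)"
      by (rule Cinf_on_has_pd[OF S that(1) ij(1) pt[OF that(2)]])
    moreover have "(pt s t)(i := r) = pt r t" for r using ij(3) by (auto simp: pt_def)
    moreover have "pt s t i = s" using ij(3) by (simp add: pt_def)
    ultimately show ?thesis by (auto simp: U_def intro: has_vector_derivative_within_subset)
  qed
  have Dt: "((\<lambda>t. h (pt s t)) has_vector_derivative pd C j h (pt s t)) (at t)"
    if "Cinf_on d S h" "s \<in> U" for h :: "(nat \<Rightarrow> real) \<Rightarrow> 'b" and s t
    using Cinf_on_has_pd[OF S that(1) ij(2) pt[OF that(2), of t]] by (simp add: pt_def sj)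
  have "((\<lambda>t. pd C i f (pt (x i) t)) has_vector_derivative pd C i (pd C j f) (pt (x i) (x j))) (at (x j))"
  proof (rule mixed_derivatives_commute[where g = "\<lambda>s t. f (pt s t)" and gt = "\<lambda>s t. pd C j f (pt s t)"
        and gs = "\<lambda>s t. pd C i f (pt s t)" and gts = "\<lambda>s t. pd C i (pd C j f) (pt s t)" and U = U])
    show "continuous_on (U \<times> UNIV) (\<lambda>(s, t). pd C i (pd C j f) (pt s t))"
      unfolding split_beta
    proof (rule continuous_on_compose2[OF Cinf_on_imp_continuous_on[OF Cinf_on_pd[OF S Cinf_on_pd[OF S f ij(2)] ij(1)]]])
      show "continuous_on (U \<times> UNIV) (\<lambda>z. pt (fst z) (snd z))"
        unfolding pt_def
        by (intro continuous_on_fun_upd continuous_on_const continuous_on_fst continuous_on_snd continuous_on_id)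
    qed (auto intro: pt)
    show "convex U" by (simp add: U_def convex_Int convex_slice)
    show "x i \<in> U" using e(1) corner_open_mem_slice[OF S x] by (simp add: U_def)
    show "at (x i) within U \<noteq> bot"
      unfolding U_def by (rule at_within_slice_ball_nontrivial[OF corner_open_mem_slice[OF S x] e(1)])
  qed (auto intro: Ds Dt f Cinf_on_pd[OF S f ij(2)])
  moreover have "pt (x i) t = x(j := t)" for t by (simp add: pt_def)
  ultimately show D: "((\<lambda>t. pd C i f (x(j := t))) has_vector_derivative pd C i (pd C j f) x) (at (x j))"
    by simp
  show "pd C j (pd C i f) x = pd C i (pd C j f) x"
    by (rule pd_eqI) (simp_all add: sj D)
qed

section \<open>Boxes and Hadamard's lemma\<close>

definition corner_box :: "nat \<Rightarrow> nat set \<Rightarrow> (nat \<Rightarrow> real) \<Rightarrow> real \<Rightarrow> (nat \<Rightarrow> real) set" where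
  "corner_box d C c e = {a \<in> corner_model d C. \<forall>i<d. \<bar>a i - c i\<bar> < e}"

lemma corner_open_box:
  assumes "C \<subseteq> {..<d}"
  shows "corner_open d C (corner_box d C c e)"
proof -
  let ?O = "\<Inter>i\<in>{..<d}. {a :: nat \<Rightarrow> real. \<bar>a i - c i\<bar> < e}"
  have "open ?O"
    by (intro open_INT finite_lessThan ballI open_Collect_less continuous_on_rabs
        continuous_on_diff continuous_on_product_coordinates continuous_on_const)
  moreover have "corner_box d C c e = corner_model d C \<inter> ?O"
    by (auto simp: corner_box_def)
  ultimately show ?thesis using assms unfolding corner_open_def openin_open by blast
qed

lemma corner_box_subset:
  assumes "corner_open d C S" "c \<in> S"
  obtains e where "e > 0" "corner_box d C c e \<subseteq> S"
proof -
  obtain V where V: "open V" "S = corner_model d C \<inter> V" using corner_open_obtain[OF assms(1)] .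
  have "openin (product_topology (\<lambda>i. euclidean) UNIV) V"
    using V(1) by (simp only: open_fun_def)
  moreover have cV: "c \<in> V" using V(2) assms(2) by blast
  ultimately have "\<exists>W. finite {i \<in> UNIV. W i \<noteq> topspace euclidean} \<and>
      (\<forall>i\<in>UNIV. openin euclidean (W i)) \<and> c \<in> Pi\<^sub>E UNIV W \<and> Pi\<^sub>E UNIV W \<subseteq> V"
    unfolding openin_product_topology_alt by (rule bspec)
  then obtain W :: "nat \<Rightarrow> real set" where W0: "\<forall>i\<in>UNIV. openin euclidean (W i)"
    and W': "c \<in> Pi\<^sub>E UNIV W" "Pi\<^sub>E UNIV W \<subseteq> V"
    by (elim exE conjE)
  have W1: "open (W i)" for i using bspec[OF W0 UNIV_I] by (rule open_openin[THEN iffD2])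
  note W = W1 W'
  have "\<forall>i. \<exists>e>0. ball (c i) e \<subseteq> W i"
  proof
    fix i
    have "c i \<in> W i" using W(2) by auto
    then show "\<exists>e>0. ball (c i) e \<subseteq> W i" using W(1)[of i] open_contains_ball by blast
  qed
  then obtain \<epsilon> where \<epsilon>: "\<And>i. \<epsilon> i > 0" "\<And>i. ball (c i) (\<epsilon> i) \<subseteq> W i" by metis
  define e where "e = Min (insert 1 (\<epsilon> ` {..<d}))"
  \<comment> \<open>Only coordinates below \<open>d\<close> enter the minimum, since the others
    vanish both at \<open>a\<close> and at \<open>c\<close>; the inserted \<open>1\<close> keeps the
    set nonempty for \<open>d = 0\<close>.\<close>
  have "e > 0" unfolding e_def using \<epsilon>(1) by (subst Min_gr_iff) auto
  moreover have e_le: "e \<le> \<epsilon> i" if "i < d" for i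
    unfolding e_def using that by (intro Min_le) auto
  have "corner_box d C c e \<subseteq> S"
  proof
    fix a assume a: "a \<in> corner_box d C c e"
    have "a i \<in> W i" for i
    proof (cases "i < d")
      case True
      then have "\<bar>a i - c i\<bar> < \<epsilon> i" using a e_le[OF True] by (fastforce simp: corner_box_def)
      then show ?thesis using \<epsilon>(2)[of i] by (auto simp: dist_real_def abs_minus_commute)
    next
      case False
      then have "a i = c i" using a assms V by (simp add: corner_box_def corner_model_def)
      then show ?thesis using W(2) by auto
    qed
    then have "a \<in> V" using W(3) by auto
    then show "a \<in> S" using a V by (simp add: corner_box_def)
  qed
  ultimately show ?thesis using that by blast
qed

lemma corner_box_upd:
  assumes "a \<in> corner_box d C c e" "i < d"
  shows "a(i := s) \<in> corner_box d C c e \<longleftrightarrow> s \<in> slice C i \<inter> ball (c i) e"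
  using assms fun_upd_mem_corner_model[of a d C i s]
  by (auto simp: corner_box_def dist_real_def abs_minus_commute)

text \<open>The reason for working with boxes: moving a single coordinate towards the centre never
  leaves them, at a face because slices are convex.\<close>

lemma corner_box_segment:
  assumes "a \<in> corner_box d C c e" "c \<in> corner_model d C" "i < d" "t \<in> {0..1}"
  shows "a(i := c i + t * (a i - c i)) \<in> corner_box d C c e"
proof -
  have "a i \<in> slice C i" "c i \<in> slice C i"
    using assms mem_corner_model_slice by (auto simp: corner_box_def)
  then have "(1 - t) *\<^sub>R c i + t *\<^sub>R a i \<in> slice C i"
    using convexD_alt[OF convex_slice] assms(4) by auto
  moreover have "(1 - t) *\<^sub>R c i + t *\<^sub>R a i = c i + t * (a i - c i)" by (simp add: algebra_simps)
  moreover have "\<bar>t * (a i - c i)\<bar> < e"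
  proof -
    have "\<bar>t * (a i - c i)\<bar> \<le> 1 * \<bar>a i - c i\<bar>"
      unfolding abs_mult using assms(4) by (intro mult_right_mono) auto
    then show ?thesis using assms(1,3) by (fastforce simp: corner_box_def)
  qed
  ultimately show ?thesis
    unfolding corner_box_upd[OF assms(1,3)] by (simp add: dist_real_def)
qed

text \<open>Differentiation under the integral sign gives integrals of the same kind, with \<open>p\<close> raised for the
  derivative in the direction \<open>i\<close>.\<close>

lemma Ck_on_segment_integral:
  fixes u :: "(nat \<Rightarrow> real) \<Rightarrow> real"
  assumes C: "C \<subseteq> {..<d}" and c: "c \<in> corner_model d C" and i: "i < d"
  shows "Cinf_on d (corner_box d C c e) u \<Longrightarrow> Ck_on k d (corner_box d C c e)
    (\<lambda>a. integral (cbox 0 1) (\<lambda>t. t ^ p * u (a(i := c i + t * (a i - c i)))))"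
proof (induction k arbitrary: u p)
  let ?B = "corner_box d C c e"
  note B = corner_open_box[OF C, of c e]
  have cont: "continuous_on (?B \<times> cbox 0 1) (\<lambda>(a, t). t ^ p * u (a(i := c i + t * (a i - c i))))"
    if u: "Cinf_on d ?B u" for u :: "(nat \<Rightarrow> real) \<Rightarrow> real" and p
    unfolding split_beta
  proof (intro continuous_on_mult continuous_on_power continuous_on_snd continuous_on_id
      continuous_on_compose2[OF Cinf_on_imp_continuous_on[OF u]])
    show "continuous_on (?B \<times> cbox 0 1) (\<lambda>x. (fst x)(i := c i + snd x * (fst x i - c i)))"
      by (intro continuous_on_fun_upd continuous_intros continuous_on_product_then_coordinatewise)
  qed (use c i in \<open>auto intro!: corner_box_segment\<close>)
  {
    case 0
    then show ?case using integral_continuous_on_param[OF cont[OF 0, of p]] by simp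
  next
    case (Suc k)
    define G where "G = (\<lambda>a t. t ^ p * u (a(i := c i + t * (a i - c i))))"
    have "Ck_on k d ?B (\<lambda>a. integral (cbox 0 1) (\<lambda>t. t ^ q * pd C j u (a(i := c i + t * (a i - c i)))))"
      if "j < d" for j q
      by (rule Suc.IH[OF Cinf_on_pd[OF B Suc.prems that]])
    define q where "q j = (if j = i then Suc p else p)" for j
    define G' where "G' = (\<lambda>j a t. t ^ q j * pd C j u (a(i := c i + t * (a i - c i))))"
    have deriv: "((\<lambda>s. G (a(j := s)) t) has_vector_derivative G' j a t) (at (a j) within {s. a(j := s) \<in> ?B})"
      if a: "a \<in> ?B" and t: "t \<in> {0..1}" and j: "j < d" for a j t
    proof -
      let ?w = "a(i := c i + t * (a i - c i))"
      have w: "?w \<in> ?B" by (rule corner_box_segment[OF a c i t])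
      have D: "((\<lambda>s. u (?w(j := s))) has_vector_derivative pd C j u ?w) (at (?w j) within {s. ?w(j := s) \<in> ?B})"
        using Cinf_on_has_pd[OF B Suc.prems j w] unfolding at_within_corner_open_slice[OF B w j] .
      show ?thesis
      proof (cases "j = i")
        case False
        have "{s. ?w(j := s) \<in> ?B} = {s. a(j := s) \<in> ?B}"
          by (simp only: corner_box_upd[OF w j] corner_box_upd[OF a j])
        then have "((\<lambda>s. t ^ p * u (?w(j := s))) has_vector_derivative t ^ p * pd C j u ?w)
            (at (a j) within {s. a(j := s) \<in> ?B})"
          using D False by (intro has_vector_derivative_mult_right) simp
        moreover have "G (a(j := s)) t = t ^ p * u (?w(j := s))" for s
          using False by (simp add: G_def fun_upd_twist)
        ultimately show ?thesis using False by (simp add: G'_def q_def)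
      next
        case True
        let ?L = "\<lambda>s. c i + t * (s - c i)"
        have L: "(?L has_vector_derivative t) (at (a i) within {s. a(i := s) \<in> ?B})"
          by (auto intro!: derivative_eq_intros simp: has_real_derivative_iff_has_vector_derivative[symmetric])
        have "?L s \<in> {s. a(i := s) \<in> ?B}" if "a(i := s) \<in> ?B" for s
          using corner_box_segment[OF that c i t] by simp
        \<comment> \<open>For the one-sided chain rule the affine map must carry the admissible
          values at \<open>a\<close> into those at \<open>?w\<close>; the derivative of
          \<open>u\<close> is then restricted to this image.\<close>
        then have "?L ` {s. a(i := s) \<in> ?B} \<subseteq> {s. ?w(i := s) \<in> ?B}" by auto
        then have "((\<lambda>s. u (?w(i := s))) has_vector_derivative pd C i u ?w) (at (?L (a i)) within ?L ` {s. a(i := s) \<in> ?B})"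
          using D True by (auto intro: has_vector_derivative_within_subset)
        from vector_diff_chain_within[OF L this]
        have "((\<lambda>s. u (a(i := ?L s))) has_vector_derivative t * pd C i u ?w) (at (a i) within {s. a(i := s) \<in> ?B})"
          by (simp add: o_def)
        then have "((\<lambda>s. t ^ p * u (a(i := ?L s))) has_vector_derivative t ^ p * (t * pd C i u ?w))
            (at (a i) within {s. a(i := s) \<in> ?B})"
          by (rule has_vector_derivative_mult_right)
        then show ?thesis using True by (simp add: G_def G'_def q_def mult.assoc mult.left_commute)
      qed
    qed
    have contG': "continuous_on (?B \<times> cbox 0 1) (\<lambda>(a, t). G' j a t)" if "j < d" for j
      unfolding G'_def by (rule cont[OF Cinf_on_pd[OF B Suc.prems that]])
    have contG: "continuous_on (?B \<times> cbox 0 1) (\<lambda>(a, t). G a t)"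
      unfolding G_def by (rule cont[OF Suc.prems])
    have "\<exists>g. (\<forall>a\<in>?B. ((\<lambda>s. integral (cbox 0 1) (G (a(j := s)))) has_vector_derivative g a)
        (at (a j) within {s. a(j := s) \<in> ?B})) \<and> Ck_on k d ?B g" if j: "j < d" for j
    proof (intro exI[of _ "\<lambda>a. integral (cbox 0 1) (G' j a)"] conjI ballI)
      show "Ck_on k d ?B (\<lambda>a. integral (cbox 0 1) (G' j a))"
        unfolding G'_def by (rule Suc.IH[OF Cinf_on_pd[OF B Suc.prems j]])
      fix a assume a: "a \<in> ?B"
      let ?U = "{s. a(j := s) \<in> ?B}"
      have U: "?U = slice C j \<inter> ball (c j) e" by (simp only: corner_box_upd[OF a j] Collect_mem_eq)
      have "((\<lambda>s. integral (cbox 0 1) (G (a(j := s)))) has_vector_derivative integral (cbox 0 1) (G' j (a(j := a j))))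
          (at (a j) within ?U)"
      proof (rule leibniz_rule_vector_derivative)
        fix s t assume s: "s \<in> ?U" and t: "t \<in> cbox (0::real) 1"
        show "((\<lambda>s. G (a(j := s)) t) has_vector_derivative G' j (a(j := s)) t) (at s within ?U)"
          using deriv[of "a(j := s)" t j] s t j by simp
      next
        fix s assume s: "s \<in> ?U"
        have "continuous_on (cbox 0 1) (\<lambda>t. (\<lambda>(a, t). G a t) (a(j := s), t))"
          by (rule continuous_on_compose2[OF contG]) (use s in \<open>auto intro!: continuous_intros\<close>)
        then show "G (a(j := s)) integrable_on cbox 0 1"
          by (intro integrable_continuous) simp
      next
        have "continuous_on (?U \<times> cbox 0 1) (\<lambda>z. (\<lambda>(a, t). G' j a t) (a(j := fst z), snd z))"
          by (rule continuous_on_compose2[OF contG'[OF j]])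
            (auto intro!: continuous_on_Pair continuous_on_fun_upd continuous_on_const continuous_on_fst
              continuous_on_snd continuous_on_id)
        then show "continuous_on (?U \<times> cbox 0 1) (\<lambda>(s, t). G' j (a(j := s)) t)"
          by (simp add: split_beta)
      next
        show "a j \<in> ?U" using a by simp
        show "convex ?U" unfolding U by (intro convex_Int convex_slice convex_ball)
      qed
      then show "((\<lambda>s. integral (cbox 0 1) (G (a(j := s)))) has_vector_derivative integral (cbox 0 1) (G' j a))
          (at (a j) within ?U)"
        by simp
    qed
    moreover have "continuous_on ?B (\<lambda>a. integral (cbox 0 1) (G a))"
      by (rule integral_continuous_on_param[OF contG])
    ultimately have "Ck_on (Suc k) d ?B (\<lambda>a. integral (cbox 0 1) (G a))" by simp
    then show ?case unfolding G_def .
  }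
qed

text \<open>The fundamental theorem of calculus along the segment that moves only coordinate
  \<open>i\<close>: \<open>K\<close> is the mean of \<open>pd C i u\<close> over it. The factor
  \<open>t ^ 0\<close> in the witness matches the family of integrals already known to be
  smooth.\<close>

lemma Hadamard_coordinate:
  fixes u :: "(nat \<Rightarrow> real) \<Rightarrow> real"
  assumes C: "C \<subseteq> {..<d}" and c: "c \<in> corner_model d C" and i: "i < d" and e: "e > 0"
    and u: "Cinf_on d (corner_box d C c e) u"
  obtains K where "Cinf_on d (corner_box d C c e) K" "K c = pd C i u c"
    "\<And>a. a \<in> corner_box d C c e \<Longrightarrow> u a = u (a(i := c i)) + (a i - c i) * K a"
proof
  let ?B = "corner_box d C c e"
  let ?K = "\<lambda>a. integral (cbox 0 1) (\<lambda>t. t ^ 0 * pd C i u (a(i := c i + t * (a i - c i))))"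
  note B = corner_open_box[OF C, of c e]
  show "Cinf_on d ?B ?K"
    by (rule Cinf_onI, rule Ck_on_segment_integral[OF C c i Cinf_on_pd[OF B u i]])
  show "?K c = pd C i u c" by simp
  fix a assume a: "a \<in> ?B"
  let ?L = "\<lambda>t. c i + t * (a i - c i)"
  have "((\<lambda>t. u (a(i := ?L t))) has_vector_derivative (a i - c i) * pd C i u (a(i := ?L t))) (at t within {0..1})"
    if t: "t \<in> {0..1}" for t
  proof -
    let ?w = "a(i := ?L t)"
    have w: "?w \<in> ?B" by (rule corner_box_segment[OF a c i t])
    have L: "(?L has_vector_derivative (a i - c i)) (at t within {0..1})"
      by (auto intro!: derivative_eq_intros simp: has_real_derivative_iff_has_vector_derivative[symmetric])
    have "((\<lambda>s. u (?w(i := s))) has_vector_derivative pd C i u ?w) (at (?w i) within {s. ?w(i := s) \<in> ?B})"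
      using Cinf_on_has_pd[OF B u i w] unfolding at_within_corner_open_slice[OF B w i] .
    moreover have "?L ` {0..1} \<subseteq> {s. ?w(i := s) \<in> ?B}"
      using corner_box_segment[OF a c i] by auto
    ultimately have "((\<lambda>s. u (?w(i := s))) has_vector_derivative pd C i u ?w) (at (?L t) within ?L ` {0..1})"
      by (auto intro: has_vector_derivative_within_subset)
    from vector_diff_chain_within[OF L this] show ?thesis by (simp add: o_def)
  qed
  then have "((\<lambda>t. (a i - c i) * pd C i u (a(i := ?L t))) has_integral u (a(i := ?L 1)) - u (a(i := ?L 0))) {0..1}"
    by (rule fundamental_theorem_of_calculus[OF zero_le_one])
  then have "u (a(i := ?L 1)) - u (a(i := ?L 0)) = (a i - c i) * ?K a"
    by (simp add: integral_unique flip: integral_mult_right)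
  then show "u a = u (a(i := c i)) + (a i - c i) * ?K a" by simp
qed

text \<open>The coordinates are replaced by those of \<open>c\<close> one after the other; each
  replacement contributes one summand by the version for a single coordinate.\<close>

lemma Hadamard:
  fixes u :: "(nat \<Rightarrow> real) \<Rightarrow> real"
  assumes C: "C \<subseteq> {..<d}" and c: "c \<in> corner_model d C" and e: "e > 0"
    and u: "Cinf_on d (corner_box d C c e) u"
  obtains K where "\<And>i. i < d \<Longrightarrow> Cinf_on d (corner_box d C c e) (K i)" "\<And>i. i < d \<Longrightarrow> K i c = pd C i u c"
    "\<And>a. a \<in> corner_box d C c e \<Longrightarrow> u a = u c + (\<Sum>i<d. (a i - c i) * K i a)"
proof -
  let ?B = "corner_box d C c e"
  \<comment> \<open>The first \<open>l\<close> coordinates are frozen at \<open>c\<close>, so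
    \<open>w 0\<close> is \<open>u\<close> and \<open>w d\<close> is constant on the box.\<close>
  define w where "w l a = u (\<lambda>i. if i < l then c i else a i)" for l :: nat and a
  have "\<exists>K. (\<forall>i<l. Cinf_on d ?B (K i) \<and> K i c = pd C i u c) \<and> Cinf_on d ?B (w l) \<and>
     (\<forall>a\<in>?B. u a = w l a + (\<Sum>i<l. (a i - c i) * K i a))" if "l \<le> d" for l
    using that
  proof (induction l)
    case 0
    then show ?case using u by (simp add: w_def[abs_def])
  next
    case (Suc l)
    then obtain K where K: "\<And>i. i < l \<Longrightarrow> Cinf_on d ?B (K i)" "\<And>i. i < l \<Longrightarrow> K i c = pd C i u c" "Cinf_on d ?B (w l)"
      "\<And>a. a \<in> ?B \<Longrightarrow> u a = w l a + (\<Sum>i<l. (a i - c i) * K i a)" by auto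
    have l: "l < d" using Suc.prems by simp
    obtain H where H: "Cinf_on d ?B H" "H c = pd C l (w l) c"
      "\<And>a. a \<in> ?B \<Longrightarrow> w l a = w l (a(l := c l)) + (a l - c l) * H a"
      using Hadamard_coordinate[OF C c l e K(3)] by blast
    have step: "w l (a(l := c l)) = w (Suc l) a" for a
      unfolding w_def by (rule arg_cong[of _ _ u]) (auto simp: fun_eq_iff less_Suc_eq)
    have "pd C l (w l) c = pd C l u c"
      by (rule pd_cong_slice) (auto simp: w_def intro!: arg_cong[of _ _ u])
    \<comment> \<open>Smoothness of the next function is read off from the identity just obtained;
      the chain rule is derived from this lemma and cannot be used here.\<close>
    moreover have "Cinf_on d ?B (w (Suc l))"
    proof (rule Cinf_on_cong)
      show "Cinf_on d ?B (\<lambda>a. w l a - (a l - c l) * H a)"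
        by (intro Cinf_on_diff Cinf_on_mult Cinf_on_coord Cinf_on_const K(3) H(1))
    qed (use H(3) step in \<open>auto simp: algebra_simps\<close>)
    moreover have "u a = w (Suc l) a + ((\<Sum>i<l. (a i - c i) * K i a) + (a l - c l) * H a)" if "a \<in> ?B" for a
      using K(4)[OF that] H(3)[OF that] step[of a] by simp
    ultimately show ?case using K H(1,2)
      by (intro exI[of _ "K(l := H)"]) (auto simp: less_Suc_eq)
  qed
  from this[of d] obtain K where K: "\<forall>i<d. Cinf_on d ?B (K i) \<and> K i c = pd C i u c"
    "\<forall>a\<in>?B. u a = w d a + (\<Sum>i<d. (a i - c i) * K i a)" by auto
  have "w d a = u c" if "a \<in> ?B" for a
    unfolding w_def using that c by (intro arg_cong[of _ _ u]) (auto simp: corner_box_def corner_model_def)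
  then show ?thesis using that[of K] K by simp
qed

text \<open>\<open>flat 0\<close> is the classical smooth function exp(-1/t), extended by zero; the
  powers of 1/t are there because its derivatives contain them.\<close>

definition flat :: "nat \<Rightarrow> real \<Rightarrow> real" where
  "flat k t = (if t > 0 then inverse t ^ k * exp (- inverse t) else 0)"

text \<open>This is the difference quotient of \<open>flat k\<close> at zero. On the right, s = 1/t
  turns it into a power of s divided by exp s; on the left it vanishes.\<close>

lemma flat_div_tendsto_0: "((\<lambda>t. flat k t / t) \<longlongrightarrow> 0) (at 0)"
proof -
  have "((\<lambda>s::real. s ^ Suc k / exp s) \<longlongrightarrow> 0) at_top"
    by (rule tendsto_power_div_exp_0)
  then have "((\<lambda>t::real. inverse t ^ Suc k / exp (inverse t)) \<longlongrightarrow> 0) (at_right 0)"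
    by (rule filterlim_compose[OF _ filterlim_inverse_at_top_right])
  then have "((\<lambda>t. flat k t / t) \<longlongrightarrow> 0) (at_right 0)"
    by (rule Lim_transform_eventually)
      (auto simp: eventually_at_right_less flat_def field_simps exp_minus
        intro!: eventually_mono[OF eventually_at_right_less[of 0]])
  moreover have "((\<lambda>t. flat k t / t) \<longlongrightarrow> 0) (at_left 0)"
    by (rule Lim_transform_eventually[OF tendsto_const])
      (auto simp: flat_def eventually_at_left_field intro!: exI[of _ "-1"])
  ultimately show ?thesis by (simp add: filterlim_at_split)
qed

lemma DERIV_flat: "(flat k has_real_derivative (flat (Suc (Suc k)) t - real k * flat (Suc k) t)) (at t)"
proof (cases "t = 0")
  case True
  have "((\<lambda>y. (flat k y - flat k 0) / (y - 0)) \<longlongrightarrow> 0) (at 0)"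
    using flat_div_tendsto_0[of k] by (simp add: flat_def)
  then have "(flat k has_real_derivative 0) (at 0)"
    by (simp add: has_field_derivative_iff)
  then show ?thesis using True by (simp add: flat_def)
next
  case False
  show ?thesis
  proof (cases "t > 0")
    case True
    define v where "v = inverse t"
    have inv: "(inverse has_real_derivative - (v * v)) (at t)"
      using DERIV_inverse[of t UNIV] True by (simp add: v_def power2_eq_square)
    have "((\<lambda>t. inverse t ^ k) has_real_derivative real k * (v ^ (k - 1) * - (v * v))) (at t)"
      using DERIV_power[OF inv, of k] by (simp add: v_def mult_ac)
    moreover have "((\<lambda>t. exp (- inverse t)) has_real_derivative exp (- v) * (v * v)) (at t)"
      using DERIV_fun_exp[OF DERIV_minus[OF inv]] by (simp add: v_def)
    ultimately have "((\<lambda>t. inverse t ^ k * exp (- inverse t)) has_real_derivative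
        (real k * (v ^ (k - 1) * - (v * v))) * exp (- v) + (exp (- v) * (v * v)) * v ^ k) (at t)"
      unfolding v_def by (rule DERIV_mult)
    moreover have "(real k * (v ^ (k - 1) * - (v * v))) * exp (- v) + (exp (- v) * (v * v)) * v ^ k =
        flat (Suc (Suc k)) t - real k * flat (Suc k) t"
      using True by (cases k) (simp_all add: flat_def v_def[symmetric] algebra_simps)
    ultimately have "((\<lambda>t. inverse t ^ k * exp (- inverse t)) has_real_derivative
        (flat (Suc (Suc k)) t - real k * flat (Suc k) t)) (at t)"
      by (simp only:)
    then show ?thesis
      by (rule has_field_derivative_transform_within_open[of _ _ _ "{0<..}"]) (use True in \<open>auto simp: flat_def\<close>)
  next
    case F2: False
    have "((\<lambda>t::real. 0) has_real_derivative 0) (at t)" by simp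
    then have "(flat k has_real_derivative 0) (at t)"
      by (rule has_field_derivative_transform_within_open[of _ _ _ "{..<0}"]) (use False F2 in \<open>auto simp: flat_def\<close>)
    then show ?thesis using F2 by (simp add: flat_def)
  qed
qed

lemma Cinf_on_flat: "Cinf_on d S u \<Longrightarrow> Cinf_on d S (\<lambda>x. flat k (u x))"
proof (rule Cinf_onI)
  \<comment> \<open>The linear span of all \<open>flat k\<close>, which \<open>DERIV_flat\<close>
    shows to be closed under differentiation.\<close>
  define P where "P = {g. \<exists>N a. g = (\<lambda>t. \<Sum>k<N::nat. a k * flat k t)}"
  have "\<exists>g'\<in>P. \<forall>t. (g has_real_derivative g' t) (at t)" if g: "g \<in> P" for g
  proof -
    obtain N a where g: "g = (\<lambda>t. \<Sum>k<N::nat. a k * flat k t)" using g by (auto simp: P_def)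
    \<comment> \<open>The two terms of the derivative of \<open>flat k\<close> shift the index by 2
      and by 1. The condition \<open>k < Suc N\<close> ends the second part in time, because the
      common range \<open>Suc (Suc N)\<close> is one too long for it.\<close>
    define b where "b k = (if k \<ge> 2 then a (k - 2) else 0) - (if k \<ge> 1 \<and> k < Suc N then a (k - 1) * real (k - 1) else 0)" for k
    have "(g has_real_derivative (\<Sum>k<N. a k * (flat (Suc (Suc k)) t - real k * flat (Suc k) t))) (at t)" for t
      unfolding g by (intro DERIV_sum DERIV_cmult DERIV_flat)
    moreover have "(\<Sum>k<N. a k * (flat (Suc (Suc k)) t - real k * flat (Suc k) t)) = (\<Sum>k<Suc (Suc N). b k * flat k t)" for t
    proof -
      have "(\<Sum>k<Suc (Suc N). (if k \<ge> 2 then a (k - 2) else 0) * flat k t) = (\<Sum>k<N. a k * flat (Suc (Suc k)) t)"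
        by (simp only: sum.lessThan_Suc_shift) (simp add: numeral_2_eq_2)
      moreover have "(\<Sum>k<Suc (Suc N). (if k \<ge> 1 \<and> k < Suc N then a (k - 1) * real (k - 1) else 0) * flat k t) =
          (\<Sum>k<N. a k * real k * flat (Suc k) t)"
        by (simp only: sum.lessThan_Suc_shift[of _ "Suc N"]) simp
      ultimately show ?thesis
        by (simp add: b_def left_diff_distrib right_diff_distrib sum_subtractf mult.assoc del: sum.lessThan_Suc)
    qed
    moreover have "(\<lambda>t. \<Sum>k<Suc (Suc N). b k * flat k t) \<in> P" unfolding P_def by blast
    ultimately show ?thesis
      by (intro bexI[of _ "\<lambda>t. \<Sum>k<Suc (Suc N). b k * flat k t"] allI) (simp_all only:)
  qed
  moreover have "flat k \<in> P"
    unfolding P_def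
    by (intro CollectI exI[of _ "Suc k"] exI[of _ "\<lambda>j. if j = k then 1 else 0"]) (auto simp: fun_eq_iff)
  ultimately show "Ck_on l d S (\<lambda>x. flat k (u x))" if "Cinf_on d S u" for l
    using Ck_on_compose[of P "flat k" l d S u] Cinf_onD[OF that] by blast
qed

lemma flat_0_pos: "flat 0 t > 0 \<longleftrightarrow> t > 0" "flat 0 t = 0 \<longleftrightarrow> t \<le> 0"
  by (auto simp: flat_def)

text \<open>\<open>dtheta\<close> applies a tangent vector to a sine of the angle. The fields
  considered are zero by convention on functions that are not smooth, so smoothness of this function
  has to be known.\<close>

lemma Cinf_on_sin:
  fixes u :: "(nat \<Rightarrow> real) \<Rightarrow> real"
  shows "Cinf_on d S u \<Longrightarrow> Cinf_on d S (\<lambda>x. sin (u x - c))"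
proof (rule Cinf_onI)
  define P where "P = {g. \<exists>a b. g = (\<lambda>t::real. a * sin (t - c) + b * cos (t - c))}"
  have "\<exists>g'\<in>P. \<forall>t. (g has_real_derivative g' t) (at t)" if g: "g \<in> P" for g
  proof -
    obtain a b where g: "g = (\<lambda>t::real. a * sin (t - c) + b * cos (t - c))" using g by (auto simp: P_def)
    have "(g has_real_derivative (- b * sin (t - c) + a * cos (t - c))) (at t)" for t
      unfolding g by (auto intro!: derivative_eq_intros)
    moreover have "(\<lambda>t. - b * sin (t - c) + a * cos (t - c)) \<in> P" unfolding P_def by blast
    ultimately show ?thesis by (intro bexI[of _ "\<lambda>t. - b * sin (t - c) + a * cos (t - c)"]) auto
  qed
  moreover have "(\<lambda>t. sin (t - c)) \<in> P"
    unfolding P_def by (intro CollectI exI[of _ 1] exI[of _ 0]) simp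
  ultimately show "Ck_on l d S (\<lambda>x. sin (u x - c))" if "Cinf_on d S u" for l
    using Ck_on_compose[of P "\<lambda>t. sin (t - c)" l d S u] Cinf_onD[OF that] by blast
qed

section \<open>Smooth maps into the loop algebra as functions on a cylinder\<close>

lemma circ_eq_iff: "circ s = circ t \<longleftrightarrow> (\<exists>k::int. t = s + 2 * pi * of_int k)"
  by (rule circle.abs_eq_iff)

lemma circ_rep [simp]: "circ (rep_circle z) = z"
  by (rule Quotient3_abs_rep[OF Quotient3_circle])

lemma circ_periodic: "circ (t + 2 * pi * of_int k) = circ t"
  by (metis circ_eq_iff)

lemma rep_circ_obtain: obtains k :: int where "rep_circle (circ t) = t + 2 * pi * of_int k"
  using circ_eq_iff[of t "rep_circle (circ t)"] by auto

lemma circ_surj_interval: obtains t where "t \<in> {a..<a + 2 * pi}" "z = circ t"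
proof -
  define k where "k = \<lfloor>(rep_circle z - a) / (2 * pi)\<rfloor>"
  have "of_int k * (2 * pi) \<le> rep_circle z - a" "rep_circle z - a < (of_int k + 1) * (2 * pi)"
    unfolding k_def using pi_gt_zero by (simp_all add: pos_le_divide_eq[symmetric] pos_divide_less_eq[symmetric])
  then have "rep_circle z - 2 * pi * of_int k \<in> {a..<a + 2 * pi}" by (simp add: algebra_simps)
  moreover have "z = circ (rep_circle z + 2 * pi * of_int (- k))" unfolding circ_periodic by simp
  ultimately show ?thesis using that by simp
qed

lemma periodic_has_vector_derivative:
  fixes g :: "real \<Rightarrow> 'a::real_normed_vector"
  assumes "\<And>x. g (x + a) = g x"
  shows "(g has_vector_derivative D) (at (t + a)) \<longleftrightarrow> (g has_vector_derivative D) (at t)"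
proof
  assume "(g has_vector_derivative D) (at (t + a))"
  moreover have "((\<lambda>x. x + a) has_vector_derivative 1) (at t)"
    by (auto intro!: derivative_eq_intros simp: has_real_derivative_iff_has_vector_derivative[symmetric])
  ultimately show "(g has_vector_derivative D) (at t)"
    using vector_diff_chain_at[of "\<lambda>x. x + a" 1 t g D] assms by (simp add: o_def)
next
  assume "(g has_vector_derivative D) (at t)"
  moreover have "((\<lambda>x. x - a) has_vector_derivative 1) (at (t + a))"
    by (auto intro!: derivative_eq_intros simp: has_real_derivative_iff_has_vector_derivative[symmetric])
  moreover have "g (x - a) = g x" for x using assms[of "x - a"] by simp
  ultimately show "(g has_vector_derivative D) (at (t + a))"
    using vector_diff_chain_at[of "\<lambda>x. x - a" 1 "t + a" g D] by (simp add: o_def)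
qed

text \<open>\<open>dcirc\<close> differentiates at the chosen representative of a point of the
  circle; by periodicity every other representative gives the same value.\<close>

lemma vector_derivative_circ_rep:
  "vector_derivative (f \<circ> circ) (at (rep_circle (circ t))) = vector_derivative (f \<circ> circ) (at t)"
proof -
  obtain k :: int where k: "rep_circle (circ t) = t + 2 * pi * of_int k" by (rule rep_circ_obtain)
  show ?thesis
    unfolding vector_derivative_def k
    by (subst periodic_has_vector_derivative) (simp_all add: circ_periodic)
qed

lemma dcirc_circ: "dcirc f (circ t) = vector_derivative (f \<circ> circ) (at t)"
  unfolding dcirc_def by (rule vector_derivative_circ_rep)

lemma LC_carrierD:
  assumes "f \<in> carrier LC"
  shows "((dcirc ^^ k) f \<circ> circ has_vector_derivative (dcirc ^^ Suc k) f (circ t)) (at t)"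
proof -
  have "((dcirc ^^ k) f \<circ> circ) differentiable (at t)" using assms by (simp add: LC_def)
  then show ?thesis unfolding vector_derivative_works by (simp add: dcirc_circ)
qed

lemma LC_carrierI:
  assumes "\<And>k t. \<exists>D. ((dcirc ^^ k) f \<circ> circ has_vector_derivative D) (at t)"
  shows "f \<in> carrier LC"
proof -
  have "((dcirc ^^ k) f \<circ> circ) differentiable (at t)" for k t
    using assms[of k t] by (elim exE) (rule differentiableI_vector)
  then show ?thesis by (simp add: LC_def)
qed

lemma dcirc_eqI: "(f \<circ> circ has_vector_derivative D) (at t) \<Longrightarrow> dcirc f (circ t) = D"
  by (simp add: dcirc_circ vector_derivative_at)

lemma LC_dcirc: "f \<in> carrier LC \<Longrightarrow> dcirc f \<in> carrier LC"
  by (rule LC_carrierI) (metis LC_carrierD funpow_Suc_right comp_apply)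

lemma dcirc_funpow_lin:
  assumes f: "f \<in> carrier LC" and g: "g \<in> carrier LC"
  shows "(dcirc ^^ k) (\<lambda>z. a * f z + b * g z) = (\<lambda>z. a * (dcirc ^^ k) f z + b * (dcirc ^^ k) g z)"
proof (induction k)
  case (Suc k)
  have "dcirc (\<lambda>z. a * (dcirc ^^ k) f z + b * (dcirc ^^ k) g z) (circ t) =
      a * (dcirc ^^ Suc k) f (circ t) + b * (dcirc ^^ Suc k) g (circ t)" for t
  proof (rule dcirc_eqI)
    have "((\<lambda>t. a * ((dcirc ^^ k) f \<circ> circ) t + b * ((dcirc ^^ k) g \<circ> circ) t) has_vector_derivative
        a * (dcirc ^^ Suc k) f (circ t) + b * (dcirc ^^ Suc k) g (circ t)) (at t)"
      by (intro has_vector_derivative_add has_vector_derivative_mult_right LC_carrierD f g)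
    then show "((\<lambda>z. a * (dcirc ^^ k) f z + b * (dcirc ^^ k) g z) \<circ> circ has_vector_derivative
        a * (dcirc ^^ Suc k) f (circ t) + b * (dcirc ^^ Suc k) g (circ t)) (at t)"
      by (simp add: o_def)
  qed
  then have "dcirc (\<lambda>z. a * (dcirc ^^ k) f z + b * (dcirc ^^ k) g z) z =
      a * (dcirc ^^ Suc k) f z + b * (dcirc ^^ Suc k) g z" for z
    using circ_rep by metis
  then show ?case using Suc by auto
qed simp

lemma LC_lin:
  assumes f: "f \<in> carrier LC" and g: "g \<in> carrier LC"
  shows "(\<lambda>z. a * f z + b * g z) \<in> carrier LC"
proof (rule LC_carrierI)
  fix k t
  have "((\<lambda>t. a * ((dcirc ^^ k) f \<circ> circ) t + b * ((dcirc ^^ k) g \<circ> circ) t) has_vector_derivative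
        a * (dcirc ^^ Suc k) f (circ t) + b * (dcirc ^^ Suc k) g (circ t)) (at t)"
    by (intro has_vector_derivative_add has_vector_derivative_mult_right LC_carrierD f g)
  then show "\<exists>D. ((dcirc ^^ k) (\<lambda>z. a * f z + b * g z) \<circ> circ has_vector_derivative D) (at t)"
    unfolding dcirc_funpow_lin[OF f g] by (auto simp: o_def)
qed

lemma dcirc_funpow_quotient:
  assumes f: "f \<in> carrier LC" and g: "g \<in> carrier LC"
  shows "(dcirc ^^ k) (\<lambda>z. (f z - g z) / c) = (\<lambda>z. ((dcirc ^^ k) f z - (dcirc ^^ k) g z) / c)"
proof -
  have eq: "(u - v) / c = 1 / c * u + - (1 / c) * v" for u v :: complex
    by (simp add: diff_divide_distrib)
  show ?thesis unfolding eq by (rule dcirc_funpow_lin[OF f g])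
qed

lemma quotient_has_vector_derivative:
  fixes f :: "real \<Rightarrow> complex"
  assumes "((\<lambda>t. (f t - f a) / of_real (t - a)) \<longlongrightarrow> D) (at a within s)"
  shows "(f has_vector_derivative D) (at a within s)"
proof -
  have "((\<lambda>t. norm ((f t - f a) / of_real (t - a) - D)) \<longlongrightarrow> 0) (at a within s)"
    using assms by (intro tendsto_norm_zero LIM_zero)
  moreover have "\<forall>\<^sub>F t in at a within s. norm ((f t - f a) / of_real (t - a) - D) =
      norm (f t - f a - (t - a) *\<^sub>R D) / norm (t - a)"
    unfolding eventually_at_filter
  proof (intro always_eventually allI impI)
    fix t :: real assume "t \<noteq> a"
    then have "(f t - f a) / of_real (t - a) - D = (f t - f a - (t - a) *\<^sub>R D) / of_real (t - a)"
      by (simp add: scaleR_conv_of_real diff_divide_distrib)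
    then show "norm ((f t - f a) / of_real (t - a) - D) = norm (f t - f a - (t - a) *\<^sub>R D) / norm (t - a)"
      by (simp add: norm_divide del: of_real_diff)
  qed
  ultimately have "((\<lambda>t. norm (f t - f a - (t - a) *\<^sub>R D) / norm (t - a)) \<longlongrightarrow> 0) (at a within s)"
    by (rule Lim_transform_eventually)
  then show ?thesis
    by (simp add: has_vector_derivative_def has_derivative_iff_norm bounded_linear_scaleR_left)
qed

section \<open>The exponential law for loops\<close>

definition cyl :: "nat \<Rightarrow> (nat \<Rightarrow> real) set \<Rightarrow> (nat \<Rightarrow> real) set" where
  "cyl d S = {y. y(d := 0) \<in> S}"

text \<open>Coordinate \<open>d\<close>, which vanishes on the model, is used for the angle:
  \<open>cyl d S\<close> is \<open>S\<close> times the real line, and the loops are pulled back to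
  the universal cover of the circle. No covering of the circle by arcs is then needed.\<close>

definition unroll :: "nat \<Rightarrow> ((nat \<Rightarrow> real) \<Rightarrow> circle \<Rightarrow> 'b) \<Rightarrow> (nat \<Rightarrow> real) \<Rightarrow> 'b" where
  "unroll d f = (\<lambda>y. f (y(d := 0)) (circ (y d)))"

lemma corner_model_upd_eq: "x \<in> corner_model d C \<Longrightarrow> x(d := 0) = x"
  by (auto simp: corner_model_def)

lemma corner_model_upd_eq': "x \<in> corner_model d C \<Longrightarrow> x(d := t, d := 0) = x"
  by (auto simp: corner_model_def)

lemma mem_cyl_upd_other: "i \<noteq> d \<Longrightarrow> y(i := t) \<in> cyl d S \<longleftrightarrow> (y(d := 0))(i := t) \<in> S"
  by (simp add: cyl_def fun_upd_twist)

lemma mem_cyl_upd_same: "y(d := t) \<in> cyl d S \<longleftrightarrow> y \<in> cyl d S"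
  by (simp add: cyl_def)

lemma mem_cylI: "S \<subseteq> corner_model d C \<Longrightarrow> x \<in> S \<Longrightarrow> x(d := t) \<in> cyl d S"
  by (metis cyl_def corner_model_upd_eq' mem_Collect_eq subsetD)

lemma unroll_upd_same: "S \<subseteq> corner_model d C \<Longrightarrow> x \<in> S \<Longrightarrow> unroll d f (x(d := t)) = f x (circ t)"
  unfolding unroll_def using corner_model_upd_eq'[of x d C t] by auto

lemma unroll_upd_other: "i \<noteq> d \<Longrightarrow> unroll d f (y(i := t)) = f ((y(d := 0))(i := t)) (circ (y d))"
  by (simp add: unroll_def fun_upd_twist)

lemma corner_open_cyl:
  assumes "corner_open d C S"
  shows "corner_open (Suc d) C (cyl d S)"
proof -
  have C: "C \<subseteq> {..<d}" using assms by (simp add: corner_open_def)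
  then have C': "C \<subseteq> {..<Suc d}" by auto
  obtain V where V: "open V" "S = corner_model d C \<inter> V" using corner_open_obtain[OF assms] .
  have "open ((\<lambda>y. y(d := 0)) -` V)"
    by (rule open_vimage[OF V(1)]) (intro continuous_on_fun_upd continuous_on_id continuous_on_const)
  moreover have "y \<in> corner_model (Suc d) C \<longleftrightarrow> y(d := 0) \<in> corner_model d C" for y
  proof -
    have "(\<forall>i\<ge>d. (y(d := 0)) i = 0) \<longleftrightarrow> (\<forall>i>d. y i = 0)" by (auto simp: le_less)
    moreover have "(\<forall>i\<in>C. 0 \<le> (y(d := 0)) i) \<longleftrightarrow> (\<forall>i\<in>C. 0 \<le> y i)" using C by (intro ball_cong) auto
    ultimately show ?thesis unfolding corner_model_def mem_Collect_eq Suc_le_eq by blast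
  qed
  then have "cyl d S = corner_model (Suc d) C \<inter> (\<lambda>y. y(d := 0)) -` V"
    using V by (auto simp: cyl_def)
  ultimately show ?thesis using C' unfolding corner_open_def openin_open by blast
qed

lemma LC_tendsto_0D: "LC_tendsto F f \<F> \<Longrightarrow> uniform_limit UNIV F f \<F>"
  unfolding LC_tendsto_def by (drule spec[of _ 0]) simp

lemma LC_tendsto_dcirc:
  assumes "LC_tendsto F f \<F>"
  shows "LC_tendsto (\<lambda>x. dcirc (F x)) (dcirc f) \<F>"
  unfolding LC_tendsto_def
proof
  fix k
  have "uniform_limit UNIV (\<lambda>y. (dcirc ^^ Suc k) (F y)) ((dcirc ^^ Suc k) f) \<F>"
    using assms unfolding LC_tendsto_def by blast
  then show "uniform_limit UNIV (\<lambda>y. (dcirc ^^ k) (dcirc (F y))) ((dcirc ^^ k) (dcirc f)) \<F>"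
    by (simp only: funpow_Suc_right o_apply)
qed

lemma LC_tendsto_cong:
  assumes "LC_tendsto F f \<F>" "\<forall>\<^sub>F x in \<F>. F x = G x"
  shows "LC_tendsto G f \<F>"
  unfolding LC_tendsto_def
proof
  fix k
  have "uniform_limit UNIV (\<lambda>y. (dcirc ^^ k) (F y)) ((dcirc ^^ k) f) \<F>"
    using assms unfolding LC_tendsto_def by blast
  then show "uniform_limit UNIV (\<lambda>y. (dcirc ^^ k) (G y)) ((dcirc ^^ k) f) \<F>"
    by (rule uniform_limit_cong[THEN iffD1, rotated 2]) (use assms(2) in \<open>auto elim: eventually_mono\<close>)
qed

lemma LC_Ck_onD: "LC_Ck_on k d S f \<Longrightarrow> x \<in> S \<Longrightarrow> f x \<in> carrier LC \<and> LC_tendsto f (f x) (at x within S)"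
  by (cases k) auto

lemma LC_Ck_on_SucE:
  assumes "LC_Ck_on (Suc k) d S f" "i < d"
  obtains g where
    "\<And>x. x \<in> S \<Longrightarrow> LC_tendsto (\<lambda>t z. (f (x(i := t)) z - f x z) / of_real (t - x i)) (g x)
                        (at (x i) within {t. x(i := t) \<in> S})" "LC_Ck_on k d S g"
proof -
  have "\<exists>g. (\<forall>x\<in>S. LC_tendsto (\<lambda>t z. (f (x(i := t)) z - f x z) / of_real (t - x i)) (g x)
                        (at (x i) within {t. x(i := t) \<in> S})) \<and> LC_Ck_on k d S g"
    by (rule assms(1)[unfolded LC_Ck_on.simps(2), THEN conjunct2, rule_format, OF assms(2)])
  then show ?thesis by (elim exE conjE) (rule that, erule bspec)
qed

lemma LC_Ck_on_Suc_imp: "LC_Ck_on (Suc k) d S f \<Longrightarrow> LC_Ck_on k d S f"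
proof (induction k arbitrary: f)
  case (Suc k)
  have "\<exists>g. (\<forall>x\<in>S. LC_tendsto (\<lambda>t z. (f (x(i := t)) z - f x z) / of_real (t - x i)) (g x)
                        (at (x i) within {t. x(i := t) \<in> S})) \<and> LC_Ck_on k d S g" if "i < d" for i
  proof -
    obtain g where
      "\<And>x. x \<in> S \<Longrightarrow> LC_tendsto (\<lambda>t z. (f (x(i := t)) z - f x z) / of_real (t - x i)) (g x)
                        (at (x i) within {t. x(i := t) \<in> S})" "LC_Ck_on (Suc k) d S g"
      by (rule LC_Ck_on_SucE[OF Suc.prems \<open>i < d\<close>]) (rule that)
    then show ?thesis using Suc.IH by (intro exI[of _ g] conjI ballI)
  qed
  then show ?case using LC_Ck_onD[OF Suc.prems] by simp
qed simp

text \<open>\<open>dcirc\<close> is linear, and continuous because the topology controls all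
  derivatives, so it passes through limits of difference quotients. No order of differentiability is
  lost.\<close>

lemma LC_Ck_on_dcirc: "LC_Ck_on k d S f \<Longrightarrow> LC_Ck_on k d S (\<lambda>x. dcirc (f x))"
proof (induction k arbitrary: f)
  case 0
  then show ?case by (auto intro: LC_dcirc LC_tendsto_dcirc)
next
  case (Suc k)
  have "\<exists>g. (\<forall>x\<in>S. LC_tendsto (\<lambda>t z. (dcirc (f (x(i := t))) z - dcirc (f x) z) / of_real (t - x i)) (g x)
                        (at (x i) within {t. x(i := t) \<in> S})) \<and> LC_Ck_on k d S g" if "i < d" for i
  proof -
    obtain g where g:
      "\<And>x. x \<in> S \<Longrightarrow> LC_tendsto (\<lambda>t z. (f (x(i := t)) z - f x z) / of_real (t - x i)) (g x)
                        (at (x i) within {t. x(i := t) \<in> S})" "LC_Ck_on k d S g"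
      by (rule LC_Ck_on_SucE[OF Suc.prems \<open>i < d\<close>]) (rule that)
    show ?thesis
    proof (intro exI[of _ "\<lambda>x. dcirc (g x)"] conjI ballI)
      fix x assume x: "x \<in> S"
      show "LC_tendsto (\<lambda>t z. (dcirc (f (x(i := t))) z - dcirc (f x) z) / of_real (t - x i)) (dcirc (g x))
                        (at (x i) within {t. x(i := t) \<in> S})"
      proof (rule LC_tendsto_cong[OF LC_tendsto_dcirc[OF g(1)[OF x]]])
        have "dcirc (\<lambda>z. (f (x(i := t)) z - f x z) / of_real (t - x i)) =
            (\<lambda>z. (dcirc (f (x(i := t))) z - dcirc (f x) z) / of_real (t - x i))" if "x(i := t) \<in> S" for t
          using dcirc_funpow_quotient[of "f (x(i := t))" "f x" 1] LC_Ck_onD[OF Suc.prems] x that by simp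
        then show "\<forall>\<^sub>F t in at (x i) within {t. x(i := t) \<in> S}. dcirc (\<lambda>z. (f (x(i := t)) z - f x z) / of_real (t - x i)) =
            (\<lambda>z. (dcirc (f (x(i := t))) z - dcirc (f x) z) / of_real (t - x i))"
          unfolding eventually_at_filter by (intro always_eventually) simp
      qed
    qed (rule Suc.IH[OF g(2)])
  qed
  moreover have "dcirc (f x) \<in> carrier LC \<and> LC_tendsto (\<lambda>x. dcirc (f x)) (dcirc (f x)) (at x within S)" if "x \<in> S" for x
    using LC_Ck_onD[OF Suc.prems that] by (auto intro: LC_dcirc LC_tendsto_dcirc)
  ultimately show ?case by simp
qed

text \<open>Frechet convergence makes nearby loops uniformly close, and the single loop over a point
  is continuous in the angle; half of \<open>e\<close> is spent on each.\<close>

lemma LC_continuous_imp_unroll: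
  assumes S: "S \<subseteq> corner_model d C" and f: "\<And>x. x \<in> S \<Longrightarrow> f x \<in> carrier LC \<and> LC_tendsto f (f x) (at x within S)"
  shows "continuous_on (cyl d S) (unroll d f)"
  unfolding continuous_on_eq_continuous_within continuous_within
proof (intro ballI tendstoI)
  fix y :: "nat \<Rightarrow> real" and e :: real
  assume y: "y \<in> cyl d S" and e: "e > 0"
  let ?x = "y(d := 0)"
  have x: "?x \<in> S" using y by (simp add: cyl_def)
  have "\<forall>\<^sub>F x' in at ?x within S. \<forall>z\<in>UNIV. dist (f x' z) (f ?x z) < e / 2"
    using f[OF x] e by (intro uniform_limitD[OF LC_tendsto_0D]) auto
  then obtain V where V: "open V" "?x \<in> V" "\<forall>x'\<in>V. x' \<noteq> ?x \<longrightarrow> x' \<in> S \<longrightarrow> (\<forall>z\<in>UNIV. dist (f x' z) (f ?x z) < e / 2)"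
    unfolding eventually_at_topological by (elim exE conjE) (rule that)
  have V': "dist (f x' z) (f ?x z) < e / 2" if "x' \<in> V" "x' \<in> S" for x' z
    using V(3) that e by (cases "x' = ?x") auto
  have "isCont (f ?x \<circ> circ) (y d)"
    using has_vector_derivative_continuous[OF LC_carrierD[of "f ?x" 0 "y d"]] f[OF x] by simp
  then obtain \<delta> where \<delta>: "\<delta> > 0" "\<And>t. dist t (y d) < \<delta> \<Longrightarrow> dist (f ?x (circ t)) (f ?x (circ (y d))) < e / 2"
    using e unfolding continuous_at_eps_delta o_apply by (elim allE[of _ "e / 2"]) auto
  let ?W = "(\<lambda>y. y(d := 0)) -` V \<inter> (\<lambda>y. y d) -` ball (y d) \<delta>"
  have "open ?W"
    by (intro open_Int open_vimage V(1) open_ball continuous_on_fun_upd continuous_on_id continuous_on_const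
        continuous_on_product_coordinates)
  moreover have "y \<in> ?W" using V \<delta> by simp
  moreover have "dist (unroll d f y') (unroll d f y) < e" if "y' \<in> ?W" "y' \<in> cyl d S" for y'
  proof -
    have "dist (unroll d f y') (unroll d f y) \<le>
        dist (f (y'(d := 0)) (circ (y' d))) (f ?x (circ (y' d))) + dist (f ?x (circ (y' d))) (f ?x (circ (y d)))"
      unfolding unroll_def by (rule dist_triangle)
    also have "\<dots> < e / 2 + e / 2"
      using that by (intro add_strict_mono V' \<delta>(2)) (auto simp: cyl_def dist_commute)
    finally show ?thesis by simp
  qed
  ultimately show "\<forall>\<^sub>F y' in at y within cyl d S. dist (unroll d f y') (unroll d f y) < e"
    unfolding eventually_at_topological by (intro exI[of _ ?W] conjI ballI impI)
qed

text \<open>In the angular direction the derivative is the unrolled \<open>dcirc\<close>, to which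
  the induction applies as well; in the other directions the limit of loops is evaluated at a point
  of the circle.\<close>

lemma LC_Ck_on_imp_Ck_on_unroll:
  assumes S: "S \<subseteq> corner_model d C"
  shows "LC_Ck_on k d S f \<Longrightarrow> Ck_on k (Suc d) (cyl d S) (unroll d f)"
proof (induction k arbitrary: f)
  case 0
  have "continuous_on (cyl d S) (unroll d f)"
    by (rule LC_continuous_imp_unroll[where f = f, OF S], rule LC_Ck_onD[OF 0])
  then show ?case by simp
next
  case (Suc k)
  have cont: "continuous_on (cyl d S) (unroll d f)"
    by (rule LC_continuous_imp_unroll[where f = f, OF S], rule LC_Ck_onD[OF Suc.prems])
  have "\<exists>g. (\<forall>y\<in>cyl d S. ((\<lambda>t. unroll d f (y(i := t))) has_vector_derivative g y)
      (at (y i) within {t. y(i := t) \<in> cyl d S})) \<and> Ck_on k (Suc d) (cyl d S) g" if i: "i < Suc d" for i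
  proof (cases "i = d")
    case True
    show ?thesis
    proof (intro exI[of _ "unroll d (\<lambda>x. dcirc (f x))"] conjI ballI)
      show "Ck_on k (Suc d) (cyl d S) (unroll d (\<lambda>x. dcirc (f x)))"
        by (rule Suc.IH[OF LC_Ck_on_dcirc[OF LC_Ck_on_Suc_imp[OF Suc.prems]]])
      fix y assume "y \<in> cyl d S"
      then have x: "y(d := 0) \<in> S" by (simp add: cyl_def)
      have "((\<lambda>t. f (y(d := 0)) (circ t)) has_vector_derivative dcirc (f (y(d := 0))) (circ (y d))) (at (y d))"
        using LC_carrierD[OF conjunct1[OF LC_Ck_onD[OF Suc.prems x]], of 0 "y d"]
        by (simp only: funpow.simps o_def id_apply)
      moreover have "unroll d f (y(d := t)) = f (y(d := 0)) (circ t)" for t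
        by (simp only: unroll_def fun_upd_upd fun_upd_same)
      ultimately show "((\<lambda>t. unroll d f (y(i := t))) has_vector_derivative unroll d (\<lambda>x. dcirc (f x)) y)
          (at (y i) within {t. y(i := t) \<in> cyl d S})"
        unfolding True by - (rule has_vector_derivative_at_within, simp only: unroll_def)
    qed
  next
    case False
    then have "i < d" using i by simp
    obtain g where g:
      "\<And>x. x \<in> S \<Longrightarrow> LC_tendsto (\<lambda>t z. (f (x(i := t)) z - f x z) / of_real (t - x i)) (g x)
                        (at (x i) within {t. x(i := t) \<in> S})" "LC_Ck_on k d S g"
      by (rule LC_Ck_on_SucE[OF Suc.prems \<open>i < d\<close>]) (rule that)
    show ?thesis
    proof (intro exI[of _ "unroll d g"] conjI ballI)
      show "Ck_on k (Suc d) (cyl d S) (unroll d g)" by (rule Suc.IH[OF g(2)])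
      fix y assume "y \<in> cyl d S"
      then have x: "y(d := 0) \<in> S" by (simp add: cyl_def)
      let ?x = "y(d := 0)" and ?z = "circ (y d)"
      have "((\<lambda>t. (f (?x(i := t)) ?z - f ?x ?z) / of_real (t - ?x i)) \<longlongrightarrow> g ?x ?z) (at (?x i) within {t. ?x(i := t) \<in> S})"
        by (rule tendsto_uniform_limitI[OF LC_tendsto_0D[OF g(1)[OF x]] UNIV_I])
      then have "((\<lambda>t. f (?x(i := t)) ?z) has_vector_derivative g ?x ?z) (at (?x i) within {t. ?x(i := t) \<in> S})"
        by - (rule quotient_has_vector_derivative, simp only: fun_upd_triv)
      moreover have "?x i = y i" using False by simp
      ultimately show "((\<lambda>t. unroll d f (y(i := t))) has_vector_derivative unroll d g y)
          (at (y i) within {t. y(i := t) \<in> cyl d S})"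
        by (simp only: unroll_upd_other[OF False] mem_cyl_upd_other[OF False]) (simp only: unroll_def)
    qed
  qed
  then show ?case using cont by simp
qed

lemma unroll_dcirc_funpow:
  assumes S: "corner_open d C S" and F: "Cinf_on (Suc d) (cyl d S) (unroll d f)" and x: "x \<in> S"
  shows "(dcirc ^^ k) (f x) (circ t) = (pd C d ^^ k) (unroll d f) (x(d := t))"
    and "((dcirc ^^ k) (f x) \<circ> circ has_vector_derivative (pd C d ^^ Suc k) (unroll d f) (x(d := t))) (at t)"
proof -
  note S' = corner_open_cyl[OF S]
  have d: "slice C d = UNIV" using S by (auto simp: corner_open_def slice_def)
  have smooth: "Cinf_on (Suc d) (cyl d S) ((pd C d ^^ k) (unroll d f))" for k
    by (induction k) (auto intro: F Cinf_on_pd[OF S'])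
  have sub: "S \<subseteq> corner_model d C" by (rule corner_open_subset[OF S])
  have D: "((\<lambda>t. (pd C d ^^ k) (unroll d f) (x(d := t))) has_vector_derivative
      (pd C d ^^ Suc k) (unroll d f) (x(d := t))) (at t)" for k t
    using Cinf_on_has_pd[OF S' smooth[of k] lessI mem_cylI[OF sub x, of t]] by (simp add: d)
  show eq: "(dcirc ^^ k) (f x) (circ t) = (pd C d ^^ k) (unroll d f) (x(d := t))" for k t
  proof (induction k arbitrary: t)
    case 0
    then show ?case by (simp only: funpow.simps id_apply unroll_upd_same[OF sub x])
  next
    case (Suc k)
    have "(dcirc ^^ Suc k) (f x) (circ t) = vector_derivative ((dcirc ^^ k) (f x) \<circ> circ) (at t)"
      by (simp add: dcirc_circ)
    also have "(dcirc ^^ k) (f x) \<circ> circ = (\<lambda>t. (pd C d ^^ k) (unroll d f) (x(d := t)))"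
      by (rule ext) (simp only: o_apply Suc)
    finally show ?case using vector_derivative_at[OF D] by metis
  qed
  have "(dcirc ^^ k) (f x) \<circ> circ = (\<lambda>t. (pd C d ^^ k) (unroll d f) (x(d := t)))"
    by (rule ext) (simp only: o_apply eq)
  then show "((dcirc ^^ k) (f x) \<circ> circ has_vector_derivative (pd C d ^^ Suc k) (unroll d f) (x(d := t))) (at t)"
    using D by metis
qed

lemma unroll_LC_carrier:
  assumes S: "corner_open d C S" and F: "Cinf_on (Suc d) (cyl d S) (unroll d f)" and x: "x \<in> S"
  shows "f x \<in> carrier LC"
  by (rule LC_carrierI) (use unroll_dcirc_funpow(2)[OF assms] in blast)

text \<open>The exchange of mixed partials, iterated, with the angle as the direction without a
  face.\<close>

lemma pd_funpow_commute:
  fixes F :: "(nat \<Rightarrow> real) \<Rightarrow> 'b::banach"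
  assumes S: "corner_open d C S" and F: "Cinf_on (Suc d) (cyl d S) F" and i: "i < d"
  shows "y \<in> cyl d S \<Longrightarrow> (pd C d ^^ k) (pd C i F) y = pd C i ((pd C d ^^ k) F) y"
proof (induction k arbitrary: y)
  case (Suc k)
  note S' = corner_open_cyl[OF S]
  have d: "d \<notin> C" using S by (auto simp: corner_open_def)
  have smooth: "Cinf_on (Suc d) (cyl d S) ((pd C d ^^ k) F)" for k
    by (induction k) (auto intro: F Cinf_on_pd[OF S'])
  have "(pd C d ^^ Suc k) (pd C i F) y = pd C d (pd C i ((pd C d ^^ k) F)) y"
  proof -
    have "(pd C d ^^ k) (pd C i F) (y(d := t)) = pd C i ((pd C d ^^ k) F) (y(d := t))" for t
      by (rule Suc.IH) (simp only: mem_cyl_upd_same Suc.prems)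
    then show ?thesis unfolding funpow.simps o_apply by (rule pd_cong_slice) (rule refl)
  qed
  also have "\<dots> = pd C i (pd C d ((pd C d ^^ k) F)) y"
    using i d Suc.prems by (intro pd_commute(2)[OF S' smooth]) (auto simp: mem_cyl_upd_same)
  finally show ?case by simp
qed simp

text \<open>Compactness of a full period gives one neighbourhood that works for all angles at once,
  as uniform convergence over the circle demands.\<close>

lemma uniform_nbhd:
  assumes S: "S \<subseteq> corner_model d C" and H: "continuous_on (cyl d S) H" and x: "x \<in> S" and e: "e > 0"
  obtains V where "open V" "x \<in> V" "\<And>x' t. x' \<in> V \<Longrightarrow> x' \<in> S \<Longrightarrow> t \<in> {0..<2 * pi} \<Longrightarrow> dist (H (x'(d := t))) (H (x(d := t))) \<le> e"
proof -
  have "continuous_on (S \<times> {0..2 * pi}) (\<lambda>p. H ((fst p)(d := snd p)))"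
  proof (rule continuous_on_compose2[OF H])
    show "continuous_on (S \<times> {0..2 * pi}) (\<lambda>p. (fst p)(d := snd p))"
      by (intro continuous_on_fun_upd continuous_on_fst continuous_on_snd continuous_on_id)
    show "(\<lambda>p. (fst p)(d := snd p)) ` (S \<times> {0..2 * pi}) \<subseteq> cyl d S"
      by (rule image_subsetI, rule mem_cylI[OF S], erule mem_Times_iff[THEN iffD1, THEN conjunct1])
  qed
  then obtain V where V: "x \<in> V" "open V"
    "\<forall>x'\<in>V \<inter> S. \<forall>t\<in>{0..2 * pi}. dist (H ((fst (x', t))(d := snd (x', t)))) (H ((fst (x, t))(d := snd (x, t)))) \<le> e"
    by (rule continuous_on_prod_compactE[OF _ compact_Icc x e]) (rule that)
  show ?thesis
  proof (rule that[OF V(2,1)])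
    fix x' t assume "x' \<in> V" "x' \<in> S" "t \<in> {0..<2 * pi}"
    then show "dist (H (x'(d := t))) (H (x(d := t))) \<le> e"
      by (intro V(3)[unfolded fst_conv snd_conv, rule_format]) auto
  qed
qed

lemma unroll_LC_tendsto:
  assumes S: "corner_open d C S" and F: "Cinf_on (Suc d) (cyl d S) (unroll d f)" and x: "x \<in> S"
  shows "LC_tendsto f (f x) (at x within S)"
  unfolding LC_tendsto_def
proof (intro allI uniform_limitI)
  fix k and e :: real assume e: "e > 0"
  define H where "H = (pd C d ^^ k) (unroll d f)"
  note S' = corner_open_cyl[OF S]
  have "Cinf_on (Suc d) (cyl d S) H"
    unfolding H_def by (induction k) (auto intro: F Cinf_on_pd[OF S'])
  then have cH: "continuous_on (cyl d S) H" by (rule Cinf_on_imp_continuous_on)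
  obtain V where V: "open V" "x \<in> V"
    "\<And>x' t. x' \<in> V \<Longrightarrow> x' \<in> S \<Longrightarrow> t \<in> {0..<2 * pi} \<Longrightarrow> dist (H (x'(d := t))) (H (x(d := t))) \<le> e / 2"
    by (rule uniform_nbhd[OF corner_open_subset[OF S] cH x half_gt_zero[OF e]]) (rule that)
  have "dist ((dcirc ^^ k) (f x') z) ((dcirc ^^ k) (f x) z) < e" if "x' \<in> V" "x' \<in> S" for x' z
  proof -
    obtain t where t: "t \<in> {0..<0 + 2 * pi}" "z = circ t" using circ_surj_interval[of 0 z] .
    have "dist ((dcirc ^^ k) (f x') z) ((dcirc ^^ k) (f x) z) = dist (H (x'(d := t))) (H (x(d := t)))"
      using unroll_dcirc_funpow(1)[OF S F] x that t(2) by (simp add: H_def)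
    also have "\<dots> \<le> e / 2" using V(3) that t(1) by simp
    finally show ?thesis using e by simp
  qed
  then show "\<forall>\<^sub>F x' in at x within S. \<forall>z\<in>UNIV. dist ((dcirc ^^ k) (f x') z) ((dcirc ^^ k) (f x) z) < e"
    unfolding eventually_at_topological using V(1,2) by (intro exI[of _ V] conjI ballI impI)
qed

lemma unroll_pd: "i \<noteq> d \<Longrightarrow> unroll d (\<lambda>x z. pd C i (\<lambda>x. f x z) x) = pd C i (unroll d f)"
proof
  fix y :: "nat \<Rightarrow> real" assume i: "i \<noteq> d"
  have "pd C i (\<lambda>x. f x (circ (y d))) (y(d := 0)) = pd C i (unroll d f) y"
    by (rule pd_cong_slice) (simp_all add: unroll_upd_other[OF i] i)
  then show "unroll d (\<lambda>x z. pd C i (\<lambda>x. f x z) x) y = pd C i (unroll d f) y"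
    by (simp add: unroll_def)
qed

text \<open>For each number \<open>k\<close> of angular derivatives the error of the difference
  quotient is bounded, by the mean value inequality, by the oscillation of \<open>pd C i H\<close>.
  This oscillation is small uniformly in the angle, and the exchange of mixed partials identifies
  the limit.\<close>

lemma unroll_LC_tendsto_quotient:
  assumes S: "corner_open d C S" and F: "Cinf_on (Suc d) (cyl d S) (unroll d f)" and x: "x \<in> S" and i: "i < d"
  shows "LC_tendsto (\<lambda>t z. (f (x(i := t)) z - f x z) / of_real (t - x i)) (\<lambda>z. pd C i (\<lambda>x. f x z) x)
     (at (x i) within {t. x(i := t) \<in> S})"
  unfolding LC_tendsto_def
proof (intro allI uniform_limitI)
  fix k and e :: real assume e: "e > 0"
  define H where "H = (pd C d ^^ k) (unroll d f)"
  note S' = corner_open_cyl[OF S]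
  note sub = corner_open_subset[OF S]
  have i': "i < Suc d" "i \<noteq> d" using i by auto
  have H: "Cinf_on (Suc d) (cyl d S) H"
    unfolding H_def by (induction k) (auto intro: F Cinf_on_pd[OF S'])
  obtain V where V: "open V" "x \<in> V"
    "\<And>x' t. x' \<in> V \<Longrightarrow> x' \<in> S \<Longrightarrow> t \<in> {0..<2 * pi} \<Longrightarrow> dist (pd C i H (x'(d := t))) (pd C i H (x(d := t))) \<le> e / 2"
    by (rule uniform_nbhd[OF sub Cinf_on_imp_continuous_on[OF Cinf_on_pd[OF S' H i'(1)]] x half_gt_zero[OF e]])
      (rule that)
  obtain \<delta> where \<delta>: "\<delta> > 0" "\<And>s. \<bar>s - x i\<bar> < \<delta> \<Longrightarrow> x(i := s) \<in> S \<longleftrightarrow> s \<in> slice C i"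
    using corner_open_slice[OF S x i] by blast
  have "open ((\<lambda>s. x(i := s)) -` V)"
    by (intro open_vimage V(1) continuous_on_fun_upd continuous_on_const continuous_on_id)
  moreover have "x i \<in> (\<lambda>s. x(i := s)) -` V" using V(2) by simp
  ultimately obtain \<eta> where \<eta>: "\<eta> > 0" "ball (x i) \<eta> \<subseteq> (\<lambda>s. x(i := s)) -` V" using openE by blast
  \<comment> \<open>\<delta> keeps \<open>x(i := s)\<close> in \<open>S\<close> and \<eta> keeps it
    in \<open>V\<close>. The resulting \<open>U\<close> is convex, as the mean value inequality
    requires a segment.\<close>
  define r where "r = min \<delta> \<eta>"
  define U where "U = slice C i \<inter> ball (x i) r"
  have r: "r > 0" using \<delta> \<eta> by (simp add: r_def)
  have US: "x(i := s) \<in> S" and UV: "x(i := s) \<in> V" if "s \<in> U" for s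
    using that \<delta>(2)[of s] \<eta>(2) by (auto simp: U_def r_def dist_real_def abs_minus_commute)
  have xU: "x i \<in> U" using r corner_open_mem_slice[OF S x] by (simp add: U_def)
  have cU: "convex U" by (simp add: U_def convex_Int convex_slice)
  have est: "dist ((dcirc ^^ k) (\<lambda>z. (f (x(i := s)) z - f x z) / of_real (s - x i)) z)
      ((dcirc ^^ k) (\<lambda>z. pd C i (\<lambda>x. f x z) x) z) < e"
    if s: "s \<in> ball (x i) r" "s \<noteq> x i" "x(i := s) \<in> S" for s z
  proof -
    obtain t where t: "t \<in> {0..<0 + 2 * pi}" "z = circ t" using circ_surj_interval[of 0 z] .
    have sU: "s \<in> U" using s \<delta>(2)[of s] by (auto simp: U_def r_def dist_real_def abs_minus_commute)
    define h where "h = (\<lambda>s. H (x(i := s, d := t)))"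
    have q: "(dcirc ^^ k) (\<lambda>z. (f (x(i := s)) z - f x z) / of_real (s - x i)) z = (h s - h (x i)) / of_real (s - x i)"
      using dcirc_funpow_quotient[OF unroll_LC_carrier[OF S F s(3)] unroll_LC_carrier[OF S F x]]
        unroll_dcirc_funpow(1)[OF S F s(3)] unroll_dcirc_funpow(1)[OF S F x] t(2)
      by (simp add: h_def H_def)
    have F': "Cinf_on (Suc d) (cyl d S) (unroll d (\<lambda>x z. pd C i (\<lambda>x. f x z) x))"
      unfolding unroll_pd[OF i'(2)] by (rule Cinf_on_pd[OF S' F i'(1)])
    have p: "(dcirc ^^ k) (\<lambda>z. pd C i (\<lambda>x. f x z) x) z = pd C i H (x(d := t))"
      using unroll_dcirc_funpow(1)[OF S F' x, of k t] pd_funpow_commute[OF S F i mem_cylI[OF sub x, of t], of k] t(2)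
      unfolding unroll_pd[OF i'(2)] by (simp add: H_def)
    have h': "(h has_vector_derivative pd C i H (x(i := s', d := t))) (at s' within U)" if "s' \<in> U" for s'
    proof -
      have tw: "x(i := s', d := t, i := r) = x(i := r, d := t)" for r using i' by auto
      show ?thesis
        using Cinf_on_has_pd[OF S' H i'(1) mem_cylI[OF sub US[OF that], of t]] i'(2)
        by (auto simp: h_def tw U_def intro: has_vector_derivative_within_subset)
    qed
    have "norm (h s - h (x i) - (s - x i) *\<^sub>R pd C i H (x(i := x i, d := t))) \<le> norm (s - x i) * (e / 2)"
    proof (rule vector_differentiable_bound_linearization[OF h' _ _ xU])
      show "closed_segment (x i) s \<subseteq> U" using cU xU sU by (rule closed_segment_subset[rotated 2])
      show "norm (pd C i H (x(i := s', d := t)) - pd C i H (x(i := x i, d := t))) \<le> e / 2" if "s' \<in> U" for s'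
        using V(3)[OF UV[OF that] US[OF that]] t(1) by (simp add: dist_norm)
    qed
    then have b: "norm (h s - h (x i) - (s - x i) *\<^sub>R pd C i H (x(d := t))) \<le> \<bar>s - x i\<bar> * (e / 2)" by simp
    have "(h s - h (x i)) / of_real (s - x i) - pd C i H (x(d := t)) =
        (h s - h (x i) - (s - x i) *\<^sub>R pd C i H (x(d := t))) / of_real (s - x i)"
      using s(2) by (simp add: scaleR_conv_of_real diff_divide_distrib)
    then have "norm ((h s - h (x i)) / of_real (s - x i) - pd C i H (x(d := t))) =
        norm (h s - h (x i) - (s - x i) *\<^sub>R pd C i H (x(d := t))) / \<bar>s - x i\<bar>"
      by (simp add: norm_divide del: of_real_diff)
    also have "\<dots> \<le> e / 2"
      using b s(2) by (simp add: pos_divide_le_eq mult.commute)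
    finally show ?thesis unfolding q p dist_norm using e by linarith
  qed
  show "\<forall>\<^sub>F s in at (x i) within {t. x(i := t) \<in> S}. \<forall>z\<in>UNIV.
      dist ((dcirc ^^ k) (\<lambda>z. (f (x(i := s)) z - f x z) / of_real (s - x i)) z)
        ((dcirc ^^ k) (\<lambda>z. pd C i (\<lambda>x. f x z) x) z) < e"
    unfolding eventually_at_topological
  proof (intro exI[of _ "ball (x i) r"] conjI ballI impI open_ball)
    show "x i \<in> ball (x i) r" using r by simp
  qed (rule est, assumption, assumption, erule CollectD)
qed

text \<open>Convergence in \<open>LC\<close> involves all angular derivatives at once, so smoothness
  of every order enters even for a fixed \<open>k\<close>.\<close>

lemma Cinf_on_unroll_imp_LC_Ck_on:
  assumes S: "corner_open d C S"
  shows "Cinf_on (Suc d) (cyl d S) (unroll d f) \<Longrightarrow> LC_Ck_on k d S f"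
proof (induction k arbitrary: f)
  case 0
  then show ?case using unroll_LC_tendsto[OF S] unroll_LC_carrier[OF S] by simp
next
  case (Suc k)
  have "\<exists>g. (\<forall>x\<in>S. LC_tendsto (\<lambda>t z. (f (x(i := t)) z - f x z) / of_real (t - x i)) (g x)
                        (at (x i) within {t. x(i := t) \<in> S})) \<and> LC_Ck_on k d S g" if i: "i < d" for i
  proof (intro exI[of _ "\<lambda>x z. pd C i (\<lambda>x. f x z) x"] conjI ballI)
    show "LC_Ck_on k d S (\<lambda>x z. pd C i (\<lambda>x. f x z) x)"
      using i by (intro Suc.IH) (simp add: unroll_pd Cinf_on_pd[OF corner_open_cyl[OF S] Suc.prems])
  qed (rule unroll_LC_tendsto_quotient[OF S Suc.prems _ i])
  then show ?case using unroll_LC_tendsto[OF S Suc.prems] unroll_LC_carrier[OF S Suc.prems] by simp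
qed

text \<open>The exponential law in a chart: a smooth map into the Frechet space of loops is the same
  as a smooth function of both variables.\<close>

lemma LC_smooth_iff_unroll:
  assumes S: "corner_open d C S"
  shows "(\<forall>k. LC_Ck_on k d S f) \<longleftrightarrow> Cinf_on (Suc d) (cyl d S) (unroll d f)"
  using LC_Ck_on_imp_Ck_on_unroll[OF corner_open_subset[OF S]] Cinf_on_unroll_imp_LC_Ck_on[OF S]
  unfolding Cinf_on_def by blast

section \<open>The chain rule and smooth functions on \<open>M \<times> S\<^sup>1\<close>\<close>

lemma pd_cong_open:
  assumes S: "corner_open d C S" and x: "x \<in> S" and i: "i < d" and eq: "\<And>a. a \<in> S \<Longrightarrow> f a = g a"
  shows "pd C i f x = pd C i g x"
proof -
  have "((\<lambda>t. f (x(i := t))) has_vector_derivative D) (at (x i) within {t. x(i := t) \<in> S}) \<longleftrightarrow>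
      ((\<lambda>t. g (x(i := t))) has_vector_derivative D) (at (x i) within {t. x(i := t) \<in> S})" for D
  proof
    assume D: "((\<lambda>t. f (x(i := t))) has_vector_derivative D) (at (x i) within {t. x(i := t) \<in> S})"
    show "((\<lambda>t. g (x(i := t))) has_vector_derivative D) (at (x i) within {t. x(i := t) \<in> S})"
      by (rule has_vector_derivative_cong_on[OF D]) (simp_all add: eq x)
  next
    assume D: "((\<lambda>t. g (x(i := t))) has_vector_derivative D) (at (x i) within {t. x(i := t) \<in> S})"
    show "((\<lambda>t. f (x(i := t))) has_vector_derivative D) (at (x i) within {t. x(i := t) \<in> S})"
      by (rule has_vector_derivative_cong_on[OF D]) (simp_all add: eq x)
  qed
  then show ?thesis
    unfolding pd_def vector_derivative_def at_within_corner_open_slice[OF S x i] by (simp only:)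
qed

lemma pd_bounded_linear:
  assumes "bounded_linear L" "corner_open d C S" "Cinf_on d S f" "i < d" "x \<in> S"
  shows "pd C i (\<lambda>x. L (f x)) x = L (pd C i f x)"
  by (rule pd_eqI[OF bounded_linear.has_vector_derivative[OF assms(1) Cinf_on_has_pd[OF assms(2-5)]]
        corner_open_mem_slice[OF assms(2,5)]])

text \<open>The difference quotient of the product is that of \<open>g\<close> times
  \<open>k\<close>, because \<open>g\<close> vanishes at \<open>t\<close>. In the chain rule
  \<open>g\<close> is the increment of a coordinate and \<open>k\<close> a Hadamard coefficient
  along the curve, of which only continuity is known.\<close>

lemma has_vector_derivative_mult_zero:
  fixes g k :: "real \<Rightarrow> real"
  assumes g: "(g has_vector_derivative g') (at t within T)" "g t = 0"
    and k: "continuous (at t within T) k"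
  shows "((\<lambda>s. g s * k s) has_vector_derivative g' * k t) (at t within T)"
proof -
  have "((\<lambda>s. (g s - g t) / (s - t)) \<longlongrightarrow> g') (at t within T)"
    using g(1) by (simp add: has_real_derivative_iff_has_vector_derivative[symmetric] has_field_derivative_iff)
  then have "((\<lambda>s. (g s - g t) / (s - t) * k s) \<longlongrightarrow> g' * k t) (at t within T)"
    using k unfolding continuous_within by (rule tendsto_mult)
  then show ?thesis
    using g(2) by (simp add: has_real_derivative_iff_has_vector_derivative[symmetric] has_field_derivative_iff)
qed

text \<open>The chain rule holds up to the boundary because Hadamard's lemma expresses an increment of \<open>f\<close>
  through the increments of the coordinates.\<close>

lemma chain_rule_corner:
  fixes f :: "(nat \<Rightarrow> real) \<Rightarrow> real"
  assumes S: "corner_open d C S" and f: "Cinf_on d S f"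
    and \<gamma>: "\<And>s. s \<in> T \<Longrightarrow> \<gamma> s \<in> S" and t: "t \<in> T"
    and \<gamma>': "\<And>j. j < d \<Longrightarrow> ((\<lambda>s. \<gamma> s j) has_vector_derivative \<gamma>' j) (at t within T)"
  shows "((\<lambda>s. f (\<gamma> s)) has_vector_derivative (\<Sum>j<d. \<gamma>' j * pd C j f (\<gamma> t))) (at t within T)"
proof -
  let ?c = "\<gamma> t"
  have C: "C \<subseteq> {..<d}" using S by (simp add: corner_open_def)
  have c: "?c \<in> corner_model d C" using corner_open_subset[OF S] \<gamma>[OF t] by blast
  obtain e where e: "e > 0" "corner_box d C ?c e \<subseteq> S" using corner_box_subset[OF S \<gamma>[OF t]] by blast
  obtain K where K: "\<And>j. j < d \<Longrightarrow> Cinf_on d (corner_box d C ?c e) (K j)" "\<And>j. j < d \<Longrightarrow> K j ?c = pd C j f ?c"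
    "\<And>a. a \<in> corner_box d C ?c e \<Longrightarrow> f a = f ?c + (\<Sum>j<d. (a j - ?c j) * K j a)"
    using Hadamard[OF C c e(1) Cinf_on_subset[OF f e(2)]] by blast
  have comp: "continuous (at t within T) (\<lambda>s. \<gamma> s j)" if "j < d" for j
    using has_vector_derivative_continuous[OF \<gamma>'[OF that]] .
  have "\<exists>\<delta>>0. \<forall>s\<in>T. \<bar>s - t\<bar> < \<delta> \<longrightarrow> \<gamma> s \<in> corner_box d C ?c e"
  proof -
    have "\<forall>\<^sub>F s in at t within T. \<forall>j<d. \<bar>\<gamma> s j - ?c j\<bar> < e"
    proof -
      have "\<forall>\<^sub>F s in at t within T. \<forall>j\<in>{..<d}. dist (\<gamma> s j) (?c j) < e"
        using comp e(1) by (intro eventually_ball_finite) (auto simp: continuous_within dest: tendstoD)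
      then show ?thesis by (rule eventually_mono) (auto simp: dist_real_def)
    qed
    then obtain \<delta> where "\<delta> > 0" "\<forall>s\<in>T. s \<noteq> t \<and> dist s t < \<delta> \<longrightarrow> (\<forall>j<d. \<bar>\<gamma> s j - ?c j\<bar> < e)"
      unfolding eventually_at by blast
    moreover have "\<gamma> s \<in> corner_model d C" if "s \<in> T" for s
      using corner_open_subset[OF S] \<gamma>[OF that] by blast
    ultimately show ?thesis using e(1) by (intro exI[of _ \<delta>]) (auto simp: corner_box_def dist_real_def)
  qed
  then obtain \<delta> where \<delta>: "\<delta> > 0" "\<And>s. s \<in> T \<Longrightarrow> \<bar>s - t\<bar> < \<delta> \<Longrightarrow> \<gamma> s \<in> corner_box d C ?c e" by blast
  define T' where "T' = T \<inter> ball t \<delta>"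
  have T': "at t within T' = at t within T"
    unfolding T'_def using \<delta>(1) by (intro at_within_nhd[of _ "ball t \<delta>"]) auto
  have box: "\<gamma> s \<in> corner_box d C ?c e" if "s \<in> T'" for s
    using that by (intro \<delta>(2)) (auto simp: T'_def dist_real_def abs_minus_commute)
  have tT': "t \<in> T'" using t \<delta>(1) by (simp add: T'_def)
  \<comment> \<open>Convergence in the product topology is coordinatewise; the coordinates from
    \<open>d\<close> on are constantly zero in the model.\<close>
  have \<gamma>_tendsto: "(\<gamma> \<longlongrightarrow> ?c) (at t within T')"
  proof -
    have "((\<lambda>s. \<gamma> s j) \<longlongrightarrow> ?c j) (at t within T')" for j
    proof (cases "j < d")
      case True
      then show ?thesis using comp[OF True] T' by (simp add: continuous_within)
    next
      case False
      have z: "\<gamma> s j = 0" if "s \<in> T'" for s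
        using False box[OF that] by (simp add: corner_box_def corner_model_def)
      have "((\<lambda>s. \<gamma> s j) \<longlongrightarrow> 0) (at t within T')"
        by (rule Lim_transform_eventually[OF tendsto_const])
          (auto simp: eventually_at_filter z intro!: always_eventually)
      then show ?thesis using z[OF tT'] by simp
    qed
    then have "limitin (product_topology (\<lambda>i. euclidean) UNIV) \<gamma> ?c (at t within T')"
      unfolding limitin_componentwise by simp
    then show ?thesis unfolding euclidean_product_topology limitin_canonical_iff .
  qed
  have Kcont: "continuous (at t within T') (\<lambda>s. K j (\<gamma> s))" if "j < d" for j
  proof -
    have "continuous (at ?c within corner_box d C ?c e) (K j)"
      using Cinf_on_imp_continuous_on[OF K(1)[OF that]] box[OF tT'] by (simp add: continuous_on_eq_continuous_within)
    then have lim: "(K j \<longlongrightarrow> K j ?c) (at ?c within corner_box d C ?c e)" by (simp add: continuous_within)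
    have "\<forall>\<^sub>F s in at t within T'. \<gamma> s \<in> corner_box d C ?c e"
      unfolding eventually_at_filter using box by (intro always_eventually) simp
    with \<gamma>_tendsto have "filterlim \<gamma> (inf (nhds ?c) (principal (corner_box d C ?c e))) (at t within T')"
      by (simp add: filterlim_inf filterlim_principal)
    moreover have "(K j \<longlongrightarrow> K j ?c) (inf (nhds ?c) (principal (corner_box d C ?c e)))"
      using lim tendsto_at_iff_tendsto_nhds_within by blast
    ultimately show ?thesis unfolding continuous_within by (rule filterlim_compose[rotated])
  qed
  have "((\<lambda>s. f ?c + (\<Sum>j<d. (\<gamma> s j - ?c j) * K j (\<gamma> s))) has_vector_derivative 0 + (\<Sum>j<d. \<gamma>' j * K j ?c)) (at t within T')"
  proof (intro has_vector_derivative_add has_vector_derivative_const has_vector_derivative_sum has_vector_derivative_mult_zero)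
    fix j assume "j \<in> {..<d}"
    then have j: "j < d" by simp
    have "((\<lambda>s. \<gamma> s j - ?c j) has_vector_derivative \<gamma>' j - 0) (at t within T')"
      unfolding T' by (intro has_vector_derivative_diff has_vector_derivative_const \<gamma>'[OF j])
    then show "((\<lambda>s. \<gamma> s j - ?c j) has_vector_derivative \<gamma>' j) (at t within T')" by simp
    show "continuous (at t within T') (\<lambda>s. K j (\<gamma> s))" by (rule Kcont[OF j])
  qed simp
  then have "((\<lambda>s. f (\<gamma> s)) has_vector_derivative 0 + (\<Sum>j<d. \<gamma>' j * K j ?c)) (at t within T')"
    by (rule has_vector_derivative_cong_on[OF _ K(3)[OF box, symmetric] tT'])
  then show ?thesis using K(2) unfolding T' by simp
qed

text \<open>A partial derivative of the composite is a sum of products of derivatives of \<phi> with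
  composites of \<open>pd C j f\<close>, so the induction runs over all smooth \<open>f\<close>
  simultaneously. The derivatives of \<phi> enter as the witnesses in \<open>Ck_on\<close>, so
  \<open>A\<close> may be an arbitrary set.\<close>

lemma Cinf_on_compose:
  fixes f :: "(nat \<Rightarrow> real) \<Rightarrow> real"
  assumes S: "corner_open d C S" and \<phi>: "\<And>a. a \<in> A \<Longrightarrow> \<phi> a \<in> S"
    and smooth: "\<And>j. j < d \<Longrightarrow> Cinf_on e A (\<lambda>a. \<phi> a j)"
  shows "Cinf_on d S f \<Longrightarrow> Cinf_on e A (\<lambda>a. f (\<phi> a))"
proof (rule Cinf_onI)
  have cont\<phi>: "continuous_on A \<phi>"
  proof (rule continuous_on_coordinatewise_then_product)
    fix j show "continuous_on A (\<lambda>a. \<phi> a j)"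
    proof (cases "j < d")
      case True
      then show ?thesis by (rule Cinf_on_imp_continuous_on[OF smooth])
    next
      case False
      then have "\<phi> a j = 0" if "a \<in> A" for a
        using corner_open_subset[OF S] \<phi>[OF that] by (auto simp: corner_model_def)
      then show ?thesis by (simp cong: continuous_on_cong)
    qed
  qed
  show "Cinf_on d S f \<Longrightarrow> Ck_on k e A (\<lambda>a. f (\<phi> a))" for k
  proof (induction k arbitrary: f)
    case 0
    have "continuous_on A (\<lambda>a. f (\<phi> a))"
      by (rule continuous_on_compose2[OF Cinf_on_imp_continuous_on[OF 0] cont\<phi>]) (rule image_subsetI, rule \<phi>)
    then show ?case by simp
  next
    case (Suc k)
    have "continuous_on A (\<lambda>a. f (\<phi> a))"
      by (rule continuous_on_compose2[OF Cinf_on_imp_continuous_on[OF Suc.prems] cont\<phi>]) (rule image_subsetI, rule \<phi>)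
    moreover have "\<exists>g. (\<forall>a\<in>A. ((\<lambda>t. f (\<phi> (a(i := t)))) has_vector_derivative g a)
        (at (a i) within {t. a(i := t) \<in> A})) \<and> Ck_on k e A g" if i: "i < e" for i
    proof -
      have "\<exists>h. (\<forall>a\<in>A. ((\<lambda>t. \<phi> (a(i := t)) j) has_vector_derivative h a)
        (at (a i) within {t. a(i := t) \<in> A})) \<and> Ck_on k e A h" if "j < d" for j
        by (rule Cinf_onD[OF smooth[OF that], of "Suc k", unfolded Ck_on.simps(2), THEN conjunct2, rule_format, OF i])
      then obtain h where h: "\<And>j. j < d \<Longrightarrow> (\<forall>a\<in>A. ((\<lambda>t. \<phi> (a(i := t)) j) has_vector_derivative h j a)
        (at (a i) within {t. a(i := t) \<in> A})) \<and> Ck_on k e A (h j)" by metis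
      show ?thesis
      proof (intro exI[of _ "\<lambda>a. \<Sum>j<d. h j a * pd C j f (\<phi> a)"] conjI ballI)
        have "Ck_on k e A (\<lambda>a. pd C j f (\<phi> a))" if "j < d" for j
          by (rule Suc.IH[OF Cinf_on_pd[OF S Suc.prems that]])
        then show "Ck_on k e A (\<lambda>a. \<Sum>j<d. h j a * pd C j f (\<phi> a))"
          using h by (intro Ck_on_sum Ck_on_mult) simp_all
        fix a assume a: "a \<in> A"
        have "((\<lambda>t. f (\<phi> (a(i := t)))) has_vector_derivative (\<Sum>j<d. h j a * pd C j f (\<phi> (a(i := a i)))))
            (at (a i) within {t. a(i := t) \<in> A})"
        proof (rule chain_rule_corner[OF S Suc.prems])
          show "\<phi> (a(i := s)) \<in> S" if "s \<in> {t. a(i := t) \<in> A}" for s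
            using \<phi> that by blast
          show "a i \<in> {t. a(i := t) \<in> A}" using a by simp
          show "((\<lambda>s. \<phi> (a(i := s)) j) has_vector_derivative h j a) (at (a i) within {t. a(i := t) \<in> A})" if "j < d" for j
            using h[OF that] a by blast
        qed
        then show "((\<lambda>t. f (\<phi> (a(i := t)))) has_vector_derivative (\<Sum>j<d. h j a * pd C j f (\<phi> a)))
            (at (a i) within {t. a(i := t) \<in> A})"
          by (simp only: fun_upd_triv)
      qed
    qed
    ultimately show ?case by simp
  qed
qed

lemma Ck_on_cyl_pullback: "Ck_on k d S f \<Longrightarrow> Ck_on k (Suc d) (cyl d S) (\<lambda>y. f (y(d := 0)))"
proof (induction k arbitrary: f)
  have cont: "continuous_on (cyl d S) (\<lambda>y. f (y(d := 0)))" if "continuous_on S f" for f :: "(nat \<Rightarrow> real) \<Rightarrow> 'a"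
  proof (rule continuous_on_compose2[OF that])
    show "continuous_on (cyl d S) (\<lambda>y. y(d := 0))"
      by (intro continuous_on_fun_upd continuous_on_id continuous_on_const)
    show "(\<lambda>y. y(d := 0)) ` cyl d S \<subseteq> S" by (rule image_subsetI) (simp only: cyl_def mem_Collect_eq)
  qed
  {
    case 0
    then show ?case by (simp only: Ck_on.simps(1) cont)
  next
    case (Suc k)
    have "\<exists>g. (\<forall>y\<in>cyl d S. ((\<lambda>t. f (y(i := t, d := 0))) has_vector_derivative g y)
        (at (y i) within {t. y(i := t) \<in> cyl d S})) \<and> Ck_on k (Suc d) (cyl d S) g" if i: "i < Suc d" for i
    proof (cases "i = d")
      case True
      show ?thesis
        unfolding True by (intro exI[of _ "\<lambda>y. 0"] conjI ballI Ck_on_const) (simp only: fun_upd_upd has_vector_derivative_const)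
    next
      case False
      then have i': "i < d" using i by simp
      obtain g where g: "\<And>x. x \<in> S \<Longrightarrow> ((\<lambda>t. f (x(i := t))) has_vector_derivative g x) (at (x i) within {t. x(i := t) \<in> S})"
        "Ck_on k d S g"
        by (rule Ck_on_SucE[OF Suc.prems i']) (rule that)
      show ?thesis
      proof (intro exI[of _ "\<lambda>y. g (y(d := 0))"] conjI ballI)
        show "Ck_on k (Suc d) (cyl d S) (\<lambda>y. g (y(d := 0)))" by (rule Suc.IH[OF g(2)])
        fix y assume "y \<in> cyl d S"
        then have x: "y(d := 0) \<in> S" by (simp only: cyl_def mem_Collect_eq)
        have "(y(d := 0)) i = y i" using False by simp
        then show "((\<lambda>t. f (y(i := t, d := 0))) has_vector_derivative g (y(d := 0)))
            (at (y i) within {t. y(i := t) \<in> cyl d S})"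
          using g(1)[OF x] by (simp only: mem_cyl_upd_other[OF False] fun_upd_twist[OF False])
      qed
    qed
    moreover have "continuous_on (cyl d S) (\<lambda>y. f (y(d := 0)))"
      by (rule cont[OF Ck_on_imp_continuous_on[OF Suc.prems]])
    ultimately show ?case unfolding Ck_on.simps(2) by blast
  }
qed

lemma Ck_on_cyl_slice:
  assumes S: "S \<subseteq> corner_model d C"
  shows "Ck_on k (Suc d) (cyl d S) G \<Longrightarrow> Ck_on k d S (\<lambda>x. G (x(d := \<theta>)))"
proof (induction k arbitrary: G)
  have cont: "continuous_on S (\<lambda>x. G (x(d := \<theta>)))" if "continuous_on (cyl d S) G" for G :: "(nat \<Rightarrow> real) \<Rightarrow> 'a"
  proof (rule continuous_on_compose2[OF that])
    show "continuous_on S (\<lambda>y. y(d := \<theta>))"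
      by (intro continuous_on_fun_upd continuous_on_id continuous_on_const)
    show "(\<lambda>y. y(d := \<theta>)) ` S \<subseteq> cyl d S" by (rule image_subsetI) (rule mem_cylI[OF S])
  qed
  {
    case 0
    then show ?case by (simp only: Ck_on.simps(1) cont)
  next
    case (Suc k)
    have "\<exists>g. (\<forall>x\<in>S. ((\<lambda>t. G (x(i := t, d := \<theta>))) has_vector_derivative g x)
        (at (x i) within {t. x(i := t) \<in> S})) \<and> Ck_on k d S g" if i: "i < d" for i
    proof -
      have i': "i < Suc d" "i \<noteq> d" using i by auto
      obtain g where g: "\<And>y. y \<in> cyl d S \<Longrightarrow> ((\<lambda>t. G (y(i := t))) has_vector_derivative g y) (at (y i) within {t. y(i := t) \<in> cyl d S})"
        "Ck_on k (Suc d) (cyl d S) g"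
        by (rule Ck_on_SucE[OF Suc.prems i'(1)]) (rule that)
      show ?thesis
      proof (intro exI[of _ "\<lambda>x. g (x(d := \<theta>))"] conjI ballI)
        show "Ck_on k d S (\<lambda>x. g (x(d := \<theta>)))" by (rule Suc.IH[OF g(2)])
        fix x assume x: "x \<in> S"
        have "(x(d := \<theta>)) i = x i" using i'(2) by simp
        moreover have "x(d := \<theta>, d := 0) = x" using corner_model_upd_eq' S x by blast
        ultimately show "((\<lambda>t. G (x(i := t, d := \<theta>))) has_vector_derivative g (x(d := \<theta>)))
            (at (x i) within {t. x(i := t) \<in> S})"
          using g(1)[OF mem_cylI[OF S x, of \<theta>]]
          by (simp only: mem_cyl_upd_other[OF i'(2)] fun_upd_twist[OF i'(2)])
      qed
    qed
    moreover have "continuous_on S (\<lambda>x. G (x(d := \<theta>)))"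
      by (rule cont[OF Ck_on_imp_continuous_on[OF Suc.prems]])
    ultimately show ?case unfolding Ck_on.simps(2) by blast
  }
qed

lemma Cinf_on_cyl_pullback: "Cinf_on d S f \<Longrightarrow> Cinf_on (Suc d) (cyl d S) (\<lambda>y. f (y(d := 0)))"
  by (simp add: Cinf_on_def Ck_on_cyl_pullback)

lemma Cinf_on_cyl_slice:
  "S \<subseteq> corner_model d C \<Longrightarrow> Cinf_on (Suc d) (cyl d S) G \<Longrightarrow> Cinf_on d S (\<lambda>x. G (x(d := \<theta>)))"
  by (simp add: Cinf_on_def Ck_on_cyl_slice)

text \<open>Joint smoothness in point and angle, with the angle unrolled. This one notion stands for
  smooth maps into \<open>LC\<close>, for smooth functions on \<open>times_circle M\<close> and, for
  families constant in the angle, for smooth functions on \<open>M\<close>.\<close>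

definition smooth_cyl :: "'m manifold \<Rightarrow> 'm set \<Rightarrow> ('m \<Rightarrow> circle \<Rightarrow> 'b::real_normed_vector) \<Rightarrow> bool" where
  "smooth_cyl M W F \<longleftrightarrow> (\<forall>(U, x)\<in>charts M. Cinf_on (Suc (mdim M)) (cyl (mdim M) (x ` (U \<inter> W)))
     (unroll (mdim M) (F \<circ> inv_into U x)))"

lemma smooth_cylI:
  assumes "\<And>U x. (U, x) \<in> charts M \<Longrightarrow> Cinf_on (Suc (mdim M)) (cyl (mdim M) (x ` (U \<inter> W)))
     (\<lambda>y. F (inv_into U x (y(mdim M := 0))) (circ (y (mdim M))))"
  shows "smooth_cyl M W F"
  using assms by (auto simp: smooth_cyl_def unroll_def)

lemma smooth_cylD:
  assumes "smooth_cyl M W F" "(U, x) \<in> charts M"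
  shows "Cinf_on (Suc (mdim M)) (cyl (mdim M) (x ` (U \<inter> W))) (\<lambda>y. F (inv_into U x (y(mdim M := 0))) (circ (y (mdim M))))"
  using assms by (auto simp: smooth_cyl_def unroll_def)

lemma smooth_cyl_const: "smooth_cyl M W (\<lambda>m z. c)"
  by (rule smooth_cylI) (rule Cinf_on_const)

lemma smooth_cyl_add: "smooth_cyl M W F \<Longrightarrow> smooth_cyl M W G \<Longrightarrow> smooth_cyl M W (\<lambda>m z. F m z + G m z)"
  by (rule smooth_cylI, rule Cinf_on_add) (erule (1) smooth_cylD)+

lemma smooth_cyl_diff: "smooth_cyl M W F \<Longrightarrow> smooth_cyl M W G \<Longrightarrow> smooth_cyl M W (\<lambda>m z. F m z - G m z)"
  by (rule smooth_cylI, rule Cinf_on_diff) (erule (1) smooth_cylD)+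

lemma smooth_cyl_mult:
  fixes F G :: "'m \<Rightarrow> circle \<Rightarrow> 'b::real_normed_algebra"
  shows "smooth_cyl M W F \<Longrightarrow> smooth_cyl M W G \<Longrightarrow> smooth_cyl M W (\<lambda>m z. F m z * G m z)"
  by (rule smooth_cylI, rule Cinf_on_mult) (erule (1) smooth_cylD)+

lemma Cinf_on_scaleR: "Cinf_on d S f \<Longrightarrow> Cinf_on d S g \<Longrightarrow> Cinf_on d S (\<lambda>x. f x *\<^sub>R g x)"
  by (simp add: Cinf_on_def Ck_on_scaleR)

lemma smooth_cyl_scaleR: "smooth_cyl M W F \<Longrightarrow> smooth_cyl M W G \<Longrightarrow> smooth_cyl M W (\<lambda>m z. F m z *\<^sub>R G m z)"
  by (rule smooth_cylI, rule Cinf_on_scaleR) (erule (1) smooth_cylD)+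

lemma smooth_cyl_sum:
  "(\<And>a. a \<in> A \<Longrightarrow> smooth_cyl M W (F a)) \<Longrightarrow> smooth_cyl M W (\<lambda>m z. \<Sum>a\<in>A. F a m z)"
  by (rule smooth_cylI, rule Cinf_on_sum) (rule smooth_cylD)

lemma smooth_cyl_bounded_linear: "bounded_linear L \<Longrightarrow> smooth_cyl M W F \<Longrightarrow> smooth_cyl M W (\<lambda>m z. L (F m z))"
  by (rule smooth_cylI, rule Cinf_on_bounded_linear, assumption) (erule (1) smooth_cylD)

lemma smooth_cyl_subset: "smooth_cyl M W F \<Longrightarrow> W' \<subseteq> W \<Longrightarrow> smooth_cyl M W' F"
  by (rule smooth_cylI, rule Cinf_on_subset, erule (1) smooth_cylD) (auto simp: cyl_def)

section \<open>Charts, smooth families and bump functions on a manifold with corners\<close>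

locale corners =
  fixes M :: "'m::t2_space manifold"
  assumes mc: "manifold_with_corners M"
begin

abbreviation "d \<equiv> mdim M"

lemma chart_open: "(U, x) \<in> charts M \<Longrightarrow> open U"
  using mc by (auto simp: manifold_with_corners_def)

lemma chart_homeo: "(U, x) \<in> charts M \<Longrightarrow> homeomorphism U (x ` U) x (inv_into U x)"
  using mc by (auto simp: manifold_with_corners_def)

lemma chart_corner:
  assumes "(U, x) \<in> charts M"
  obtains C where "corner_open d C (x ` U)"
  using mc assms unfolding manifold_with_corners_def corner_open_def by blast

lemma chart_transition:
  "(U, x) \<in> charts M \<Longrightarrow> (V, y) \<in> charts M \<Longrightarrow> i < d \<Longrightarrow> Cinf_on d (x ` (U \<inter> V)) (\<lambda>a. y (inv_into U x a) i)"
  using mc unfolding manifold_with_corners_def by blast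

lemma chart_cover: obtains U x where "(U, x) \<in> charts M" "m \<in> U"
proof -
  have "m \<in> (\<Union>(U, x)\<in>charts M. U)" using mc by (simp add: manifold_with_corners_def)
  then show ?thesis using that by blast
qed

lemma inv_chart: "(U, x) \<in> charts M \<Longrightarrow> m \<in> U \<Longrightarrow> inv_into U x (x m) = m"
  using chart_homeo homeomorphism_apply1 by fastforce

lemma inv_chart_mem: "(U, x) \<in> charts M \<Longrightarrow> a \<in> x ` (U \<inter> W) \<Longrightarrow> inv_into U x a \<in> U \<inter> W"
  using inv_chart by fastforce

lemma chart_corner_open:
  assumes "(U, x) \<in> charts M" "corner_open d C (x ` U)" "open W"
  shows "corner_open d C (x ` (U \<inter> W))"
proof -
  have "openin (top_of_set (x ` U)) (x ` (U \<inter> W))"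
    by (rule homeomorphism_imp_open_map[OF chart_homeo[OF assms(1)]]) (use assms(3) in \<open>simp add: openin_open_Int\<close>)
  then show ?thesis using assms(2) unfolding corner_open_def using openin_trans by blast
qed

lemma chart_vimage_open:
  assumes "(U, x) \<in> charts M" "corner_open d C (x ` U)" "corner_open d C S" "S \<subseteq> x ` U"
  shows "open (U \<inter> x -` S)"
proof -
  have "openin (top_of_set (x ` U)) S"
    using assms(3,4) corner_open_subset[OF assms(2)] openin_subset_trans unfolding corner_open_def by blast
  then have "openin (top_of_set U) (U \<inter> x -` S)"
    using chart_homeo[OF assms(1)] by (intro continuous_openin_preimage[of U x "x ` U"]) (auto simp: homeomorphism_def)
  then show ?thesis using chart_open[OF assms(1)] openin_open_trans by blast
qed

lemma chart_subset_model:
  assumes "(U, x) \<in> charts M"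
  obtains C where "x ` (U \<inter> W) \<subseteq> corner_model d C"
proof -
  obtain C where "corner_open d C (x ` U)" using chart_corner[OF assms] .
  then show ?thesis using that corner_open_subset by blast
qed

lemma chart_upd:
  assumes "(U, x) \<in> charts M" "m \<in> U"
  shows "(x m)(d := 0) = x m" "(x m)(d := t, d := 0) = x m"
proof -
  obtain C where "corner_open d C (x ` U)" using chart_corner[OF assms(1)] .
  then have "x m \<in> corner_model d C" using corner_open_subset assms(2) by blast
  then show "(x m)(d := 0) = x m" "(x m)(d := t, d := 0) = x m"
    by (rule corner_model_upd_eq, rule corner_model_upd_eq')
qed

lemma smooth_cyl_local:
  assumes "\<And>m. m \<in> W \<Longrightarrow> \<exists>W'. open W' \<and> m \<in> W' \<and> smooth_cyl M W' F" and W: "open W"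
  shows "smooth_cyl M W F"
proof (rule smooth_cylI)
  fix U x assume ch: "(U, x) \<in> charts M"
  obtain C where C: "corner_open d C (x ` U)" using chart_corner[OF ch] .
  show "Cinf_on (Suc d) (cyl d (x ` (U \<inter> W))) (\<lambda>y. F (inv_into U x (y(d := 0))) (circ (y d)))"
  proof (rule Cinf_on_local[OF corner_open_cyl[OF chart_corner_open[OF ch C W]]])
    fix y assume "y \<in> cyl d (x ` (U \<inter> W))"
    then obtain m where m: "m \<in> U" "m \<in> W" "y(d := 0) = x m" by (auto simp: cyl_def)
    obtain W' where W': "open W'" "m \<in> W'" "smooth_cyl M W' F" using assms(1)[OF m(2)] by blast
    show "\<exists>S'. y \<in> S' \<and> corner_open (Suc d) C S' \<and>
        Cinf_on (Suc d) S' (\<lambda>y. F (inv_into U x (y(d := 0))) (circ (y d)))"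
    proof (intro exI[of _ "cyl d (x ` (U \<inter> W'))"] conjI)
      show "y \<in> cyl d (x ` (U \<inter> W'))" using m W' unfolding cyl_def mem_Collect_eq m(3) by blast
      show "corner_open (Suc d) C (cyl d (x ` (U \<inter> W')))"
        by (rule corner_open_cyl[OF chart_corner_open[OF ch C W'(1)]])
    qed (rule smooth_cylD[OF W'(3) ch])
  qed
qed

lemma smooth_cyl_cong:
  assumes F: "smooth_cyl M W F" and eq: "\<And>m z. m \<in> W \<Longrightarrow> F m z = G m z"
  shows "smooth_cyl M W G"
proof (rule smooth_cylI)
  fix U x assume ch: "(U, x) \<in> charts M"
  show "Cinf_on (Suc d) (cyl d (x ` (U \<inter> W))) (\<lambda>y. G (inv_into U x (y(d := 0))) (circ (y d)))"
  proof (rule Cinf_on_cong[OF smooth_cylD[OF F ch]])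
    fix y assume "y \<in> cyl d (x ` (U \<inter> W))"
    then have "inv_into U x (y(d := 0)) \<in> U \<inter> W"
      unfolding cyl_def mem_Collect_eq by (rule inv_chart_mem[OF ch])
    then show "F (inv_into U x (y(d := 0))) (circ (y d)) = G (inv_into U x (y(d := 0))) (circ (y d))"
      using eq by blast
  qed
qed

text \<open>Through this equivalence the closure properties of \<open>smooth_cyl\<close> carry over
  to functions on \<open>M\<close>.\<close>

lemma smooth_fun_on_iff_cyl: "smooth_fun_on M W f \<longleftrightarrow> smooth_cyl M W (\<lambda>m z. f m)"
proof
  assume f: "smooth_fun_on M W f"
  show "smooth_cyl M W (\<lambda>m z. f m)"
  proof (rule smooth_cylI)
    fix U x assume ch: "(U, x) \<in> charts M"
    then have "Cinf_on d (x ` (U \<inter> W)) (\<lambda>a. f (inv_into U x a))"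
      using f by (auto simp: smooth_fun_on_def o_def)
    then show "Cinf_on (Suc d) (cyl d (x ` (U \<inter> W))) (\<lambda>y. f (inv_into U x (y(d := 0))))"
      by (rule Cinf_on_cyl_pullback)
  qed
next
  assume f: "smooth_cyl M W (\<lambda>m z. f m)"
  have "Cinf_on d (x ` (U \<inter> W)) (f \<circ> inv_into U x)" if ch: "(U, x) \<in> charts M" for U x
  proof -
    obtain C where C: "x ` (U \<inter> W) \<subseteq> corner_model d C" using chart_subset_model[OF ch] .
    show ?thesis
      using Cinf_on_cyl_slice[OF C smooth_cylD[OF f ch], of 0]
    proof (rule Cinf_on_cong)
      fix a assume "a \<in> x ` (U \<inter> W)"
      then show "f (inv_into U x (a(d := 0, d := 0))) = (f \<circ> inv_into U x) a"
        using corner_model_upd_eq'[of a d C 0] C by (metis comp_apply subsetD)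
    qed
  qed
  then show "smooth_fun_on M W f" by (auto simp: smooth_fun_on_def)
qed

lemma smooth_cyl_slice:
  assumes F: "smooth_cyl M W F"
  shows "smooth_fun_on M W (\<lambda>m. F m z)"
proof -
  have "Cinf_on d (x ` (U \<inter> W)) ((\<lambda>m. F m z) \<circ> inv_into U x)" if ch: "(U, x) \<in> charts M" for U x
  proof -
    obtain C where C: "x ` (U \<inter> W) \<subseteq> corner_model d C" using chart_subset_model[OF ch] .
    show ?thesis
      using Cinf_on_cyl_slice[OF C smooth_cylD[OF F ch], of "rep_circle z"]
    proof (rule Cinf_on_cong)
      fix a assume "a \<in> x ` (U \<inter> W)"
      then have "a(d := rep_circle z, d := 0) = a" using corner_model_upd_eq'[of a d C] C by blast
      then show "F (inv_into U x (a(d := rep_circle z, d := 0))) (circ ((a(d := rep_circle z)) d)) = ((\<lambda>m. F m z) \<circ> inv_into U x) a"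
        by (simp only: fun_upd_same circ_rep o_apply)
    qed
  qed
  then show ?thesis by (auto simp: smooth_fun_on_def)
qed

lemma LC_smooth_on_iff_cyl:
  assumes "open W"
  shows "LC_smooth_on M W F \<longleftrightarrow> smooth_cyl M W F"
proof -
  have "(\<forall>k. LC_Ck_on k d (x ` (U \<inter> W)) (F \<circ> inv_into U x)) \<longleftrightarrow>
      Cinf_on (Suc d) (cyl d (x ` (U \<inter> W))) (unroll d (F \<circ> inv_into U x))" if ch: "(U, x) \<in> charts M" for U x
  proof -
    obtain C where C: "corner_open d C (x ` U)" using chart_corner[OF ch] .
    show ?thesis by (rule LC_smooth_iff_unroll[OF chart_corner_open[OF ch C assms]])
  qed
  then show ?thesis unfolding LC_smooth_on_def smooth_cyl_def by fast
qed

lemma smooth_cyl_LC_carrier: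
  assumes F: "smooth_cyl M W F" and W: "open W" and m: "m \<in> W"
  shows "F m \<in> carrier LC"
proof -
  obtain U x where ch: "(U, x) \<in> charts M" "m \<in> U" using chart_cover .
  obtain C where C: "corner_open d C (x ` U)" using chart_corner[OF ch(1)] .
  have F': "Cinf_on (Suc d) (cyl d (x ` (U \<inter> W))) (unroll d (F \<circ> inv_into U x))"
    using F ch(1) by (auto simp: smooth_cyl_def)
  have "x m \<in> x ` (U \<inter> W)" using ch m by blast
  from unroll_LC_carrier[OF chart_corner_open[OF ch(1) C W] F' this] show ?thesis
    by (simp only: o_apply inv_chart[OF ch])
qed

text \<open>The angular derivative is taken on the Frechet side, where it is an operator on the
  values, and carried back by the exponential law.\<close>

lemma smooth_cyl_dcirc:
  assumes F: "smooth_cyl M W F" and W: "open W"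
  shows "smooth_cyl M W (\<lambda>m. dcirc (F m))"
proof -
  have "LC_smooth_on M W F" using F LC_smooth_on_iff_cyl[OF W] by blast
  then have "\<forall>(U, x)\<in>charts M. \<forall>k. LC_Ck_on k d (x ` (U \<inter> W)) ((\<lambda>m. dcirc (F m)) \<circ> inv_into U x)"
    using LC_Ck_on_dcirc unfolding LC_smooth_on_def by (fastforce simp: o_def)
  then show ?thesis using LC_smooth_on_iff_cyl[OF W] unfolding LC_smooth_on_def by blast
qed

lemma inj_on_circ_arc: "inj_on circ {a<..<a + 2 * pi}"
proof (rule inj_onI)
  fix s t assume st: "s \<in> {a<..<a + 2 * pi}" "t \<in> {a<..<a + 2 * pi}" "circ s = circ t"
  then obtain k :: int where k: "t = s + 2 * pi * of_int k" using circ_eq_iff by blast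
  have "\<bar>t - s\<bar> < 2 * pi" using st by auto
  then have "\<bar>of_int k\<bar> < (1::real)" using k pi_gt_zero by (simp add: abs_mult)
  then have "k = 0" by linarith
  then show "s = t" using k by simp
qed

text \<open>A product chart uses a branch of the angle on an open arc, so it sees the strip
  \<open>A x U a\<close> of the cylinder over a chart of \<open>M\<close>. These strips are
  relatively open and cover the cylinder, and smoothness is local.\<close>

lemma smooth_times_circle_iff:
  assumes W: "open W"
  shows "smooth_fun_on (times_circle M) (W \<times> UNIV) f \<longleftrightarrow> smooth_cyl M W (\<lambda>m z. f (m, z))"
proof -
  define J where "J a = {a<..<a + 2 * pi}" for a :: real
  define X where "X x a = (\<lambda>(m :: 'm, z). (x m)(d := the_inv_into (J a) circ z))" for x :: "'m \<Rightarrow> nat \<Rightarrow> real" and a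
  define A where "A x U a = {y \<in> cyl d (x ` (U \<inter> W)). y d \<in> J a}" for x :: "'m \<Rightarrow> nat \<Rightarrow> real" and U a
  have X_circ: "X x a (m, circ s) = (x m)(d := s)" if "s \<in> J a" for x a m s
    using that inj_on_circ_arc[of a] by (simp add: X_def J_def the_inv_into_f_f)
  have img: "X x a ` ((U \<times> circ ` J a) \<inter> (W \<times> UNIV)) = A x U a" if ch: "(U, x) \<in> charts M" for U x a
  proof (intro equalityI subsetI)
    fix y assume "y \<in> X x a ` ((U \<times> circ ` J a) \<inter> (W \<times> UNIV))"
    then obtain m s where ms: "m \<in> U" "m \<in> W" "s \<in> J a" "y = X x a (m, circ s)" by blast
    have y: "y = (x m)(d := s)" using X_circ ms by simp
    then have "y(d := 0) = x m" using chart_upd(2)[OF ch ms(1)] by simp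
    then have "y(d := 0) \<in> x ` (U \<inter> W)" using ms by blast
    moreover have "y d = s" by (simp add: y)
    ultimately show "y \<in> A x U a" using ms(3) by (simp add: A_def cyl_def)
  next
    fix y assume "y \<in> A x U a"
    then obtain m where m: "m \<in> U" "m \<in> W" "y(d := 0) = x m" "y d \<in> J a" by (auto simp: A_def cyl_def)
    have "y = (y(d := 0))(d := y d)" by simp
    then have "y = X x a (m, circ (y d))" using X_circ[OF m(4)] m(3) by simp
    then show "y \<in> X x a ` ((U \<times> circ ` J a) \<inter> (W \<times> UNIV))" using m by blast
  qed
  have inv: "inv_into (U \<times> circ ` J a) (X x a) y = (inv_into U x (y(d := 0)), circ (y d))"
    if ch: "(U, x) \<in> charts M" and y: "y \<in> A x U a" for U x a y
  proof -
    obtain m where m: "m \<in> U" "m \<in> W" "y(d := 0) = x m" "y d \<in> J a" using y by (auto simp: A_def cyl_def)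
    have "y = (y(d := 0))(d := y d)" by simp
    then have yX: "y = X x a (m, circ (y d))" using X_circ[OF m(4)] m(3) by simp
    have "inj_on (X x a) (U \<times> circ ` J a)"
    proof (rule inj_onI)
      fix p q assume pq: "p \<in> U \<times> circ ` J a" "q \<in> U \<times> circ ` J a" "X x a p = X x a q"
      obtain m1 s1 where 1: "p = (m1, circ s1)" "m1 \<in> U" "s1 \<in> J a" using pq(1) by blast
      obtain m2 s2 where 2: "q = (m2, circ s2)" "m2 \<in> U" "s2 \<in> J a" using pq(2) by blast
      have eq: "(x m1)(d := s1) = (x m2)(d := s2)" using pq(3) X_circ 1 2 by simp
      then have "s1 = s2" by (metis fun_upd_same)
      moreover have "x m1 = x m2"
        using arg_cong[OF eq, of "\<lambda>y. y(d := 0)"] chart_upd(2)[OF ch 1(2)] chart_upd(2)[OF ch 2(2)] by simp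
      then have "m1 = m2" using inv_chart[OF ch] 1(2) 2(2) by metis
      ultimately show "p = q" using 1 2 by simp
    qed
    then have "inv_into (U \<times> circ ` J a) (X x a) y = (m, circ (y d))"
      using m by (subst yX) (intro inv_into_f_f, auto)
    then show ?thesis using inv_chart[OF ch m(1)] m(3) by simp
  qed
  have charts: "charts (times_circle M) = {(U \<times> circ ` J a, X x a) | U x a. (U, x) \<in> charts M}"
    by (simp add: times_circle_def J_def X_def)
  have key: "smooth_fun_on (times_circle M) (W \<times> UNIV) f \<longleftrightarrow>
     (\<forall>(U, x)\<in>charts M. \<forall>a. Cinf_on (Suc d) (A x U a) (f \<circ> inv_into (U \<times> circ ` J a) (X x a)))"
  proof -
    have dim: "mdim (times_circle M) = Suc d" by (simp add: times_circle_def)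
    have reindex: "(\<forall>(V, Y)\<in>charts (times_circle M). P V Y) \<longleftrightarrow>
        (\<forall>(U, x)\<in>charts M. \<forall>a. P (U \<times> circ ` J a) (X x a))" for P
      unfolding charts by blast
    show ?thesis
      unfolding smooth_fun_on_def dim reindex
    proof (rule ball_cong[OF refl], unfold split_beta)
      fix p assume "p \<in> charts M"
      then have "(fst p, snd p) \<in> charts M" by simp
      note img[OF this]
      then show "(\<forall>a. Cinf_on (Suc d) (X (snd p) a ` (fst p \<times> circ ` J a \<inter> W \<times> UNIV))
          (f \<circ> inv_into (fst p \<times> circ ` J a) (X (snd p) a))) =
        (\<forall>a. Cinf_on (Suc d) (A (snd p) (fst p) a) (f \<circ> inv_into (fst p \<times> circ ` J a) (X (snd p) a)))"
        by (simp only:)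
    qed
  qed
  have cong: "Cinf_on (Suc d) (A x U a) (f \<circ> inv_into (U \<times> circ ` J a) (X x a)) \<longleftrightarrow>
      Cinf_on (Suc d) (A x U a) (\<lambda>y. f (inv_into U x (y(d := 0)), circ (y d)))" if ch: "(U, x) \<in> charts M" for U x a
  proof -
    have eq: "(f \<circ> inv_into (U \<times> circ ` J a) (X x a)) y = f (inv_into U x (y(d := 0)), circ (y d))" if "y \<in> A x U a" for y
      using inv[OF ch that] by (simp only: o_apply)
    show ?thesis
    proof
      show "Cinf_on (Suc d) (A x U a) (f \<circ> inv_into (U \<times> circ ` J a) (X x a)) \<Longrightarrow>
        Cinf_on (Suc d) (A x U a) (\<lambda>y. f (inv_into U x (y(d := 0)), circ (y d)))"
        by (erule Cinf_on_cong) (rule eq)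
      show "Cinf_on (Suc d) (A x U a) (\<lambda>y. f (inv_into U x (y(d := 0)), circ (y d))) \<Longrightarrow>
        Cinf_on (Suc d) (A x U a) (f \<circ> inv_into (U \<times> circ ` J a) (X x a))"
        by (erule Cinf_on_cong) (rule eq[symmetric])
    qed
  qed
  show ?thesis
  proof
    assume L: "smooth_fun_on (times_circle M) (W \<times> UNIV) f"
    show "smooth_cyl M W (\<lambda>m z. f (m, z))"
    proof (rule smooth_cylI)
      fix U x assume ch: "(U, x) \<in> charts M"
      obtain C where C: "corner_open d C (x ` U)" using chart_corner[OF ch] .
      note S = corner_open_cyl[OF chart_corner_open[OF ch C W]]
      show "Cinf_on (Suc d) (cyl d (x ` (U \<inter> W))) (\<lambda>y. f (inv_into U x (y(d := 0)), circ (y d)))"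
      proof (rule Cinf_on_local[OF S])
        fix y assume y: "y \<in> cyl d (x ` (U \<inter> W))"
        \<comment> \<open>The arc is centred at the angle of \<open>y\<close>, which puts
          \<open>y\<close> inside its strip.\<close>
        let ?a = "y d - pi"
        have "y \<in> A x U ?a" using y pi_gt_zero by (simp add: A_def J_def)
        moreover have "corner_open (Suc d) C (A x U ?a)"
        proof -
          obtain V where V: "open V" "cyl d (x ` (U \<inter> W)) = corner_model (Suc d) C \<inter> V" using corner_open_obtain[OF S] .
          have "open (V \<inter> (\<lambda>y. y d) -` J ?a)"
            unfolding J_def by (intro open_Int V(1) open_vimage continuous_on_product_coordinates open_greaterThanLessThan)
          moreover have "A x U ?a = corner_model (Suc d) C \<inter> (V \<inter> (\<lambda>y. y d) -` J ?a)"
            using V(2) by (auto simp: A_def)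
          ultimately show ?thesis using S unfolding corner_open_def openin_open by blast
        qed
        moreover have "Cinf_on (Suc d) (A x U ?a) (\<lambda>y. f (inv_into U x (y(d := 0)), circ (y d)))"
          using L ch unfolding key cong[OF ch, symmetric] by blast
        ultimately show "\<exists>S'. y \<in> S' \<and> corner_open (Suc d) C S' \<and>
            Cinf_on (Suc d) S' (\<lambda>y. f (inv_into U x (y(d := 0)), circ (y d)))"
          by (intro exI[of _ "A x U ?a"] conjI)
      qed
    qed
  next
    assume R: "smooth_cyl M W (\<lambda>m z. f (m, z))"
    have "Cinf_on (Suc d) (A x U a) (f \<circ> inv_into (U \<times> circ ` J a) (X x a))" if ch: "(U, x) \<in> charts M" for U x a
      unfolding cong[OF ch] by (rule Cinf_on_subset[OF smooth_cylD[OF R ch]]) (auto simp: A_def)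
    then show "smooth_fun_on (times_circle M) (W \<times> UNIV) f" unfolding key by blast
  qed
qed

lemma smooth_times_circle_iff_UNIV: "smooth_fun (times_circle M) f \<longleftrightarrow> smooth_cyl M UNIV (\<lambda>m z. f (m, z))"
  using smooth_times_circle_iff[of UNIV f] by simp

text \<open>Read in another chart, the function is \<open>K\<close> composed with a transition map;
  this is where the composition result is used.\<close>

lemma smooth_fun_chart:
  fixes K :: "(nat \<Rightarrow> real) \<Rightarrow> real"
  assumes ch: "(U, x) \<in> charts M" and S: "corner_open d C S" "S \<subseteq> x ` U" and K: "Cinf_on d S K"
  shows "smooth_fun_on M (U \<inter> x -` S) (\<lambda>q. K (x q))"
proof -
  have "Cinf_on d (y ` (V \<inter> (U \<inter> x -` S))) ((\<lambda>q. K (x q)) \<circ> inv_into V y)" if ch': "(V, y) \<in> charts M" for V y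
  proof -
    have "Cinf_on d (y ` (V \<inter> (U \<inter> x -` S))) (\<lambda>a. K (x (inv_into V y a)))"
    proof (rule Cinf_on_compose[OF S(1) _ _ K])
      fix a assume "a \<in> y ` (V \<inter> (U \<inter> x -` S))"
      then have "inv_into V y a \<in> V \<inter> (U \<inter> x -` S)" by (rule inv_chart_mem[OF ch'])
      then show "x (inv_into V y a) \<in> S" by blast
    next
      fix j assume "j < d"
      show "Cinf_on d (y ` (V \<inter> (U \<inter> x -` S))) (\<lambda>a. x (inv_into V y a) j)"
        by (rule Cinf_on_subset[OF chart_transition[OF ch' ch \<open>j < d\<close>]]) auto
    qed
    then show ?thesis by (simp add: o_def)
  qed
  then show ?thesis by (auto simp: smooth_fun_on_def)
qed

lemma smooth_fun_on_local:
  assumes "\<And>m. m \<in> W \<Longrightarrow> \<exists>W'. open W' \<and> m \<in> W' \<and> smooth_fun_on M W' f" and W: "open W"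
  shows "smooth_fun_on M W f"
  using assms unfolding smooth_fun_on_iff_cyl by (rule smooth_cyl_local)

text \<open>The open sets \<open>W\<close> and \<open>- K\<close> cover the manifold: on the first
  the extension is a product of smooth families, on the second it is zero.\<close>

lemma smooth_cyl_extend:
  assumes b: "smooth_fun M b" "closed K" "K \<subseteq> W" "\<And>q. q \<notin> K \<Longrightarrow> b q = 0" and W: "open W" and F: "smooth_cyl M W F"
  shows "smooth_cyl M UNIV (\<lambda>q z. if q \<in> W then b q *\<^sub>R F q z else 0)"
proof (rule smooth_cyl_local[OF _ open_UNIV])
  fix q
  let ?G = "\<lambda>q z. if q \<in> W then b q *\<^sub>R F q z else 0"
  show "\<exists>W'. open W' \<and> q \<in> W' \<and> smooth_cyl M W' ?G"
  proof (cases "q \<in> W")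
    case True
    have "smooth_cyl M W (\<lambda>q z. b q *\<^sub>R F q z)"
      using b(1) unfolding smooth_fun_on_iff_cyl
      by (intro smooth_cyl_scaleR F) (erule smooth_cyl_subset, simp)
    then have "smooth_cyl M W ?G" by (rule smooth_cyl_cong) simp
    then show ?thesis using True W by blast
  next
    case False
    have "smooth_cyl M (- K) (\<lambda>q z. 0)" by (rule smooth_cyl_const)
    then have "smooth_cyl M (- K) ?G" by (rule smooth_cyl_cong) (use b(4) in auto)
    moreover have "q \<in> - K" using False b(3) by blast
    ultimately show ?thesis using b(2) by blast
  qed
qed

lemma smooth_fun_extend:
  assumes b: "smooth_fun M b" "closed K" "K \<subseteq> W" "\<And>q. q \<notin> K \<Longrightarrow> b q = 0" and W: "open W" and F: "smooth_fun_on M W g"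
  shows "smooth_fun M (\<lambda>q. if q \<in> W then b q *\<^sub>R g q else 0)"
  using smooth_cyl_extend[OF b W F[unfolded smooth_fun_on_iff_cyl]] unfolding smooth_fun_on_iff_cyl .

text \<open>A product of flat functions of the coordinates, nonzero exactly inside a small box
  around \<open>x m\<close>, extended by zero and normalised at \<open>m\<close>.\<close>

lemma bump:
  assumes ch: "(U, x) \<in> charts M" "m \<in> U" and O: "open W" "m \<in> W"
  obtains b :: "'m \<Rightarrow> real" and K where "smooth_fun M b" "b m = 1" "closed K" "K \<subseteq> U \<inter> W" "\<And>q. q \<notin> K \<Longrightarrow> b q = 0"
proof -
  obtain C where C: "corner_open d C (x ` U)" using chart_corner[OF ch(1)] .
  have S: "corner_open d C (x ` (U \<inter> W))" by (rule chart_corner_open[OF ch(1) C O(1)])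
  let ?c = "x m"
  have cS: "?c \<in> x ` (U \<inter> W)" using ch O by blast
  obtain e where e: "e > 0" "corner_box d C ?c e \<subseteq> x ` (U \<inter> W)" using corner_box_subset[OF S cS] by blast
  \<comment> \<open>Half of the available radius, so that the closed box \<open>Kb\<close> still
    lies in the image of the chart.\<close>
  define r where "r = e / 2"
  have r: "0 < r" "r < e" using e(1) by (auto simp: r_def)
  define Kb where "Kb = {a \<in> corner_model d C. \<forall>i<d. \<bar>a i - ?c i\<bar> \<le> r}"
  define K where "K = inv_into U x ` Kb"
  \<comment> \<open>These intervals present \<open>Kb\<close> as a product of compact sets; the
    factors from index \<open>d\<close> on are single points, which makes the infinite product
    describe the model.\<close>
  define I where "I i = (if i < d then (if i \<in> C then {max 0 (?c i - r)..?c i + r} else {?c i - r..?c i + r}) else {0})" for i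
  have "Kb = Pi\<^sub>E UNIV I"
  proof (intro equalityI subsetI)
    fix a assume a: "a \<in> Kb"
    have "a i \<in> I i" for i
      using a unfolding Kb_def I_def corner_model_def by (auto simp: abs_le_iff)
    then show "a \<in> Pi\<^sub>E UNIV I" by auto
  next
    fix a assume "a \<in> Pi\<^sub>E UNIV I"
    then have a: "a i \<in> I i" for i by auto
    have "C \<subseteq> {..<d}" using C by (simp add: corner_open_def)
    then have "0 \<le> a i" if "i \<in> C" for i using a[of i] that by (auto simp: I_def)
    moreover have "a i = 0" if "i \<ge> d" for i using a[of i] that by (simp add: I_def)
    moreover have "\<bar>a i - ?c i\<bar> \<le> r" if "i < d" for i
      using a[of i] that by (auto simp: I_def abs_le_iff split: if_splits)
    ultimately show "a \<in> Kb" by (simp add: Kb_def corner_model_def)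
  qed
  moreover have "compactin (product_topology (\<lambda>i. euclidean) UNIV) (Pi\<^sub>E UNIV I)"
    unfolding compactin_PiE by (auto simp: I_def)
  ultimately have "compact Kb" by (simp add: euclidean_product_topology)
  have KbS: "Kb \<subseteq> x ` (U \<inter> W)"
    using e(2) r(2) by (force simp: Kb_def corner_box_def)
  then have "continuous_on Kb (inv_into U x)"
    using chart_homeo[OF ch(1)] by (auto simp: homeomorphism_def intro: continuous_on_subset)
  \<comment> \<open>Closedness in the whole manifold comes from compactness in a Hausdorff space. It
    is what makes the extension by zero smooth at points outside the chart domain.\<close>
  then have "closed K" unfolding K_def using \<open>compact Kb\<close> by (intro compact_imp_closed compact_continuous_image)
  have KU: "K \<subseteq> U \<inter> W" unfolding K_def using KbS inv_chart_mem[OF ch(1)] by blast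
  define b where "b q = (if q \<in> U then \<Prod>i<d. flat 0 (r\<^sup>2 - (x q i - ?c i)\<^sup>2) else 0)" for q
  have b0: "b q = 0" if "q \<notin> K" for q
  proof (rule ccontr)
    assume nz: "b q \<noteq> 0"
    then have q: "q \<in> U" by (auto simp: b_def split: if_splits)
    have "\<bar>x q i - ?c i\<bar> \<le> r" if "i < d" for i
    proof -
      have "flat 0 (r\<^sup>2 - (x q i - ?c i)\<^sup>2) \<noteq> 0" using nz q that by (simp add: b_def)
      then have "(x q i - ?c i)\<^sup>2 \<le> r\<^sup>2" by (simp add: flat_0_pos)
      then show ?thesis using r(1) abs_le_square_iff[of "x q i - ?c i" r] by simp
    qed
    moreover have "x q \<in> corner_model d C" using q corner_open_subset[OF C] by blast
    ultimately have "x q \<in> Kb" by (simp add: Kb_def)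
    then have "q \<in> K" unfolding K_def using inv_chart[OF ch(1) q] by (metis imageI)
    then show False using that by blast
  qed
  have "smooth_fun M b"
  proof (rule smooth_fun_on_local[OF _ open_UNIV])
    fix q
    show "\<exists>W'. open W' \<and> q \<in> W' \<and> smooth_fun_on M W' b"
    proof (cases "q \<in> U")
      case True
      have "Cinf_on d (x ` U) (\<lambda>a. \<Prod>i<d. flat 0 (r\<^sup>2 - (a i - ?c i) * (a i - ?c i)))"
        by (intro Cinf_on_prod Cinf_on_flat Cinf_on_diff Cinf_on_mult Cinf_on_const Cinf_on_coord)
      from smooth_fun_chart[OF ch(1) C subset_refl this]
      have "smooth_fun_on M U (\<lambda>q. \<Prod>i<d. flat 0 (r\<^sup>2 - (x q i - ?c i) * (x q i - ?c i)))"
        by (simp add: vimage_def Int_absorb2 subset_eq)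
      then have "smooth_fun_on M U b"
        unfolding smooth_fun_on_iff_cyl by (rule smooth_cyl_cong) (simp add: b_def power2_eq_square)
      then show ?thesis using True chart_open[OF ch(1)] by blast
    next
      case False
      have "smooth_fun_on M (- K) b"
        unfolding smooth_fun_on_iff_cyl by (rule smooth_cyl_cong[OF smooth_cyl_const[of _ _ 0]]) (simp add: b0)
      moreover have "q \<in> - K" using False KU by blast
      ultimately show ?thesis using \<open>closed K\<close> by blast
    qed
  qed
  then have "smooth_fun M (\<lambda>q. inverse (b m) * b q)"
    unfolding smooth_fun_on_iff_cyl by (intro smooth_cyl_mult smooth_cyl_const)
  moreover have "b m \<noteq> 0"
    using ch(2) r(1) by (simp add: b_def flat_0_pos)
  ultimately show ?thesis
    using that[of "\<lambda>q. inverse (b m) * b q" K] \<open>closed K\<close> KU b0 by simp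
qed

end

section \<open>Tangent vectors\<close>

lemma sum_LC:
  fixes g :: "nat \<Rightarrow> circle \<Rightarrow> complex"
  assumes "\<And>i. i < n \<Longrightarrow> g i \<in> carrier LC"
  shows "(\<lambda>z. \<Sum>i<n. a i * g i z) \<in> carrier LC \<and> dcirc (\<lambda>z. \<Sum>i<n. a i * g i z) = (\<lambda>z. \<Sum>i<n. a i * dcirc (g i) z)"
  using assms
proof (induction n)
  case 0
  have z: "dcirc (\<lambda>z. 0) = (\<lambda>z. 0)"
    by (rule ext) (simp add: dcirc_def o_def)
  have "(dcirc ^^ k) (\<lambda>z. 0) = (\<lambda>z. 0)" for k
    by (induction k) (simp_all add: z)
  then have "(\<lambda>z. 0) \<in> carrier LC" by (simp add: LC_def o_def)
  then show ?case by (simp add: z)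
next
  case (Suc n)
  let ?s = "\<lambda>z. \<Sum>i<n. a i * g i z"
  have IH: "?s \<in> carrier LC" "dcirc ?s = (\<lambda>z. \<Sum>i<n. a i * dcirc (g i) z)" using Suc by auto
  have g: "g n \<in> carrier LC" using Suc.prems by simp
  show ?case
    using LC_lin[OF IH(1) g, of 1 "a n"] dcirc_funpow_lin[OF IH(1) g, of 1 1 "a n"] IH(2) by simp
qed

context corners
begin

lemma tangent_add: "X \<in> tangent_space M m \<Longrightarrow> smooth_fun M f \<Longrightarrow> smooth_fun M g \<Longrightarrow> X (\<lambda>q. f q + g q) = X f + X g"
  by (simp add: tangent_space_def)

lemma tangent_scale: "X \<in> tangent_space M m \<Longrightarrow> smooth_fun M f \<Longrightarrow> X (\<lambda>q. c * f q) = c * X f"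
  by (simp add: tangent_space_def)

lemma tangent_mult: "X \<in> tangent_space M m \<Longrightarrow> smooth_fun M f \<Longrightarrow> smooth_fun M g \<Longrightarrow>
    X (\<lambda>q. f q * g q) = f m * X g + g m * X f"
  by (simp add: tangent_space_def)

lemma smooth_fun_const: "smooth_fun_on M W (\<lambda>q. c)"
  unfolding smooth_fun_on_iff_cyl by (rule smooth_cyl_const)

lemma smooth_fun_add: "smooth_fun_on M W f \<Longrightarrow> smooth_fun_on M W g \<Longrightarrow> smooth_fun_on M W (\<lambda>q. f q + g q)"
  unfolding smooth_fun_on_iff_cyl by (rule smooth_cyl_add)

lemma smooth_fun_diff: "smooth_fun_on M W f \<Longrightarrow> smooth_fun_on M W g \<Longrightarrow> smooth_fun_on M W (\<lambda>q. f q - g q)"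
  unfolding smooth_fun_on_iff_cyl by (rule smooth_cyl_diff)

lemma smooth_fun_mult:
  fixes f g :: "'m \<Rightarrow> 'b::real_normed_algebra"
  shows "smooth_fun_on M W f \<Longrightarrow> smooth_fun_on M W g \<Longrightarrow> smooth_fun_on M W (\<lambda>q. f q * g q)"
  unfolding smooth_fun_on_iff_cyl by (rule smooth_cyl_mult)

lemma smooth_fun_sum: "(\<And>a. a \<in> A \<Longrightarrow> smooth_fun_on M W (f a)) \<Longrightarrow> smooth_fun_on M W (\<lambda>q. \<Sum>a\<in>A. f a q)"
  unfolding smooth_fun_on_iff_cyl by (rule smooth_cyl_sum)

lemma smooth_fun_Re: "smooth_fun_on M W f \<Longrightarrow> smooth_fun_on M W (\<lambda>q. Re (f q))"
  and smooth_fun_Im: "smooth_fun_on M W f \<Longrightarrow> smooth_fun_on M W (\<lambda>q. Im (f q))"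
  unfolding smooth_fun_on_iff_cyl
  by (rule smooth_cyl_bounded_linear[OF bounded_linear_Re], assumption,
      rule smooth_cyl_bounded_linear[OF bounded_linear_Im], assumption)

lemma tangent_const:
  assumes X: "X \<in> tangent_space M m"
  shows "X (\<lambda>q. c) = 0"
proof -
  have "X (\<lambda>q. 1 * 1) = 1 * X (\<lambda>q. 1) + 1 * X (\<lambda>q. 1)"
    by (rule tangent_mult[OF X smooth_fun_const smooth_fun_const])
  then have "X (\<lambda>q. 1) = 0" by simp
  moreover have "X (\<lambda>q. c * 1) = c * X (\<lambda>q. 1)" by (rule tangent_scale[OF X smooth_fun_const])
  ultimately show ?thesis by simp
qed

lemma tangent_sum:
  assumes X: "X \<in> tangent_space M m" and A: "finite A"
  shows "(\<And>a. a \<in> A \<Longrightarrow> smooth_fun M (f a)) \<Longrightarrow> X (\<lambda>q. \<Sum>a\<in>A. f a q) = (\<Sum>a\<in>A. X (f a))"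
  using A
proof (induction A rule: finite_induct)
  case empty
  then show ?case using tangent_const[OF X] by simp
next
  case (insert a A)
  have "X (\<lambda>q. f a q + (\<Sum>a\<in>A. f a q)) = X (f a) + X (\<lambda>q. \<Sum>a\<in>A. f a q)"
    using insert.prems by (intro tangent_add[OF X] smooth_fun_sum) auto
  then show ?case using insert by simp
qed

lemma chart_smooth_fun:
  assumes "smooth_fun M u" "(U, x) \<in> charts M"
  shows "Cinf_on d (x ` U) (\<lambda>a. u (inv_into U x a))"
  using assms by (auto simp: smooth_fun_on_def o_def)

text \<open>Derivations act on global functions only. Hadamard's expansion of \<open>u\<close> in
  the chart, multiplied by the square of a bump function, becomes an identity between smooth
  functions on \<open>M\<close>, to which the Leibniz rule applies.\<close>

lemma tangent_chart:
  assumes ch: "(U, x) \<in> charts M" "m \<in> U" and C: "corner_open d C (x ` U)" and X: "X \<in> tangent_space M m"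
  obtains \<xi> where "\<And>u. smooth_fun M u \<Longrightarrow> X u = (\<Sum>i<d. \<xi> i * pd C i (\<lambda>a. u (inv_into U x a)) (x m))"
proof -
  let ?c = "x m"
  have C': "C \<subseteq> {..<d}" using C by (simp add: corner_open_def)
  have cU: "?c \<in> x ` U" using ch by blast
  then have cm: "?c \<in> corner_model d C" using corner_open_subset[OF C] by blast
  obtain e where e: "e > 0" "corner_box d C ?c e \<subseteq> x ` U" using corner_box_subset[OF C cU] by blast
  let ?B = "corner_box d C ?c e"
  have B: "corner_open d C ?B" by (rule corner_open_box[OF C'])
  have cB: "?c \<in> ?B" using cm e(1) by (simp add: corner_box_def)
  define W where "W = U \<inter> x -` ?B"
  have W: "open W" unfolding W_def by (rule chart_vimage_open[OF ch(1) C B e(2)])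
  have mW: "m \<in> W" using ch(2) cB by (simp add: W_def)
  obtain b :: "'m \<Rightarrow> real" and K0 where b: "smooth_fun M b" "b m = 1" "closed K0" "K0 \<subseteq> U \<inter> W" "\<And>q. q \<notin> K0 \<Longrightarrow> b q = 0"
    by (rule bump[OF ch W mW]) (rule that)
  have KW: "K0 \<subseteq> W" using b(4) by blast
  define ext where "ext g q = (if q \<in> W then b q *\<^sub>R g (x q) else 0)" for g :: "(nat \<Rightarrow> real) \<Rightarrow> real" and q
  have ext_smooth: "smooth_fun M (ext g)" if "Cinf_on d ?B g" for g
    unfolding ext_def
  proof (rule smooth_fun_extend[OF b(1,3) KW _ W])
    show "smooth_fun_on M W (\<lambda>q. g (x q))"
      unfolding W_def by (rule smooth_fun_chart[OF ch(1) B e(2) that])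
  qed (rule b(5))
  define \<xi> where "\<xi> i = X (ext (\<lambda>a. a i - ?c i))" for i
  have "X u = (\<Sum>i<d. \<xi> i * pd C i (\<lambda>a. u (inv_into U x a)) ?c)" if u: "smooth_fun M u" for u
  proof -
    let ?u = "\<lambda>a. u (inv_into U x a)"
    obtain H where H: "\<And>i. i < d \<Longrightarrow> Cinf_on d ?B (H i)" "\<And>i. i < d \<Longrightarrow> H i ?c = pd C i ?u ?c"
      "\<And>a. a \<in> ?B \<Longrightarrow> ?u a = ?u ?c + (\<Sum>i<d. (a i - ?c i) * H i a)"
      using Hadamard[OF C' cm e(1) Cinf_on_subset[OF chart_smooth_fun[OF u ch(1)] e(2)]] by blast
    let ?E = "\<lambda>i. ext (\<lambda>a. a i - ?c i)"
    have E: "smooth_fun M (?E i)" for i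
      by (intro ext_smooth Cinf_on_diff Cinf_on_coord Cinf_on_const)
    have EH: "smooth_fun M (ext (H i))" if "i < d" for i by (rule ext_smooth[OF H(1)[OF that]])
    have bb: "smooth_fun M (\<lambda>q. b q * b q)" by (intro smooth_fun_mult b(1))
    \<comment> \<open>The square of \<open>b\<close> appears because both factors of each product,
      the coordinate increment and the Hadamard coefficient, have to be cut off.\<close>
    have id: "b q * b q * u q = u m * (b q * b q) + (\<Sum>i<d. ?E i q * ext (H i) q)" for q
    proof (cases "q \<in> W")
      case True
      then have q: "q \<in> U" "x q \<in> ?B" by (auto simp: W_def)
      have "u q = u m + (\<Sum>i<d. (x q i - ?c i) * H i (x q))"
        using H(3)[OF q(2)] by (simp add: inv_chart[OF ch(1) q(1)] inv_chart[OF ch])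
      then have "b q * b q * u q = u m * (b q * b q) + (\<Sum>i<d. b q * b q * ((x q i - ?c i) * H i (x q)))"
        by (simp add: algebra_simps sum_distrib_left)
      also have "(\<Sum>i<d. b q * b q * ((x q i - ?c i) * H i (x q))) = (\<Sum>i<d. ?E i q * ext (H i) q)"
        using True by (intro sum.cong) (simp_all add: ext_def)
      finally show ?thesis .
    next
      case False
      then have "b q = 0" using b(5) KW by blast
      then show ?thesis using False by (simp add: ext_def)
    qed
    have "X (\<lambda>q. b q * b q * u q) = b m * b m * X u + u m * X (\<lambda>q. b q * b q)"
      by (rule tangent_mult[OF X bb u])
    moreover have "X (\<lambda>q. b q * b q * u q) = u m * X (\<lambda>q. b q * b q) + (\<Sum>i<d. X (\<lambda>q. ?E i q * ext (H i) q))"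
    proof -
      have "X (\<lambda>q. u m * (b q * b q) + (\<Sum>i<d. ?E i q * ext (H i) q)) =
          X (\<lambda>q. u m * (b q * b q)) + X (\<lambda>q. \<Sum>i<d. ?E i q * ext (H i) q)"
        using E EH by (intro tangent_add[OF X] smooth_fun_sum smooth_fun_mult smooth_fun_const b(1)) auto
      also have "X (\<lambda>q. u m * (b q * b q)) = u m * X (\<lambda>q. b q * b q)" by (rule tangent_scale[OF X bb])
      also have "X (\<lambda>q. \<Sum>i<d. ?E i q * ext (H i) q) = (\<Sum>i<d. X (\<lambda>q. ?E i q * ext (H i) q))"
        using E EH by (intro tangent_sum[OF X] smooth_fun_mult) auto
      finally show ?thesis by (simp only: id)
    qed
    ultimately have "X u = (\<Sum>i<d. X (\<lambda>q. ?E i q * ext (H i) q))" using b(2) by simp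
    also have "\<dots> = (\<Sum>i<d. \<xi> i * pd C i ?u ?c)"
    proof (rule sum.cong[OF refl])
      fix i assume "i \<in> {..<d}"
      then have i: "i < d" by simp
      have "X (\<lambda>q. ?E i q * ext (H i) q) = ?E i m * X (ext (H i)) + ext (H i) m * X (?E i)"
        by (rule tangent_mult[OF X E EH[OF i]])
      \<comment> \<open>The increment vanishes at \<open>m\<close>; of the two Leibniz terms only
        the one with the value of the coefficient survives, and this value is a partial derivative
        of \<open>u\<close>.\<close>
      also have "?E i m = 0" using mW by (simp add: ext_def)
      also have "ext (H i) m = pd C i ?u ?c" using mW b(2) H(2)[OF i] by (simp add: ext_def)
      finally show "X (\<lambda>q. ?E i q * ext (H i) q) = \<xi> i * pd C i ?u ?c" by (simp add: \<xi>_def)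
    qed
    finally show ?thesis .
  qed
  then show ?thesis by (rule that)
qed

lemma cderiv_chart:
  assumes ch: "(U, x) \<in> charts M" "m \<in> U" and C: "corner_open d C (x ` U)"
    and \<xi>: "\<And>u. smooth_fun M u \<Longrightarrow> X u = (\<Sum>i<d. \<xi> i * pd C i (\<lambda>a. u (inv_into U x a)) (x m))"
    and f: "smooth_fun M f"
  shows "cderiv X f = (\<Sum>i<d. of_real (\<xi> i) * pd C i (\<lambda>a. f (inv_into U x a)) (x m))"
proof -
  have c: "x m \<in> x ` U" using ch by blast
  note f' = chart_smooth_fun[OF f ch(1)]
  have "X (\<lambda>q. Re (f q)) = (\<Sum>i<d. \<xi> i * Re (pd C i (\<lambda>a. f (inv_into U x a)) (x m)))"
    unfolding \<xi>[OF smooth_fun_Re[OF f]]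
    by (intro sum.cong refl) (simp add: pd_bounded_linear[OF bounded_linear_Re C f' _ c])
  moreover have "X (\<lambda>q. Im (f q)) = (\<Sum>i<d. \<xi> i * Im (pd C i (\<lambda>a. f (inv_into U x a)) (x m)))"
    unfolding \<xi>[OF smooth_fun_Im[OF f]]
    by (intro sum.cong refl) (simp add: pd_bounded_linear[OF bounded_linear_Im C f' _ c])
  ultimately show ?thesis by (simp add: cderiv_def complex_eq_iff)
qed

text \<open>At a fixed point the derivation is a constant combination of coordinate derivatives.
  Each of these produces a loop and commutes with the angular derivative; the second part is what
  makes \<triangle>\<phi> linear over functions on the product.\<close>

lemma cderiv_family:
  assumes F: "smooth_cyl M UNIV F" and X: "X \<in> tangent_space M m"
  shows "(\<lambda>z. cderiv X (\<lambda>q. F q z)) \<in> carrier LC"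
    and "dcirc (\<lambda>z. cderiv X (\<lambda>q. F q z)) = (\<lambda>z. cderiv X (\<lambda>q. dcirc (F q) z))"
proof -
  obtain U x where ch: "(U, x) \<in> charts M" "m \<in> U" using chart_cover .
  obtain C where C: "corner_open d C (x ` U)" using chart_corner[OF ch(1)] .
  obtain \<xi> where \<xi>: "\<And>u. smooth_fun M u \<Longrightarrow> X u = (\<Sum>i<d. \<xi> i * pd C i (\<lambda>a. u (inv_into U x a)) (x m))"
    by (rule tangent_chart[OF ch C X]) (rule that)
  let ?S = "x ` U" and ?c = "x m"
  have c: "?c \<in> ?S" using ch by blast
  define f where "f = (\<lambda>a. F (inv_into U x a))"
  define f' where "f' = (\<lambda>a. dcirc (f a))"
  have f: "Cinf_on (Suc d) (cyl d ?S) (unroll d f)"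
    using smooth_cylD[OF F ch(1)] by (simp add: unroll_def f_def)
  have f': "Cinf_on (Suc d) (cyl d ?S) (unroll d f')"
    using smooth_cylD[OF smooth_cyl_dcirc[OF F open_UNIV] ch(1)] by (simp add: unroll_def f'_def f_def)
  define g where "g i = (\<lambda>a z. pd C i (\<lambda>a. f a z) a)" for i
  note S' = corner_open_cyl[OF C]
  have g: "unroll d (g i) = pd C i (unroll d f)" if "i < d" for i
    unfolding g_def by (rule unroll_pd) (use that in simp)
  have gS: "Cinf_on (Suc d) (cyl d ?S) (unroll d (g i))" if "i < d" for i
    unfolding g[OF that] using that by (intro Cinf_on_pd[OF S' f]) simp
  have g_LC: "g i ?c \<in> carrier LC" if "i < d" for i
    by (rule unroll_LC_carrier[OF C gS[OF that] c])
  have Z: "(\<lambda>z. cderiv X (\<lambda>q. F q z)) = (\<lambda>z. \<Sum>i<d. of_real (\<xi> i) * g i ?c z)"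
  proof
    fix z
    show "cderiv X (\<lambda>q. F q z) = (\<Sum>i<d. of_real (\<xi> i) * g i ?c z)"
      unfolding g_def f_def by (rule cderiv_chart[OF ch C \<xi> smooth_cyl_slice[OF F]])
  qed
  have Z': "(\<lambda>z. cderiv X (\<lambda>q. dcirc (F q) z)) = (\<lambda>z. \<Sum>i<d. of_real (\<xi> i) * pd C i (\<lambda>a. f' a z) ?c)"
  proof
    fix z
    show "cderiv X (\<lambda>q. dcirc (F q) z) = (\<Sum>i<d. of_real (\<xi> i) * pd C i (\<lambda>a. f' a z) ?c)"
      unfolding f'_def f_def by (rule cderiv_chart[OF ch C \<xi> smooth_cyl_slice[OF smooth_cyl_dcirc[OF F open_UNIV]]])
  qed
  have dg: "dcirc (g i ?c) z = pd C i (\<lambda>a. f' a z) ?c" if i: "i < d" for i z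
  proof -
    obtain t where t: "z = circ t" by (metis circ_rep)
    have sub: "?S \<subseteq> corner_model d C" by (rule corner_open_subset[OF C])
    have ct: "?c(d := t) \<in> cyl d ?S" by (rule mem_cylI[OF sub c])
    have i': "i \<noteq> d" "i < Suc d" using i by auto
    have "dcirc (g i ?c) (circ t) = (pd C d ^^ 1) (unroll d (g i)) (?c(d := t))"
      using unroll_dcirc_funpow(1)[OF C gS[OF i] c, of 1 t] by (simp only: funpow.simps One_nat_def o_apply id_apply)
    also have "\<dots> = pd C i ((pd C d ^^ 1) (unroll d f)) (?c(d := t))"
      unfolding g[OF i] by (rule pd_funpow_commute[OF C f i ct])
    also have "\<dots> = pd C i (unroll d f') (?c(d := t))"
    proof (rule pd_cong_open[OF S' ct i'(2)])
      fix y assume y: "y \<in> cyl d ?S"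
      then have y0: "y(d := 0) \<in> ?S" by (simp only: cyl_def mem_Collect_eq)
      have "(pd C d ^^ 1) (unroll d f) ((y(d := 0))(d := y d)) = (dcirc ^^ 1) (f (y(d := 0))) (circ (y d))"
        by (rule unroll_dcirc_funpow(1)[OF C f y0, symmetric])
      then show "(pd C d ^^ 1) (unroll d f) y = unroll d f' y"
        by (simp only: fun_upd_upd fun_upd_triv funpow.simps One_nat_def o_apply id_apply unroll_def f'_def)
    qed
    also have "\<dots> = unroll d (\<lambda>a z. pd C i (\<lambda>a. f' a z) a) (?c(d := t))"
      by (simp only: unroll_pd[OF i'(1)])
    also have "\<dots> = pd C i (\<lambda>a. f' a (circ t)) ?c" by (rule unroll_upd_same[OF sub c])
    finally show ?thesis by (simp only: t)
  qed
  have *: "(\<lambda>z. \<Sum>i<d. of_real (\<xi> i) * g i ?c z) \<in> carrier LC"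
    "dcirc (\<lambda>z. \<Sum>i<d. of_real (\<xi> i) * g i ?c z) = (\<lambda>z. \<Sum>i<d. of_real (\<xi> i) * dcirc (g i ?c) z)"
    using sum_LC[of d "\<lambda>i. g i ?c" "\<lambda>i. of_real (\<xi> i)"] g_LC by blast+
  show "(\<lambda>z. cderiv X (\<lambda>q. F q z)) \<in> carrier LC" unfolding Z by (rule *(1))
  show "dcirc (\<lambda>z. cderiv X (\<lambda>q. F q z)) = (\<lambda>z. cderiv X (\<lambda>q. dcirc (F q) z))"
    unfolding Z Z' *(2) by (intro ext sum.cong) (simp_all add: dg)
qed

text \<open>A field is smooth in the sense that it preserves smooth functions on \<open>M\<close>;
  for smoothness in the angle as well, its coefficients in a chart have to be shown smooth. The
  result makes \<open>X f\<close> an admissible multiplier of sections.\<close>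

lemma vector_field_smooth_cyl:
  assumes X: "X \<in> vector_fields M" and F: "smooth_cyl M UNIV F"
  shows "smooth_cyl M UNIV (\<lambda>m z. cderiv (X m) (\<lambda>q. F q z))"
proof (rule smooth_cylI)
  fix U x assume ch: "(U, x) \<in> charts M"
  obtain C where C: "corner_open d C (x ` U)" using chart_corner[OF ch] .
  let ?G = "\<lambda>y. cderiv (X (inv_into U x (y(d := 0)))) (\<lambda>q. F q (circ (y d)))"
  have Xt: "X q \<in> tangent_space M q" for q using X by (simp add: vector_fields_def)
  have Xs: "smooth_fun M (\<lambda>q. X q f)" if "smooth_fun M f" for f using X that by (simp add: vector_fields_def)
  show "Cinf_on (Suc d) (cyl d (x ` (U \<inter> UNIV))) ?G"
    unfolding Int_UNIV_right
  proof (rule Cinf_on_local[OF corner_open_cyl[OF C]])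
    fix y0 assume "y0 \<in> cyl d (x ` U)"
    then obtain m where m: "m \<in> U" "y0(d := 0) = x m" by (auto simp: cyl_def)
    obtain b :: "'m \<Rightarrow> real" and K where b: "smooth_fun M b" "b m = 1" "closed K" "K \<subseteq> U \<inter> UNIV" "\<And>q. q \<notin> K \<Longrightarrow> b q = 0"
      by (rule bump[OF ch m(1) open_UNIV UNIV_I]) (rule that)
    have KU: "K \<subseteq> U" using b(4) by blast
    let ?b = "\<lambda>a. b (inv_into U x a)"
    note b' = chart_smooth_fun[OF b(1) ch]
    define S where "S = x ` U \<inter> ?b -` (- {0})"
    have S: "corner_open d C S"
    proof -
      have "openin (top_of_set (x ` U)) S"
        unfolding S_def by (rule continuous_openin_preimage_gen[OF Cinf_on_imp_continuous_on[OF b']])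
          (rule open_Compl[OF closed_singleton])
      then show ?thesis using C openin_trans unfolding corner_open_def by blast
    qed
    have SU: "S \<subseteq> x ` U" by (auto simp: S_def)
    define w where "w i q = (if q \<in> U then b q *\<^sub>R x q i else 0)" for i q
    have w: "smooth_fun M (w i)" for i
      unfolding w_def
    proof (rule smooth_fun_extend[OF b(1,3) KU _ chart_open[OF ch]])
      have "smooth_fun_on M (U \<inter> x -` (x ` U)) (\<lambda>q. x q i)"
        by (rule smooth_fun_chart[OF ch C subset_refl Cinf_on_coord])
      moreover have "U \<inter> x -` (x ` U) = U" by blast
      ultimately show "smooth_fun_on M U (\<lambda>q. x q i)" by simp
    qed (rule b(5))
    \<comment> \<open>Coordinates are not global functions, but \<open>w i\<close>, a coordinate
      times a bump function, is one. The product rule for \<open>X q (w i)\<close> is solved for the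
      coefficient where \<open>b\<close> is nonzero.\<close>
    define \<Xi> where "\<Xi> i q = (X q (w i) - x q i * X q b) * inverse (b q)" for i q
    have chart: "X q u = (\<Sum>i<d. \<Xi> i q * pd C i (\<lambda>a. u (inv_into U x a)) (x q))"
      if q: "q \<in> U" "b q \<noteq> 0" and u: "smooth_fun M u" for q u
    proof -
      obtain \<xi> where \<xi>: "\<And>u. smooth_fun M u \<Longrightarrow> X q u = (\<Sum>i<d. \<xi> i * pd C i (\<lambda>a. u (inv_into U x a)) (x q))"
        by (rule tangent_chart[OF ch q(1) C Xt]) (rule that)
      have xq: "x q \<in> x ` U" using q by blast
      have "\<Xi> i q = \<xi> i" if i: "i < d" for i
      proof -
        have "pd C j (\<lambda>a. w i (inv_into U x a)) (x q) = b q * (if i = j then 1 else 0) + pd C j ?b (x q) * x q i" if j: "j < d" for j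
        proof -
          have "pd C j (\<lambda>a. w i (inv_into U x a)) (x q) = pd C j (\<lambda>a. ?b a * a i) (x q)"
          proof (rule pd_cong_open[OF C xq j])
            fix a assume a: "a \<in> x ` U"
            then have "inv_into U x a \<in> U" by (rule inv_into_into)
            then show "w i (inv_into U x a) = ?b a * a i"
              using f_inv_into_f[OF a] by (simp add: w_def)
          qed
          also have "\<dots> = b q * (if i = j then 1 else 0) + pd C j ?b (x q) * x q i"
          proof (rule pd_eqI[OF _ corner_open_mem_slice[OF C xq]])
            have 1: "((\<lambda>t. ?b ((x q)(j := t))) has_vector_derivative pd C j ?b (x q)) (at (x q j) within slice C j)"
              by (rule Cinf_on_has_pd[OF C b' j xq])
            have 2: "((\<lambda>t. ((x q)(j := t)) i) has_vector_derivative (if i = j then 1 else 0)) (at (x q j) within slice C j)"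
              by (cases "i = j") simp_all
            show "((\<lambda>t. ?b ((x q)(j := t)) * ((x q)(j := t)) i) has_vector_derivative
                b q * (if i = j then 1 else 0) + pd C j ?b (x q) * x q i) (at (x q j) within slice C j)"
              using has_vector_derivative_mult[OF 1 2] by (simp only: fun_upd_triv inv_chart[OF ch q(1)])
          qed
          finally show ?thesis .
        qed
        then have "X q (w i) = (\<Sum>j<d. \<xi> j * (b q * (if i = j then 1 else 0) + pd C j ?b (x q) * x q i))"
          unfolding \<xi>[OF w] by (intro sum.cong) simp_all
        also have "\<dots> = (\<Sum>j<d. if i = j then \<xi> j * b q else 0) + x q i * (\<Sum>j<d. \<xi> j * pd C j ?b (x q))"
          unfolding sum_distrib_left sum.distrib[symmetric] by (intro sum.cong) (simp_all add: algebra_simps)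
        also have "\<dots> = \<xi> i * b q + x q i * X q b"
          unfolding \<xi>[OF b(1)] using i by simp
        finally show ?thesis using q(2) by (simp add: \<Xi>_def)
      qed
      then show ?thesis unfolding \<xi>[OF u] by simp
    qed
    have \<Xi>_smooth: "Cinf_on d S (\<lambda>a. \<Xi> i (inv_into U x a))" for i
    proof -
      have 1: "Cinf_on d S (\<lambda>a. X (inv_into U x a) (w i))"
        by (rule Cinf_on_subset[OF chart_smooth_fun[OF Xs[OF w] ch] SU])
      have 2: "Cinf_on d S (\<lambda>a. X (inv_into U x a) b)"
        by (rule Cinf_on_subset[OF chart_smooth_fun[OF Xs[OF b(1)] ch] SU])
      have 3: "Cinf_on d S (\<lambda>a. inverse (?b a))"
        by (rule Cinf_on_inverse[OF Cinf_on_subset[OF b' SU]]) (simp add: S_def)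
      have "Cinf_on d S (\<lambda>a. (X (inv_into U x a) (w i) - a i * X (inv_into U x a) b) * inverse (?b a))"
        by (rule Cinf_on_mult[OF Cinf_on_diff[OF 1 Cinf_on_mult[OF Cinf_on_coord 2]] 3])
      then show ?thesis
      proof (rule Cinf_on_cong)
        fix a assume "a \<in> S"
        then have "x (inv_into U x a) = a" using f_inv_into_f[of a x U] SU by blast
        then show "(X (inv_into U x a) (w i) - a i * X (inv_into U x a) b) * inverse (?b a) = \<Xi> i (inv_into U x a)"
          by (simp add: \<Xi>_def)
      qed
    qed
    define f where "f = (\<lambda>a. F (inv_into U x a))"
    have f: "Cinf_on (Suc d) (cyl d (x ` U)) (unroll d f)"
      using smooth_cylD[OF F ch] by (simp add: unroll_def f_def)
    have cylS: "cyl d S \<subseteq> cyl d (x ` U)" using SU unfolding cyl_def by blast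
    have "Cinf_on (Suc d) (cyl d S) (\<lambda>y. \<Sum>i<d. of_real (\<Xi> i (inv_into U x (y(d := 0)))) * pd C i (unroll d f) y)"
    proof (intro Cinf_on_sum Cinf_on_mult)
      fix i assume "i \<in> {..<d}"
      then have "i < Suc d" by simp
      show "Cinf_on (Suc d) (cyl d S) (\<lambda>y. of_real (\<Xi> i (inv_into U x (y(d := 0)))) :: complex)"
        by (rule Cinf_on_bounded_linear[OF bounded_linear_of_real Cinf_on_cyl_pullback[OF \<Xi>_smooth]])
      show "Cinf_on (Suc d) (cyl d S) (pd C i (unroll d f))"
        by (rule Cinf_on_subset[OF Cinf_on_pd[OF corner_open_cyl[OF C] f \<open>i < Suc d\<close>] cylS])
    qed
    then have "Cinf_on (Suc d) (cyl d S) ?G"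
    proof (rule Cinf_on_cong)
      fix y assume "y \<in> cyl d S"
      then have aS: "y(d := 0) \<in> S" by (simp only: cyl_def mem_Collect_eq)
      define a where "a = y(d := 0)"
      define q where "q = inv_into U x a"
      have a: "a \<in> x ` U" "b q \<noteq> 0" using aS by (auto simp: S_def a_def q_def)
      have q: "q \<in> U" "x q = a" using a(1) by (auto simp: q_def inv_into_into f_inv_into_f)
      have "cderiv (X q) (\<lambda>q. F q (circ (y d))) = (\<Sum>i<d. of_real (\<Xi> i q) * pd C i (\<lambda>a. f a (circ (y d))) (x q))"
        unfolding f_def by (rule cderiv_chart[OF ch q(1) C chart[OF q(1) a(2)] smooth_cyl_slice[OF F]])
      also have "\<dots> = (\<Sum>i<d. of_real (\<Xi> i q) * pd C i (unroll d f) y)"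
      proof (rule sum.cong[OF refl])
        fix i assume "i \<in> {..<d}"
        then have "i \<noteq> d" by simp
        have "pd C i (\<lambda>a. f a (circ (y d))) (x q) = unroll d (\<lambda>a z. pd C i (\<lambda>a. f a z) a) y"
          by (simp only: unroll_def q(2) a_def)
        then show "of_real (\<Xi> i q) * pd C i (\<lambda>a. f a (circ (y d))) (x q) = of_real (\<Xi> i q) * pd C i (unroll d f) y"
          by (simp only: unroll_pd[OF \<open>i \<noteq> d\<close>])
      qed
      finally show "(\<Sum>i<d. of_real (\<Xi> i (inv_into U x (y(d := 0)))) * pd C i (unroll d f) y) = ?G y"
        by (simp only: q_def a_def)
    qed
    moreover have "y0 \<in> cyl d S"
    proof -
      have "x m \<in> S" using m(1) b(2) inv_chart[OF ch m(1)] by (simp add: S_def)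
      then show ?thesis using m(2) by (simp only: cyl_def mem_Collect_eq)
    qed
    ultimately show "\<exists>S'. y0 \<in> S' \<and> corner_open (Suc d) C S' \<and> Cinf_on (Suc d) S' ?G"
      using corner_open_cyl[OF S] by (intro exI[of _ "cyl d S"] conjI)
  qed
qed

lemma cderiv_lie_bracket:
  assumes "smooth_fun M f"
  shows "cderiv (lie_bracket M X Y m) f = cderiv (X m) (\<lambda>q. cderiv (Y q) f) - cderiv (Y m) (\<lambda>q. cderiv (X q) f)"
  using smooth_fun_Re[OF assms] smooth_fun_Im[OF assms]
  by (simp add: cderiv_def lie_bracket_def complex_eq_iff)

lemma zero_tangent: "(\<lambda>f. 0) \<in> tangent_space M m"
  by (simp add: tangent_space_def)

lemma lie_bracket_tangent:
  assumes X: "X \<in> vector_fields M" and Y: "Y \<in> vector_fields M"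
  shows "lie_bracket M X Y m \<in> tangent_space M m"
proof -
  have t: "X q \<in> tangent_space M q" "Y q \<in> tangent_space M q" for q using X Y by (auto simp: vector_fields_def)
  have s: "smooth_fun M (\<lambda>q. X q f)" "smooth_fun M (\<lambda>q. Y q f)" if "smooth_fun M f" for f
    using X Y that by (auto simp: vector_fields_def)
  show ?thesis
    unfolding tangent_space_def
  proof (intro CollectI conjI allI impI)
    fix f :: "'m \<Rightarrow> real" assume "\<not> smooth_fun M f"
    then show "lie_bracket M X Y m f = 0" by (simp add: lie_bracket_def)
  next
    fix f g :: "'m \<Rightarrow> real" assume fg: "smooth_fun M f" "smooth_fun M g"
    show "lie_bracket M X Y m (\<lambda>q. f q + g q) = lie_bracket M X Y m f + lie_bracket M X Y m g"
      using fg smooth_fun_add[OF fg] by (simp add: lie_bracket_def tangent_add[OF t(1)] tangent_add[OF t(2)] s)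
    have "X m (\<lambda>q. Y q (\<lambda>q. f q * g q)) = X m (\<lambda>q. f q * Y q g + g q * Y q f)"
      by (simp add: tangent_mult[OF t(2) fg])
    also have "\<dots> = f m * X m (\<lambda>q. Y q g) + Y m g * X m f + (g m * X m (\<lambda>q. Y q f) + Y m f * X m g)"
      by (simp add: tangent_add[OF t(1)] tangent_mult[OF t(1)] smooth_fun_mult s fg)
    finally have 1: "X m (\<lambda>q. Y q (\<lambda>q. f q * g q)) = \<dots>" .
    have "Y m (\<lambda>q. X q (\<lambda>q. f q * g q)) = Y m (\<lambda>q. f q * X q g + g q * X q f)"
      by (simp add: tangent_mult[OF t(1) fg])
    also have "\<dots> = f m * Y m (\<lambda>q. X q g) + X m g * Y m f + (g m * Y m (\<lambda>q. X q f) + X m f * Y m g)"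
      by (simp add: tangent_add[OF t(2)] tangent_mult[OF t(2)] smooth_fun_mult s fg)
    finally have 2: "Y m (\<lambda>q. X q (\<lambda>q. f q * g q)) = \<dots>" .
    show "lie_bracket M X Y m (\<lambda>q. f q * g q) = f m * lie_bracket M X Y m g + g m * lie_bracket M X Y m f"
      using fg smooth_fun_mult[OF fg] by (simp add: lie_bracket_def 1 2 algebra_simps)
  next
    fix c and f :: "'m \<Rightarrow> real" assume f: "smooth_fun M f"
    have "smooth_fun M (\<lambda>q. c * f q)" by (intro smooth_fun_mult smooth_fun_const f)
    then show "lie_bracket M X Y m (\<lambda>q. c * f q) = c * lie_bracket M X Y m f"
      using f by (simp add: lie_bracket_def tangent_scale[OF t(1)] tangent_scale[OF t(2)] s algebra_simps)
  qed
qed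

end

section \<open>Modules over the loop algebra and their fibres\<close>

lemma (in abelian_monoid) additive_finsum:
  fixes \<kappa> :: "'a \<Rightarrow> complex"
  assumes add: "\<And>v w. v \<in> carrier G \<Longrightarrow> w \<in> carrier G \<Longrightarrow> \<kappa> (v \<oplus> w) = \<kappa> v + \<kappa> w"
    and A: "finite A"
  shows "(\<And>a. a \<in> A \<Longrightarrow> f a \<in> carrier G) \<Longrightarrow> \<kappa> (\<Oplus>a\<in>A. f a) = (\<Sum>a\<in>A. \<kappa> (f a))"
  using A
proof (induction A rule: finite_induct)
  case empty
  have "\<kappa> (\<zero> \<oplus> \<zero>) = \<kappa> \<zero> + \<kappa> \<zero>" by (rule add) simp_all
  then show ?case by simp
next
  case (insert a A)
  have "(\<Oplus>a\<in>insert a A. f a) = f a \<oplus> (\<Oplus>a\<in>A. f a)"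
    using insert by (intro finsum_insert) auto
  moreover have "(\<Oplus>a\<in>A. f a) \<in> carrier G" using insert.prems by (intro finsum_closed) auto
  ultimately show ?case using insert by (simp add: add)
qed

lemma (in abelian_group) additive_minus:
  fixes \<kappa> :: "'a \<Rightarrow> complex"
  assumes add: "\<And>v w. v \<in> carrier G \<Longrightarrow> w \<in> carrier G \<Longrightarrow> \<kappa> (v \<oplus> w) = \<kappa> v + \<kappa> w"
    and v: "v \<in> carrier G" and w: "w \<in> carrier G"
  shows "\<kappa> (v \<ominus> w) = \<kappa> v - \<kappa> w"
proof -
  have "(v \<ominus> w) \<oplus> w = v" using v w by (simp add: a_minus_def a_assoc l_neg)
  then have "\<kappa> v = \<kappa> (v \<ominus> w) + \<kappa> w" using add[of "v \<ominus> w" w] v w by simp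
  then show ?thesis by simp
qed

lemma module_iso_bij: "module_iso R N P h \<Longrightarrow> bij_betw h (carrier N) (carrier P)"
  and module_iso_add: "module_iso R N P h \<Longrightarrow> v \<in> carrier N \<Longrightarrow> w \<in> carrier N \<Longrightarrow> h (v \<oplus>\<^bsub>N\<^esub> w) = h v \<oplus>\<^bsub>P\<^esub> h w"
  and module_iso_smult: "module_iso R N P h \<Longrightarrow> a \<in> carrier R \<Longrightarrow> v \<in> carrier N \<Longrightarrow> h (a \<odot>\<^bsub>N\<^esub> v) = a \<odot>\<^bsub>P\<^esub> h v"
  by (auto simp: module_iso_def)

lemma module_iso_mem: "module_iso R N P h \<Longrightarrow> v \<in> carrier N \<Longrightarrow> h v \<in> carrier P"
  by (rule bij_betw_apply[OF module_iso_bij])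

lemma module_iso_inv:
  assumes "module_iso R N P h" "w \<in> carrier P"
  shows "inv_into (carrier N) h w \<in> carrier N" "h (inv_into (carrier N) h w) = w"
  using module_iso_bij[OF assms(1)] assms(2) by (auto simp: bij_betw_def inv_into_into f_inv_into_f)

lemma module_iso_inv': "module_iso R N P h \<Longrightarrow> v \<in> carrier N \<Longrightarrow> inv_into (carrier N) h (h v) = v"
  by (rule bij_betw_inv_into_left[OF module_iso_bij])

text \<open>Used with the identity of \<open>CC\<close> and with evaluation of \<open>LC\<close> at
  a point, so that one computation covers the trace on the caloron fibre and the values of the
  \<open>LC\<close>-valued trace.\<close>

locale ring_eval =
  fixes R :: "'k ring" (structure) and ev :: "'k \<Rightarrow> complex"
  assumes cring: "cring R"
    and ev_add: "a \<in> carrier R \<Longrightarrow> b \<in> carrier R \<Longrightarrow> ev (a \<oplus> b) = ev a + ev b"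
    and ev_mult: "a \<in> carrier R \<Longrightarrow> b \<in> carrier R \<Longrightarrow> ev (a \<otimes> b) = ev a * ev b"
    and ev_one: "ev \<one> = 1"
begin

interpretation cring R by (rule cring)

lemma ev_zero: "ev \<zero> = 0"
  using ev_add[of \<zero> \<zero>] by simp

lemma unit_vector_mem: "j < n \<Longrightarrow> unit_vector R j \<in> carrier (free_module R n)"
  by (auto simp: free_module_def unit_vector_def)

text \<open>Scalars reach \<open>l\<close> only through \<open>ev\<close>, so the evaluated
  coordinates of \<open>v\<close> suffice. The vector is assembled coordinate by coordinate,
  \<open>w k\<close> keeping the first \<open>k\<close> of them.\<close>

lemma linear_expansion:
  fixes N :: "('k, 'v) module"
  assumes iso: "module_iso R N (free_module R n) h"
    and closed: "\<And>v w. v \<in> carrier N \<Longrightarrow> w \<in> carrier N \<Longrightarrow> v \<oplus>\<^bsub>N\<^esub> w \<in> carrier N"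
      "\<And>a v. a \<in> carrier R \<Longrightarrow> v \<in> carrier N \<Longrightarrow> a \<odot>\<^bsub>N\<^esub> v \<in> carrier N"
    and l_add: "\<And>v w. v \<in> carrier N \<Longrightarrow> w \<in> carrier N \<Longrightarrow> l (v \<oplus>\<^bsub>N\<^esub> w) = l v + l w"
    and l_smult: "\<And>a v. a \<in> carrier R \<Longrightarrow> v \<in> carrier N \<Longrightarrow> l (a \<odot>\<^bsub>N\<^esub> v) = ev a * l v"
    and v: "v \<in> carrier N"
  shows "l v = (\<Sum>j<n. ev (h v j) * l (inv_into (carrier N) h (unit_vector R j)))"
proof -
  let ?F = "free_module R n" and ?g = "inv_into (carrier N) h"
  define w where "w k i = (if i < k then h v i else \<zero>)" for k i
  have hv: "h v \<in> carrier ?F" by (rule module_iso_mem[OF iso v])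
  then have hvR: "\<And>i. i < n \<Longrightarrow> h v i \<in> carrier R" "\<And>i. i \<ge> n \<Longrightarrow> h v i = \<zero>"
    by (auto simp: free_module_def)
  have wF: "w k \<in> carrier ?F" if "k \<le> n" for k
    using that hvR by (auto simp: free_module_def w_def)
  have g_add: "?g (a \<oplus>\<^bsub>?F\<^esub> b) = ?g a \<oplus>\<^bsub>N\<^esub> ?g b" if "a \<in> carrier ?F" "b \<in> carrier ?F" for a b
    using module_iso_inv'[OF iso closed(1)[OF module_iso_inv(1)[OF iso that(1)] module_iso_inv(1)[OF iso that(2)]]]
      module_iso_add[OF iso module_iso_inv(1)[OF iso that(1)] module_iso_inv(1)[OF iso that(2)]]
    by (simp add: module_iso_inv(2)[OF iso that(1)] module_iso_inv(2)[OF iso that(2)])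
  have g_smult: "?g (c \<odot>\<^bsub>?F\<^esub> a) = c \<odot>\<^bsub>N\<^esub> ?g a" if "c \<in> carrier R" "a \<in> carrier ?F" for c a
    using module_iso_inv'[OF iso closed(2)[OF that(1) module_iso_inv(1)[OF iso that(2)]]]
      module_iso_smult[OF iso that(1) module_iso_inv(1)[OF iso that(2)]]
    by (simp add: module_iso_inv(2)[OF iso that(2)])
  have "l (?g (w k)) = (\<Sum>j<k. ev (h v j) * l (?g (unit_vector R j)))" if "k \<le> n" for k
    using that
  proof (induction k)
    case 0
    have "w 0 \<oplus>\<^bsub>?F\<^esub> w 0 = w 0" by (simp add: w_def[abs_def] free_module_def)
    then have "?g (w 0) = ?g (w 0) \<oplus>\<^bsub>N\<^esub> ?g (w 0)" using g_add[OF wF[OF 0] wF[OF 0]] by simp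
    then have "l (?g (w 0)) = l (?g (w 0)) + l (?g (w 0))"
      using l_add[OF module_iso_inv(1)[OF iso wF[OF 0]] module_iso_inv(1)[OF iso wF[OF 0]]] by simp
    then show ?case by simp
  next
    case (Suc k)
    then have k: "k < n" by simp
    let ?e = "unit_vector R k"
    have e: "?e \<in> carrier ?F" by (rule unit_vector_mem[OF k])
    have c: "h v k \<in> carrier R" by (rule hvR(1)[OF k])
    have ce: "h v k \<odot>\<^bsub>?F\<^esub> ?e \<in> carrier ?F"
      using c k by (auto simp: free_module_def unit_vector_def)
    have "w (Suc k) = w k \<oplus>\<^bsub>?F\<^esub> (h v k \<odot>\<^bsub>?F\<^esub> ?e)"
    proof
      fix i
      consider "i < k" | "i = k" | "i > k" by linarith
      then show "w (Suc k) i = (w k \<oplus>\<^bsub>?F\<^esub> (h v k \<odot>\<^bsub>?F\<^esub> ?e)) i"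
      proof cases
        case 1
        then have "h v i \<in> carrier R" using hvR(1) k by simp
        then show ?thesis using 1 c by (simp add: w_def free_module_def unit_vector_def)
      qed (use c k in \<open>simp_all add: w_def free_module_def unit_vector_def\<close>)
    qed
    then have "?g (w (Suc k)) = ?g (w k) \<oplus>\<^bsub>N\<^esub> (h v k \<odot>\<^bsub>N\<^esub> ?g ?e)"
      using g_add[OF wF ce] g_smult[OF c e] k by simp
    then have "l (?g (w (Suc k))) = l (?g (w k)) + ev (h v k) * l (?g ?e)"
      using k by (simp add: l_add l_smult module_iso_inv(1)[OF iso] wF e c closed(2))
    then show ?case using Suc by simp
  qed
  moreover have "w n = h v" using hvR by (auto simp: w_def)
  ultimately show ?thesis using module_iso_inv'[OF iso v] by fastforce
qed

text \<open>The trace is defined by an arbitrarily chosen isomorphism \<open>h'\<close>. After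
  evaluation the changes of basis between \<open>h\<close> and \<open>h'\<close> are inverse
  matrices, so the trace can be computed from the matrix \<open>b\<close> found in the coordinates
  \<open>h\<close>.\<close>

lemma module_trace_eval:
  fixes N :: "('k, 'v) module"
  assumes iso: "module_iso R N (free_module R n) h"
    and closed: "\<And>v w. v \<in> carrier N \<Longrightarrow> w \<in> carrier N \<Longrightarrow> v \<oplus>\<^bsub>N\<^esub> w \<in> carrier N"
      "\<And>a v. a \<in> carrier R \<Longrightarrow> v \<in> carrier N \<Longrightarrow> a \<odot>\<^bsub>N\<^esub> v \<in> carrier N"
    and A: "\<And>v. v \<in> carrier N \<Longrightarrow> A v \<in> carrier N"
    and b: "\<And>v i. v \<in> carrier N \<Longrightarrow> i < n \<Longrightarrow> ev (h (A v) i) = (\<Sum>j<n. b i j * ev (h v j))"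
  shows "ev (module_trace R n N A) = (\<Sum>i<n. b i i)"
proof -
  define h' where "h' = (SOME h. module_iso R N (free_module R n) h)"
  have iso': "module_iso R N (free_module R n) h'"
    unfolding h'_def by (rule someI[where P = "module_iso R N (free_module R n)", OF iso])
  let ?g = "inv_into (carrier N) h" and ?g' = "inv_into (carrier N) h'"
  let ?e = "unit_vector R"
  define P where "P i j = ev (h' (?g (?e j)) i)" for i j
  define Q where "Q i j = ev (h (?g' (?e j)) i)" for i j
  have memR: "k v i \<in> carrier R" if "module_iso R N (free_module R n) k" "v \<in> carrier N" "i < n" for k v i
    using module_iso_mem[OF that(1,2)] that(3) by (simp add: free_module_def)
  have coord_add: "ev (k (v \<oplus>\<^bsub>N\<^esub> w) i) = ev (k v i) + ev (k w i)"
    if "module_iso R N (free_module R n) k" "v \<in> carrier N" "w \<in> carrier N" "i < n" for k v w i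
    using module_iso_add[OF that(1-3)] memR[OF that(1,2,4)] memR[OF that(1,3,4)] by (simp add: free_module_def ev_add)
  have coord_smult: "ev (k (a \<odot>\<^bsub>N\<^esub> v) i) = ev a * ev (k v i)"
    if "module_iso R N (free_module R n) k" "a \<in> carrier R" "v \<in> carrier N" "i < n" for k a v i
    using module_iso_smult[OF that(1-3)] memR[OF that(1,3,4)] that(2) by (simp add: free_module_def ev_mult)
  have hP: "ev (h' v i) = (\<Sum>j<n. ev (h v j) * P i j)" if "v \<in> carrier N" "i < n" for v i
    unfolding P_def
    by (rule linear_expansion[OF iso closed, where l = "\<lambda>v. ev (h' v i)"])
      (simp_all add: coord_add[OF iso'] coord_smult[OF iso'] that)
  have hQ: "ev (h v i) = (\<Sum>j<n. ev (h' v j) * Q i j)" if "v \<in> carrier N" "i < n" for v i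
    unfolding Q_def
    by (rule linear_expansion[OF iso' closed, where l = "\<lambda>v. ev (h v i)"])
      (simp_all add: coord_add[OF iso] coord_smult[OF iso] that)
  have eN: "?g (?e j) \<in> carrier N" "?g' (?e j) \<in> carrier N" "h (?g (?e j)) = ?e j" if "j < n" for j
    using module_iso_inv[OF iso unit_vector_mem[OF that]] module_iso_inv[OF iso' unit_vector_mem[OF that]] by auto
  \<comment> \<open>A basis vector of \<open>h\<close>, passed through the coordinates of
    \<open>h'\<close>, is recovered: this is the statement that \<open>Q\<close> and
    \<open>P\<close> are inverse.\<close>
  have delta: "(\<Sum>i<n. P i j * Q k i) = (if j = k then 1 else 0)" if "j < n" "k < n" for j k
  proof -
    have "(\<Sum>i<n. P i j * Q k i) = ev (?e j k)"
      using hQ[OF eN(1)[OF that(1)] that(2)] eN(3)[OF that(1)] by (simp add: P_def)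
    then show ?thesis by (simp add: unit_vector_def ev_one ev_zero)
  qed
  have "module_trace R n N A = (\<Oplus>i\<in>{..<n}. h' (A (?g' (?e i))) i)"
    by (simp add: module_trace_def Let_def h'_def)
  also have "ev \<dots> = (\<Sum>i<n. ev (h' (A (?g' (?e i))) i))"
    by (rule additive_finsum) (auto simp: ev_add intro!: memR[OF iso'] A eN)
  also have "\<dots> = (\<Sum>i<n. \<Sum>j<n. \<Sum>k<n. b j k * (P i j * Q k i))"
  proof (rule sum.cong[OF refl])
    fix i assume "i \<in> {..<n}"
    then have i: "i < n" by simp
    have "ev (h' (A (?g' (?e i))) i) = (\<Sum>j<n. ev (h (A (?g' (?e i))) j) * P i j)"
      by (rule hP[OF A[OF eN(2)[OF i]] i])
    also have "\<dots> = (\<Sum>j<n. \<Sum>k<n. b j k * (P i j * Q k i))"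
      by (intro sum.cong refl) (simp add: b[OF eN(2)[OF i]] sum_distrib_right sum_distrib_left Q_def mult_ac)
    finally show "ev (h' (A (?g' (?e i))) i) = (\<Sum>j<n. \<Sum>k<n. b j k * (P i j * Q k i))" .
  qed
  also have "\<dots> = (\<Sum>j<n. \<Sum>i<n. \<Sum>k<n. b j k * (P i j * Q k i))"
    by (rule sum.swap)
  also have "\<dots> = (\<Sum>j<n. \<Sum>k<n. \<Sum>i<n. b j k * (P i j * Q k i))"
    by (rule sum.cong[OF refl], rule sum.swap)
  also have "\<dots> = (\<Sum>j<n. \<Sum>k<n. b j k * (if j = k then 1 else 0))"
    by (intro sum.cong refl) (simp add: sum_distrib_left[symmetric] delta)
  also have "\<dots> = (\<Sum>j<n. b j j)"
    by (intro sum.cong refl) (simp add: if_distrib[where f = "times _"] cong: if_cong)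
  finally show ?thesis .
qed

end

lemma cring_CC: "cring CC"
proof (rule cringI)
  show "abelian_group CC"
  proof (rule abelian_groupI)
    fix x assume "x \<in> carrier CC"
    show "\<exists>y\<in>carrier CC. y \<oplus>\<^bsub>CC\<^esub> x = \<zero>\<^bsub>CC\<^esub>"
      by (rule bexI[of _ "- x"]) (simp_all add: CC_def)
  qed (simp_all add: CC_def)
  show "Group.comm_monoid CC"
    by (rule comm_monoidI) (simp_all add: CC_def)
qed (simp add: CC_def algebra_simps)

lemma ring_eval_CC: "ring_eval CC (\<lambda>c. c)"
  by (rule ring_eval.intro[OF cring_CC]) (simp_all add: CC_def)

lemma ring_eval_LC: "cring LC \<Longrightarrow> ring_eval LC (\<lambda>f. f z)"
  by (rule ring_eval.intro) (simp_all add: LC_def)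

lemma const_LC: "(\<lambda>z. c) \<in> carrier LC"
proof -
  have "dcirc (\<lambda>z. b) = (\<lambda>z. 0)" for b
    by (rule ext) (simp add: dcirc_def o_def)
  then have "(dcirc ^^ k) (\<lambda>z. c) = (\<lambda>z. if k = 0 then c else 0)" for k
    by (induction k) simp_all
  then show ?thesis by (simp add: LC_def o_def)
qed

locale loop_module =
  fixes N :: "(circle \<Rightarrow> complex, 'v) module" (structure) and n :: nat and h :: "'v \<Rightarrow> nat \<Rightarrow> circle \<Rightarrow> complex"
  assumes module_N: "module LC N" and iso: "module_iso LC N (free_module LC n) h"
begin

interpretation module LC N by (rule module_N)

lemma ev: "ring_eval LC (\<lambda>f. f z)"
  by (rule ring_eval_LC) (rule R.is_cring)

lemma coord_add: "v \<in> carrier N \<Longrightarrow> w \<in> carrier N \<Longrightarrow> h (v \<oplus> w) i z = h v i z + h w i z"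
  using module_iso_add[OF iso] by (simp add: free_module_def LC_def)

lemma coord_smult: "a \<in> carrier LC \<Longrightarrow> v \<in> carrier N \<Longrightarrow> h (a \<odot> v) i z = a z * h v i z"
  using module_iso_smult[OF iso] by (simp add: free_module_def LC_def)

lemma coord_zero: "h \<zero> i z = 0"
  using coord_add[of \<zero> \<zero> i z] by simp

lemma coord_minus: "v \<in> carrier N \<Longrightarrow> w \<in> carrier N \<Longrightarrow> h (v \<ominus> w) i z = h v i z - h w i z"
  by (rule additive_minus) (simp_all add: coord_add)

lemma coord_ge: "v \<in> carrier N \<Longrightarrow> i \<ge> n \<Longrightarrow> h v i z = 0"
  using module_iso_mem[OF iso] by (fastforce simp: free_module_def LC_def)

lemma coord_eqI: "v \<in> carrier N \<Longrightarrow> w \<in> carrier N \<Longrightarrow> (\<And>i z. i < n \<Longrightarrow> h v i z = h w i z) \<Longrightarrow> v = w"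
proof -
  assume vw: "v \<in> carrier N" "w \<in> carrier N" "\<And>i z. i < n \<Longrightarrow> h v i z = h w i z"
  have "h v = h w"
  proof (intro ext)
    fix i z show "h v i z = h w i z" using vw coord_ge by (cases "i < n") simp_all
  qed
  then show "v = w" using module_iso_bij[OF iso] vw by (auto simp: bij_betw_def inj_on_def)
qed

text \<open>The definition quantifies over all isomorphisms with the free module; by linear
  expansion the coordinates at \<open>z\<close> in any of them are combinations of those in
  \<open>h\<close> at \<open>z\<close>.\<close>

lemma vanishing: "vanishing_at n N z = {v \<in> carrier N. \<forall>i<n. h v i z = 0}"
proof (intro equalityI subsetI)
  fix v assume "v \<in> vanishing_at n N z"
  then show "v \<in> {v \<in> carrier N. \<forall>i<n. h v i z = 0}" using iso by (auto simp: vanishing_at_def)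
next
  fix v assume v: "v \<in> {v \<in> carrier N. \<forall>i<n. h v i z = 0}"
  have "k v i z = 0" if k: "module_iso LC N (free_module LC n) k" and i: "i < n" for k i
  proof -
    have "k v i z = (\<Sum>j<n. h v j z * k (inv_into (carrier N) h (unit_vector LC j)) i z)"
      by (rule ring_eval.linear_expansion[OF ev iso, where l = "\<lambda>v. k v i z"])
        (use v module_iso_add[OF k] module_iso_smult[OF k] in \<open>simp_all add: free_module_def LC_def smult_closed[unfolded LC_def]\<close>)
    then show ?thesis using v by simp
  qed
  then show "v \<in> vanishing_at n N z" using v by (simp add: vanishing_at_def)
qed

text \<open>This is the coset modulo the elements vanishing at \<open>z\<close>, written in
  coordinates; in this form the operations of the quotient are computed on representatives.\<close>

definition cls :: "circle \<Rightarrow> 'v \<Rightarrow> 'v set" where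
  "cls z v = {w \<in> carrier N. \<forall>i<n. h w i z = h v i z}"

lemma cls_eq_iff: "v \<in> carrier N \<Longrightarrow> w \<in> carrier N \<Longrightarrow> cls z v = cls z w \<longleftrightarrow> (\<forall>i<n. h v i z = h w i z)"
  unfolding cls_def by auto

lemma coset: "v \<in> carrier N \<Longrightarrow> vanishing_at n N z +> v = cls z v"
proof (intro equalityI subsetI)
  fix w assume v: "v \<in> carrier N" and "w \<in> vanishing_at n N z +> v"
  then obtain a where "a \<in> carrier N" "\<forall>i<n. h a i z = 0" "w = a \<oplus> v"
    by (auto simp: a_r_coset_def' vanishing)
  then show "w \<in> cls z v" using v by (simp add: cls_def coord_add)
next
  fix w assume v: "v \<in> carrier N" and "w \<in> cls z v"
  then have w: "w \<in> carrier N" "\<forall>i<n. h w i z = h v i z" by (auto simp: cls_def)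
  have "w = (w \<ominus> v) \<oplus> v" using v w(1) by (simp add: a_minus_def a_assoc l_neg)
  moreover have "w \<ominus> v \<in> vanishing_at n N z" using v w by (simp add: vanishing coord_minus)
  ultimately show "w \<in> vanishing_at n N z +> v" unfolding a_r_coset_def' by blast
qed

abbreviation "V z \<equiv> fibre_at n N z"

lemma coset': "v \<in> carrier N \<Longrightarrow> vanishing_at n N z +>\<^bsub>complex_scalars N\<^esub> v = cls z v"
  using coset by (simp add: a_r_coset_def' complex_scalars_def)

lemma carrier_V: "carrier (V z) = cls z ` carrier N"
  using coset' by (auto simp: fibre_at_def quotient_module_def A_RCOSETS_def' complex_scalars_def)

lemma add_V: "v \<in> carrier N \<Longrightarrow> w \<in> carrier N \<Longrightarrow> cls z v \<oplus>\<^bsub>V z\<^esub> cls z w = cls z (v \<oplus> w)"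
proof -
  assume v: "v \<in> carrier N" and w: "w \<in> carrier N"
  have "cls z v \<oplus>\<^bsub>V z\<^esub> cls z w = (\<Union>a\<in>cls z v. \<Union>b\<in>cls z w. {a \<oplus> b})"
    by (simp add: fibre_at_def quotient_module_def set_add_def' complex_scalars_def)
  also have "\<dots> = cls z (v \<oplus> w)"
  proof (intro equalityI subsetI)
    fix u assume "u \<in> (\<Union>a\<in>cls z v. \<Union>b\<in>cls z w. {a \<oplus> b})"
    then show "u \<in> cls z (v \<oplus> w)" using v w by (auto simp: cls_def coord_add)
  next
    fix u assume u: "u \<in> cls z (v \<oplus> w)"
    then have uN: "u \<in> carrier N" by (simp add: cls_def)
    have "u = v \<oplus> (u \<ominus> v)" using v uN by (metis a_comm a_minus_def add.inv_closed add.inv_solve_right' minus_closed)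
    moreover have "u \<ominus> v \<in> cls z w" using u v w by (simp add: cls_def coord_minus coord_add)
    moreover have "v \<in> cls z v" using v by (simp add: cls_def)
    ultimately show "u \<in> (\<Union>a\<in>cls z v. \<Union>b\<in>cls z w. {a \<oplus> b})" by blast
  qed
  finally show ?thesis .
qed

lemma zero_V: "\<zero>\<^bsub>V z\<^esub> = cls z \<zero>"
  by (auto simp: fibre_at_def quotient_module_def vanishing cls_def coord_zero)

lemma smult_V: "v \<in> carrier N \<Longrightarrow> c \<odot>\<^bsub>V z\<^esub> cls z v = cls z ((\<lambda>z. c) \<odot> v)"
proof -
  assume v: "v \<in> carrier N"
  have "c \<odot>\<^bsub>V z\<^esub> cls z v = (\<Union>w\<in>cls z v. vanishing_at n N z +>\<^bsub>complex_scalars N\<^esub> ((\<lambda>z. c) \<odot> w))"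
    by (simp add: fibre_at_def quotient_module_def complex_scalars_def)
  also have "\<dots> = (\<Union>w\<in>cls z v. cls z ((\<lambda>z. c) \<odot> v))"
  proof (rule SUP_cong[OF refl])
    fix w assume "w \<in> cls z v"
    then show "vanishing_at n N z +>\<^bsub>complex_scalars N\<^esub> ((\<lambda>z. c) \<odot> w) = cls z ((\<lambda>z. c) \<odot> v)"
      using v by (simp add: cls_def coset' const_LC coord_smult)
  qed
  also have "\<dots> = cls z ((\<lambda>z. c) \<odot> v)" using v by (auto simp: cls_def)
  finally show ?thesis .
qed

lemma abelian_group_V: "abelian_group (V z)"
proof (rule abelian_groupI)
  show "\<exists>y\<in>carrier (V z). y \<oplus>\<^bsub>V z\<^esub> x = \<zero>\<^bsub>V z\<^esub>" if "x \<in> carrier (V z)" for x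
  proof -
    obtain v where v: "v \<in> carrier N" "x = cls z v" using \<open>x \<in> carrier (V z)\<close> by (auto simp: carrier_V)
    then have "cls z (\<ominus> v) \<oplus>\<^bsub>V z\<^esub> x = \<zero>\<^bsub>V z\<^esub>" by (simp add: add_V zero_V l_neg)
    then show ?thesis using v by (auto simp: carrier_V)
  qed
qed (auto simp: carrier_V add_V zero_V a_assoc a_comm a_lcomm)

lemma minus_V: "v \<in> carrier N \<Longrightarrow> w \<in> carrier N \<Longrightarrow> cls z v \<ominus>\<^bsub>V z\<^esub> cls z w = cls z (v \<ominus> w)"
proof -
  assume v: "v \<in> carrier N" and w: "w \<in> carrier N"
  interpret V: abelian_group "V z" by (rule abelian_group_V)
  have m: "cls z u \<in> carrier (V z)" if "u \<in> carrier N" for u using that by (simp add: carrier_V)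
  have "cls z (\<ominus> w) \<oplus>\<^bsub>V z\<^esub> cls z w = \<zero>\<^bsub>V z\<^esub>" using w by (simp add: add_V zero_V l_neg)
  then have "\<ominus>\<^bsub>V z\<^esub> cls z w = cls z (\<ominus> w)" using w by (intro V.minus_equality m) simp_all
  then show ?thesis using v w by (simp add: V.minus_eq a_minus_def add_V)
qed

text \<open>The choice of a representative copies the trivialisations of \<open>caloron\<close>. It
  is harmless, since all elements of a coset have the same coordinates at \<open>z\<close>.\<close>

definition fibre_coord :: "circle \<Rightarrow> 'v set \<Rightarrow> nat \<Rightarrow> complex" where
  "fibre_coord z K i = h (SOME v. v \<in> K) i z"

lemma some_cls:
  assumes "v \<in> carrier N"
  shows "(SOME w. w \<in> cls z v) \<in> cls z v"
proof -
  have "v \<in> cls z v" using assms by (simp add: cls_def)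
  then show ?thesis by (rule someI[where P = "\<lambda>w. w \<in> cls z v"])
qed

lemma fibre_coord_cls: "v \<in> carrier N \<Longrightarrow> fibre_coord z (cls z v) i = h v i z"
  using some_cls[of v z] coord_ge[of _ i z] by (cases "i < n") (simp_all add: fibre_coord_def cls_def)

lemma fibre_iso: "module_iso CC (V z) (free_module CC n) (fibre_coord z)"
  unfolding module_iso_def
proof (intro conjI ballI)
  show "bij_betw (fibre_coord z) (carrier (V z)) (carrier (free_module CC n))"
    unfolding bij_betw_def
  proof (rule conjI)
    show "inj_on (fibre_coord z) (carrier (V z))"
    proof (rule inj_onI)
      fix K L assume "K \<in> carrier (V z)" "L \<in> carrier (V z)" and eq: "fibre_coord z K = fibre_coord z L"
      then obtain v w where vw: "v \<in> carrier N" "w \<in> carrier N" "K = cls z v" "L = cls z w" by (auto simp: carrier_V)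
      have "h v i z = h w i z" for i using fun_cong[OF eq, of i] vw by (simp add: fibre_coord_cls)
      then show "K = L" using vw by (simp add: cls_eq_iff)
    qed
  next
    show "fibre_coord z ` carrier (V z) = carrier (free_module CC n)"
    proof (intro equalityI subsetI)
    fix y assume "y \<in> fibre_coord z ` carrier (V z)"
    then obtain v where v: "v \<in> carrier N" "y = fibre_coord z (cls z v)" by (auto simp: carrier_V)
    then show "y \<in> carrier (free_module CC n)" by (simp add: fibre_coord_cls free_module_def CC_def coord_ge)
  next
    fix y assume y: "y \<in> carrier (free_module CC n)"
    \<comment> \<open>Surjectivity: complex numbers are lifted to constant loops.\<close>
    let ?y = "\<lambda>i z'. y i"
    have "?y \<in> carrier (free_module LC n)" using y by (simp add: free_module_def CC_def const_LC) (simp add: LC_def)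
    note g = module_iso_inv[OF iso this]
    have "fibre_coord z (cls z (inv_into (carrier N) h ?y)) = y"
      by (rule ext) (simp add: fibre_coord_cls g)
    moreover have "cls z (inv_into (carrier N) h ?y) \<in> carrier (V z)"
      unfolding carrier_V using g(1) by (rule imageI)
    ultimately show "y \<in> fibre_coord z ` carrier (V z)" by (metis imageI)
    qed
  qed
  fix K assume "K \<in> carrier (V z)"
  then obtain v where v: "v \<in> carrier N" "K = cls z v" by (auto simp: carrier_V)
  show "fibre_coord z (K \<oplus>\<^bsub>V z\<^esub> L) = fibre_coord z K \<oplus>\<^bsub>free_module CC n\<^esub> fibre_coord z L" if "L \<in> carrier (V z)" for L
  proof -
    obtain w where w: "w \<in> carrier N" "L = cls z w" using \<open>L \<in> carrier (V z)\<close> by (auto simp: carrier_V)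
    show ?thesis using v w by (simp add: add_V fibre_coord_cls coord_add free_module_def CC_def fun_eq_iff)
  qed
  show "fibre_coord z (c \<odot>\<^bsub>V z\<^esub> K) = c \<odot>\<^bsub>free_module CC n\<^esub> fibre_coord z K" for c
    using v by (simp add: smult_V fibre_coord_cls coord_smult const_LC free_module_def CC_def fun_eq_iff)
qed

end

section \<open>Traces of wedge powers of antisymmetric families of matrices\<close>

type_synonym cmat = "nat \<Rightarrow> nat \<Rightarrow> complex"

definition mm :: "nat \<Rightarrow> cmat \<Rightarrow> cmat \<Rightarrow> cmat" where
  "mm n A B = (\<lambda>r c. \<Sum>k<n. A r k * B k c)"

definition mid :: "nat \<Rightarrow> cmat" where
  "mid n = (\<lambda>r c. if r = c \<and> r < n then 1 else 0)"

definition tr :: "nat \<Rightarrow> cmat \<Rightarrow> complex" where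
  "tr n A = (\<Sum>i<n. A i i)"

definition supported :: "nat \<Rightarrow> cmat \<Rightarrow> bool" where
  "supported n A \<longleftrightarrow> (\<forall>r c. \<not> (r < n \<and> c < n) \<longrightarrow> A r c = 0)"

lemma mm_assoc: "mm n (mm n A B) C = mm n A (mm n B C)"
proof (intro ext)
  fix r c
  have "mm n (mm n A B) C r c = (\<Sum>k<n. \<Sum>l<n. A r l * B l k * C k c)"
    by (simp add: mm_def sum_distrib_right)
  also have "\<dots> = (\<Sum>l<n. \<Sum>k<n. A r l * B l k * C k c)" by (rule sum.swap)
  finally show "mm n (mm n A B) C r c = mm n A (mm n B C) r c"
    by (simp add: mm_def sum_distrib_left mult.assoc)
qed

lemma mm_mid:
  assumes "supported n A"
  shows "mm n A (mid n) = A" "mm n (mid n) A = A"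
proof -
  have "mm n A (mid n) r c = A r c \<and> mm n (mid n) A r c = A r c" for r c
  proof -
    have "mm n A (mid n) r c = (\<Sum>k<n. if k = c then A r k else 0)"
      unfolding mm_def mid_def by (intro sum.cong) auto
    moreover have "mm n (mid n) A r c = (\<Sum>k<n. if r = k then A k c else 0)"
      unfolding mm_def mid_def by (intro sum.cong) auto
    ultimately show ?thesis using assms by (auto simp: supported_def)
  qed
  then show "mm n A (mid n) = A" "mm n (mid n) A = A" by (auto intro!: ext)
qed

lemma tr_comm: "tr n (mm n A B) = tr n (mm n B A)"
  unfolding tr_def mm_def by (subst sum.swap) (simp add: mult.commute)

lemma mm_uminus: "mm n (\<lambda>r c. - A r c) B = (\<lambda>r c. - mm n A B r c)" "mm n A (\<lambda>r c. - B r c) = (\<lambda>r c. - mm n A B r c)"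
  by (auto simp: mm_def sum_negf)

lemma mm_sum_right: "mm n A (\<lambda>r c. \<Sum>x\<in>I. u x * B x r c) = (\<lambda>r c. \<Sum>x\<in>I. u x * mm n A (B x) r c)"
proof (intro ext)
  fix r c
  have "mm n A (\<lambda>r c. \<Sum>x\<in>I. u x * B x r c) r c = (\<Sum>k<n. \<Sum>x\<in>I. u x * (A r k * B x k c))"
    by (simp add: mm_def sum_distrib_left mult.left_commute)
  also have "\<dots> = (\<Sum>x\<in>I. \<Sum>k<n. u x * (A r k * B x k c))" by (rule sum.swap)
  finally show "mm n A (\<lambda>r c. \<Sum>x\<in>I. u x * B x r c) r c = (\<Sum>x\<in>I. u x * mm n A (B x) r c)"
    by (simp add: mm_def sum_distrib_left)
qed

lemma tr_sum: "tr n (\<lambda>r c. \<Sum>x\<in>I. u x * B x r c) = (\<Sum>x\<in>I. u x * tr n (B x))"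
  unfolding tr_def by (subst sum.swap) (simp add: sum_distrib_left)

abbreviation perms :: "nat \<Rightarrow> (nat \<Rightarrow> nat) set" where
  "perms m \<equiv> {\<sigma>. \<sigma> permutes {..<m}}"

abbreviation sg :: "(nat \<Rightarrow> nat) \<Rightarrow> complex" where
  "sg \<sigma> \<equiv> of_int (sign \<sigma>)"

lemma perms_permutation: "\<sigma> \<in> perms m \<Longrightarrow> permutation \<sigma>"
  using permutation_permutes[of \<sigma>] finite_lessThan by blast

lemma sg_compose: "\<sigma> \<in> perms m \<Longrightarrow> \<tau> \<in> perms m \<Longrightarrow> sg (\<sigma> \<circ> \<tau>) = sg \<sigma> * sg \<tau>"
  using sign_compose[OF perms_permutation perms_permutation] by (metis of_int_mult)

text \<open>A nested wedge product permutes a tail of the slots once more; this is that inner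
  permutation as a permutation of all slots.\<close>

definition embed :: "nat \<Rightarrow> (nat \<Rightarrow> nat) \<Rightarrow> nat \<Rightarrow> nat" where
  "embed a \<tau> = (\<lambda>i. if i < a then i else a + \<tau> (i - a))"

lemma embed_perms:
  assumes "\<tau> \<in> perms l"
  shows "embed a \<tau> \<in> perms (a + l) \<and> sign (embed a \<tau>) = sign \<tau>"
  using assms finite_lessThan[of l] unfolding mem_Collect_eq
proof (induction rule: permutes_induct)
  case id
  have "embed a id = id" by (auto simp: embed_def)
  then show ?case by (simp only: permutes_id)
next
  case (swap x y p)
  have e: "embed a (Transposition.transpose x y \<circ> p) = Transposition.transpose (a + x) (a + y) \<circ> embed a p"
    by (auto simp: embed_def Transposition.transpose_def fun_eq_iff)
  have t: "Transposition.transpose (a + x) (a + y) permutes {..<a + l}" using swap by (intro permutes_swap_id) auto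
  have "permutation (embed a p)" "permutation p"
    using swap permutation_permutes finite_lessThan by blast+
  then have "sign (embed a (Transposition.transpose x y \<circ> p)) = sign (Transposition.transpose x y \<circ> p)"
    unfolding e using swap by (simp add: sign_compose permutation_swap_id sign_swap_id)
  moreover have "embed a (Transposition.transpose x y \<circ> p) permutes {..<a + l}"
    unfolding e using swap t by (intro permutes_compose) auto
  ultimately show ?case by blast
qed

text \<open>For fixed \<tau>, right translation by \<open>embed a \<tau>\<close> preserves the
  signed sum over \<sigma>, so each of the \<open>fact l\<close> inner permutations contributes the
  same amount. The factor cancels the normalisation of the wedge product.\<close>

lemma sum_perms_flatten:
  "(\<Sum>\<sigma>\<in>perms (a + l). \<Sum>\<tau>\<in>perms l. sg \<sigma> * sg \<tau> * f (\<sigma> \<circ> embed a \<tau>)) = fact l * (\<Sum>\<sigma>\<in>perms (a + l). sg \<sigma> * f \<sigma>)"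
proof -
  have "(\<Sum>\<sigma>\<in>perms (a + l). sg \<sigma> * sg \<tau> * f (\<sigma> \<circ> embed a \<tau>)) = (\<Sum>\<sigma>\<in>perms (a + l). sg \<sigma> * f \<sigma>)" if \<tau>: "\<tau> \<in> perms l" for \<tau>
  proof -
    have e: "embed a \<tau> \<in> perms (a + l)" "sign (embed a \<tau>) = sign \<tau>" using embed_perms[OF \<tau>] by auto
    have "(\<Sum>\<sigma>\<in>perms (a + l). sg \<sigma> * sg \<tau> * f (\<sigma> \<circ> embed a \<tau>)) =
        (\<Sum>\<sigma>\<in>perms (a + l). sg (\<sigma> \<circ> embed a \<tau>) * f (\<sigma> \<circ> embed a \<tau>))"
      by (intro sum.cong refl) (simp only: sg_compose[OF _ e(1)] e(2))
    also have "\<dots> = (\<Sum>\<sigma>\<in>perms (a + l). sg \<sigma> * f \<sigma>)"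
      using e(1) sum_permutations_compose_right[of "embed a \<tau>" "{..<a + l}" "\<lambda>\<sigma>. sg \<sigma> * f \<sigma>"] by simp
    finally show ?thesis .
  qed
  then have "(\<Sum>\<tau>\<in>perms l. \<Sum>\<sigma>\<in>perms (a + l). sg \<sigma> * sg \<tau> * f (\<sigma> \<circ> embed a \<tau>)) =
      (\<Sum>\<tau>\<in>perms l. \<Sum>\<sigma>\<in>perms (a + l). sg \<sigma> * f \<sigma>)"
    by (rule sum.cong[OF refl])
  also have "\<dots> = fact l * (\<Sum>\<sigma>\<in>perms (a + l). sg \<sigma> * f \<sigma>)"
    using card_permutations[of "{..<l}" l] by simp
  finally show ?thesis by (subst sum.swap)
qed

definition rot :: "nat \<Rightarrow> nat \<Rightarrow> nat" where
  "rot m p = (if p < m then (p + 1) mod m else p)"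

lemma rot_perms: "rot m \<in> perms m"
proof -
  have "inj_on (rot m) {..<m}"
    by (rule inj_onI) (auto simp: rot_def mod_Suc split: if_splits)
  moreover have "rot m ` {..<m} \<subseteq> {..<m}" by (auto simp: rot_def)
  ultimately have "bij_betw (rot m) {..<m} {..<m}"
    by (simp add: bij_betw_def endo_inj_surj)
  then show ?thesis by (intro CollectI bij_imp_permutes) (auto simp: rot_def)
qed

lemma rot_funpow: "(rot m ^^ c) p = (if p < m then (p + c) mod m else p)"
  by (induction c) (auto simp: rot_def mod_Suc_eq)

lemma rot_funpow_perms: "rot m ^^ c \<in> perms m \<and> sg (rot m ^^ c) = sg (rot m) ^ c"
proof (induction c)
  case 0
  show ?case by (simp add: permutes_id[unfolded id_def])
next
  case (Suc c)
  have "rot m ^^ Suc c = rot m \<circ> rot m ^^ c" by simp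
  moreover have "rot m \<circ> rot m ^^ c \<in> perms m" using rot_perms[of m] Suc by (auto intro: permutes_compose)
  moreover have "sg (rot m \<circ> rot m ^^ c) = sg (rot m) ^ Suc c"
    using sg_compose[OF rot_perms conjunct1[OF Suc]] conjunct2[OF Suc] by (simp only: power_Suc)
  ultimately show ?case by (simp only:)
qed

text \<open>Only even powers of the rotation occur below, so the sign of the rotation itself never
  has to be determined.\<close>

lemma sg_rot_even: "even c \<Longrightarrow> sg (rot m ^^ c) = 1"
  using rot_funpow_perms[where m = m and c = c] by (cases "evenperm (rot m)") (simp_all add: sign_def)

text \<open>\<open>W x y\<close> stands for the matrix of a two-form on the vector fields with indices \<open>x\<close> and \<open>y\<close>.\<close>

fun block_product :: "nat \<Rightarrow> (nat \<Rightarrow> nat \<Rightarrow> cmat) \<Rightarrow> nat \<Rightarrow> (nat \<Rightarrow> nat) \<Rightarrow> cmat" where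
  "block_product n W 0 a = mid n"
| "block_product n W (Suc j) a = mm n (W (a 0) (a 1)) (block_product n W j (\<lambda>i. a (2 + i)))"

fun power_matrix :: "nat \<Rightarrow> (nat \<Rightarrow> nat \<Rightarrow> cmat) \<Rightarrow> nat \<Rightarrow> (nat \<Rightarrow> nat) \<Rightarrow> cmat" where
  "power_matrix n W 0 a = mid n"
| "power_matrix n W (Suc j) a = (\<lambda>r c. \<Sum>\<sigma>\<in>perms (2 + 2 * j). (sg \<sigma> / (fact 2 * fact (2 * j))) *
     mm n (W (a (\<sigma> 0)) (a (\<sigma> 1))) (power_matrix n W j (\<lambda>i. a (\<sigma> (2 + i)))) r c)"

text \<open>In each step \<open>fact (2 * j)\<close> cancels against the flattened inner sum, so
  that only the factor 1/2 from \<open>fact 2\<close> is left per block.\<close>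

lemma power_matrix_eq:
  "power_matrix n W j a = (\<lambda>r c. \<Sum>\<sigma>\<in>perms (2 * j). sg \<sigma> / 2 ^ j * block_product n W j (\<lambda>i. a (\<sigma> i)) r c)"
proof (induction j arbitrary: a)
  case 0
  have "perms 0 = {id}" by auto
  then show ?case by (simp add: sign_id)
next
  case (Suc j)
  show ?case
  proof (intro ext)
    fix r c
    define f where "f \<sigma> = block_product n W (Suc j) (\<lambda>i. a (\<sigma> i)) r c" for \<sigma>
    have *: "mm n (W (a (\<sigma> 0)) (a (\<sigma> 1))) (block_product n W j (\<lambda>i. a (\<sigma> (2 + \<tau> i)))) r c = f (\<sigma> \<circ> embed 2 \<tau>)" for \<sigma> \<tau>
      by (simp add: f_def embed_def)
    have "power_matrix n W (Suc j) a r c = (\<Sum>\<sigma>\<in>perms (2 + 2 * j). (sg \<sigma> / (fact 2 * fact (2 * j))) *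
        (\<Sum>\<tau>\<in>perms (2 * j). sg \<tau> / 2 ^ j * f (\<sigma> \<circ> embed 2 \<tau>)))"
      by (simp only: power_matrix.simps Suc mm_sum_right *)
    also have "\<dots> = (\<Sum>\<sigma>\<in>perms (2 + 2 * j). \<Sum>\<tau>\<in>perms (2 * j). 1 / (2 ^ Suc j * fact (2 * j)) * (sg \<sigma> * sg \<tau> * f (\<sigma> \<circ> embed 2 \<tau>)))"
      unfolding sum_distrib_left by (intro sum.cong refl) (simp add: fact_2 field_simps)
    also have "\<dots> = 1 / (2 ^ Suc j * fact (2 * j)) * (\<Sum>\<sigma>\<in>perms (2 + 2 * j). \<Sum>\<tau>\<in>perms (2 * j). sg \<sigma> * sg \<tau> * f (\<sigma> \<circ> embed 2 \<tau>))"
      by (simp only: sum_distrib_left)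
    also have "\<dots> = 1 / (2 ^ Suc j) * (\<Sum>\<sigma>\<in>perms (2 + 2 * j). sg \<sigma> * f \<sigma>)"
      unfolding sum_perms_flatten by simp
    also have "\<dots> = (\<Sum>\<sigma>\<in>perms (2 * Suc j). sg \<sigma> / 2 ^ Suc j * f \<sigma>)"
      by (simp add: sum_distrib_left)
    finally show "power_matrix n W (Suc j) a r c =
        (\<Sum>\<sigma>\<in>perms (2 * Suc j). sg \<sigma> / 2 ^ Suc j * block_product n W (Suc j) (\<lambda>i. a (\<sigma> i)) r c)"
      by (simp only: f_def)
  qed
qed

lemma block_product_cong:
  "(\<And>i. i < 2 * j \<Longrightarrow> a i = b i) \<Longrightarrow> block_product n W j a = block_product n W j b"
proof (induction j arbitrary: a b)
  case (Suc j)
  have "block_product n W j (\<lambda>i. a (2 + i)) = block_product n W j (\<lambda>i. b (2 + i))"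
    by (rule Suc.IH) (rule Suc.prems, simp)
  moreover have "a 0 = b 0" "a 1 = b 1" by (auto intro: Suc.prems)
  ultimately show ?case by simp
qed simp

locale antisymmetric_matrices =
  fixes n :: nat and W :: "nat \<Rightarrow> nat \<Rightarrow> cmat"
  assumes W_supp: "supported n (W x y)"
    and W_anti: "W x y r c = - W y x r c"
begin

lemma block_product_snoc:
  "block_product n W (Suc j) a = mm n (block_product n W j a) (W (a (2 * j)) (a (2 * j + 1)))"
proof (induction j arbitrary: a)
  case 0
  then show ?case by (simp add: mm_mid[OF W_supp])
next
  case (Suc j)
  have "block_product n W (Suc (Suc j)) a = mm n (W (a 0) (a 1)) (block_product n W (Suc j) (\<lambda>i. a (2 + i)))"
    by (rule block_product.simps)
  also have "\<dots> = mm n (mm n (W (a 0) (a 1)) (block_product n W j (\<lambda>i. a (2 + i)))) (W (a (2 + 2 * j)) (a (2 + (2 * j + 1))))"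
    unfolding Suc mm_assoc ..
  finally show ?case by simp
qed

lemma block_product_swap:
  "l < j \<Longrightarrow> block_product n W j (\<lambda>i. a (Transposition.transpose (2 * l) (2 * l + 1) i)) = (\<lambda>r c. - block_product n W j a r c)"
proof (induction j arbitrary: a l)
  case (Suc j)
  show ?case
  proof (cases l)
    case 0
    have "block_product n W (Suc j) (\<lambda>i. a (Transposition.transpose (2 * l) (2 * l + 1) i)) = mm n (W (a 1) (a 0)) (block_product n W j (\<lambda>i. a (2 + i)))"
      by (simp add: 0 Transposition.transpose_def)
    also have "W (a 1) (a 0) = (\<lambda>r c. - W (a 0) (a 1) r c)" by (intro ext) (rule W_anti)
    finally show ?thesis by (simp add: mm_uminus)
  next
    case (Suc l')
    have "block_product n W j (\<lambda>i. a (Transposition.transpose (2 * l) (2 * l + 1) (2 + i))) =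
        block_product n W j (\<lambda>i. (\<lambda>i. a (2 + i)) (Transposition.transpose (2 * l') (2 * l' + 1) i))"
      by (rule block_product_cong) (auto simp: Suc Transposition.transpose_def)
    also have "\<dots> = (\<lambda>r c. - block_product n W j (\<lambda>i. a (2 + i)) r c)"
      using Suc.prems Suc by (intro Suc.IH) simp
    finally have tail: "block_product n W j (\<lambda>i. a (Transposition.transpose (2 * l) (2 * l + 1) (2 + i))) =
        (\<lambda>r c. - block_product n W j (\<lambda>i. a (2 + i)) r c)" .
    have "Transposition.transpose (2 * l) (2 * l + 1) 0 = 0" "Transposition.transpose (2 * l) (2 * l + 1) 1 = 1"
      by (simp_all add: Suc Transposition.transpose_def)
    then show ?thesis by (simp only: block_product.simps tail mm_uminus)
  qed
qed simp

definition word_trace :: "nat \<Rightarrow> (nat \<Rightarrow> nat) \<Rightarrow> complex" where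
  "word_trace j a = tr n (block_product n W j a)"

lemma word_trace_swap: "l < j \<Longrightarrow> word_trace j (a \<circ> Transposition.transpose (2 * l) (2 * l + 1)) = - word_trace j a"
  using block_product_swap[of l j a] by (simp add: word_trace_def tr_def o_def sum_negf)

text \<open>Rotation by two positions moves the first block to the end of the product, which the
  trace does not notice.\<close>

lemma word_trace_rot: "word_trace (Suc j) (a \<circ> rot (2 * Suc j) ^^ 2) = word_trace (Suc j) a"
proof -
  let ?\<rho> = "rot (2 * Suc j) ^^ 2"
  have "block_product n W j (\<lambda>i. a (?\<rho> i)) = block_product n W j (\<lambda>i. a (2 + i))"
    by (rule block_product_cong) (simp add: rot_funpow del: funpow.simps)
  moreover have "?\<rho> (2 * j) = 0" "?\<rho> (2 * j + 1) = 1"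
    by (simp_all add: rot_funpow mod_if del: funpow.simps)
  ultimately have "block_product n W (Suc j) (\<lambda>i. a (?\<rho> i)) = mm n (block_product n W j (\<lambda>i. a (2 + i))) (W (a 0) (a 1))"
    unfolding block_product_snoc by simp
  then have "word_trace (Suc j) (\<lambda>i. a (?\<rho> i)) = tr n (mm n (block_product n W j (\<lambda>i. a (2 + i))) (W (a 0) (a 1)))"
    by (simp only: word_trace_def)
  also have "\<dots> = tr n (mm n (W (a 0) (a 1)) (block_product n W j (\<lambda>i. a (2 + i))))" by (rule tr_comm)
  also have "\<dots> = word_trace (Suc j) a" by (simp only: word_trace_def block_product.simps)
  finally show ?thesis by (simp only: o_def)
qed

text \<open>The value of the sum over permutations with \<open>\<sigma> p = 2 j + 1\<close> does not depend on the position
  \<open>p\<close>: swap the two entries of a block, or rotate the blocks under the trace.\<close>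

lemma sum_perms_last:
  "(\<Sum>\<sigma>\<in>perms (2 * Suc j). sg \<sigma> * word_trace (Suc j) \<sigma>) = of_nat (2 * Suc j) * (\<Sum>\<sigma>\<in>perms (2 * j + 1). sg \<sigma> * word_trace (Suc j) \<sigma>)"
proof -
  let ?N = "2 * Suc j"
  let ?k = "2 * j + 1"
  \<comment> \<open>The part of the sum in which the label \<open>2 * j + 1\<close>, later that of
    the circle direction, occupies slot \<open>p\<close>.\<close>
  define T where "T p = (\<Sum>\<sigma>\<in>{\<sigma> \<in> perms ?N. \<sigma> p = ?k}. sg \<sigma> * word_trace (Suc j) \<sigma>)" for p
  \<comment> \<open>Composition with \<rho> matches the permutations with the label in slot
    \<open>\<rho> q\<close> and those with it in slot \<open>q\<close>; the second premise says that
    the sign of \<rho> compensates its effect on the trace.\<close>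
  have T_inv: "T (\<rho> q) = T q" if \<rho>: "\<rho> \<in> perms ?N" and inv: "\<And>\<sigma>. sg \<rho> * word_trace (Suc j) (\<sigma> \<circ> \<rho>) = word_trace (Suc j) \<sigma>" for \<rho> q
  proof -
    have \<rho>': "\<rho> permutes {..<?N}" using \<rho> by simp
    note \<rho>i = permutes_inv[OF \<rho>']
    have "T (\<rho> q) = (\<Sum>\<sigma>\<in>{\<sigma> \<in> perms ?N. \<sigma> (\<rho> q) = ?k}. sg (\<sigma> \<circ> \<rho>) * word_trace (Suc j) (\<sigma> \<circ> \<rho>))"
      unfolding T_def
    proof (rule sum.cong[OF refl])
      fix \<sigma> assume "\<sigma> \<in> {\<sigma> \<in> perms ?N. \<sigma> (\<rho> q) = ?k}"
      then have "\<sigma> \<in> perms ?N" by simp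
      then show "sg \<sigma> * word_trace (Suc j) \<sigma> = sg (\<sigma> \<circ> \<rho>) * word_trace (Suc j) (\<sigma> \<circ> \<rho>)"
        using sg_compose[OF _ \<rho>, of \<sigma>] inv[of \<sigma>] by (simp only: mult.assoc)
    qed
    also have "\<dots> = T q"
      unfolding T_def
    proof (rule sum.reindex_bij_witness[where i = "\<lambda>\<sigma>. \<sigma> \<circ> Hilbert_Choice.inv \<rho>" and j = "\<lambda>\<sigma>. \<sigma> \<circ> \<rho>"])
      fix \<sigma> assume s: "\<sigma> \<in> {\<sigma> \<in> perms ?N. \<sigma> (\<rho> q) = ?k}"
      show "(\<sigma> \<circ> \<rho>) \<circ> Hilbert_Choice.inv \<rho> = \<sigma>" by (simp add: o_assoc[symmetric] permutes_inv_o[OF \<rho>'])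
      show "\<sigma> \<circ> \<rho> \<in> {\<sigma> \<in> perms ?N. \<sigma> q = ?k}" using s permutes_compose[OF \<rho>'] by simp
    next
      fix \<sigma> assume s: "\<sigma> \<in> {\<sigma> \<in> perms ?N. \<sigma> q = ?k}"
      show "(\<sigma> \<circ> Hilbert_Choice.inv \<rho>) \<circ> \<rho> = \<sigma>" by (simp add: o_assoc[symmetric] permutes_inv_o[OF \<rho>'])
      show "\<sigma> \<circ> Hilbert_Choice.inv \<rho> \<in> {\<sigma> \<in> perms ?N. \<sigma> (\<rho> q) = ?k}"
        using s permutes_compose[OF \<rho>i] by (simp add: permutes_inverses[OF \<rho>'])
    qed simp
    finally show ?thesis .
  qed
  have T_swap: "T (2 * l) = T (2 * l + 1)" if "l < Suc j" for l
  proof -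
    have "T (Transposition.transpose (2 * l) (2 * l + 1) (2 * l + 1)) = T (2 * l + 1)"
    proof (rule T_inv[where \<rho> = "Transposition.transpose (2 * l) (2 * l + 1)"])
      show "Transposition.transpose (2 * l) (2 * l + 1) \<in> perms ?N" using that by (intro CollectI permutes_swap_id) auto
      show "sg (Transposition.transpose (2 * l) (2 * l + 1)) * word_trace (Suc j) (\<sigma> \<circ> Transposition.transpose (2 * l) (2 * l + 1)) = word_trace (Suc j) \<sigma>" for \<sigma>
        unfolding word_trace_swap[OF that] by (simp add: sign_swap_id)
    qed
    then show ?thesis by simp
  qed
  have T_rot: "T (p + 2) = T p" if "p + 2 < ?N" for p
  proof -
    have "T ((rot ?N ^^ 2) p) = T p"
    proof (rule T_inv[where \<rho> = "rot ?N ^^ 2"])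
      show "rot ?N ^^ 2 \<in> perms ?N" using rot_funpow_perms by blast
      show "sg (rot ?N ^^ 2) * word_trace (Suc j) (\<sigma> \<circ> rot ?N ^^ 2) = word_trace (Suc j) \<sigma>" for \<sigma>
        using sg_rot_even[where c = 2 and m = ?N] unfolding word_trace_rot by simp
    qed
    moreover have "(rot ?N ^^ 2) p = p + 2" using that unfolding rot_funpow by simp
    ultimately show ?thesis by simp
  qed
  have T_odd: "T (2 * l + 1) = T ?k" if "l \<le> j" for l
    using that
  proof (induction rule: inc_induct)
    case (step l)
    then have "T (2 * l + 1 + 2) = T (2 * l + 1)" by (intro T_rot) simp
    then show ?case using step by simp
  qed simp
  have T_all: "T p = T ?k" if "p < ?N" for p
  proof -
    have l: "p div 2 \<le> j" using less_mult_imp_div_less[of p "Suc j" 2] that by (simp add: mult.commute)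
    show ?thesis
    proof (cases "even p")
      case True
      then show ?thesis using T_swap[of "p div 2"] T_odd[OF l] l by simp
    next
      case False
      then show ?thesis using T_odd[OF l] by simp
    qed
  qed
  \<comment> \<open>Each permutation puts the label \<open>?k\<close> into exactly one slot, so the
    sum splits over the slots.\<close>
  have "(\<Sum>\<sigma>\<in>perms ?N. sg \<sigma> * word_trace (Suc j) \<sigma>) = (\<Sum>\<sigma>\<in>perms ?N. \<Sum>p<?N. if \<sigma> p = ?k then sg \<sigma> * word_trace (Suc j) \<sigma> else 0)"
  proof (rule sum.cong[OF refl])
    fix \<sigma> assume "\<sigma> \<in> perms ?N"
    then have s: "\<sigma> permutes {..<?N}" by simp
    have "\<sigma> p = ?k \<longleftrightarrow> p = Hilbert_Choice.inv \<sigma> ?k" for p using permutes_inv_eq[OF s, of ?k p] by auto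
    moreover have "Hilbert_Choice.inv \<sigma> ?k < ?N" using permutes_in_image[OF permutes_inv[OF s], of ?k] by simp
    ultimately show "sg \<sigma> * word_trace (Suc j) \<sigma> = (\<Sum>p<?N. if \<sigma> p = ?k then sg \<sigma> * word_trace (Suc j) \<sigma> else 0)" by simp
  qed
  also have "\<dots> = (\<Sum>p<?N. \<Sum>\<sigma>\<in>perms ?N. if \<sigma> p = ?k then sg \<sigma> * word_trace (Suc j) \<sigma> else 0)" by (rule sum.swap)
  also have "\<dots> = (\<Sum>p<?N. T p)"
    unfolding T_def
    by (rule sum.cong[OF refl], rule sum.inter_filter[symmetric], rule finite_permutations, rule finite_lessThan)
  also have "\<dots> = (\<Sum>p<?N. T ?k)"
    by (rule sum.cong[OF refl], rule T_all) (simp only: lessThan_iff)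
  also have "\<dots> = of_nat ?N * T ?k" by (simp only: sum_constant card_lessThan)
  also have "T ?k = (\<Sum>\<sigma>\<in>perms ?k. sg \<sigma> * word_trace (Suc j) \<sigma>)"
  proof -
    \<comment> \<open>With the last label in the last slot, the remaining labels are permuted freely
      among the other slots.\<close>
    have "{\<sigma> \<in> perms ?N. \<sigma> ?k = ?k} = perms ?k"
    proof (intro equalityI subsetI)
      fix \<sigma> assume s: "\<sigma> \<in> {\<sigma> \<in> perms ?N. \<sigma> ?k = ?k}"
      then have N: "\<sigma> permutes {..<?N}" and k: "\<sigma> ?k = ?k" by blast+
      have "\<sigma> x = x" if "x \<in> {..<?N} - {..<?k}" for x
      proof -
        have "x = ?k" using that by simp
        then show ?thesis using k by (simp only:)
      qed
      then have "\<sigma> permutes {..<?k}" by (rule permutes_superset[OF N])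
      then show "\<sigma> \<in> perms ?k" by blast
    next
      fix \<sigma> assume "\<sigma> \<in> perms ?k"
      then have s: "\<sigma> permutes {..<?k}" by simp
      then have "\<sigma> permutes {..<?N}" by (rule permutes_subset) auto
      moreover have "\<sigma> ?k = ?k" using s by (rule permutes_not_in) simp
      ultimately show "\<sigma> \<in> {\<sigma> \<in> perms ?N. \<sigma> ?k = ?k}" by blast
    qed
    then show ?thesis by (simp only: T_def)
  qed
  finally show ?thesis .
qed

text \<open>On the right the label \<open>2 * j + 1\<close> sits in the second slot of the first
  block, where the Higgs derivative stands, whereas \<open>sum_perms_last\<close> leaves it at the
  very end. A cyclic shift of the other labels and cyclicity of the trace reconcile the two
  positions.\<close>

lemma trace_power_matrix:
  "tr n (power_matrix n W (Suc j) (\<lambda>i. i)) = of_nat (Suc j) *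
     tr n (\<lambda>r c. \<Sum>\<sigma>\<in>perms (1 + 2 * j). (sg \<sigma> / (fact 1 * fact (2 * j))) *
       mm n (W (\<sigma> 0) (2 * j + 1)) (power_matrix n W j (\<lambda>i. \<sigma> (1 + i))) r c)"
proof -
  let ?k = "2 * j + 1"
  define u where "u \<sigma> = tr n (mm n (W (\<sigma> 0) ?k) (block_product n W j (\<lambda>i. \<sigma> (1 + i))))" for \<sigma>
  \<comment> \<open>Rotating \<open>2 * j + 1\<close> slots by \<open>2 * j\<close> brings the entry
    in slot \<open>2 * j\<close> to the front and moves the others back by one; as an even power of
    the rotation it has sign 1.\<close>
  have u: "u (\<sigma> \<circ> rot ?k ^^ (2 * j)) = word_trace (Suc j) \<sigma>" if "\<sigma> \<in> perms ?k" for \<sigma>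
  proof -
    let ?\<rho> = "rot ?k ^^ (2 * j)"
    have 1: "?\<rho> 0 = 2 * j" unfolding rot_funpow by simp
    have 2: "block_product n W j (\<lambda>i. \<sigma> (?\<rho> (1 + i))) = block_product n W j \<sigma>"
    proof (rule block_product_cong)
      fix i assume "i < 2 * j"
      then have "?\<rho> (1 + i) = i" unfolding rot_funpow by (simp add: mod_if)
      then show "\<sigma> (?\<rho> (1 + i)) = \<sigma> i" by simp
    qed
    have 3: "\<sigma> ?k = ?k" using that permutes_not_in[of \<sigma> "{..<?k}" ?k] by simp
    have "u (\<sigma> \<circ> ?\<rho>) = tr n (mm n (W (\<sigma> (2 * j)) ?k) (block_product n W j \<sigma>))"
      by (simp only: u_def o_apply 1 2)
    also have "\<dots> = tr n (mm n (block_product n W j \<sigma>) (W (\<sigma> (2 * j)) ?k))" by (rule tr_comm)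
    also have "\<dots> = word_trace (Suc j) \<sigma>" by (simp only: word_trace_def block_product_snoc 3)
    finally show ?thesis .
  qed
  have "tr n (\<lambda>r c. \<Sum>\<sigma>\<in>perms (1 + 2 * j). (sg \<sigma> / (fact 1 * fact (2 * j))) *
       mm n (W (\<sigma> 0) ?k) (power_matrix n W j (\<lambda>i. \<sigma> (1 + i))) r c) =
     (\<Sum>\<sigma>\<in>perms (1 + 2 * j). (sg \<sigma> / (fact 1 * fact (2 * j))) *
       (\<Sum>\<tau>\<in>perms (2 * j). sg \<tau> / 2 ^ j * u (\<sigma> \<circ> embed 1 \<tau>)))"
    unfolding tr_sum power_matrix_eq mm_sum_right by (simp add: u_def embed_def)
  also have "\<dots> = (\<Sum>\<sigma>\<in>perms (1 + 2 * j). \<Sum>\<tau>\<in>perms (2 * j). 1 / (2 ^ j * fact (2 * j)) * (sg \<sigma> * sg \<tau> * u (\<sigma> \<circ> embed 1 \<tau>)))"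
    unfolding sum_distrib_left by (intro sum.cong refl) (simp add: field_simps)
  also have "\<dots> = 1 / (2 ^ j * fact (2 * j)) * (\<Sum>\<sigma>\<in>perms (1 + 2 * j). \<Sum>\<tau>\<in>perms (2 * j). sg \<sigma> * sg \<tau> * u (\<sigma> \<circ> embed 1 \<tau>))"
    by (simp only: sum_distrib_left)
  also have "\<dots> = 1 / 2 ^ j * (\<Sum>\<sigma>\<in>perms (1 + 2 * j). sg \<sigma> * u \<sigma>)"
    unfolding sum_perms_flatten by simp
  also have "(\<Sum>\<sigma>\<in>perms (1 + 2 * j). sg \<sigma> * u \<sigma>) = (\<Sum>\<sigma>\<in>perms ?k. sg \<sigma> * word_trace (Suc j) \<sigma>)"
  proof -
    let ?\<rho> = "rot ?k ^^ (2 * j)"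
    have \<rho>: "?\<rho> \<in> perms ?k" "sg ?\<rho> = 1" using rot_funpow_perms[where m = ?k and c = "2 * j"] sg_rot_even[where c = "2 * j" and m = ?k] by auto
    have "(\<Sum>\<sigma>\<in>perms ?k. sg \<sigma> * u \<sigma>) = (\<Sum>\<sigma>\<in>perms ?k. sg (\<sigma> \<circ> ?\<rho>) * u (\<sigma> \<circ> ?\<rho>))"
      using \<rho>(1) by (intro sum_permutations_compose_right) simp
    also have "\<dots> = (\<Sum>\<sigma>\<in>perms ?k. sg \<sigma> * word_trace (Suc j) \<sigma>)"
      by (intro sum.cong refl) (simp only: sg_compose[OF _ \<rho>(1)] \<rho>(2) u mult_1_right)
    finally show ?thesis by (simp add: add.commute)
  qed
  finally have R: "tr n (\<lambda>r c. \<Sum>\<sigma>\<in>perms (1 + 2 * j). (sg \<sigma> / (fact 1 * fact (2 * j))) *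
       mm n (W (\<sigma> 0) ?k) (power_matrix n W j (\<lambda>i. \<sigma> (1 + i))) r c) = 1 / 2 ^ j * (\<Sum>\<sigma>\<in>perms ?k. sg \<sigma> * word_trace (Suc j) \<sigma>)" .
  have "tr n (power_matrix n W (Suc j) (\<lambda>i. i)) = (\<Sum>\<sigma>\<in>perms (2 * Suc j). sg \<sigma> / 2 ^ Suc j * word_trace (Suc j) \<sigma>)"
    unfolding power_matrix_eq tr_sum word_trace_def ..
  also have "\<dots> = 1 / 2 ^ Suc j * (\<Sum>\<sigma>\<in>perms (2 * Suc j). sg \<sigma> * word_trace (Suc j) \<sigma>)"
    by (simp add: sum_distrib_left)
  \<comment> \<open>There are \<open>2 * Suc j\<close> slots, and the left side has one more block
    than the right, hence one more factor 1/2.\<close>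
  also have "\<dots> = of_nat (Suc j) * (1 / 2 ^ j * (\<Sum>\<sigma>\<in>perms ?k. sg \<sigma> * word_trace (Suc j) \<sigma>))"
    unfolding sum_perms_last by (simp add: field_simps)
  finally show ?thesis unfolding R .
qed

end

section \<open>Operators on sections\<close>

text \<open>Common ground for sections of \<open>E\<close> and of its caloron transform. \<kappa>
  gives \<open>n\<close> numbers at the single point \<open>p\<close>; for \<open>E\<close> these
  are the values of the loop coordinates at one \<open>z\<close>, so they do not determine a
  vector.\<close>

locale form_space =
  fixes V :: "'p \<Rightarrow> (complex, 'v) module" and \<Gamma> :: "('p \<Rightarrow> 'v) set" and p :: 'p
    and \<kappa> :: "'v \<Rightarrow> nat \<Rightarrow> complex" and n :: nat
  assumes V: "\<And>q. abelian_group (V q)"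
    and V_smult: "\<And>q c v. v \<in> carrier (V q) \<Longrightarrow> c \<odot>\<^bsub>V q\<^esub> v \<in> carrier (V q)"
    and \<Gamma>_mem: "\<And>s q. s \<in> \<Gamma> \<Longrightarrow> s q \<in> carrier (V q)"
    and \<Gamma>_zero: "(\<lambda>q. \<zero>\<^bsub>V q\<^esub>) \<in> \<Gamma>"
    and \<Gamma>_add: "\<And>s t. s \<in> \<Gamma> \<Longrightarrow> t \<in> \<Gamma> \<Longrightarrow> (\<lambda>q. s q \<oplus>\<^bsub>V q\<^esub> t q) \<in> \<Gamma>"
    and \<Gamma>_smult: "\<And>s c. s \<in> \<Gamma> \<Longrightarrow> (\<lambda>q. c \<odot>\<^bsub>V q\<^esub> s q) \<in> \<Gamma>"
    and \<kappa>_add: "\<And>v w i. v \<in> carrier (V p) \<Longrightarrow> w \<in> carrier (V p) \<Longrightarrow> i < n \<Longrightarrow> \<kappa> (v \<oplus>\<^bsub>V p\<^esub> w) i = \<kappa> v i + \<kappa> w i"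
    and \<kappa>_smult: "\<And>c v i. v \<in> carrier (V p) \<Longrightarrow> i < n \<Longrightarrow> \<kappa> (c \<odot>\<^bsub>V p\<^esub> v) i = c * \<kappa> v i"
begin

lemma \<Gamma>_finsum:
  assumes "finite A"
  shows "(\<And>a. a \<in> A \<Longrightarrow> f a \<in> \<Gamma>) \<Longrightarrow> (\<lambda>q. \<Oplus>\<^bsub>V q\<^esub>a\<in>A. f a q) \<in> \<Gamma>"
  using assms
proof (induction A rule: finite_induct)
  case empty
  have "(\<Oplus>\<^bsub>V q\<^esub>a\<in>{}. f a q) = \<zero>\<^bsub>V q\<^esub>" for q
    using V[of q] by (simp add: abelian_group_def abelian_monoid.finsum_empty)
  then show ?case using \<Gamma>_zero by simp
next
  case (insert a A)
  have "(\<Oplus>\<^bsub>V q\<^esub>a\<in>insert a A. f a q) = f a q \<oplus>\<^bsub>V q\<^esub> (\<Oplus>\<^bsub>V q\<^esub>a\<in>A. f a q)" for q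
    using V[of q] insert.hyps insert.prems \<Gamma>_mem
    by (intro abelian_monoid.finsum_insert) (auto simp: abelian_group_def)
  then show ?case using \<Gamma>_add insert by simp
qed

text \<open>That \<open>A\<close> preserves sections is included because operators will be composed;
  the matrix describes the action at \<open>p\<close> only.\<close>

definition has_matrix :: "(('p \<Rightarrow> 'v) \<Rightarrow> 'p \<Rightarrow> 'v) \<Rightarrow> cmat \<Rightarrow> bool" where
  "has_matrix A a \<longleftrightarrow> (\<forall>s\<in>\<Gamma>. A s \<in> \<Gamma> \<and> (\<forall>i<n. \<kappa> (A s p) i = (\<Sum>j<n. a i j * \<kappa> (s p) j)))"

lemma has_matrix_id: "has_matrix (\<lambda>s. s) (mid n)"
proof -
  have "(\<Sum>j<n. mid n i j * \<kappa> (s p) j) = \<kappa> (s p) i" if "i < n" for s i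
  proof -
    have "(\<Sum>j<n. mid n i j * \<kappa> (s p) j) = (\<Sum>j<n. if i = j then \<kappa> (s p) j else 0)"
      by (intro sum.cong) (auto simp: mid_def)
    then show ?thesis using that by simp
  qed
  then show ?thesis by (simp add: has_matrix_def)
qed

text \<open>The inner operator returns a section, to which the matrix relation of the outer one
  applies; composition of coefficients thus becomes the matrix product \<open>mm\<close>.\<close>

lemma has_matrix_wedge:
  assumes \<alpha>: "\<And>\<sigma>. \<sigma> \<in> perms (k + l) \<Longrightarrow> has_matrix (\<alpha> (\<lambda>i. X (\<sigma> i))) (a \<sigma>)"
    and \<beta>: "\<And>\<sigma>. \<sigma> \<in> perms (k + l) \<Longrightarrow> has_matrix (\<beta> (\<lambda>i. X (\<sigma> (k + i)))) (b \<sigma>)"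
  shows "has_matrix (wedge V k l \<alpha> \<beta> X) (\<lambda>r c. \<Sum>\<sigma>\<in>perms (k + l). (sg \<sigma> / (fact k * fact l)) * mm n (a \<sigma>) (b \<sigma>) r c)"
  unfolding has_matrix_def
proof (intro ballI conjI allI impI)
  fix s assume s: "s \<in> \<Gamma>"
  define c :: "(nat \<Rightarrow> nat) \<Rightarrow> complex" where "c \<sigma> = sg \<sigma> / (fact k * fact l)" for \<sigma>
  define u where "u \<sigma> = \<alpha> (\<lambda>i. X (\<sigma> i)) (\<beta> (\<lambda>i. X (\<sigma> (k + i))) s)" for \<sigma>
  have \<beta>s: "\<beta> (\<lambda>i. X (\<sigma> (k + i))) s \<in> \<Gamma>" if "\<sigma> \<in> perms (k + l)" for \<sigma>
    using \<beta>[OF that] s by (simp add: has_matrix_def)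
  have u: "u \<sigma> \<in> \<Gamma>" if "\<sigma> \<in> perms (k + l)" for \<sigma>
    using \<alpha>[OF that] \<beta>s[OF that] by (simp add: has_matrix_def u_def)
  have fin: "finite (perms (k + l))" by (rule finite_permutations) (rule finite_lessThan)
  have eq: "wedge V k l \<alpha> \<beta> X s = (\<lambda>q. \<Oplus>\<^bsub>V q\<^esub>\<sigma>\<in>perms (k + l). c \<sigma> \<odot>\<^bsub>V q\<^esub> u \<sigma> q)"
    by (rule ext) (simp only: wedge_def c_def u_def)
  show "wedge V k l \<alpha> \<beta> X s \<in> \<Gamma>"
    unfolding eq by (rule \<Gamma>_finsum[OF fin], rule \<Gamma>_smult, rule u)
  fix i assume i: "i < n"
  have "\<kappa> (wedge V k l \<alpha> \<beta> X s p) i = (\<Sum>\<sigma>\<in>perms (k + l). \<kappa> (c \<sigma> \<odot>\<^bsub>V p\<^esub> u \<sigma> p) i)"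
    unfolding eq
    by (rule abelian_monoid.additive_finsum[where \<kappa> = "\<lambda>v. \<kappa> v i"])
      (use V[of p] fin \<kappa>_add i u \<Gamma>_mem V_smult in \<open>auto simp: abelian_group_def\<close>)
  also have "\<dots> = (\<Sum>\<sigma>\<in>perms (k + l). c \<sigma> * (\<Sum>j<n. mm n (a \<sigma>) (b \<sigma>) i j * \<kappa> (s p) j))"
  proof (rule sum.cong[OF refl])
    fix \<sigma> assume \<sigma>: "\<sigma> \<in> perms (k + l)"
    have "\<kappa> (c \<sigma> \<odot>\<^bsub>V p\<^esub> u \<sigma> p) i = c \<sigma> * \<kappa> (u \<sigma> p) i" by (rule \<kappa>_smult[OF \<Gamma>_mem[OF u[OF \<sigma>]] i])
    also have "\<kappa> (u \<sigma> p) i = (\<Sum>j<n. a \<sigma> i j * \<kappa> (\<beta> (\<lambda>i. X (\<sigma> (k + i))) s p) j)"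
      using \<alpha>[OF \<sigma>] \<beta>s[OF \<sigma>] i by (simp add: has_matrix_def u_def)
    also have "\<dots> = (\<Sum>j<n. a \<sigma> i j * (\<Sum>l<n. b \<sigma> j l * \<kappa> (s p) l))"
      using \<beta>[OF \<sigma>] s by (intro sum.cong refl) (simp add: has_matrix_def)
    also have "\<dots> = (\<Sum>j<n. \<Sum>l<n. a \<sigma> i j * b \<sigma> j l * \<kappa> (s p) l)"
      by (simp add: sum_distrib_left mult.assoc)
    also have "\<dots> = (\<Sum>l<n. \<Sum>j<n. a \<sigma> i j * b \<sigma> j l * \<kappa> (s p) l)" by (rule sum.swap)
    also have "\<dots> = (\<Sum>l<n. mm n (a \<sigma>) (b \<sigma>) i l * \<kappa> (s p) l)"
      by (simp add: mm_def sum_distrib_right)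
    finally show "\<kappa> (c \<sigma> \<odot>\<^bsub>V p\<^esub> u \<sigma> p) i = c \<sigma> * (\<Sum>j<n. mm n (a \<sigma>) (b \<sigma>) i j * \<kappa> (s p) j)" .
  qed
  also have "\<dots> = (\<Sum>\<sigma>\<in>perms (k + l). \<Sum>j<n. c \<sigma> * mm n (a \<sigma>) (b \<sigma>) i j * \<kappa> (s p) j)"
    by (simp add: sum_distrib_left mult.assoc)
  also have "\<dots> = (\<Sum>j<n. \<Sum>\<sigma>\<in>perms (k + l). c \<sigma> * mm n (a \<sigma>) (b \<sigma>) i j * \<kappa> (s p) j)" by (rule sum.swap)
  finally show "\<kappa> (wedge V k l \<alpha> \<beta> X s p) i =
      (\<Sum>j<n. (\<Sum>\<sigma>\<in>perms (k + l). (sg \<sigma> / (fact k * fact l)) * mm n (a \<sigma>) (b \<sigma>) i j) * \<kappa> (s p) j)"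
    by (simp only: c_def sum_distrib_right)
qed

text \<open>\<open>G\<close> is the set of labels for which the matrices of \<alpha> are known: a
  bounded set for the connection on \<open>E\<close>, all labels for the caloron connection.
  Permutations only rearrange the labels in use.\<close>

lemma has_matrix_wedge_power:
  assumes \<alpha>: "\<And>a. a 0 \<in> G \<Longrightarrow> a 1 \<in> G \<Longrightarrow> has_matrix (\<alpha> (\<lambda>i. Y (a i))) (W (a 0) (a 1))"
  shows "(\<And>i. i < 2 * j \<Longrightarrow> a i \<in> G) \<Longrightarrow> has_matrix (wedge_power V \<alpha> j (\<lambda>i. Y (a i))) (power_matrix n W j a)"
proof (induction j arbitrary: a)
  case 0
  then show ?case by (simp add: has_matrix_id)
next
  case (Suc j)
  have G: "a (\<sigma> i) \<in> G" if "\<sigma> \<in> perms (2 + 2 * j)" "i < 2 + 2 * j" for \<sigma> i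
  proof (rule Suc.prems)
    have "\<sigma> i \<in> {..<2 + 2 * j}" using that permutes_in_image[of \<sigma> "{..<2 + 2 * j}" i] by blast
    then show "\<sigma> i < 2 * Suc j" by simp
  qed
  show ?case
    unfolding wedge_power.simps power_matrix.simps
  proof (rule has_matrix_wedge)
    fix \<sigma> assume \<sigma>: "\<sigma> \<in> perms (2 + 2 * j)"
    show "has_matrix (\<alpha> (\<lambda>i. Y (a (\<sigma> i)))) (W (a (\<sigma> 0)) (a (\<sigma> 1)))"
      by (rule \<alpha>[where a = "\<lambda>i. a (\<sigma> i)"]) (rule G[OF \<sigma>], simp)+
    show "has_matrix (wedge_power V \<alpha> j (\<lambda>i. Y (a (\<sigma> (2 + i))))) (power_matrix n W j (\<lambda>i. a (\<sigma> (2 + i))))"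
      by (rule Suc.IH[where a = "\<lambda>i. a (\<sigma> (2 + i))"], rule G[OF \<sigma>]) simp
  qed
qed

end

lemma LC_tendsto_const: "LC_tendsto (\<lambda>x. c) c F"
  by (simp add: LC_tendsto_def uniform_limit_const)

lemma LC_Ck_on_const: "c \<in> carrier LC \<Longrightarrow> LC_Ck_on k d S (\<lambda>x. c)"
proof (induction k arbitrary: c)
  case 0
  then show ?case by (simp add: LC_tendsto_const)
next
  case (Suc k)
  have "\<exists>g. (\<forall>x\<in>S. LC_tendsto (\<lambda>t z. (c z - c z) / of_real (t - x i)) (g x)
      (at (x i) within {t. x(i := t) \<in> S})) \<and> LC_Ck_on k d S g" for i
    by (rule exI[of _ "\<lambda>x z. 0"]) (simp add: LC_tendsto_const Suc.IH[OF const_LC])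
  then show ?case using Suc.prems by (simp add: LC_tendsto_const)
qed

lemma (in corners) smooth_cyl_LC_const: "c \<in> carrier LC \<Longrightarrow> smooth_cyl M UNIV (\<lambda>m. c)"
  using LC_smooth_on_iff_cyl[of UNIV "\<lambda>m. c"] LC_Ck_on_const
  by (simp add: LC_smooth_on_def o_def)

section \<open>Sections of an \<Omega> vector bundle and operators on them\<close>

locale omega_bundle_over = corners M for M :: "'m::t2_space manifold" +
  fixes E :: "('m, 'v) omega_bundle"
  assumes ob: "omega_vector_bundle M E"
begin

abbreviation "n \<equiv> orank E"
abbreviation "N \<equiv> ofibre E"
abbreviation "\<Gamma> \<equiv> osections M E"

lemma module_N: "module LC (N m)"
  using ob by (simp add: omega_vector_bundle_def omega_module_def free_of_rank_def)

sublocale module_m: module LC "N m" for m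
  by (rule module_N)

lemma triv_open: "(U, \<Psi>) \<in> otrivs E \<Longrightarrow> open U"
  using ob by (auto simp: omega_vector_bundle_def)

lemma triv_cover: obtains U \<Psi> where "(U, \<Psi>) \<in> otrivs E" "m \<in> U"
proof -
  have "m \<in> (\<Union>(U, \<Psi>)\<in>otrivs E. U)" using ob by (simp add: omega_vector_bundle_def)
  then show ?thesis using that by blast
qed

lemma triv: "(U, \<Psi>) \<in> otrivs E \<Longrightarrow> m \<in> U \<Longrightarrow> loop_module (N m) n (\<Psi> m)"
  using ob module_N by (auto simp: omega_vector_bundle_def omega_iso_std_def loop_module_def)

lemma triv_transition:
  assumes "(U, \<Psi>) \<in> otrivs E" "(V, \<Phi>) \<in> otrivs E" "i < n" "j < n"
  shows "smooth_cyl M (U \<inter> V) (\<lambda>m. \<Phi> m (inv_into (carrier (N m)) (\<Psi> m) (unit_vector LC j)) i)"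
proof -
  have "LC_smooth_on M (U \<inter> V) (\<lambda>m. \<Phi> m (inv_into (carrier (N m)) (\<Psi> m) (unit_vector LC j)) i)"
    using ob assms unfolding omega_vector_bundle_def by blast
  then show ?thesis using LC_smooth_on_iff_cyl[of "U \<inter> V"] triv_open assms(1,2) by blast
qed

text \<open>Transition maps are linear over \<open>LC\<close>, hence act at each \<open>z\<close>
  separately through their matrix evaluated at \<open>z\<close>.\<close>

lemma coords_transition:
  assumes t: "(U, \<Psi>) \<in> otrivs E" "(V, \<Phi>) \<in> otrivs E" and m: "m \<in> U" "m \<in> V" and v: "v \<in> carrier (N m)" and i: "i < n"
  shows "\<Phi> m v i z = (\<Sum>j<n. \<Psi> m v j z * \<Phi> m (inv_into (carrier (N m)) (\<Psi> m) (unit_vector LC j)) i z)"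
proof -
  interpret A: loop_module "N m" n "\<Psi> m" by (rule triv[OF t(1) m(1)])
  interpret B: loop_module "N m" n "\<Phi> m" by (rule triv[OF t(2) m(2)])
  show ?thesis
    by (rule ring_eval.linear_expansion[OF A.ev A.iso, where l = "\<lambda>v. \<Phi> m v i z"])
      (simp_all add: B.coord_add B.coord_smult v)
qed

lemma osections_iff:
  "s \<in> \<Gamma> \<longleftrightarrow> (\<forall>m. s m \<in> carrier (N m)) \<and> (\<forall>(U, \<Psi>)\<in>otrivs E. \<forall>i<n. smooth_cyl M U (\<lambda>m. \<Psi> m (s m) i))"
proof -
  have "LC_smooth_on M (U \<inter> UNIV) (\<lambda>m. \<Psi> m (s m) i) \<longleftrightarrow> smooth_cyl M U (\<lambda>m. \<Psi> m (s m) i)"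
    if "(U, \<Psi>) \<in> otrivs E" for U \<Psi> i
    using LC_smooth_on_iff_cyl[OF triv_open[OF that]] by simp
  then show ?thesis unfolding osections_on_def by blast
qed

lemma osections_mem: "s \<in> \<Gamma> \<Longrightarrow> s m \<in> carrier (N m)"
  by (simp add: osections_iff)

lemma osections_smooth: "s \<in> \<Gamma> \<Longrightarrow> (U, \<Psi>) \<in> otrivs E \<Longrightarrow> i < n \<Longrightarrow> smooth_cyl M U (\<lambda>m. \<Psi> m (s m) i)"
  unfolding osections_iff by blast

lemma osectionsI:
  assumes "\<And>m. s m \<in> carrier (N m)"
    and "\<And>U \<Psi> i. (U, \<Psi>) \<in> otrivs E \<Longrightarrow> i < n \<Longrightarrow> smooth_cyl M U (\<lambda>m. \<Psi> m (s m) i)"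
  shows "s \<in> \<Gamma>"
  using assms unfolding osections_iff by blast

text \<open>Transition matrices are smooth, so it suffices to test a section near each point in one
  trivialisation.\<close>

lemma osections_local:
  assumes mem: "\<And>m. s m \<in> carrier (N m)"
    and loc: "\<And>m. \<exists>W U \<Psi>. (U, \<Psi>) \<in> otrivs E \<and> open W \<and> m \<in> W \<and> W \<subseteq> U \<and> (\<forall>i<n. smooth_cyl M W (\<lambda>m. \<Psi> m (s m) i))"
  shows "s \<in> \<Gamma>"
proof (rule osectionsI[OF mem])
  fix V \<Phi> i assume V: "(V, \<Phi>) \<in> otrivs E" and i: "i < n"
  show "smooth_cyl M V (\<lambda>m. \<Phi> m (s m) i)"
  proof (rule smooth_cyl_local[OF _ triv_open[OF V]])
    fix m assume m: "m \<in> V"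
    obtain W U \<Psi> where W: "(U, \<Psi>) \<in> otrivs E" "open W" "m \<in> W" "W \<subseteq> U" "\<forall>i<n. smooth_cyl M W (\<lambda>m. \<Psi> m (s m) i)"
      using loc[of m] by blast
    have "smooth_cyl M (W \<inter> V) (\<lambda>m z. \<Sum>j<n. \<Psi> m (s m) j z * \<Phi> m (inv_into (carrier (N m)) (\<Psi> m) (unit_vector LC j)) i z)"
    proof (rule smooth_cyl_sum, rule smooth_cyl_mult)
      fix j assume "j \<in> {..<n}"
      then have j: "j < n" by simp
      show "smooth_cyl M (W \<inter> V) (\<lambda>m z. \<Psi> m (s m) j z)"
        by (rule smooth_cyl_subset[of _ W]) (use W(5) j in auto)
      show "smooth_cyl M (W \<inter> V) (\<lambda>m z. \<Phi> m (inv_into (carrier (N m)) (\<Psi> m) (unit_vector LC j)) i z)"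
        by (rule smooth_cyl_subset[OF triv_transition[OF W(1) V i j]]) (use W(4) in auto)
    qed
    then have "smooth_cyl M (W \<inter> V) (\<lambda>m. \<Phi> m (s m) i)"
    proof (rule smooth_cyl_cong)
      fix q z assume "q \<in> W \<inter> V"
      then show "(\<Sum>j<n. \<Psi> q (s q) j z * \<Phi> q (inv_into (carrier (N q)) (\<Psi> q) (unit_vector LC j)) i z) = \<Phi> q (s q) i z"
        using W(4) by (intro coords_transition[OF W(1) V _ _ mem i, symmetric]) auto
    qed
    then show "\<exists>W'. open W' \<and> m \<in> W' \<and> smooth_cyl M W' (\<lambda>m. \<Phi> m (s m) i)"
      using W(2,3) m triv_open[OF V] by (intro exI[of _ "W \<inter> V"]) auto
  qed
qed

lemma smooth_cyl_LC: "smooth_cyl M UNIV f \<Longrightarrow> f m \<in> carrier LC"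
  by (rule smooth_cyl_LC_carrier[OF _ open_UNIV UNIV_I])

lemma osections_add: "s \<in> \<Gamma> \<Longrightarrow> t \<in> \<Gamma> \<Longrightarrow> (\<lambda>q. s q \<oplus>\<^bsub>N q\<^esub> t q) \<in> \<Gamma>"
proof (rule osectionsI)
  assume s: "s \<in> \<Gamma>" and t: "t \<in> \<Gamma>"
  show "s m \<oplus>\<^bsub>N m\<^esub> t m \<in> carrier (N m)" for m using osections_mem s t by simp
  fix U \<Psi> i assume U: "(U, \<Psi>) \<in> otrivs E" "i < n"
  show "smooth_cyl M U (\<lambda>m. \<Psi> m (s m \<oplus>\<^bsub>N m\<^esub> t m) i)"
  proof (rule smooth_cyl_cong[OF smooth_cyl_add[OF osections_smooth[OF s U] osections_smooth[OF t U]]])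
    fix m z assume "m \<in> U"
    then interpret loop_module "N m" n "\<Psi> m" by (rule triv[OF U(1)])
    show "\<Psi> m (s m) i z + \<Psi> m (t m) i z = \<Psi> m (s m \<oplus>\<^bsub>N m\<^esub> t m) i z"
      using osections_mem s t by (simp add: coord_add)
  qed
qed

lemma osections_smult: "smooth_cyl M UNIV f \<Longrightarrow> s \<in> \<Gamma> \<Longrightarrow> (\<lambda>q. f q \<odot>\<^bsub>N q\<^esub> s q) \<in> \<Gamma>"
proof (rule osectionsI)
  assume f: "smooth_cyl M UNIV f" and s: "s \<in> \<Gamma>"
  show "f m \<odot>\<^bsub>N m\<^esub> s m \<in> carrier (N m)" for m using osections_mem[OF s] smooth_cyl_LC[OF f] by simp
  fix U \<Psi> i assume U: "(U, \<Psi>) \<in> otrivs E" "i < n"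
  show "smooth_cyl M U (\<lambda>m. \<Psi> m (f m \<odot>\<^bsub>N m\<^esub> s m) i)"
  proof (rule smooth_cyl_cong[OF smooth_cyl_mult[OF smooth_cyl_subset[OF f subset_UNIV] osections_smooth[OF s U]]])
    fix m z assume "m \<in> U"
    then interpret loop_module "N m" n "\<Psi> m" by (rule triv[OF U(1)])
    show "f m z * \<Psi> m (s m) i z = \<Psi> m (f m \<odot>\<^bsub>N m\<^esub> s m) i z"
      using osections_mem[OF s] smooth_cyl_LC[OF f] by (simp add: coord_smult)
  qed
qed

lemma osections_zero: "(\<lambda>q. \<zero>\<^bsub>N q\<^esub>) \<in> \<Gamma>"
proof (rule osectionsI)
  fix U \<Psi> i assume U: "(U, \<Psi>) \<in> otrivs E" "i < n"
  show "smooth_cyl M U (\<lambda>m. \<Psi> m \<zero>\<^bsub>N m\<^esub> i)"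
  proof (rule smooth_cyl_cong[OF smooth_cyl_const[of _ _ 0]])
    fix m z assume "m \<in> U"
    then interpret loop_module "N m" n "\<Psi> m" by (rule triv[OF U(1)])
    show "0 = \<Psi> m \<zero>\<^bsub>N m\<^esub> i z" by (simp add: coord_zero)
  qed
qed simp

lemma osections_minus: "s \<in> \<Gamma> \<Longrightarrow> t \<in> \<Gamma> \<Longrightarrow> (\<lambda>q. s q \<ominus>\<^bsub>N q\<^esub> t q) \<in> \<Gamma>"
proof (rule osectionsI)
  assume s: "s \<in> \<Gamma>" and t: "t \<in> \<Gamma>"
  show "s m \<ominus>\<^bsub>N m\<^esub> t m \<in> carrier (N m)" for m using osections_mem s t by simp
  fix U \<Psi> i assume U: "(U, \<Psi>) \<in> otrivs E" "i < n"
  show "smooth_cyl M U (\<lambda>m. \<Psi> m (s m \<ominus>\<^bsub>N m\<^esub> t m) i)"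
  proof (rule smooth_cyl_cong[OF smooth_cyl_diff[OF osections_smooth[OF s U] osections_smooth[OF t U]]])
    fix m z assume "m \<in> U"
    then interpret loop_module "N m" n "\<Psi> m" by (rule triv[OF U(1)])
    show "\<Psi> m (s m) i z - \<Psi> m (t m) i z = \<Psi> m (s m \<ominus>\<^bsub>N m\<^esub> t m) i z"
      using osections_mem s t by (simp add: coord_minus)
  qed
qed

lemma bump_in_triv:
  assumes "(U, \<Psi>) \<in> otrivs E" "m \<in> U"
  obtains b :: "'m \<Rightarrow> real" and K where "smooth_fun M b" "b m = 1" "closed K" "K \<subseteq> U" "\<And>q. q \<notin> K \<Longrightarrow> b q = 0"
proof -
  obtain C x where ch: "(C, x) \<in> charts M" "m \<in> C" using chart_cover .
  obtain b :: "'m \<Rightarrow> real" and K where b: "smooth_fun M b" "b m = 1" "closed K" "K \<subseteq> C \<inter> U" "\<And>q. q \<notin> K \<Longrightarrow> b q = 0"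
    by (rule bump[OF ch triv_open[OF assms(1)] assms(2)]) (rule that)
  from b(4) have "K \<subseteq> U" by blast
  then show ?thesis using that b(1,2,3,5) by blast
qed

text \<open>Constant coordinates in a trivialisation, cut off by a bump function; near points
  outside \<open>U\<close> the result is zero because \<open>K\<close> is closed and contained in
  \<open>U\<close>.\<close>

lemma local_section:
  assumes U: "(U, \<Psi>) \<in> otrivs E"
    and b: "smooth_fun M b" "closed K" "K \<subseteq> U" "\<And>q. q \<notin> K \<Longrightarrow> b q = (0::real)"
    and c: "c \<in> carrier (free_module LC n)"
  defines "s \<equiv> \<lambda>q. if q \<in> U then (\<lambda>z. of_real (b q)) \<odot>\<^bsub>N q\<^esub> inv_into (carrier (N q)) (\<Psi> q) c else \<zero>\<^bsub>N q\<^esub>"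
  shows "s \<in> \<Gamma>" "\<And>q i z. q \<in> U \<Longrightarrow> \<Psi> q (s q) i z = of_real (b q) * c i z"
proof -
  have g: "inv_into (carrier (N q)) (\<Psi> q) c \<in> carrier (N q)" "\<Psi> q (inv_into (carrier (N q)) (\<Psi> q) c) = c" if "q \<in> U" for q
    using module_iso_inv[OF loop_module.iso[OF triv[OF U that]] c] by auto
  have mem: "s q \<in> carrier (N q)" for q
    using g const_LC by (simp add: s_def)
  show coord: "\<Psi> q (s q) i z = of_real (b q) * c i z" if "q \<in> U" for q i z
  proof -
    interpret loop_module "N q" n "\<Psi> q" by (rule triv[OF U that])
    show ?thesis using that g[OF that] by (simp add: s_def coord_smult const_LC)
  qed
  show "s \<in> \<Gamma>"
  proof (rule osections_local[OF mem])
    fix m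
    show "\<exists>W U \<Psi>. (U, \<Psi>) \<in> otrivs E \<and> open W \<and> m \<in> W \<and> W \<subseteq> U \<and> (\<forall>i<n. smooth_cyl M W (\<lambda>m. \<Psi> m (s m) i))"
    proof (cases "m \<in> U")
      case True
      have "smooth_cyl M U (\<lambda>m. \<Psi> m (s m) i)" if i: "i < n" for i
      proof (rule smooth_cyl_cong)
        have "c i \<in> carrier LC" using c i by (simp add: free_module_def)
        then have "smooth_cyl M U (\<lambda>q. c i)"
          by (intro smooth_cyl_subset[OF smooth_cyl_LC_const subset_UNIV])
        moreover have "smooth_cyl M U (\<lambda>q z. of_real (b q) :: complex)"
          by (rule smooth_cyl_bounded_linear[OF bounded_linear_of_real
                smooth_cyl_subset[OF b(1)[unfolded smooth_fun_on_iff_cyl] subset_UNIV]])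
        ultimately show "smooth_cyl M U (\<lambda>q z. of_real (b q) * c i z)" by - (rule smooth_cyl_mult)
      qed (simp add: coord)
      then show ?thesis using True U triv_open[OF U] by blast
    next
      case False
      obtain V \<Phi> where V: "(V, \<Phi>) \<in> otrivs E" "m \<in> V" using triv_cover .
      have "smooth_cyl M (V \<inter> - K) (\<lambda>m. \<Phi> m (s m) i)" if i: "i < n" for i
      proof (rule smooth_cyl_cong[OF smooth_cyl_const[of _ _ 0]])
        fix q z assume q: "q \<in> V \<inter> - K"
        interpret loop_module "N q" n "\<Phi> q" by (rule triv[OF V(1)]) (use q in simp)
        show "0 = \<Phi> q (s q) i z"
          using q b(4) g[of q] by (cases "q \<in> U") (simp_all add: s_def coord_zero coord_smult const_LC)
      qed
      moreover have "m \<in> V \<inter> - K" using V False b(3) by blast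
      moreover have "open (V \<inter> - K)" using triv_open[OF V(1)] b(2) by blast
      ultimately show ?thesis using V(1) by blast
    qed
  qed
qed

text \<open>\<open>endo_at\<close> chooses a section through a given vector; this guarantees that
  the choice is possible.\<close>

lemma section_through:
  assumes v: "v \<in> carrier (N m)"
  shows "\<exists>s\<in>\<Gamma>. s m = v"
proof -
  obtain U \<Psi> where U: "(U, \<Psi>) \<in> otrivs E" "m \<in> U" using triv_cover .
  obtain b :: "'m \<Rightarrow> real" and K where b: "smooth_fun M b" "b m = 1" "closed K" "K \<subseteq> U" "\<And>q. q \<notin> K \<Longrightarrow> b q = 0"
    by (rule bump_in_triv[OF U]) (rule that)
  interpret loop_module "N m" n "\<Psi> m" by (rule triv[OF U])
  have c: "\<Psi> m v \<in> carrier (free_module LC n)" by (rule module_iso_mem[OF iso v])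
  have "\<exists>s\<in>\<Gamma>. \<forall>i z. \<Psi> m (s m) i z = of_real (b m) * \<Psi> m v i z"
    by (rule bexI[OF _ local_section(1)[OF U(1) b(1,3,4) b(5) c]], intro allI,
        rule local_section(2)[OF U(1) b(1,3,4) b(5) c U(2)])
  then obtain s where s: "s \<in> \<Gamma>" "\<And>i z. \<Psi> m (s m) i z = of_real (b m) * \<Psi> m v i z" by blast
  have "s m = v"
    by (rule coord_eqI[OF osections_mem[OF s(1)] v]) (simp add: s(2) b(2))
  then show ?thesis using s(1) by blast
qed

text \<open>Multipliers are functions on the product with the circle, given as smooth families of
  loops. Linearity over functions on \<open>M\<close> alone would localise an operator at
  \<open>m\<close>, but not at \<open>z\<close>.\<close>

definition tensorial :: "(('m \<Rightarrow> 'v) \<Rightarrow> 'm \<Rightarrow> 'v) \<Rightarrow> bool" where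
  "tensorial A \<longleftrightarrow> (\<forall>s\<in>\<Gamma>. A s \<in> \<Gamma>) \<and>
     (\<forall>s\<in>\<Gamma>. \<forall>t\<in>\<Gamma>. \<forall>m. A (\<lambda>q. s q \<oplus>\<^bsub>N q\<^esub> t q) m = A s m \<oplus>\<^bsub>N m\<^esub> A t m) \<and>
     (\<forall>f s m. smooth_cyl M UNIV f \<longrightarrow> s \<in> \<Gamma> \<longrightarrow> A (\<lambda>q. f q \<odot>\<^bsub>N q\<^esub> s q) m = f m \<odot>\<^bsub>N m\<^esub> A s m)"

lemma tensorialD:
  assumes "tensorial A"
  shows "s \<in> \<Gamma> \<Longrightarrow> A s \<in> \<Gamma>"
    and "s \<in> \<Gamma> \<Longrightarrow> t \<in> \<Gamma> \<Longrightarrow> A (\<lambda>q. s q \<oplus>\<^bsub>N q\<^esub> t q) m = A s m \<oplus>\<^bsub>N m\<^esub> A t m"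
    and "smooth_cyl M UNIV f \<Longrightarrow> s \<in> \<Gamma> \<Longrightarrow> A (\<lambda>q. f q \<odot>\<^bsub>N q\<^esub> s q) m = f m \<odot>\<^bsub>N m\<^esub> A s m"
  using assms unfolding tensorial_def by blast+

text \<open>With a bump function \<open>b\<close> at \<open>m\<close>, a section \<open>s\<close> is
  (1 - b^2) times \<open>s\<close> plus the sum of \<open>b\<close> times its coordinates, each
  multiplying \<open>b\<close> times a basis vector. At \<open>m\<close> the first summand
  disappears, and linearity over functions gives the matrix.\<close>

lemma tensorial_matrix:
  assumes A: "tensorial A" and U: "(U, \<Psi>) \<in> otrivs E" "m \<in> U"
  obtains a where "supported n a" "\<And>s i. s \<in> \<Gamma> \<Longrightarrow> i < n \<Longrightarrow> \<Psi> m (A s m) i z = (\<Sum>j<n. a i j * \<Psi> m (s m) j z)"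
proof -
  obtain b :: "'m \<Rightarrow> real" and K where b: "smooth_fun M b" "b m = 1" "closed K" "K \<subseteq> U" "\<And>q. q \<notin> K \<Longrightarrow> b q = 0"
    by (rule bump_in_triv[OF U]) (rule that)
  define e where "e j = (\<lambda>q. if q \<in> U then (\<lambda>z. of_real (b q)) \<odot>\<^bsub>N q\<^esub> inv_into (carrier (N q)) (\<Psi> q) (unit_vector LC j) else \<zero>\<^bsub>N q\<^esub>)" for j
  interpret loop_module "N m" n "\<Psi> m" by (rule triv[OF U])
  have unit: "unit_vector LC j \<in> carrier (free_module LC n)" if "j < n" for j
    by (rule ring_eval.unit_vector_mem[OF ev that])
  have e: "e j \<in> \<Gamma>" and e_coord: "\<And>q i z. q \<in> U \<Longrightarrow> \<Psi> q (e j q) i z = of_real (b q) * unit_vector LC j i z" if "j < n" for j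
    unfolding e_def using local_section[OF U(1) b(1,3,4) _ unit[OF that]] b(5) by blast+
  define a where "a i j = (if i < n \<and> j < n then \<Psi> m (A (e j) m) i z else 0)" for i j
  have "\<Psi> m (A s m) i z = (\<Sum>j<n. a i j * \<Psi> m (s m) j z)" if s: "s \<in> \<Gamma>" and i: "i < n" for s i
  proof -
    define f where "f j = (\<lambda>q z. if q \<in> U then b q *\<^sub>R \<Psi> q (s q) j z else 0)" for j
    have f: "smooth_cyl M UNIV (f j)" if "j < n" for j
      unfolding f_def
      by (rule smooth_cyl_extend[OF b(1,3,4) _ triv_open[OF U(1)] osections_smooth[OF s U(1) that]]) (rule b(5))
    define g where "g = (\<lambda>q (z::circle). 1 - complex_of_real (b q) * complex_of_real (b q))"
    have bc: "smooth_cyl M UNIV (\<lambda>q (z::circle). complex_of_real (b q))"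
      by (rule smooth_cyl_bounded_linear[OF bounded_linear_of_real b(1)[unfolded smooth_fun_on_iff_cyl]])
    have g: "smooth_cyl M UNIV g"
      unfolding g_def by (rule smooth_cyl_diff[OF smooth_cyl_const smooth_cyl_mult[OF bc bc]])
    \<comment> \<open>Partial sums that start with the remainder term, so that additivity of
      \<open>A\<close> is applied to one frame section at a time.\<close>
    define S where "S = rec_nat (\<lambda>q. g q \<odot>\<^bsub>N q\<^esub> s q) (\<lambda>l t q. t q \<oplus>\<^bsub>N q\<^esub> (f l q \<odot>\<^bsub>N q\<^esub> e l q))"
    have S0: "S 0 = (\<lambda>q. g q \<odot>\<^bsub>N q\<^esub> s q)" and SSuc: "\<And>l. S (Suc l) = (\<lambda>q. S l q \<oplus>\<^bsub>N q\<^esub> (f l q \<odot>\<^bsub>N q\<^esub> e l q))"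
      by (simp_all add: S_def)
    have S\<Gamma>: "S l \<in> \<Gamma>" if "l \<le> n" for l
      using that by (induction l) (simp_all add: S0 SSuc osections_add osections_smult f g e s)
    have AS: "\<Psi> m (A (S l) m) i z = g m z * \<Psi> m (A s m) i z + (\<Sum>j<l. f j m z * \<Psi> m (A (e j) m) i z)" if "l \<le> n" for l
      using that
    proof (induction l)
      case 0
      show ?case
        unfolding S0 tensorialD(3)[OF A g s]
        using osections_mem[OF tensorialD(1)[OF A s]] smooth_cyl_LC[OF g] by (simp add: coord_smult)
    next
      case (Suc l)
      then have l: "l < n" "l \<le> n" by auto
      note fe = osections_smult[OF f[OF l(1)] e[OF l(1)]]
      have "A (S (Suc l)) m = A (S l) m \<oplus>\<^bsub>N m\<^esub> (f l m \<odot>\<^bsub>N m\<^esub> A (e l) m)"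
        unfolding SSuc tensorialD(2)[OF A S\<Gamma>[OF l(2)] fe] tensorialD(3)[OF A f[OF l(1)] e[OF l(1)]] ..
      then show ?case
        using Suc.IH[OF l(2)] osections_mem[OF tensorialD(1)[OF A S\<Gamma>[OF l(2)]]]
          osections_mem[OF tensorialD(1)[OF A e[OF l(1)]]] smooth_cyl_LC[OF f[OF l(1)]]
        by (simp add: coord_add coord_smult)
    qed
    have "S n = s"
    proof
      fix q
      \<comment> \<open>On \<open>U\<close> the given trivialisation is used; elsewhere any other
        one will do, since \<open>b\<close> is zero there and only the remainder is left.\<close>
      obtain V \<Phi> where V: "(V, \<Phi>) \<in> otrivs E" "q \<in> V" "q \<in> U \<Longrightarrow> \<Phi> = \<Psi>"
        using triv_cover[of q] U(1) by metis
      interpret Q: loop_module "N q" n "\<Phi> q" by (rule triv[OF V(1,2)])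
      have coord: "\<Phi> q (S l q) i' z' = g q z' * \<Phi> q (s q) i' z' + (\<Sum>j<l. f j q z' * \<Phi> q (e j q) i' z')" if "l \<le> n" for l i' z'
        using that
      proof (induction l)
        case 0
        then show ?case using osections_mem[OF s] smooth_cyl_LC[OF g] by (simp add: S0 Q.coord_smult)
      next
        case (Suc l)
        then have l: "l < n" "l \<le> n" by auto
        then show ?case
          using Suc.IH[OF l(2)] osections_mem[OF S\<Gamma>[OF l(2)]] osections_mem[OF e[OF l(1)]] smooth_cyl_LC[OF f[OF l(1)]]
          by (simp add: SSuc Q.coord_add Q.coord_smult)
      qed
      show "S n q = s q"
      proof (rule Q.coord_eqI[OF osections_mem[OF S\<Gamma>[OF order_refl]] osections_mem[OF s]])
        fix i' z' assume i': "i' < n"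
        show "\<Phi> q (S n q) i' z' = \<Phi> q (s q) i' z'"
        proof (cases "q \<in> U")
          case True
          then have \<Phi>: "\<Phi> = \<Psi>" by (rule V(3))
          have "(\<Sum>j<n. f j q z' * \<Psi> q (e j q) i' z') = (\<Sum>j<n. if i' = j then of_real (b q) * \<Psi> q (s q) j z' * of_real (b q) else 0)"
            using True by (intro sum.cong refl) (simp add: e_coord f_def unit_vector_def LC_def scaleR_conv_of_real)
          also have "\<dots> = of_real (b q) * of_real (b q) * \<Psi> q (s q) i' z'" using i' by simp
          finally have sum: "(\<Sum>j<n. f j q z' * \<Psi> q (e j q) i' z') = of_real (b q) * of_real (b q) * \<Psi> q (s q) i' z'" .
          show ?thesis
            using coord[OF order_refl, of i' z'] unfolding \<Phi> sum by (simp add: g_def algebra_simps)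
        next
          case False
          then have "b q = 0" using b(4,5) by blast
          then show ?thesis unfolding coord[OF order_refl] using False by (simp add: g_def f_def)
        qed
      qed
    qed
    then have "\<Psi> m (A s m) i z = (\<Sum>j<n. f j m z * \<Psi> m (A (e j) m) i z)"
      using AS[OF order_refl] b(2) by (simp add: g_def)
    also have "\<dots> = (\<Sum>j<n. a i j * \<Psi> m (s m) j z)"
      using U(2) b(2) i by (intro sum.cong refl) (simp add: a_def f_def)
    finally show ?thesis .
  qed
  moreover have "supported n a" by (simp add: supported_def a_def)
  ultimately show ?thesis using that by blast
qed

end

section \<open>The caloron connection\<close>

lemma minus_complex_scalars: "v \<ominus>\<^bsub>complex_scalars N\<^esub> w = v \<ominus>\<^bsub>N\<^esub> w"
  by (simp add: a_minus_def a_inv_def m_inv_def complex_scalars_def)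

lemma curvature_cong:
  assumes "X 0 = Y 0" "X 1 = Y 1"
  shows "curvature M V D X = curvature M V D Y"
  by (intro ext) (simp only: curvature_def assms)

lemma (in corners) lie_bracket_vector_field:
  assumes X: "X \<in> vector_fields M" and Y: "Y \<in> vector_fields M"
  shows "lie_bracket M X Y \<in> vector_fields M"
  unfolding vector_fields_def
proof (intro CollectI conjI allI impI)
  show "lie_bracket M X Y p \<in> tangent_space M p" for p by (rule lie_bracket_tangent[OF X Y])
  fix f :: "'m \<Rightarrow> real" assume f: "smooth_fun M f"
  have s: "smooth_fun M (\<lambda>q. X q g)" "smooth_fun M (\<lambda>q. Y q g)" if "smooth_fun M g" for g
    using X Y that by (auto simp: vector_fields_def)
  have "smooth_fun M (\<lambda>p. X p (\<lambda>q. Y q f) - Y p (\<lambda>q. X q f))"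
    by (rule smooth_fun_diff[OF s(1)[OF s(2)[OF f]] s(2)[OF s(1)[OF f]]])
  then show "smooth_fun M (\<lambda>p. lie_bracket M X Y p f)" using f by (simp add: lie_bracket_def)
qed

lemma (in omega_bundle_over) tensorialI:
  assumes "\<And>s. s \<in> \<Gamma> \<Longrightarrow> A s \<in> \<Gamma>"
    and "\<And>s t m. s \<in> \<Gamma> \<Longrightarrow> t \<in> \<Gamma> \<Longrightarrow> A (\<lambda>q. s q \<oplus>\<^bsub>N q\<^esub> t q) m = A s m \<oplus>\<^bsub>N m\<^esub> A t m"
    and "\<And>f s m. smooth_cyl M UNIV f \<Longrightarrow> s \<in> \<Gamma> \<Longrightarrow> A (\<lambda>q. f q \<odot>\<^bsub>N q\<^esub> s q) m = f m \<odot>\<^bsub>N m\<^esub> A s m"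
  shows "tensorial A"
  unfolding tensorial_def by (intro conjI ballI allI impI) (fact assms)+

locale connected_bundle = omega_bundle_over M E for M :: "'m::t2_space manifold" and E :: "('m, 'v) omega_bundle" +
  fixes D :: "('m, 'v) covariant_derivative" and \<phi> :: "'m \<Rightarrow> 'v \<Rightarrow> 'v"
  assumes mconn: "module_connection M E D" and higgs: "higgs_field M E \<phi>"
begin

lemmas mconn_conjuncts =
  mconn[unfolded module_connection_def, THEN conjunct1]
  mconn[unfolded module_connection_def, THEN conjunct2, THEN conjunct1]
  mconn[unfolded module_connection_def, THEN conjunct2, THEN conjunct2, THEN conjunct1]
  mconn[unfolded module_connection_def, THEN conjunct2, THEN conjunct2, THEN conjunct2, THEN conjunct1]
  mconn[unfolded module_connection_def, THEN conjunct2, THEN conjunct2, THEN conjunct2, THEN conjunct2, THEN conjunct1]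

lemmas higgs_conjuncts =
  higgs[unfolded higgs_field_def, THEN conjunct1]
  higgs[unfolded higgs_field_def, THEN conjunct2, THEN conjunct1]
  higgs[unfolded higgs_field_def, THEN conjunct2, THEN conjunct2, THEN conjunct2, THEN conjunct1]
  higgs[unfolded higgs_field_def, THEN conjunct2, THEN conjunct2, THEN conjunct2, THEN conjunct2]

lemma D_mem: "X \<in> tangent_space M m \<Longrightarrow> s \<in> \<Gamma> \<Longrightarrow> D m X s \<in> carrier (N m)"
  by (rule mconn_conjuncts(1)[rule_format])

lemma D_lin: "X \<in> tangent_space M m \<Longrightarrow> Y \<in> tangent_space M m \<Longrightarrow> s \<in> \<Gamma> \<Longrightarrow>
    D m (\<lambda>f. a * X f + b * Y f) s =
      ((\<lambda>z. of_real a) \<odot>\<^bsub>N m\<^esub> D m X s) \<oplus>\<^bsub>N m\<^esub> ((\<lambda>z. of_real b) \<odot>\<^bsub>N m\<^esub> D m Y s)"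
  by (rule mconn_conjuncts(2)[rule_format])

lemma D_add: "X \<in> tangent_space M m \<Longrightarrow> s \<in> \<Gamma> \<Longrightarrow> s' \<in> \<Gamma> \<Longrightarrow>
    D m X (\<lambda>q. s q \<oplus>\<^bsub>N q\<^esub> s' q) = D m X s \<oplus>\<^bsub>N m\<^esub> D m X s'"
  by (rule mconn_conjuncts(3)[rule_format])

lemma D_leibniz:
  assumes X: "X \<in> tangent_space M m" and s: "s \<in> \<Gamma>" and f: "smooth_cyl M UNIV f"
  shows "D m X (\<lambda>q. f q \<odot>\<^bsub>N q\<^esub> s q) =
    ((\<lambda>z. cderiv X (\<lambda>q. f q z)) \<odot>\<^bsub>N m\<^esub> s m) \<oplus>\<^bsub>N m\<^esub> (f m \<odot>\<^bsub>N m\<^esub> D m X s)"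
proof -
  let ?f = "\<lambda>p. f (fst p) (snd p)"
  have "smooth_fun (times_circle M) ?f"
    unfolding smooth_times_circle_iff_UNIV by (simp add: f)
  then have "D m X (\<lambda>q. (\<lambda>z. ?f (q, z)) \<odot>\<^bsub>N q\<^esub> s q) =
    ((\<lambda>z. cderiv X (\<lambda>q. ?f (q, z))) \<odot>\<^bsub>N m\<^esub> s m) \<oplus>\<^bsub>N m\<^esub> ((\<lambda>z. ?f (m, z)) \<odot>\<^bsub>N m\<^esub> D m X s)"
    by (rule mconn_conjuncts(4)[rule_format, OF X s])
  then show ?thesis by simp
qed

lemma vf_tangent: "X \<in> vector_fields M \<Longrightarrow> X m \<in> tangent_space M m"
  by (simp add: vector_fields_def)

lemma D_section: "X \<in> vector_fields M \<Longrightarrow> s \<in> \<Gamma> \<Longrightarrow> (\<lambda>m. D m (X m) s) \<in> \<Gamma>"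
  by (rule mconn_conjuncts(5)[rule_format])

lemma \<phi>_mem: "v \<in> carrier (N m) \<Longrightarrow> \<phi> m v \<in> carrier (N m)"
  by (rule higgs_conjuncts(1)[rule_format])

lemma \<phi>_add: "v \<in> carrier (N m) \<Longrightarrow> w \<in> carrier (N m) \<Longrightarrow> \<phi> m (v \<oplus>\<^bsub>N m\<^esub> w) = \<phi> m v \<oplus>\<^bsub>N m\<^esub> \<phi> m w"
  by (rule higgs_conjuncts(2)[rule_format])

lemma \<phi>_leibniz: "f \<in> carrier LC \<Longrightarrow> v \<in> carrier (N m) \<Longrightarrow>
    \<phi> m (f \<odot>\<^bsub>N m\<^esub> v) = (dcirc f \<odot>\<^bsub>N m\<^esub> v) \<oplus>\<^bsub>N m\<^esub> (f \<odot>\<^bsub>N m\<^esub> \<phi> m v)"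
  by (rule higgs_conjuncts(3)[rule_format])

lemma \<phi>_section: "s \<in> \<Gamma> \<Longrightarrow> (\<lambda>m. \<phi> m (s m)) \<in> \<Gamma>"
  by (rule higgs_conjuncts(4)[rule_format, OF open_UNIV])

lemma D_zero:
  assumes "s \<in> \<Gamma>"
  shows "D m (\<lambda>f. 0) s = \<zero>\<^bsub>N m\<^esub>"
proof -
  obtain U \<Psi> where U: "(U, \<Psi>) \<in> otrivs E" "m \<in> U" using triv_cover .
  interpret loop_module "N m" n "\<Psi> m" by (rule triv[OF U])
  have mem: "D m (\<lambda>f. 0) s \<in> carrier (N m)" by (rule D_mem[OF zero_tangent assms])
  have "D m (\<lambda>f. 0 * 0 + 0 * 0) s = ((\<lambda>z. of_real 0) \<odot>\<^bsub>N m\<^esub> D m (\<lambda>f. 0) s) \<oplus>\<^bsub>N m\<^esub> ((\<lambda>z. of_real 0) \<odot>\<^bsub>N m\<^esub> D m (\<lambda>f. 0) s)"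
    by (rule D_lin[OF zero_tangent zero_tangent assms])
  then have eq: "D m (\<lambda>f. 0) s = ((\<lambda>z. 0) \<odot>\<^bsub>N m\<^esub> D m (\<lambda>f. 0) s) \<oplus>\<^bsub>N m\<^esub> ((\<lambda>z. 0) \<odot>\<^bsub>N m\<^esub> D m (\<lambda>f. 0) s)" by simp
  show ?thesis
  proof (rule coord_eqI[OF mem])
    fix i z
    show "\<Psi> m (D m (\<lambda>f. 0) s) i z = \<Psi> m \<zero>\<^bsub>N m\<^esub> i z"
      by (subst eq) (simp add: coord_add coord_smult coord_zero const_LC mem)
  qed simp
qed

lemma curvature_E:
  "curvature M (complex_fibre E) D X s m =
    (D m (X 0 m) (\<lambda>q. D q (X 1 q) s) \<ominus>\<^bsub>N m\<^esub> D m (X 1 m) (\<lambda>q. D q (X 0 q) s)) \<ominus>\<^bsub>N m\<^esub> D m (lie_bracket M (X 0) (X 1) m) s"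
  by (simp add: curvature_def complex_fibre_def minus_complex_scalars)

text \<open>The terms with one derivative of \<open>f\<close> cancel in pairs, those with two
  derivatives cancel against the bracket. Applying the Leibniz rule twice is possible because
  \<open>Xf\<close> and \<open>Yf\<close> are again smooth families.\<close>

lemma curvature_tensorial:
  assumes X0: "X 0 \<in> vector_fields M" and X1: "X 1 \<in> vector_fields M"
  shows "tensorial (curvature M (complex_fibre E) D X)"
proof -
  let ?X = "X 0" and ?Y = "X 1"
  let ?B = "lie_bracket M ?X ?Y"
  have Z: "?B \<in> vector_fields M" by (rule lie_bracket_vector_field[OF X0 X1])
  note t = vf_tangent[OF X0] vf_tangent[OF X1] vf_tangent[OF Z]
  note sec = D_section[OF X0] D_section[OF X1] D_section[OF Z]
  note mem = D_mem[OF t(1)] D_mem[OF t(2)] D_mem[OF t(3)]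
  show ?thesis
  proof (rule tensorialI)
    fix s assume s: "s \<in> \<Gamma>"
    show "curvature M (complex_fibre E) D X s \<in> \<Gamma>"
    proof -
      have "curvature M (complex_fibre E) D X s = (\<lambda>m. (D m (?X m) (\<lambda>q. D q (?Y q) s) \<ominus>\<^bsub>N m\<^esub> D m (?Y m) (\<lambda>q. D q (?X q) s)) \<ominus>\<^bsub>N m\<^esub> D m (?B m) s)"
        by (rule ext) (rule curvature_E)
      then show ?thesis
        using osections_minus[OF osections_minus[OF sec(1)[OF sec(2)[OF s]] sec(2)[OF sec(1)[OF s]]] sec(3)[OF s]] by simp
    qed
  next
    fix s s' m assume s: "s \<in> \<Gamma>" and s': "s' \<in> \<Gamma>"
      obtain U \<Psi> where U: "(U, \<Psi>) \<in> otrivs E" "m \<in> U" using triv_cover .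
      interpret loop_module "N m" n "\<Psi> m" by (rule triv[OF U])
      have 1: "(\<lambda>q. D q (?Y q) (\<lambda>q. s q \<oplus>\<^bsub>N q\<^esub> s' q)) = (\<lambda>q. D q (?Y q) s \<oplus>\<^bsub>N q\<^esub> D q (?Y q) s')"
        by (rule ext) (rule D_add[OF t(2) s s'])
      have 2: "(\<lambda>q. D q (?X q) (\<lambda>q. s q \<oplus>\<^bsub>N q\<^esub> s' q)) = (\<lambda>q. D q (?X q) s \<oplus>\<^bsub>N q\<^esub> D q (?X q) s')"
        by (rule ext) (rule D_add[OF t(1) s s'])
      show "curvature M (complex_fibre E) D X (\<lambda>q. s q \<oplus>\<^bsub>N q\<^esub> s' q) m = curvature M (complex_fibre E) D X s m \<oplus>\<^bsub>N m\<^esub> curvature M (complex_fibre E) D X s' m"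
        unfolding curvature_E 1 2 D_add[OF t(1) sec(2)[OF s] sec(2)[OF s']] D_add[OF t(2) sec(1)[OF s] sec(1)[OF s']] D_add[OF t(3) s s']
        by (rule coord_eqI) (simp_all add: coord_add coord_minus mem sec s s' del: One_nat_def)
  next
    fix f :: "'m \<Rightarrow> circle \<Rightarrow> complex" and s m assume f: "smooth_cyl M UNIV f" and s: "s \<in> \<Gamma>"
    obtain U \<Psi> where U: "(U, \<Psi>) \<in> otrivs E" "m \<in> U" using triv_cover .
    interpret loop_module "N m" n "\<Psi> m" by (rule triv[OF U])
    define Xf where "Xf = (\<lambda>q z. cderiv (?X q) (\<lambda>q. f q z))"
    define Yf where "Yf = (\<lambda>q z. cderiv (?Y q) (\<lambda>q. f q z))"
    have Xf: "smooth_cyl M UNIV Xf" and Yf: "smooth_cyl M UNIV Yf"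
      unfolding Xf_def Yf_def by (rule vector_field_smooth_cyl[OF X0 f], rule vector_field_smooth_cyl[OF X1 f])
    have X: "D q (?X q) (\<lambda>q. g q \<odot>\<^bsub>N q\<^esub> r q) = ((\<lambda>z. cderiv (?X q) (\<lambda>q. g q z)) \<odot>\<^bsub>N q\<^esub> r q) \<oplus>\<^bsub>N q\<^esub> (g q \<odot>\<^bsub>N q\<^esub> D q (?X q) r)"
      if "smooth_cyl M UNIV g" "r \<in> \<Gamma>" for g r q by (rule D_leibniz[OF t(1) that(2,1)])
    have Y: "D q (?Y q) (\<lambda>q. g q \<odot>\<^bsub>N q\<^esub> r q) = ((\<lambda>z. cderiv (?Y q) (\<lambda>q. g q z)) \<odot>\<^bsub>N q\<^esub> r q) \<oplus>\<^bsub>N q\<^esub> (g q \<odot>\<^bsub>N q\<^esub> D q (?Y q) r)"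
      if "smooth_cyl M UNIV g" "r \<in> \<Gamma>" for g r q by (rule D_leibniz[OF t(2) that(2,1)])
    have 1: "(\<lambda>q. D q (?Y q) (\<lambda>q. f q \<odot>\<^bsub>N q\<^esub> s q)) = (\<lambda>q. (Yf q \<odot>\<^bsub>N q\<^esub> s q) \<oplus>\<^bsub>N q\<^esub> (f q \<odot>\<^bsub>N q\<^esub> D q (?Y q) s))"
      unfolding Yf_def by (rule ext) (rule Y[OF f s])
    have 2: "(\<lambda>q. D q (?X q) (\<lambda>q. f q \<odot>\<^bsub>N q\<^esub> s q)) = (\<lambda>q. (Xf q \<odot>\<^bsub>N q\<^esub> s q) \<oplus>\<^bsub>N q\<^esub> (f q \<odot>\<^bsub>N q\<^esub> D q (?X q) s))"
      unfolding Xf_def by (rule ext) (rule X[OF f s])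
    have XYf: "(\<lambda>z. cderiv (?X m) (\<lambda>q. Yf q z)) \<in> carrier LC" and YXf: "(\<lambda>z. cderiv (?Y m) (\<lambda>q. Xf q z)) \<in> carrier LC"
      and Bf: "(\<lambda>z. cderiv (?B m) (\<lambda>q. f q z)) \<in> carrier LC"
      by (rule cderiv_family(1)[OF Yf t(1)], rule cderiv_family(1)[OF Xf t(2)], rule cderiv_family(1)[OF f t(3)])
    have br: "cderiv (?B m) (\<lambda>q. f q z) = cderiv (?X m) (\<lambda>q. Yf q z) - cderiv (?Y m) (\<lambda>q. Xf q z)" for z
      unfolding Xf_def Yf_def by (rule cderiv_lie_bracket[OF smooth_cyl_slice[OF f]])
    note LC = smooth_cyl_LC[OF f] smooth_cyl_LC[OF Xf] smooth_cyl_LC[OF Yf] XYf YXf Bf[unfolded br]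
    have eX: "(\<lambda>z. cderiv (?X m) (\<lambda>q. f q z)) = Xf m" and eY: "(\<lambda>z. cderiv (?Y m) (\<lambda>q. f q z)) = Yf m"
      by (simp_all add: Xf_def Yf_def)
    show "curvature M (complex_fibre E) D X (\<lambda>q. f q \<odot>\<^bsub>N q\<^esub> s q) m = f m \<odot>\<^bsub>N m\<^esub> curvature M (complex_fibre E) D X s m"
      unfolding curvature_E 1 2 D_add[OF t(1) osections_smult[OF Yf s] osections_smult[OF f sec(2)[OF s]]]
        D_add[OF t(2) osections_smult[OF Xf s] osections_smult[OF f sec(1)[OF s]]]
        X[OF Yf s] X[OF f sec(2)[OF s]] Y[OF Xf s] Y[OF f sec(1)[OF s]] D_leibniz[OF t(3) s f] eX eY
      by (rule coord_eqI)
        (simp_all add: coord_add coord_minus coord_smult mem sec s LC osections_mem[OF s] br algebra_simps del: One_nat_def)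
  qed
qed

lemma curvature_coord_swap:
  assumes X0: "X 0 \<in> vector_fields M" and X1: "X 1 \<in> vector_fields M" and s: "s \<in> \<Gamma>"
    and U: "(U, \<Psi>) \<in> otrivs E" "m \<in> U" and Y: "Y 0 = X 1" "Y 1 = X 0"
  shows "\<Psi> m (curvature M (complex_fibre E) D Y s m) i z = - \<Psi> m (curvature M (complex_fibre E) D X s m) i z"
proof -
  interpret loop_module "N m" n "\<Psi> m" by (rule triv[OF U])
  let ?B = "lie_bracket M (X 0) (X 1)"
  have B: "?B m \<in> tangent_space M m" by (rule lie_bracket_tangent[OF X0 X1])
  \<comment> \<open>Written as a combination with a zero term, to fit the linearity clause of
    \<open>module_connection\<close>.\<close>
  have "lie_bracket M (X 1) (X 0) m = (\<lambda>f. (- 1) * ?B m f + 0 * ?B m f)"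
    by (auto simp: lie_bracket_def fun_eq_iff)
  then have "D m (lie_bracket M (X 1) (X 0) m) s =
      ((\<lambda>z. of_real (- 1)) \<odot>\<^bsub>N m\<^esub> D m (?B m) s) \<oplus>\<^bsub>N m\<^esub> ((\<lambda>z. of_real 0) \<odot>\<^bsub>N m\<^esub> D m (?B m) s)"
    by (simp only: D_lin[OF B B s])
  then show ?thesis
    unfolding curvature_E Y
    by (simp add: coord_minus coord_add coord_smult const_LC D_mem[OF B s] D_mem[OF vf_tangent[OF X0]] D_mem[OF vf_tangent[OF X1]]
        D_section[OF X0] D_section[OF X1] s del: One_nat_def)
qed

text \<open>The Leibniz terms of the connection and of the Higgs field cancel each other crosswise;
  what is left is the commutator of \<open>X 0\<close> and the angular derivative applied to
  \<open>f\<close>, which is zero.\<close>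

lemma higgs_derivative_tensorial:
  assumes X0: "X 0 \<in> vector_fields M"
  shows "tensorial (higgs_derivative E D \<phi> X)"
proof -
  let ?X = "X 0"
  note t = vf_tangent[OF X0]
  note sec = D_section[OF X0]
  note mem = D_mem[OF t]
  show ?thesis
  proof (rule tensorialI)
    fix s assume s: "s \<in> \<Gamma>"
    show "higgs_derivative E D \<phi> X s \<in> \<Gamma>"
    proof -
      have "higgs_derivative E D \<phi> X s = (\<lambda>m. D m (?X m) (\<lambda>q. \<phi> q (s q)) \<ominus>\<^bsub>N m\<^esub> \<phi> m (D m (?X m) s))"
        by (rule ext) (simp only: higgs_derivative_def)
      then show ?thesis using osections_minus[OF sec[OF \<phi>_section[OF s]] \<phi>_section[OF sec[OF s]]] by simp
    qed
  next
    fix s s' m assume s: "s \<in> \<Gamma>" and s': "s' \<in> \<Gamma>"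
      obtain U \<Psi> where U: "(U, \<Psi>) \<in> otrivs E" "m \<in> U" using triv_cover .
      interpret loop_module "N m" n "\<Psi> m" by (rule triv[OF U])
      have 1: "(\<lambda>q. \<phi> q (s q \<oplus>\<^bsub>N q\<^esub> s' q)) = (\<lambda>q. \<phi> q (s q) \<oplus>\<^bsub>N q\<^esub> \<phi> q (s' q))"
        by (rule ext) (rule \<phi>_add[OF osections_mem[OF s] osections_mem[OF s']])
      show "higgs_derivative E D \<phi> X (\<lambda>q. s q \<oplus>\<^bsub>N q\<^esub> s' q) m = higgs_derivative E D \<phi> X s m \<oplus>\<^bsub>N m\<^esub> higgs_derivative E D \<phi> X s' m"
        unfolding higgs_derivative_def 1 D_add[OF t s s'] D_add[OF t \<phi>_section[OF s] \<phi>_section[OF s']]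
          \<phi>_add[OF mem[OF s] mem[OF s']]
        by (rule coord_eqI) (simp_all add: coord_add coord_minus mem \<phi>_mem \<phi>_section s s')
  next
    fix f :: "'m \<Rightarrow> circle \<Rightarrow> complex" and s m assume f: "smooth_cyl M UNIV f" and s: "s \<in> \<Gamma>"
    obtain U \<Psi> where U: "(U, \<Psi>) \<in> otrivs E" "m \<in> U" using triv_cover .
    interpret loop_module "N m" n "\<Psi> m" by (rule triv[OF U])
    define Xf where "Xf = (\<lambda>z. cderiv (?X m) (\<lambda>q. f q z))"
    have Xf: "Xf \<in> carrier LC" unfolding Xf_def by (rule cderiv_family(1)[OF f t])
    have df: "smooth_cyl M UNIV (\<lambda>q. dcirc (f q))" by (rule smooth_cyl_dcirc[OF f open_UNIV])
    have Xdf: "(\<lambda>z. cderiv (?X m) (\<lambda>q. dcirc (f q) z)) = dcirc Xf"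
      unfolding Xf_def by (rule cderiv_family(2)[OF f t, symmetric])
    have 1: "(\<lambda>q. \<phi> q (f q \<odot>\<^bsub>N q\<^esub> s q)) = (\<lambda>q. (dcirc (f q) \<odot>\<^bsub>N q\<^esub> s q) \<oplus>\<^bsub>N q\<^esub> (f q \<odot>\<^bsub>N q\<^esub> \<phi> q (s q)))"
      by (rule ext) (rule \<phi>_leibniz[OF smooth_cyl_LC[OF f] osections_mem[OF s]])
    note LC = smooth_cyl_LC[OF f] smooth_cyl_LC[OF df] Xf LC_dcirc[OF Xf]
    have 2: "\<phi> m ((Xf \<odot>\<^bsub>N m\<^esub> s m) \<oplus>\<^bsub>N m\<^esub> (f m \<odot>\<^bsub>N m\<^esub> D m (?X m) s)) =
        ((dcirc Xf \<odot>\<^bsub>N m\<^esub> s m) \<oplus>\<^bsub>N m\<^esub> (Xf \<odot>\<^bsub>N m\<^esub> \<phi> m (s m))) \<oplus>\<^bsub>N m\<^esub>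
        ((dcirc (f m) \<odot>\<^bsub>N m\<^esub> D m (?X m) s) \<oplus>\<^bsub>N m\<^esub> (f m \<odot>\<^bsub>N m\<^esub> \<phi> m (D m (?X m) s)))"
      by (subst \<phi>_add) (simp_all add: \<phi>_leibniz LC mem s osections_mem[OF s])
    show "higgs_derivative E D \<phi> X (\<lambda>q. f q \<odot>\<^bsub>N q\<^esub> s q) m = f m \<odot>\<^bsub>N m\<^esub> higgs_derivative E D \<phi> X s m"
      unfolding higgs_derivative_def 1 D_add[OF t osections_smult[OF df s] osections_smult[OF f \<phi>_section[OF s]]]
        D_leibniz[OF t s df] D_leibniz[OF t \<phi>_section[OF s] f] D_leibniz[OF t s f] Xdf Xf_def[symmetric] 2
      by (rule coord_eqI)
        (simp_all add: coord_add coord_minus coord_smult mem \<phi>_mem \<phi>_section s LC osections_mem[OF s] algebra_simps)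
  qed
qed

section \<open>Evaluation of sections and the caloron transform\<close>

abbreviation "TM \<equiv> times_circle M"
abbreviation "cfib \<equiv> cfibre (caloron E)"
abbreviation "csec \<equiv> csections TM (caloron E)"
abbreviation "ev \<equiv> evaluate E"
abbreviation "nabla \<equiv> caloron_connection M E D \<phi>"

text \<open>The same coset as \<open>cls\<close>, but free of any trivialisation, so that it can be
  used for global sections.\<close>

definition coset_at :: "'m \<Rightarrow> circle \<Rightarrow> 'v \<Rightarrow> 'v set" where
  "coset_at m z v = vanishing_at n (N m) z +>\<^bsub>N m\<^esub> v"

lemma cfib_eq: "cfib (m, z) = fibre_at n (N m) z"
  by (simp add: caloron_def)

lemma ev_eq: "ev s (m, z) = coset_at m z (s m)"
  by (simp add: evaluate_def coset_at_def)

lemma coset_at_cls: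
  assumes "(U, \<Psi>) \<in> otrivs E" "m \<in> U" "v \<in> carrier (N m)"
  shows "coset_at m z v = loop_module.cls (N m) n (\<Psi> m) z v"
  unfolding coset_at_def by (rule loop_module.coset[OF triv[OF assms(1,2)] assms(3)])

lemma cfib_group: "abelian_group (cfib q)"
proof -
  obtain m z where q: "q = (m, z)" by (cases q)
  obtain U \<Psi> where U: "(U, \<Psi>) \<in> otrivs E" "m \<in> U" using triv_cover .
  show ?thesis unfolding q cfib_eq by (rule loop_module.abelian_group_V[OF triv[OF U]])
qed

lemma cfib_carrier: "carrier (cfib (m, z)) = coset_at m z ` carrier (N m)"
proof -
  obtain U \<Psi> where U: "(U, \<Psi>) \<in> otrivs E" "m \<in> U" using triv_cover .
  show ?thesis unfolding cfib_eq loop_module.carrier_V[OF triv[OF U]]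
    by (intro image_cong refl) (simp add: coset_at_cls[OF U])
qed

lemma cfib_add:
  assumes "v \<in> carrier (N m)" "w \<in> carrier (N m)"
  shows "coset_at m z v \<oplus>\<^bsub>cfib (m, z)\<^esub> coset_at m z w = coset_at m z (v \<oplus>\<^bsub>N m\<^esub> w)"
proof -
  obtain U \<Psi> where U: "(U, \<Psi>) \<in> otrivs E" "m \<in> U" using triv_cover .
  show ?thesis using loop_module.add_V[OF triv[OF U] assms] assms by (simp add: cfib_eq coset_at_cls[OF U])
qed

lemma cfib_minus:
  assumes "v \<in> carrier (N m)" "w \<in> carrier (N m)"
  shows "coset_at m z v \<ominus>\<^bsub>cfib (m, z)\<^esub> coset_at m z w = coset_at m z (v \<ominus>\<^bsub>N m\<^esub> w)"
proof -
  obtain U \<Psi> where U: "(U, \<Psi>) \<in> otrivs E" "m \<in> U" using triv_cover .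
  show ?thesis using loop_module.minus_V[OF triv[OF U] assms] assms by (simp add: cfib_eq coset_at_cls[OF U])
qed

lemma cfib_smult:
  assumes "v \<in> carrier (N m)"
  shows "c \<odot>\<^bsub>cfib (m, z)\<^esub> coset_at m z v = coset_at m z ((\<lambda>z. c) \<odot>\<^bsub>N m\<^esub> v)"
proof -
  obtain U \<Psi> where U: "(U, \<Psi>) \<in> otrivs E" "m \<in> U" using triv_cover .
  show ?thesis using loop_module.smult_V[OF triv[OF U] assms] assms const_LC by (simp add: cfib_eq coset_at_cls[OF U])
qed

lemma cfib_zero: "\<zero>\<^bsub>cfib (m, z)\<^esub> = coset_at m z \<zero>\<^bsub>N m\<^esub>"
proof -
  obtain U \<Psi> where U: "(U, \<Psi>) \<in> otrivs E" "m \<in> U" using triv_cover .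
  show ?thesis using loop_module.zero_V[OF triv[OF U]] by (simp add: cfib_eq coset_at_cls[OF U])
qed

lemma coset_at_eq_iff:
  assumes "(U, \<Psi>) \<in> otrivs E" "m \<in> U" "v \<in> carrier (N m)" "w \<in> carrier (N m)"
  shows "coset_at m z v = coset_at m z w \<longleftrightarrow> (\<forall>i<n. \<Psi> m v i z = \<Psi> m w i z)"
  using loop_module.cls_eq_iff[OF triv[OF assms(1,2)] assms(3,4)] by (simp add: coset_at_cls[OF assms(1,2)] assms(3,4))

definition rep_coord :: "('m \<Rightarrow> 'v \<Rightarrow> nat \<Rightarrow> circle \<Rightarrow> complex) \<Rightarrow> 'm \<Rightarrow> circle \<Rightarrow> 'v set \<Rightarrow> nat \<Rightarrow> complex" where
  "rep_coord \<Psi> m z K i = \<Psi> m (SOME v. v \<in> K) i z"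

lemma rep_coord_fibre_coord: "rep_coord \<Psi> m z = loop_module.fibre_coord (\<Psi> m) z" if "loop_module (N m) n (\<Psi> m)"
  by (intro ext) (simp add: rep_coord_def loop_module.fibre_coord_def[OF that])

lemma rep_coord_coset:
  assumes "(U, \<Psi>) \<in> otrivs E" "m \<in> U" "v \<in> carrier (N m)"
  shows "rep_coord \<Psi> m z (coset_at m z v) i = \<Psi> m v i z"
  unfolding coset_at_cls[OF assms] rep_coord_fibre_coord[where \<Psi> = \<Psi> and m = m, OF triv[OF assms(1,2)]]
  by (rule loop_module.fibre_coord_cls[OF triv[OF assms(1,2)] assms(3)])

lemma csections_iff:
  "t \<in> csec \<longleftrightarrow> (\<forall>p. t p \<in> carrier (cfib p)) \<and>
     (\<forall>(U, \<Psi>)\<in>otrivs E. \<forall>i<n. smooth_cyl M U (\<lambda>m z. rep_coord \<Psi> m z (t (m, z)) i))"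
proof -
  have trivs: "(\<forall>(U, \<psi>)\<in>ctrivs (caloron E). P U \<psi>) \<longleftrightarrow>
      (\<forall>(U, \<Psi>)\<in>otrivs E. P (U \<times> UNIV) (\<lambda>(m, z). rep_coord \<Psi> m z))" for P
    by (auto simp: caloron_def rep_coord_def[abs_def])
  have "smooth_fun_on TM (U \<times> UNIV) (\<lambda>p. (case p of (m, z) \<Rightarrow> rep_coord \<Psi> m z) (t p) i) \<longleftrightarrow>
      smooth_cyl M U (\<lambda>m z. rep_coord \<Psi> m z (t (m, z)) i)" if "(U, \<Psi>) \<in> otrivs E" for U \<Psi> i
    using smooth_times_circle_iff[OF triv_open[OF that], of "\<lambda>p. (case p of (m, z) \<Rightarrow> rep_coord \<Psi> m z) (t p) i"] by simp
  moreover have "crank (caloron E) = n" by (simp add: caloron_def)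
  ultimately show ?thesis
    unfolding csections_def mem_Collect_eq trivs by fastforce
qed

lemma ev_csec: "s \<in> \<Gamma> \<Longrightarrow> ev s \<in> csec"
  unfolding csections_iff
proof (intro conjI allI ballI)
  fix p :: "'m \<times> circle" assume s: "s \<in> \<Gamma>"
  obtain m z where p: "p = (m, z)" by (cases p)
  show "ev s p \<in> carrier (cfib p)" unfolding p ev_eq cfib_carrier by (rule imageI[OF osections_mem[OF s]])
next
  fix p assume s: "s \<in> \<Gamma>" and p: "p \<in> otrivs E"
  obtain U \<Psi> where U: "p = (U, \<Psi>)" by (cases p)
  have "smooth_cyl M U (\<lambda>m z. rep_coord \<Psi> m z (ev s (m, z)) i)" if i: "i < n" for i
  proof (rule smooth_cyl_cong)
    show "smooth_cyl M U (\<lambda>m z. \<Psi> m (s m) i z)" using osections_smooth[OF s _ i] p U by simp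
    show "\<Psi> m (s m) i z = rep_coord \<Psi> m z (ev s (m, z)) i" if "m \<in> U" for m z
      unfolding ev_eq using p U by (intro rep_coord_coset[OF _ that osections_mem[OF s], symmetric]) simp
  qed
  then show "case p of (U, \<Psi>) \<Rightarrow> \<forall>i<n. smooth_cyl M U (\<lambda>m z. rep_coord \<Psi> m z (ev s (m, z)) i)" by (simp add: U)
qed

text \<open>At a point \<open>m\<close> the values of \<open>t\<close> are cosets at different
  \<open>z\<close> with unrelated representatives. Their coordinates form smooth families, so each
  coordinate is a loop, and the tuple of these loops is one element of the fibre that represents all
  values.\<close>

lemma csec_ev:
  assumes t: "t \<in> csec"
  obtains s where "s \<in> \<Gamma>" "t = ev s"
proof -
  have tm: "\<exists>v\<in>carrier (N m). t (m, z) = coset_at m z v" for m z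
  proof -
    have "t (m, z) \<in> carrier (cfib (m, z))" by (rule t[unfolded csections_iff, THEN conjunct1, rule_format])
    then show ?thesis unfolding cfib_carrier by (simp only: image_iff)
  qed
  have ts: "smooth_cyl M U (\<lambda>m z. rep_coord \<Psi> m z (t (m, z)) i)" if "(U, \<Psi>) \<in> otrivs E" "i < n" for U \<Psi> i
    using bspec[OF t[unfolded csections_iff, THEN conjunct2] that(1)] that(2) by simp
  have "\<exists>v\<in>carrier (N m). \<forall>z. t (m, z) = coset_at m z v" for m
  proof -
    obtain U \<Psi> where U: "(U, \<Psi>) \<in> otrivs E" "m \<in> U" using triv_cover .
    interpret loop_module "N m" n "\<Psi> m" by (rule triv[OF U])
    \<comment> \<open>Zero beyond \<open>n\<close>, as membership in the free module
      demands.\<close>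
    define c where "c = (\<lambda>i z. if i < n then rep_coord \<Psi> m z (t (m, z)) i else 0)"
    have "c i \<in> carrier LC" if "i < n" for i
      using smooth_cyl_LC_carrier[OF ts[OF U(1) that] triv_open[OF U(1)] U(2)] that by (simp add: c_def)
    then have "c \<in> carrier (free_module LC n)" by (simp add: free_module_def c_def LC_def)
    note g = module_iso_inv[OF iso this]
    have "t (m, z) = coset_at m z (inv_into (carrier (N m)) (\<Psi> m) c)" for z
    proof -
      obtain v where v: "v \<in> carrier (N m)" "t (m, z) = coset_at m z v" using tm[of m z] by (rule bexE)
      show ?thesis
        unfolding v(2) coset_at_eq_iff[OF U v(1) g(1)] g(2)
        using rep_coord_coset[OF U v(1)] v(2) by (simp add: c_def)
    qed
    then show ?thesis by (intro bexI[OF _ g(1)] allI)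
  qed
  then have "\<exists>s. \<forall>m. s m \<in> carrier (N m) \<and> (\<forall>z. t (m, z) = coset_at m z (s m))"
    unfolding Bex_def by (rule choice[OF allI])
  then obtain s where s: "\<And>m. s m \<in> carrier (N m)" "\<And>m z. t (m, z) = coset_at m z (s m)" by blast
  have "s \<in> \<Gamma>"
  proof (rule osectionsI[OF s(1)])
    fix U \<Psi> i assume U: "(U, \<Psi>) \<in> otrivs E" "i < n"
    show "smooth_cyl M U (\<lambda>m. \<Psi> m (s m) i)"
      by (rule smooth_cyl_cong[OF ts[OF U]]) (simp add: s(2) rep_coord_coset[OF U(1) _ s(1)])
  qed
  moreover have "t = ev s" by (rule ext) (simp only: split_paired_all ev_eq s(2))
  ultimately show ?thesis by (rule that)
qed

text \<open>The caloron connection recovers the section of \<open>E\<close> by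
  \<open>inv_into\<close>, so injectivity is what lets it be computed. It holds because an element
  of a fibre is determined by its values at all \<open>z\<close>.\<close>

lemma ev_inj: "inj_on ev \<Gamma>"
proof (rule inj_onI, rule ext)
  fix s s' m assume s: "s \<in> \<Gamma>" "s' \<in> \<Gamma>" and eq: "ev s = ev s'"
  obtain U \<Psi> where U: "(U, \<Psi>) \<in> otrivs E" "m \<in> U" using triv_cover .
  interpret loop_module "N m" n "\<Psi> m" by (rule triv[OF U])
  show "s m = s' m"
  proof (rule coord_eqI[OF osections_mem[OF s(1)] osections_mem[OF s(2)]])
    fix i z assume i: "i < n"
    have "coset_at m z (s m) = coset_at m z (s' m)" using fun_cong[OF eq, of "(m, z)"] by (simp only: ev_eq)
    then show "\<Psi> m (s m) i z = \<Psi> m (s' m) i z"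
      unfolding coset_at_eq_iff[OF U osections_mem[OF s(1)] osections_mem[OF s(2)]] using i by blast
  qed
qed

lemma nabla_ev:
  assumes s: "s \<in> \<Gamma>"
  shows "nabla (m, z) Y (ev s) = coset_at m z (D m (push_fst M Y) s) \<oplus>\<^bsub>cfib (m, z)\<^esub>
     (of_real (dtheta z Y) \<odot>\<^bsub>cfib (m, z)\<^esub> coset_at m z (\<phi> m (s m)))"
  by (simp add: caloron_connection_def Let_def inv_into_f_f[OF ev_inj s] coset_at_def cfib_eq)

lemma nabla_horizontal:
  assumes s: "s \<in> \<Gamma>" and "dtheta z Y = 0" "push_fst M Y \<in> tangent_space M m"
  shows "nabla (m, z) Y (ev s) = coset_at m z (D m (push_fst M Y) s)"
proof -
  note v = D_mem[OF assms(3) s] and w = \<phi>_mem[OF osections_mem[OF s, of m]]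
  obtain U \<Psi> where U: "(U, \<Psi>) \<in> otrivs E" "m \<in> U" using triv_cover .
  interpret loop_module "N m" n "\<Psi> m" by (rule triv[OF U])
  have "D m (push_fst M Y) s \<oplus>\<^bsub>N m\<^esub> ((\<lambda>z. 0) \<odot>\<^bsub>N m\<^esub> \<phi> m (s m)) = D m (push_fst M Y) s"
    by (rule coord_eqI) (simp_all add: v w const_LC coord_add coord_smult)
  then show ?thesis unfolding nabla_ev[OF s] assms(2) using v w by (simp add: cfib_smult cfib_add const_LC)
qed

lemma sin_rep: "sin (rep_circle (circ t) - c) = sin (t - c)"
proof -
  obtain k :: int where k: "rep_circle (circ t) = t + 2 * pi * of_int k" by (rule rep_circ_obtain)
  have "sin ((t - c) + 2 * pi * of_int k) = sin (t - c)"
    unfolding sin_add by (simp add: sin_int_2pin cos_int_2pin)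
  then show ?thesis by (simp add: k algebra_simps)
qed

lemma smooth_sin: "smooth_fun TM (\<lambda>(m', z'). sin (rep_circle z' - c))"
  unfolding smooth_times_circle_iff_UNIV
proof (rule smooth_cylI)
  fix U and x :: "'m \<Rightarrow> nat \<Rightarrow> real"
  show "Cinf_on (Suc d) (cyl d (x ` (U \<inter> UNIV))) (\<lambda>y. case (inv_into U x (y(d := 0)), circ (y d)) of (m', z') \<Rightarrow> sin (rep_circle z' - c))"
    unfolding case_prod_conv sin_rep by (rule Cinf_on_sin[OF Cinf_on_coord])
qed

lemma smooth_pullback: "smooth_fun M f \<Longrightarrow> smooth_fun TM (\<lambda>(m, z). f m)"
  unfolding smooth_times_circle_iff_UNIV smooth_fun_on_iff_cyl by simp

lemma lift_pullback: "smooth_fun M f \<Longrightarrow> lift_vfield M X q (\<lambda>(m, z). f m) = X (fst q) f"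
  using smooth_pullback[of f] by (simp add: lift_vfield_def split_beta)

lemma theta_pullback: "theta_vfield M q (\<lambda>(m, z). f m) = 0"
  by (simp add: theta_vfield_def split_beta)

lemma theta_const: "theta_vfield M q (\<lambda>q. c) = 0"
  by (simp add: theta_vfield_def split_beta)

lemma lift_fibre: "X \<in> vector_fields M \<Longrightarrow> lift_vfield M X q (\<lambda>(m, z). g z) = 0"
  by (simp add: lift_vfield_def split_beta tangent_const[OF vf_tangent])

lemma lift_const: "X \<in> vector_fields M \<Longrightarrow> lift_vfield M X q (\<lambda>q. c) = 0"
  by (simp add: lift_vfield_def split_beta tangent_const[OF vf_tangent])

text \<open>The angular derivative of this sine depends on the angle alone, so lifted fields
  annihilate it; hence the \<open>dtheta\<close> component of the brackets vanishes.\<close>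

lemma theta_fibre: "\<exists>h. (\<lambda>q. theta_vfield M q (\<lambda>(m', z'). sin (rep_circle z' - c))) = (\<lambda>(m, z). h z)"
  by (rule exI[of _ "\<lambda>z. deriv (\<lambda>t. sin (rep_circle (circ t) - c)) (rep_circle z)"])
    (auto simp: theta_vfield_def smooth_sin)

lemma not_smooth_tangent: "X \<in> tangent_space M m \<Longrightarrow> \<not> smooth_fun M f \<Longrightarrow> X f = 0"
  by (simp add: tangent_space_def)

lemma push_lift: "X \<in> vector_fields M \<Longrightarrow> push_fst M (lift_vfield M X (m, z)) = X m"
  by (rule ext) (auto simp: push_fst_def lift_pullback not_smooth_tangent[OF vf_tangent])

lemma push_theta: "push_fst M (theta_vfield M q) = (\<lambda>f. 0)"
  by (rule ext) (simp add: push_fst_def theta_pullback)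

lemma dtheta_lift: "X \<in> vector_fields M \<Longrightarrow> dtheta z (lift_vfield M X q) = 0"
  unfolding dtheta_def by (rule lift_fibre)

lemma dtheta_theta: "dtheta z (theta_vfield M (m, z)) = 1"
proof -
  have "((\<lambda>t. sin (t - rep_circle z)) has_real_derivative cos (rep_circle z - rep_circle z) * 1) (at (rep_circle z))"
    by (auto intro!: derivative_eq_intros)
  then have "deriv (\<lambda>t. sin (t - rep_circle z)) (rep_circle z) = 1"
    using DERIV_imp_deriv by fastforce
  then show ?thesis by (simp add: dtheta_def theta_vfield_def smooth_sin sin_rep)
qed

lemma push_bracket_lift:
  assumes X: "X \<in> vector_fields M" and Y: "Y \<in> vector_fields M"
  shows "push_fst M (lie_bracket TM (lift_vfield M X) (lift_vfield M Y) (m, z)) = lie_bracket M X Y m"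
proof
  fix f
  have s: "smooth_fun M (\<lambda>q. X q g)" "smooth_fun M (\<lambda>q. Y q g)" if "smooth_fun M g" for g
    using X Y that by (auto simp: vector_fields_def)
  show "push_fst M (lie_bracket TM (lift_vfield M X) (lift_vfield M Y) (m, z)) f = lie_bracket M X Y m f"
  proof (cases "smooth_fun M f")
    case True
    have eq: "(\<lambda>q. lift_vfield M Z q (\<lambda>(m, z). f m)) = (\<lambda>(m, z). Z m f)" for Z
      by (rule ext) (simp add: lift_pullback[OF True] split_beta)
    show ?thesis
      unfolding push_fst_def lie_bracket_def if_P[OF True] if_P[OF smooth_pullback[OF True]] eq
      by (simp add: lift_pullback s True)
  next
    case False
    then show ?thesis by (simp add: push_fst_def lie_bracket_def)
  qed
qed

text \<open>The caloron connection sees a tangent vector only through its push-forward and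
  \<open>dtheta\<close>. For the former, brackets are tested on pullbacks from \<open>M\<close>,
  which the circle direction annihilates, also after differentiation along a lift.\<close>

lemma push_bracket_theta:
  assumes X: "X \<in> vector_fields M"
  shows "push_fst M (lie_bracket TM (lift_vfield M X) (theta_vfield M) q) = (\<lambda>f. 0)"
    "push_fst M (lie_bracket TM (theta_vfield M) (lift_vfield M X) q) = (\<lambda>f. 0)"
    "push_fst M (lie_bracket TM (theta_vfield M) (theta_vfield M) q) = (\<lambda>f. 0)"
proof -
  have eq: "(\<lambda>q. lift_vfield M X q (\<lambda>(m, z). f m)) = (\<lambda>(m, z). X m f)" if "smooth_fun M f" for f
    by (rule ext) (simp add: lift_pullback[OF that] split_beta)
  show "push_fst M (lie_bracket TM (lift_vfield M X) (theta_vfield M) q) = (\<lambda>f. 0)"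
    "push_fst M (lie_bracket TM (theta_vfield M) (lift_vfield M X) q) = (\<lambda>f. 0)"
    "push_fst M (lie_bracket TM (theta_vfield M) (theta_vfield M) q) = (\<lambda>f. 0)"
    by (auto simp: fun_eq_iff push_fst_def lie_bracket_def theta_pullback lift_const[OF X] theta_const eq)
qed

lemma dtheta_bracket:
  assumes X: "X \<in> vector_fields M"
  shows "Y \<in> vector_fields M \<Longrightarrow> dtheta z (lie_bracket TM (lift_vfield M X) (lift_vfield M Y) q) = 0"
    "dtheta z (lie_bracket TM (lift_vfield M X) (theta_vfield M) q) = 0"
    "dtheta z (lie_bracket TM (theta_vfield M) (lift_vfield M X) q) = 0"
    "dtheta z (lie_bracket TM (theta_vfield M) (theta_vfield M) q) = 0"
proof -
  obtain h where h: "(\<lambda>q. theta_vfield M q (\<lambda>(m', z'). sin (rep_circle z' - rep_circle z))) = (\<lambda>(m, z). h z)"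
    using theta_fibre by blast
  show "Y \<in> vector_fields M \<Longrightarrow> dtheta z (lie_bracket TM (lift_vfield M X) (lift_vfield M Y) q) = 0"
    "dtheta z (lie_bracket TM (lift_vfield M X) (theta_vfield M) q) = 0"
    "dtheta z (lie_bracket TM (theta_vfield M) (lift_vfield M X) q) = 0"
    "dtheta z (lie_bracket TM (theta_vfield M) (theta_vfield M) q) = 0"
    by (simp_all add: dtheta_def lie_bracket_def h lift_fibre[OF X] lift_fibre lift_const[OF X] lift_const theta_const)
qed

lemma nabla_lift:
  assumes X: "X \<in> vector_fields M" and s: "s \<in> \<Gamma>"
  shows "(\<lambda>p. nabla p (lift_vfield M X p) (ev s)) = ev (\<lambda>m. D m (X m) s)"
proof
  fix p :: "'m \<times> circle"
  obtain m z where p: "p = (m, z)" by (cases p)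
  show "nabla p (lift_vfield M X p) (ev s) = ev (\<lambda>m. D m (X m) s) p"
    unfolding p ev_eq
    by (subst nabla_horizontal[OF s dtheta_lift[OF X]]) (simp_all add: push_lift[OF X] vf_tangent[OF X])
qed

lemma nabla_theta:
  assumes s: "s \<in> \<Gamma>"
  shows "(\<lambda>p. nabla p (theta_vfield M p) (ev s)) = ev (\<lambda>m. \<phi> m (s m))"
proof
  fix p :: "'m \<times> circle"
  obtain m z where p: "p = (m, z)" by (cases p)
  note w = \<phi>_mem[OF osections_mem[OF s, of m]]
  obtain U \<Psi> where U: "(U, \<Psi>) \<in> otrivs E" "m \<in> U" using triv_cover .
  interpret loop_module "N m" n "\<Psi> m" by (rule triv[OF U])
  have "\<zero>\<^bsub>N m\<^esub> \<oplus>\<^bsub>N m\<^esub> ((\<lambda>z. 1) \<odot>\<^bsub>N m\<^esub> \<phi> m (s m)) = \<phi> m (s m)"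
    by (rule coord_eqI) (simp_all add: w const_LC coord_add coord_smult coord_zero)
  then show "nabla p (theta_vfield M p) (ev s) = ev (\<lambda>m. \<phi> m (s m)) p"
    unfolding p ev_eq nabla_ev[OF s] push_theta dtheta_theta D_zero[OF s]
    using w by (simp add: cfib_smult cfib_add const_LC)
qed

end

text \<open>The section chosen by \<open>endo_at\<close> is arbitrary, but the coordinates of the
  result depend only on those of \<open>v\<close> once \<open>A\<close> has a matrix.\<close>

lemma (in form_space) endo_at_matrix:
  assumes A: "has_matrix A a" and v: "\<exists>s\<in>\<Gamma>. s p = v"
  shows "endo_at \<Gamma> A p v \<in> carrier (V p)"
    and "i < n \<Longrightarrow> \<kappa> (endo_at \<Gamma> A p v) i = (\<Sum>j<n. a i j * \<kappa> v j)"
proof -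
  define s where "s = (SOME s. s \<in> \<Gamma> \<and> s p = v)"
  have "\<exists>s. s \<in> \<Gamma> \<and> s p = v" using v by blast
  then have "s \<in> \<Gamma> \<and> s p = v" unfolding s_def by (rule someI_ex)
  then have s: "s \<in> \<Gamma>" "s p = v" by blast+
  have e: "endo_at \<Gamma> A p v = A s p" by (simp add: endo_at_def s_def)
  have As: "A s \<in> \<Gamma>" "\<And>i. i < n \<Longrightarrow> \<kappa> (A s p) i = (\<Sum>j<n. a i j * \<kappa> (s p) j)"
    using A s(1) unfolding has_matrix_def by blast+
  show "endo_at \<Gamma> A p v \<in> carrier (V p)" unfolding e by (rule \<Gamma>_mem[OF As(1)])
  show "i < n \<Longrightarrow> \<kappa> (endo_at \<Gamma> A p v) i = (\<Sum>j<n. a i j * \<kappa> v j)" unfolding e As(2) s(2) ..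
qed

context connected_bundle
begin

lemma section_frame:
  assumes U: "(U, \<Psi>) \<in> otrivs E" "m \<in> U"
  obtains e where "\<And>j. j < n \<Longrightarrow> e j \<in> \<Gamma>" "\<And>j. j < n \<Longrightarrow> \<Psi> m (e j m) = unit_vector LC j"
proof -
  interpret loop_module "N m" n "\<Psi> m" by (rule triv[OF U])
  have "\<exists>s. s \<in> \<Gamma> \<and> \<Psi> m (s m) = unit_vector LC j" if "j < n" for j
  proof -
    note g = module_iso_inv[OF iso ring_eval.unit_vector_mem[OF ev that]]
    obtain s where "s \<in> \<Gamma>" "s m = inv_into (carrier (N m)) (\<Psi> m) (unit_vector LC j)"
      using section_through[OF g(1)] by blast
    then show ?thesis using g(2) by (intro exI[of _ s]) simp
  qed
  then have "\<forall>j. \<exists>s. j < n \<longrightarrow> s \<in> \<Gamma> \<and> \<Psi> m (s m) = unit_vector LC j" by blast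
  then have "\<exists>e. \<forall>j. j < n \<longrightarrow> e j \<in> \<Gamma> \<and> \<Psi> m (e j m) = unit_vector LC j" by (rule choice)
  then show ?thesis using that by blast
qed

text \<open>With one frame fixed for all operators, matrix entries are coordinates of
  \<open>A (e j)\<close>, so that relations between operators, such as antisymmetry, become
  relations between matrices.\<close>

lemma tensorial_frame:
  assumes A: "tensorial A" and U: "(U, \<Psi>) \<in> otrivs E" "m \<in> U"
    and e: "\<And>j. j < n \<Longrightarrow> e j \<in> \<Gamma>" "\<And>j. j < n \<Longrightarrow> \<Psi> m (e j m) = unit_vector LC j"
    and s: "s \<in> \<Gamma>" and i: "i < n"
  shows "\<Psi> m (A s m) i z = (\<Sum>j<n. \<Psi> m (A (e j) m) i z * \<Psi> m (s m) j z)"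
proof -
  obtain a where a: "\<And>s i. s \<in> \<Gamma> \<Longrightarrow> i < n \<Longrightarrow> \<Psi> m (A s m) i z = (\<Sum>j<n. a i j * \<Psi> m (s m) j z)"
    by (rule tensorial_matrix[OF A U, of z]) (rule that)
  have "\<Psi> m (A (e j) m) i z = a i j" if j: "j < n" for j
  proof -
    have "\<Psi> m (A (e j) m) i z = (\<Sum>l<n. if l = j then a i l else 0)"
      unfolding a[OF e(1)[OF j] i] e(2)[OF j]
      by (rule sum.cong[OF refl]) (simp add: unit_vector_def LC_def)
    then show ?thesis using j by simp
  qed
  then show ?thesis unfolding a[OF s i] by (intro sum.cong[OF refl]) simp
qed

text \<open>The curvature of the caloron connection carried back to \<open>M\<close>, with labels
  from \<open>k\<close> on standing for the circle direction. A second label of this kind gives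
  \<triangle>\<phi>, a first one its negative.\<close>

definition curvature_component :: "(nat \<Rightarrow> 'm vfield) \<Rightarrow> nat \<Rightarrow> nat \<Rightarrow> nat \<Rightarrow> ('m \<Rightarrow> 'v) \<Rightarrow> 'm \<Rightarrow> 'v" where
  "curvature_component X k a b s =
     (if a < k then
        if b < k then curvature M (complex_fibre E) D (\<lambda>i. if i = 0 then X a else X b) s
        else higgs_derivative E D \<phi> (\<lambda>i. X a) s
      else if b < k then (\<lambda>m. \<phi> m (D m (X b m) s) \<ominus>\<^bsub>N m\<^esub> D m (X b m) (\<lambda>q. \<phi> q (s q)))
      else (\<lambda>m. \<zero>\<^bsub>N m\<^esub>))"

context
  fixes X :: "nat \<Rightarrow> 'm vfield" and k :: nat
  assumes X: "\<forall>i<k. X i \<in> vector_fields M"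
begin

lemmas X_field = X[rule_format]

abbreviation "\<Omega> \<equiv> curvature_component X k"
abbreviation "Y a \<equiv> (if a < k then lift_vfield M (X a) else theta_vfield M)"

lemma \<Omega>_tensorial:
  assumes "a < k"
  shows "tensorial (\<Omega> a b)"
proof (cases "b < k")
  case True
  have "tensorial (curvature M (complex_fibre E) D (\<lambda>i. if i = 0 then X a else X b))"
    by (rule curvature_tensorial) (simp_all add: X_field assms True)
  moreover have "\<Omega> a b = curvature M (complex_fibre E) D (\<lambda>i. if i = 0 then X a else X b)"
    by (rule ext) (simp add: curvature_component_def assms True)
  ultimately show ?thesis by (simp only:)
next
  case False
  have "tensorial (higgs_derivative E D \<phi> (\<lambda>i. X a))"
    by (rule higgs_derivative_tensorial) (rule X_field[OF assms])
  moreover have "\<Omega> a b = higgs_derivative E D \<phi> (\<lambda>i. X a)"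
    by (rule ext) (simp add: curvature_component_def assms False)
  ultimately show ?thesis by (simp only:)
qed

lemma \<Omega>_section:
  assumes s: "s \<in> \<Gamma>"
  shows "\<Omega> a b s \<in> \<Gamma>"
proof -
  consider "a < k" | "\<not> a < k" "b < k" | "\<not> a < k" "\<not> b < k" by blast
  then show ?thesis
  proof cases
    case 1
    show ?thesis by (rule tensorialD(1)[OF \<Omega>_tensorial[OF 1] s])
  next
    case 2
    show ?thesis
      unfolding curvature_component_def if_not_P[OF 2(1)] if_P[OF 2(2)]
      by (rule osections_minus[OF \<phi>_section[OF D_section[OF X_field[OF 2(2)] s]] D_section[OF X_field[OF 2(2)] \<phi>_section[OF s]]])
  next
    case 3
    show ?thesis
      unfolding curvature_component_def if_not_P[OF 3(1)] if_not_P[OF 3(2)] by (rule osections_zero)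
  qed
qed

lemma \<Omega>_swap:
  assumes s: "s \<in> \<Gamma>" and U: "(U, \<Psi>) \<in> otrivs E" "m \<in> U"
  shows "\<Psi> m (\<Omega> b a s m) i z = - \<Psi> m (\<Omega> a b s m) i z"
proof -
  interpret loop_module "N m" n "\<Psi> m" by (rule triv[OF U])
  note [simp] = D_mem[OF vf_tangent[OF X_field] s] \<phi>_mem[OF D_mem[OF vf_tangent[OF X_field] s]] D_mem[OF vf_tangent[OF X_field] \<phi>_section[OF s]]
  show ?thesis
  proof (cases "a < k \<and> b < k")
    case True
    then have "\<Psi> m (curvature M (complex_fibre E) D (\<lambda>i. if i = 0 then X b else X a) s m) i z =
        - \<Psi> m (curvature M (complex_fibre E) D (\<lambda>i. if i = 0 then X a else X b) s m) i z"
      by (intro curvature_coord_swap[OF _ _ s U]) (simp_all add: X_field)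
    then show ?thesis using True by (simp add: curvature_component_def)
  next
    case False
    then show ?thesis
      by (auto simp: curvature_component_def higgs_derivative_def coord_minus coord_zero)
  qed
qed

text \<open>Tensoriality is established for \<open>a < k\<close>; for \<open>b < k\<close> the
  matrix relation follows by antisymmetry, and in the remaining case the operator is zero.\<close>

lemma \<Omega>_matrix:
  assumes U: "(U, \<Psi>) \<in> otrivs E" "m \<in> U"
  obtains W where "antisymmetric_matrices n W"
    "\<And>a b s i. s \<in> \<Gamma> \<Longrightarrow> i < n \<Longrightarrow> \<Psi> m (\<Omega> a b s m) i z = (\<Sum>j<n. W a b i j * \<Psi> m (s m) j z)"
proof -
  obtain e where e: "\<And>j. j < n \<Longrightarrow> e j \<in> \<Gamma>" "\<And>j. j < n \<Longrightarrow> \<Psi> m (e j m) = unit_vector LC j"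
    by (rule section_frame[OF U]) (rule that)
  interpret loop_module "N m" n "\<Psi> m" by (rule triv[OF U])
  define W where "W a b i j = (if i < n \<and> j < n then \<Psi> m (\<Omega> a b (e j) m) i z else 0)" for a b i j
  have anti: "W a b i j = - W b a i j" for a b i j
    using \<Omega>_swap[OF e(1) U, of j a b i z] by (simp add: W_def)
  have 1: "\<Psi> m (\<Omega> a b s m) i z = (\<Sum>j<n. W a b i j * \<Psi> m (s m) j z)" if "a < k" "s \<in> \<Gamma>" "i < n" for a b s i
  proof -
    have "\<Psi> m (\<Omega> a b s m) i z = (\<Sum>j<n. \<Psi> m (\<Omega> a b (e j) m) i z * \<Psi> m (s m) j z)"
      by (rule tensorial_frame[OF \<Omega>_tensorial[OF that(1)] U _ _ that(2,3)]) (rule e, assumption)+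
    also have "\<dots> = (\<Sum>j<n. W a b i j * \<Psi> m (s m) j z)"
      by (rule sum.cong[OF refl]) (simp add: W_def that)
    finally show ?thesis .
  qed
  have 2: "\<Psi> m (\<Omega> a b s m) i z = (\<Sum>j<n. W a b i j * \<Psi> m (s m) j z)" if s: "s \<in> \<Gamma>" and i: "i < n" for a b s i
  proof -
    consider "a < k" | "b < k" | "\<not> a < k" "\<not> b < k" by blast
    then show ?thesis
    proof cases
      case 2
      have "\<Psi> m (\<Omega> a b s m) i z = - (\<Sum>j<n. W b a i j * \<Psi> m (s m) j z)"
        unfolding \<Omega>_swap[OF s U, of a b] 1[OF 2 s i] ..
      also have "\<dots> = (\<Sum>j<n. W a b i j * \<Psi> m (s m) j z)"
        unfolding sum_negf[symmetric] by (rule sum.cong[OF refl]) (simp add: anti[of a b])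
      finally show ?thesis .
    next
      case 3
      then have z: "\<Psi> m (\<Omega> a b t m) i z = 0" for t by (simp add: curvature_component_def coord_zero)
      then show ?thesis by (simp add: W_def i)
    qed (rule 1[OF _ s i])
  qed
  have "antisymmetric_matrices n W"
    by (rule antisymmetric_matrices.intro) (simp add: supported_def W_def, rule anti)
  then show ?thesis using 2 by (rule that)
qed

lemma bracket_components:
  "dtheta z (lie_bracket TM (Y a) (Y b) q) = 0"
  "push_fst M (lie_bracket TM (Y a) (Y b) (m, z)) = (if a < k \<and> b < k then lie_bracket M (X a) (X b) m else (\<lambda>f. 0))"
proof -
  have "dtheta z (lie_bracket TM (Y a) (Y b) q) = 0 \<and>
    push_fst M (lie_bracket TM (Y a) (Y b) (m, z)) = (if a < k \<and> b < k then lie_bracket M (X a) (X b) m else (\<lambda>f. 0))"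
  proof (cases "a < k"; cases "b < k")
    assume k: "a < k" "b < k"
    then show ?thesis by (simp add: dtheta_bracket(1)[OF X_field X_field] push_bracket_lift[OF X_field X_field])
  next
    assume k: "a < k" "\<not> b < k"
    then show ?thesis by (simp add: dtheta_bracket(2)[OF X_field[OF k(1)]] push_bracket_theta(1)[OF X_field[OF k(1)]])
  next
    assume k: "\<not> a < k" "b < k"
    then show ?thesis by (simp add: dtheta_bracket(3)[OF X_field[OF k(2)]] push_bracket_theta(2)[OF X_field[OF k(2)]])
  next
    assume k: "\<not> a < k" "\<not> b < k"
    have "lie_bracket TM (theta_vfield M) (theta_vfield M) p = (\<lambda>f. 0)" for p
      by (rule ext) (simp add: lie_bracket_def)
    then show ?thesis using k by (auto simp: dtheta_def push_fst_def)
  qed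
  then show "dtheta z (lie_bracket TM (Y a) (Y b) q) = 0"
    "push_fst M (lie_bracket TM (Y a) (Y b) (m, z)) = (if a < k \<and> b < k then lie_bracket M (X a) (X b) m else (\<lambda>f. 0))"
    by blast+
qed

definition along :: "nat \<Rightarrow> ('m \<Rightarrow> 'v) \<Rightarrow> 'm \<Rightarrow> 'v" where
  "along a s = (if a < k then (\<lambda>m. D m (X a m) s) else (\<lambda>m. \<phi> m (s m)))"

lemma along_section: "s \<in> \<Gamma> \<Longrightarrow> along a s \<in> \<Gamma>"
  unfolding along_def using D_section[OF X_field] \<phi>_section by simp

lemma nabla_along:
  assumes s: "s \<in> \<Gamma>"
  shows "(\<lambda>p. nabla p (Y a p) (ev s)) = ev (along a s)"
proof (cases "a < k")
  case True
  show ?thesis unfolding along_def if_P[OF True] by (rule nabla_lift[OF X_field[OF True] s])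
next
  case False
  show ?thesis unfolding along_def if_not_P[OF False] by (rule nabla_theta[OF s])
qed

text \<open>Derivatives along lifts and along the circle send evaluated sections to evaluated
  sections, so the nested derivatives in the curvature stay in the image of \<open>ev\<close>. The
  bracket contributes only if both fields are lifts.\<close>

lemma caloron_curvature:
  assumes s: "s \<in> \<Gamma>"
  shows "curvature TM cfib nabla (\<lambda>i. Y (a i)) (ev s) = ev (\<Omega> (a 0) (a 1) s)"
proof
  fix p :: "'m \<times> circle"
  obtain m z where p: "p = (m, z)" by (cases p)
  let ?a = "a 0" and ?b = "a 1"
  let ?B = "if ?a < k \<and> ?b < k then lie_bracket M (X ?a) (X ?b) m else (\<lambda>f. 0)"
  obtain U \<Psi> where U: "(U, \<Psi>) \<in> otrivs E" "m \<in> U" using triv_cover .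
  interpret loop_module "N m" n "\<Psi> m" by (rule triv[OF U])
  have B: "?B \<in> tangent_space M m"
    using lie_bracket_tangent[OF X_field X_field] zero_tangent by simp
  have d: "nabla (m, z) (Y c (m, z)) (ev t) = coset_at m z (along c t m)" if "t \<in> \<Gamma>" for c t
    using fun_cong[OF nabla_along[OF that], of "(m, z)" c] by (simp only: ev_eq)
  have br: "nabla (m, z) (lie_bracket TM (Y ?a) (Y ?b) (m, z)) (ev s) = coset_at m z (D m ?B s)"
  proof -
    have "nabla (m, z) (lie_bracket TM (Y ?a) (Y ?b) (m, z)) (ev s) =
        coset_at m z (D m (push_fst M (lie_bracket TM (Y ?a) (Y ?b) (m, z))) s)"
      by (rule nabla_horizontal[OF s]) (simp_all only: bracket_components B)
    then show ?thesis by (simp only: bracket_components)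
  qed
  have mem: "along c t m \<in> carrier (N m)" if "t \<in> \<Gamma>" for c t by (rule osections_mem[OF along_section[OF that]])
  have DB: "D m ?B s \<in> carrier (N m)" by (rule D_mem[OF B s])
  note sec = along_section[OF s]
  have "curvature TM cfib nabla (\<lambda>i. Y (a i)) (ev s) p =
      coset_at m z ((along ?a (along ?b s) m \<ominus>\<^bsub>N m\<^esub> along ?b (along ?a s) m) \<ominus>\<^bsub>N m\<^esub> D m ?B s)"
    unfolding curvature_def p nabla_along[OF s] d[OF sec] br cfib_minus[OF mem[OF sec] mem[OF sec]]
    by (rule cfib_minus[OF module_m.minus_closed[OF mem[OF sec] mem[OF sec]] DB])
  also have "(along ?a (along ?b s) m \<ominus>\<^bsub>N m\<^esub> along ?b (along ?a s) m) \<ominus>\<^bsub>N m\<^esub> D m ?B s = \<Omega> ?a ?b s m"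
  proof (cases "?a < k \<and> ?b < k")
    case True
    then show ?thesis by (simp add: along_def curvature_component_def curvature_E)
  next
    case False
    have "(u \<ominus>\<^bsub>N m\<^esub> v) \<ominus>\<^bsub>N m\<^esub> D m ?B s = u \<ominus>\<^bsub>N m\<^esub> v" if "u \<in> carrier (N m)" "v \<in> carrier (N m)" for u v
      unfolding if_not_P[OF False] D_zero[OF s]
      by (rule coord_eqI) (simp_all add: that coord_minus coord_zero)
    then have "(along ?a (along ?b s) m \<ominus>\<^bsub>N m\<^esub> along ?b (along ?a s) m) \<ominus>\<^bsub>N m\<^esub> D m ?B s =
        along ?a (along ?b s) m \<ominus>\<^bsub>N m\<^esub> along ?b (along ?a s) m"
      using mem[OF sec] by blast
    also have "\<dots> = \<Omega> ?a ?b s m"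
    proof -
      have "\<phi> m (\<phi> m (s m)) \<ominus>\<^bsub>N m\<^esub> \<phi> m (\<phi> m (s m)) = \<zero>\<^bsub>N m\<^esub>"
        using \<phi>_mem[OF \<phi>_mem[OF osections_mem[OF s]]]
        by (intro coord_eqI) (simp_all add: coord_minus coord_zero)
      then show ?thesis using False by (auto simp: along_def curvature_component_def higgs_derivative_def)
    qed
    finally show ?thesis .
  qed
  finally show "curvature TM cfib nabla (\<lambda>i. Y (a i)) (ev s) p = ev (\<Omega> ?a ?b s) p" by (simp only: p ev_eq)
qed

end

section \<open>Comparison of the two traces\<close>

lemma form_space_E:
  assumes U: "(U, \<Psi>) \<in> otrivs E" "m \<in> U"
  shows "form_space (complex_fibre E) \<Gamma> m (\<lambda>v i. \<Psi> m v i z) n"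
proof -
  interpret loop_module "N m" n "\<Psi> m" by (rule triv[OF U])
  have c: "carrier (complex_fibre E q) = carrier (N q)" "add (complex_fibre E q) = add (N q)"
    "zero (complex_fibre E q) = zero (N q)" "smult (complex_fibre E q) = (\<lambda>c v. (\<lambda>z. c) \<odot>\<^bsub>N q\<^esub> v)" for q
    by (simp_all add: complex_fibre_def complex_scalars_def)
  show ?thesis
  proof (rule form_space.intro)
    show "abelian_group (complex_fibre E q)" for q
    proof (rule abelian_groupI)
      fix x assume x: "x \<in> carrier (complex_fibre E q)"
      show "\<exists>y\<in>carrier (complex_fibre E q). y \<oplus>\<^bsub>complex_fibre E q\<^esub> x = \<zero>\<^bsub>complex_fibre E q\<^esub>"
        by (rule bexI[of _ "\<ominus>\<^bsub>N q\<^esub> x"]) (use x in \<open>simp_all add: c module_m.l_neg\<close>)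
    qed (simp_all add: c module_m.a_ac)
  qed (simp_all add: c osections_mem const_LC osections_zero osections_add osections_smult smooth_cyl_const coord_add coord_smult)
qed

lemma csec_mem: "t \<in> csec \<Longrightarrow> t q \<in> carrier (cfib q)"
  unfolding csections_iff by blast

text \<open>The closure properties are inherited from the sections of \<open>E\<close>, because
  every caloron section is the evaluation of one of them.\<close>

lemma form_space_caloron:
  assumes U: "(U, \<Psi>) \<in> otrivs E" "m \<in> U"
  shows "form_space cfib csec (m, z) (rep_coord \<Psi> m z) n"
proof -
  interpret loop_module "N m" n "\<Psi> m" by (rule triv[OF U])
  have car: "\<exists>w\<in>carrier (N (fst q)). v = coset_at (fst q) (snd q) w" if "v \<in> carrier (cfib q)" for v q
    using that cfib_carrier[of "fst q" "snd q"] by auto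
  show ?thesis
  proof (rule form_space.intro)
    fix q :: "'m \<times> circle" and c and v assume "v \<in> carrier (cfib q)"
    then obtain w where w: "w \<in> carrier (N (fst q))" "v = coset_at (fst q) (snd q) w" using car by blast
    have "c \<odot>\<^bsub>cfib (fst q, snd q)\<^esub> v \<in> carrier (cfib (fst q, snd q))"
      unfolding w(2) cfib_smult[OF w(1)] cfib_carrier using w(1) const_LC by (intro imageI) simp
    then show "c \<odot>\<^bsub>cfib q\<^esub> v \<in> carrier (cfib q)" by simp
  next
    have "(\<lambda>q. \<zero>\<^bsub>cfib q\<^esub>) = ev (\<lambda>q. \<zero>\<^bsub>N q\<^esub>)"
    proof
      fix q show "\<zero>\<^bsub>cfib q\<^esub> = ev (\<lambda>q. \<zero>\<^bsub>N q\<^esub>) q"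
        by (cases q) (simp only: cfib_zero ev_eq)
    qed
    then show "(\<lambda>q. \<zero>\<^bsub>cfib q\<^esub>) \<in> csec" using ev_csec[OF osections_zero] by (simp only:)
  next
    fix t t' assume "t \<in> csec" "t' \<in> csec"
    then obtain s s' where s: "s \<in> \<Gamma>" "t = ev s" "s' \<in> \<Gamma>" "t' = ev s'" by (metis csec_ev)
    have "(\<lambda>q. t q \<oplus>\<^bsub>cfib q\<^esub> t' q) = ev (\<lambda>q. s q \<oplus>\<^bsub>N q\<^esub> s' q)"
    proof
      fix q show "t q \<oplus>\<^bsub>cfib q\<^esub> t' q = ev (\<lambda>q. s q \<oplus>\<^bsub>N q\<^esub> s' q) q"
        by (cases q) (simp only: s(2,4) ev_eq cfib_add[OF osections_mem[OF s(1)] osections_mem[OF s(3)]])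
    qed
    then show "(\<lambda>q. t q \<oplus>\<^bsub>cfib q\<^esub> t' q) \<in> csec" using ev_csec[OF osections_add[OF s(1,3)]] by (simp only:)
  next
    fix t c assume "t \<in> csec"
    then obtain s where s: "s \<in> \<Gamma>" "t = ev s" by (rule csec_ev)
    have "(\<lambda>q. c \<odot>\<^bsub>cfib q\<^esub> t q) = ev (\<lambda>q. (\<lambda>z. c) \<odot>\<^bsub>N q\<^esub> s q)"
    proof
      fix q show "c \<odot>\<^bsub>cfib q\<^esub> t q = ev (\<lambda>q. (\<lambda>z. c) \<odot>\<^bsub>N q\<^esub> s q) q"
        by (cases q) (simp only: s(2) ev_eq cfib_smult[OF osections_mem[OF s(1)]])
    qed
    then show "(\<lambda>q. c \<odot>\<^bsub>cfib q\<^esub> t q) \<in> csec" using ev_csec[OF osections_smult[OF smooth_cyl_const s(1)]] by (simp only:)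
  next
    fix v w i assume "v \<in> carrier (cfib (m, z))" "w \<in> carrier (cfib (m, z))"
    then obtain v' w' where w: "v' \<in> carrier (N m)" "v = coset_at m z v'" "w' \<in> carrier (N m)" "w = coset_at m z w'"
      unfolding cfib_carrier by blast
    show "rep_coord \<Psi> m z (v \<oplus>\<^bsub>cfib (m, z)\<^esub> w) i = rep_coord \<Psi> m z v i + rep_coord \<Psi> m z w i"
      unfolding w(2,4) cfib_add[OF w(1,3)] rep_coord_coset[OF U w(1)] rep_coord_coset[OF U w(3)]
        rep_coord_coset[OF U module_m.a_closed[OF w(1,3)]] by (rule coord_add[OF w(1,3)])
  next
    fix c v i assume "v \<in> carrier (cfib (m, z))"
    then obtain v' where w: "v' \<in> carrier (N m)" "v = coset_at m z v'" unfolding cfib_carrier by blast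
    show "rep_coord \<Psi> m z (c \<odot>\<^bsub>cfib (m, z)\<^esub> v) i = c * rep_coord \<Psi> m z v i"
      unfolding w(2) cfib_smult[OF w(1)] rep_coord_coset[OF U w(1)]
        rep_coord_coset[OF U module_m.smult_closed[OF const_LC w(1)]] by (rule coord_smult[OF const_LC w(1)])
  qed (rule cfib_group, rule csec_mem)
qed

text \<open>One antisymmetric family \<open>W\<close> represents the curvature of \<triangle>, the
  Higgs derivative and the curvature of the caloron connection, all in coordinates at the same
  \<open>(m, z)\<close>. Both traces thereby become traces of expressions in the same
  matrices.\<close>

lemma trace_identity:
  assumes X: "\<forall>i<2 * j + 1. X i \<in> vector_fields M"
  shows "module_trace CC (crank (caloron E)) (cfib (m, z))
      (endo_at csec (wedge_power cfib (curvature TM cfib nabla) (Suc j)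
        (\<lambda>i. if i < 2 * j + 1 then lift_vfield M (X i) else theta_vfield M)) (m, z)) =
    of_nat (Suc j) * loop_trace M E (wedge (complex_fibre E) 1 (2 * j) (higgs_derivative E D \<phi>)
      (wedge_power (complex_fibre E) (curvature M (complex_fibre E) D) j)) X m z"
proof -
  \<comment> \<open>The \<open>2 * j + 2\<close> slots carry the labels up to \<open>k\<close>, and
    \<open>k\<close> itself is the only one that stands for the circle direction.\<close>
  define k where "k = 2 * j + 1"
  have X: "\<forall>i<k. X i \<in> vector_fields M" using X by (simp only: k_def)
  let ?Y = "\<lambda>a. if a < k then lift_vfield M (X a) else theta_vfield M"
  let ?\<Omega> = "curvature_component X k"
  obtain U \<Psi> where U: "(U, \<Psi>) \<in> otrivs E" "m \<in> U" using triv_cover .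
  interpret L: loop_module "N m" n "\<Psi> m" by (rule triv[OF U])
  obtain W where W: "antisymmetric_matrices n W"
    "\<And>a b s i. s \<in> \<Gamma> \<Longrightarrow> i < n \<Longrightarrow> \<Psi> m (?\<Omega> a b s m) i z = (\<Sum>j<n. W a b i j * \<Psi> m (s m) j z)"
    by (rule \<Omega>_matrix[where z = z, OF X U]) (rule that)
  interpret A: form_space "complex_fibre E" \<Gamma> m "\<lambda>v i. \<Psi> m v i z" n by (rule form_space_E[OF U])
  interpret B: form_space cfib csec "(m, z)" "rep_coord \<Psi> m z" n by (rule form_space_caloron[OF U])

  have \<Omega>: "A.has_matrix (?\<Omega> a b) (W a b)" for a b
    unfolding A.has_matrix_def using \<Omega>_section[OF X] W(2) by blast
  have R: "A.has_matrix (curvature M (complex_fibre E) D (\<lambda>i. X (a i))) (W (a 0) (a 1))"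
    if "a 0 \<in> {..<k}" "a 1 \<in> {..<k}" for a
  proof -
    have "curvature M (complex_fibre E) D (\<lambda>i. X (a i)) = ?\<Omega> (a 0) (a 1)"
    proof
      fix s
      have "curvature M (complex_fibre E) D (\<lambda>i. X (a i)) = curvature M (complex_fibre E) D (\<lambda>i. if i = 0 then X (a 0) else X (a 1))"
        by (rule curvature_cong) simp_all
      then show "curvature M (complex_fibre E) D (\<lambda>i. X (a i)) s = ?\<Omega> (a 0) (a 1) s"
        using that by (simp add: curvature_component_def del: One_nat_def)
    qed
    then show ?thesis using \<Omega> by (simp only:)
  qed
  have H: "A.has_matrix (higgs_derivative E D \<phi> (\<lambda>i. X (\<sigma> i))) (W (\<sigma> 0) k)" if "\<sigma> 0 < k" for \<sigma>
  proof -
    have "higgs_derivative E D \<phi> (\<lambda>i. X (\<sigma> i)) = ?\<Omega> (\<sigma> 0) k"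
      by (intro ext) (simp add: curvature_component_def that higgs_derivative_def)
    then show ?thesis using \<Omega> by (simp only:)
  qed
  let ?a = "\<lambda>r c. \<Sum>\<sigma>\<in>perms (1 + 2 * j). (sg \<sigma> / (fact 1 * fact (2 * j))) *
       mm n (W (\<sigma> 0) k) (power_matrix n W j (\<lambda>i. \<sigma> (1 + i))) r c"
  let ?A = "wedge (complex_fibre E) 1 (2 * j) (higgs_derivative E D \<phi>)
      (wedge_power (complex_fibre E) (curvature M (complex_fibre E) D) j) X"
  have "A.has_matrix ?A ?a"
  proof (rule A.has_matrix_wedge)
    fix \<sigma> assume \<sigma>: "\<sigma> \<in> perms (1 + 2 * j)"
    have lt: "\<sigma> i < k" if "i < k" for i
      using permutes_in_image[of \<sigma> "{..<k}" i] \<sigma> that by (simp add: k_def)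
    show "A.has_matrix (higgs_derivative E D \<phi> (\<lambda>i. X (\<sigma> i))) (W (\<sigma> 0) k)"
      by (rule H) (rule lt, simp add: k_def)
    show "A.has_matrix (wedge_power (complex_fibre E) (curvature M (complex_fibre E) D) j (\<lambda>i. X (\<sigma> (1 + i))))
        (power_matrix n W j (\<lambda>i. \<sigma> (1 + i)))"
    proof (rule A.has_matrix_wedge_power[where G = "{..<k}" and Y = X])
      show "A.has_matrix (curvature M (complex_fibre E) D (\<lambda>i. X (a i))) (W (a 0) (a 1))"
        if "a 0 \<in> {..<k}" "a 1 \<in> {..<k}" for a by (rule R[OF that])
      fix i assume "i < 2 * j"
      then have "1 + i < k" by (simp add: k_def)
      then show "\<sigma> (1 + i) \<in> {..<k}" unfolding lessThan_iff by (rule lt)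
    qed
  qed
  note A = A.endo_at_matrix[OF this]
  have "(\<lambda>f. f z) (module_trace LC n (N m) (endo_at \<Gamma> ?A m)) = (\<Sum>i<n. ?a i i)"
  proof (rule ring_eval.module_trace_eval[where b = ?a, OF L.ev L.iso])
    fix v assume v: "v \<in> carrier (N m)"
    show "endo_at \<Gamma> ?A m v \<in> carrier (N m)"
      using A(1)[OF section_through[OF v]] by (simp add: complex_fibre_def complex_scalars_def)
    show "\<Psi> m (endo_at \<Gamma> ?A m v) i z = (\<Sum>j<n. ?a i j * \<Psi> m v j z)" if "i < n" for i
      by (rule A(2)[OF section_through[OF v] that])
  qed (rule module_m.a_closed, assumption+, rule module_m.smult_closed, assumption+)
  then have rhs: "loop_trace M E (wedge (complex_fibre E) 1 (2 * j) (higgs_derivative E D \<phi>)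
      (wedge_power (complex_fibre E) (curvature M (complex_fibre E) D) j)) X m z = tr n ?a"
    by (simp only: loop_trace_def tr_def)

  \<comment> \<open>No restriction on the labels here: the formula for the caloron curvature treats
    lifts and the circle direction uniformly.\<close>
  have C: "B.has_matrix (curvature TM cfib nabla (\<lambda>i. ?Y (a i))) (W (a 0) (a 1))" for a
    unfolding B.has_matrix_def
  proof (intro ballI conjI allI impI)
    fix t assume "t \<in> csec"
    then obtain s where s: "s \<in> \<Gamma>" "t = ev s" by (rule csec_ev)
    note eq = caloron_curvature[OF X s(1), of a, folded s(2)]
    note sec = \<Omega>_section[OF X s(1), of "a 0" "a 1"]
    show "curvature TM cfib nabla (\<lambda>i. ?Y (a i)) t \<in> csec" unfolding eq by (rule ev_csec[OF sec])
    fix i assume i: "i < n"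
    show "rep_coord \<Psi> m z (curvature TM cfib nabla (\<lambda>i. ?Y (a i)) t (m, z)) i =
        (\<Sum>j<n. W (a 0) (a 1) i j * rep_coord \<Psi> m z (t (m, z)) j)"
      unfolding eq unfolding s(2) ev_eq rep_coord_coset[OF U osections_mem[OF sec]] rep_coord_coset[OF U osections_mem[OF s(1)]]
      by (rule W(2)[OF s(1) i])
  qed
  let ?B = "wedge_power cfib (curvature TM cfib nabla) (Suc j) ?Y"
  have "B.has_matrix ?B (power_matrix n W (Suc j) (\<lambda>i. i))"
    by (rule B.has_matrix_wedge_power[where G = UNIV and Y = ?Y]) (rule C, rule UNIV_I)
  note B = B.endo_at_matrix[OF this]
  have iso: "module_iso CC (cfib (m, z)) (free_module CC n) (rep_coord \<Psi> m z)"
    unfolding cfib_eq rep_coord_fibre_coord[where \<Psi> = \<Psi> and m = m, OF triv[OF U]] by (rule L.fibre_iso)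
  have thr: "\<exists>t\<in>csec. t (m, z) = v" if "v \<in> carrier (cfib (m, z))" for v
  proof -
    obtain w where w: "w \<in> carrier (N m)" "v = coset_at m z w" using \<open>v \<in> carrier (cfib (m, z))\<close> unfolding cfib_carrier by blast
    obtain s where s: "s \<in> \<Gamma>" "s m = w" using section_through[OF w(1)] by blast
    show ?thesis by (rule bexI[OF _ ev_csec[OF s(1)]]) (simp only: ev_eq s(2) w(2))
  qed
  have "(\<lambda>c. c) (module_trace CC n (cfib (m, z)) (endo_at csec ?B (m, z))) = (\<Sum>i<n. power_matrix n W (Suc j) (\<lambda>i. i) i i)"
  proof (rule ring_eval.module_trace_eval[where b = "power_matrix n W (Suc j) (\<lambda>i. i)", OF ring_eval_CC iso])
    fix v assume v: "v \<in> carrier (cfib (m, z))"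
    show "endo_at csec ?B (m, z) v \<in> carrier (cfib (m, z))" by (rule B(1)[OF thr[OF v]])
    show "rep_coord \<Psi> m z (endo_at csec ?B (m, z) v) i = (\<Sum>l<n. power_matrix n W (Suc j) (\<lambda>i. i) i l * rep_coord \<Psi> m z v l)"
      if "i < n" for i by (rule B(2)[OF thr[OF v] that])
  next
    fix v w assume "v \<in> carrier (cfib (m, z))" "w \<in> carrier (cfib (m, z))"
    then show "v \<oplus>\<^bsub>cfib (m, z)\<^esub> w \<in> carrier (cfib (m, z))"
      using cfib_group[of "(m, z)"] by (simp add: abelian_group_def abelian_monoid.a_closed)
  next
    fix a v assume "v \<in> carrier (cfib (m, z))"
    then show "a \<odot>\<^bsub>cfib (m, z)\<^esub> v \<in> carrier (cfib (m, z))" by (rule B.V_smult)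
  qed
  moreover have "crank (caloron E) = n" by (simp add: caloron_def)
  ultimately have "module_trace CC (crank (caloron E)) (cfib (m, z)) (endo_at csec ?B (m, z)) =
      tr n (power_matrix n W (Suc j) (\<lambda>i. i))"
    by (simp only: tr_def)
  also have "\<dots> = of_nat (Suc j) * tr n ?a"
    unfolding k_def by (rule antisymmetric_matrices.trace_power_matrix[OF W(1)])
  finally show ?thesis unfolding rhs k_def .
qed

end

lemma circle_integral_cmult: "circle_integral (\<lambda>z. c * f z) = c * circle_integral f"
  unfolding circle_integral_def by (rule integral_mult_right)

theorem proposition2p2:
  fixes M :: "'m::t2_space manifold"
    and E :: "('m, 'v) omega_bundle"
    and D :: "('m, 'v) covariant_derivative"
    and \<phi> :: "'m \<Rightarrow> 'v \<Rightarrow> 'v"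
    and R :: "('m, 'v) endo_form"
    and X :: "nat \<Rightarrow> 'm vfield"
    and k :: nat and m :: 'm
  assumes "compact_manifold_with_corners M"
    and "omega_vector_bundle M E"
    and "module_connection M E D"
    and "higgs_field M E \<phi>"
    and "R = curvature M (complex_fibre E) D"
    and "\<forall>i<k. X i \<in> vector_fields M"
  shows "string_form M E D \<phi> k X m =
    (\<Sum>j. if 1 \<le> j \<and> k = 2 * j - 1
          then 1 / fact (j - 1) * (1 / (2 * of_real pi * \<i>)) ^ j *
               circle_integral
                 (loop_trace M E
                   (wedge (complex_fibre E) 1 (2 * (j - 1))
                     (higgs_derivative E D \<phi>) (wedge_power (complex_fibre E) R (j - 1))) X m)
          else 0)"
proof -
  interpret connected_bundle M E D \<phi>
    using assms(1-4)
    by (intro connected_bundle.intro omega_bundle_over.intro corners.intro omega_bundle_over_axioms.intro connected_bundle_axioms.intro)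
      (simp_all add: compact_manifold_with_corners_def)
  let ?Y = "\<lambda>i. if i < k then lift_vfield M (X i) else theta_vfield M"
  let ?T = "\<lambda>j p. module_trace CC (crank (caloron E)) (cfib p) (endo_at csec (wedge_power cfib (curvature TM cfib nabla) j ?Y) p)"
  let ?c = "1 / (2 * of_real pi * \<i>)"
  let ?L = "\<lambda>j. loop_trace M E (wedge (complex_fibre E) 1 (2 * j) (higgs_derivative E D \<phi>) (wedge_power (complex_fibre E) R j)) X m"
  have lhs: "string_form M E D \<phi> k X m =
      circle_integral (\<lambda>z. \<Sum>j. if Suc k = 2 * j then 1 / fact j * ?c ^ j * ?T j (m, z) else 0)"
    by (simp only: string_form_def fibre_integral_def chern_form_def)
  show ?thesis
  \<comment> \<open>Integration over the fibre lowers the degree by one and the Chern form has even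
    degree only, so for even \<open>k\<close> every term of both series is zero.\<close>
  proof (cases "even k")
    case True
    then have "Suc k \<noteq> 2 * j" "\<not> (1 \<le> j \<and> k = 2 * j - 1)" for j by presburger+
    then show ?thesis unfolding lhs by (simp only: if_False suminf_zero) (simp add: circle_integral_def)
  next
    case False
    then obtain j where k: "k = 2 * j + 1" by (rule oddE)
    \<comment> \<open>As \<open>Suc k = 2 * Suc j\<close>, the only term of the series that survives
      has index \<open>Suc j\<close>.\<close>
    have "(\<Sum>i. if Suc k = 2 * i then 1 / fact i * ?c ^ i * ?T i (m, z) else 0) =
        1 / fact (Suc j) * ?c ^ Suc j * ?T (Suc j) (m, z)" for z
      by (subst suminf_finite[of "{Suc j}"]) (auto simp: k)
    then have "string_form M E D \<phi> k X m = circle_integral (\<lambda>z. 1 / fact (Suc j) * ?c ^ Suc j * ?T (Suc j) (m, z))"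
      unfolding lhs by (simp only:)
    also have "(\<lambda>z. 1 / fact (Suc j) * ?c ^ Suc j * ?T (Suc j) (m, z)) = (\<lambda>z. 1 / fact j * ?c ^ Suc j * ?L j z)"
    proof
      fix z
      have f: "1 / fact (Suc j) * c * (of_nat (Suc j) * t) = 1 / fact j * c * t" for c t :: complex
        by (simp add: fact_Suc field_simps del: of_nat_Suc)
      have T: "?T (Suc j) (m, z) = of_nat (Suc j) * ?L j z"
        using trace_identity[where j = j and X = X and m = m and z = z] assms(6) unfolding k assms(5) by blast
      show "1 / fact (Suc j) * ?c ^ Suc j * ?T (Suc j) (m, z) = 1 / fact j * ?c ^ Suc j * ?L j z"
        unfolding T by (rule f)
    qed
    also have "circle_integral \<dots> = 1 / fact j * ?c ^ Suc j * circle_integral (?L j)" by (rule circle_integral_cmult)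
    also have "\<dots> = (\<Sum>i. if 1 \<le> i \<and> k = 2 * i - 1 then 1 / fact (i - 1) * ?c ^ i * circle_integral (?L (i - 1)) else 0)"
    proof (subst suminf_finite[of "{Suc j}"])
      fix i assume "i \<notin> {Suc j}"
      then have "\<not> (1 \<le> i \<and> k = 2 * i - 1)" by (auto simp: k)
      then show "(if 1 \<le> i \<and> k = 2 * i - 1 then 1 / fact (i - 1) * ?c ^ i * circle_integral (?L (i - 1)) else 0) = 0"
        by (rule if_not_P)
    qed (simp_all add: k)
    finally show ?thesis .
  qed
qed

end
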